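(* Let $\Delta$ be a connected triangulation of an orientable $(d-1)$-dimensional $\mathbf{k}$-homology manifold (without boundary) with $d\ge4$. Then $$g_2(\Delta)\;\ge\;\binom{d+1}{2}\beta_1(\Delta;\mathbf{k}).$$ Furthermore, if $g_2(\Delta)=\binom{d+1}{2}\beta_1(\Delta;\mathbf{k})$ and $d\ge5$, then $\Delta\in\mathcal{H}^d$.
   Context: $\mathbf{k}$ is an infinite field of arbitrary characteristic. A $\mathbf{k}$-homology manifold is a (finite) simplicial complex whose geometric realization is a $\mathbf{k}$-homology manifold; for a pure $(d-1)$-dimensional complex without boundary this means that for every nonempty face $F$ the link of $F$ has the reduced homology over $\mathbf{k}$ of a sphere of dimension $d-1-|F|$. Orientable means orientable over $\mathbf{k}$ (for connected $\Delta$: $H_{d-1}(\Delta;\mathbf{k})\cong\mathbf{k}$). $\beta_1(\Delta;\mathbf{k})=\dim_{\mathbf{k}}\widetilde H_1(\Delta;\mathbf{k})$. With $f_i$ the number of $i$-dimensional faces and $h_i$ defined by $\sum_{i=0}^d h_ix^{d-i}=\sum_{i=0}^d f_{i-1}(x-1)^{d-i}$, $g_2=h_2-h_1=f_1-df_0+\binom{d+1}{2}$. $\mathcal{H}^d$ is the class of simplicial complexes that can be obtained from the boundary of the $d$-simplex by a sequence of the following operations: (i) subdivide a facet with one new vertex in the interior of the facet; (ii) form the connected sum of $\Delta_1,\Delta_2\in\mathcal{H}^d$ by identifying a pair of facets, one from each complex, and then removing the interior of the identified facet; (iii) form a handle by identifying a pair of facets in $\Delta\in\mathcal{H}^d$ and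 removing the interior of the identified facet, in such a way that the resulting complex is still a simplicial complex (equivalently, the distance in the 1-skeleton between every pair of identified vertices is at least three). *)

theory Defs
  imports "HOL-Library.Function_Algebras" "HOL-Computational_Algebra.Polynomial"
begin

section \<open>Finite simplicial complexes\<close>

text \<open>A complex is given by its set of faces, including the empty face (of dimension -1).\<close>

definition simplicial_complex :: "'a set set \<Rightarrow> bool" where
  "simplicial_complex \<Delta> \<longleftrightarrow>
     finite \<Delta> \<and> (\<forall>F\<in>\<Delta>. finite F) \<and> {} \<in> \<Delta> \<and> (\<forall>F\<in>\<Delta>. \<forall>G. G \<subseteq> F \<longrightarrow> G \<in> \<Delta>)"

definition facet :: "'a set set \<Rightarrow> 'a set \<Rightarrow> bool" where
  "facet \<Delta> F \<longleftrightarrow> F \<in> \<Delta> \<and> (\<forall>G\<in>\<Delta>. F \<subseteq> G \<longrightarrow> G = F)"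

definition link :: "'a set set \<Rightarrow> 'a set \<Rightarrow> 'a set set" where
  "link \<Delta> F = {G \<in> \<Delta>. G \<inter> F = {} \<and> G \<union> F \<in> \<Delta>}"

text \<open>The adjacency relation of the 1-skeleton.\<close>

definition skeleton1 :: "'a set set \<Rightarrow> ('a \<times> 'a) set" where
  "skeleton1 \<Delta> = {(u, v). u \<noteq> v \<and> {u, v} \<in> \<Delta>}"

definition connected_complex :: "'a set set \<Rightarrow> bool" where
  "connected_complex \<Delta> \<longleftrightarrow> (\<forall>u\<in>\<Union>\<Delta>. \<forall>v\<in>\<Union>\<Delta>. (u, v) \<in> (skeleton1 \<Delta>)\<^sup>*)"


section \<open>Reduced simplicial homology with field coefficients\<close>

definition fun_scale :: "'k::field \<Rightarrow> ('b \<Rightarrow> 'k) \<Rightarrow> 'b \<Rightarrow> 'k" where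
  "fun_scale a f = (\<lambda>x. a * f x)"

global_interpretation fun_space: vector_space "fun_scale :: 'k::field \<Rightarrow> ('b \<Rightarrow> 'k) \<Rightarrow> 'b \<Rightarrow> 'k"
  by unfold_locales (auto simp: fun_scale_def fun_eq_iff algebra_simps)

text \<open>
  An oriented \<open>i\<close>-chain is encoded without choosing orientations: \<open>c [v\<^sub>0, \<dots>, v\<^sub>i]\<close> is the
  coefficient of the oriented simplex \<open>[v\<^sub>0, \<dots>, v\<^sub>i]\<close>, so \<open>c\<close> changes sign under
  odd permutations; it suffices to require this for adjacent transpositions.  Degrees are
  integers; the chains of degree -1 live on the empty list, i.e. the empty face, so
  that the resulting homology is reduced.
\<close>

definition chains :: "'a set set \<Rightarrow> int \<Rightarrow> ('a list \<Rightarrow> 'k::field) set" where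
  "chains \<Delta> i =
     {c. (\<forall>vs. c vs \<noteq> 0 \<longrightarrow> distinct vs \<and> set vs \<in> \<Delta> \<and> int (length vs) = i + 1) \<and>
         (\<forall>us x y ws. c (us @ y # x # ws) = - c (us @ x # y # ws))}"

text \<open>
  In this encoding the usual boundary
  \<open>\<partial>[v\<^sub>0, \<dots>, v\<^sub>i] = (\<Sum>j. (-1)^j [v\<^sub>0, \<dots>, v\<^sub>j\<^sub>-\<^sub>1, v\<^sub>j\<^sub>+\<^sub>1, \<dots>, v\<^sub>i])\<close> takes the following form, since
  the simplices with \<open>vs\<close> in their boundary are the \<open>v # vs\<close>, where \<open>vs\<close> has sign +1.
\<close>

definition boundary_map :: "'a set set \<Rightarrow> ('a list \<Rightarrow> 'k::field) \<Rightarrow> 'a list \<Rightarrow> 'k" where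
  "boundary_map \<Delta> c = (\<lambda>vs. \<Sum>v\<in>\<Union>\<Delta>. c (v # vs))"

definition cycles :: "'a set set \<Rightarrow> int \<Rightarrow> ('a list \<Rightarrow> 'k::field) set" where
  "cycles \<Delta> i = {c \<in> chains \<Delta> i. boundary_map \<Delta> c = 0}"

definition boundaries :: "'a set set \<Rightarrow> int \<Rightarrow> ('a list \<Rightarrow> 'k::field) set" where
  "boundaries \<Delta> i = boundary_map \<Delta> ` chains \<Delta> (i + 1)"

lemma double_sum_alternating:
  fixes g :: "'a \<Rightarrow> 'a \<Rightarrow> 'k::ab_group_add"
  assumes "\<And>u v. g u v = - g v u" and "\<And>v. g v v = 0"
  shows "(\<Sum>u\<in>A. \<Sum>v\<in>A. g v u) = 0"
proof (induction A rule: infinite_finite_induct)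
  case (insert x A)
  have "(\<Sum>u\<in>A. g u x) = (\<Sum>v\<in>A. - g x v)"
    by (rule sum.cong[OF refl], rule assms(1))
  then have "(\<Sum>u\<in>A. g u x) + (\<Sum>v\<in>A. g x v) = 0"
    by (simp only: sum_negf left_minus)
  moreover have "(\<Sum>u\<in>insert x A. \<Sum>v\<in>insert x A. g v u) =
      (\<Sum>u\<in>A. g u x) + (\<Sum>v\<in>A. g x v) + (\<Sum>u\<in>A. \<Sum>v\<in>A. g v u)"
    using insert(1,2) by (simp add: sum.distrib assms(2) add.assoc)
  ultimately show ?case
    using insert(3) by simp
qed simp_all

lemma boundaries_subset_cycles:
  assumes "simplicial_complex \<Delta>"
  shows "(boundaries \<Delta> i :: ('a list \<Rightarrow> 'k::field) set) \<subseteq> cycles \<Delta> i"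
  unfolding boundaries_def
proof (rule image_subsetI)
  fix c :: "'a list \<Rightarrow> 'k"
  assume "c \<in> chains \<Delta> (i + 1)"
  note c = this[unfolded chains_def, THEN CollectD]
  have supp: "distinct vs" "set vs \<in> \<Delta>" "int (length vs) = i + 2" if "c vs \<noteq> 0" for vs
    using conjunct1[OF c, rule_format, OF that] by simp_all
  note alt = conjunct2[OF c, rule_format]
  show "boundary_map \<Delta> c \<in> cycles \<Delta> i"
    unfolding cycles_def chains_def
  proof (intro CollectI conjI allI impI)
    fix vs assume "boundary_map \<Delta> c vs \<noteq> 0"
    then obtain v where v: "c (v # vs) \<noteq> 0"
      unfolding boundary_map_def by (rule sum.not_neutral_contains_not_neutral)
    show "distinct vs" and "int (length vs) = i + 1"
      using supp(1,3)[OF v] by simp_all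
    show "set vs \<in> \<Delta>"
      using assms supp(2)[OF v] unfolding simplicial_complex_def by (meson set_subset_Cons)
  next
    fix us x y ws
    show "boundary_map \<Delta> c (us @ y # x # ws) = - boundary_map \<Delta> c (us @ x # y # ws)"
      unfolding boundary_map_def sum_negf[symmetric]
      by (rule sum.cong[OF refl], rule alt[of "_ # us", unfolded append_Cons])
  next
    have "c (v # v # ws) = 0" for v ws
      using supp(1)[of "v # v # ws"] by (metis distinct_length_2_or_more)
    then have "boundary_map \<Delta> (boundary_map \<Delta> c) ws = 0" for ws
      unfolding boundary_map_def
      by (intro double_sum_alternating[OF alt[of "[]", unfolded append_Nil]])
    then show "boundary_map \<Delta> (boundary_map \<Delta> c) = 0"
      unfolding fun_eq_iff zero_fun_apply by (intro allI)
  qed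
qed

text \<open>
  The dimension over \<open>'k\<close> of the quotient of cycles by boundaries; the subtraction is not
  truncated, by the previous lemma.
\<close>

definition reduced_betti :: "'k::field itself \<Rightarrow> 'a set set \<Rightarrow> int \<Rightarrow> nat" where
  "reduced_betti k \<Delta> i =
     fun_space.dim (cycles \<Delta> i :: ('a list \<Rightarrow> 'k) set) -
     fun_space.dim (boundaries \<Delta> i :: ('a list \<Rightarrow> 'k) set)"

definition homology_sphere_like :: "'k::field itself \<Rightarrow> int \<Rightarrow> 'a set set \<Rightarrow> bool" where
  "homology_sphere_like k m \<Delta> \<longleftrightarrow> (\<forall>i. reduced_betti k \<Delta> i = (if i = m then 1 else 0))"


section \<open>Homology manifolds\<close>

text \<open>
  Closed homology manifolds of dimension \<open>d - 1\<close>.  For a facet \<open>F\<close>, the link is \<open>{{}}\<close>,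
  with the reduced homology of the (-1)-dimensional sphere.
\<close>

definition homology_manifold :: "'k::field itself \<Rightarrow> nat \<Rightarrow> 'a set set \<Rightarrow> bool" where
  "homology_manifold k d \<Delta> \<longleftrightarrow>
     simplicial_complex \<Delta> \<and>
     (\<forall>F. facet \<Delta> F \<longrightarrow> card F = d) \<and>
     (\<forall>F\<in>\<Delta>. F \<noteq> {} \<longrightarrow> homology_sphere_like k (int d - 1 - int (card F)) (link \<Delta> F))"

text \<open>
  Orientability of a connected closed manifold of dimension \<open>d - 1 \<ge> 1\<close>, where reduced and
  unreduced top homology agree.
\<close>

definition orientable :: "'k::field itself \<Rightarrow> nat \<Rightarrow> 'a set set \<Rightarrow> bool" where
  "orientable k d \<Delta> \<longleftrightarrow> reduced_betti k \<Delta> (int d - 1) = 1"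


section \<open>Face numbers\<close>

definition f_num :: "'a set set \<Rightarrow> int \<Rightarrow> nat" where
  "f_num \<Delta> i = card {F \<in> \<Delta>. int (card F) = i + 1}"

definition h_poly :: "nat \<Rightarrow> 'a set set \<Rightarrow> int poly" where
  "h_poly d \<Delta> = (\<Sum>i\<le>d. of_nat (f_num \<Delta> (int i - 1)) * [:-1, 1:] ^ (d - i))"

definition h_num :: "nat \<Rightarrow> 'a set set \<Rightarrow> nat \<Rightarrow> int" where
  "h_num d \<Delta> i = coeff (h_poly d \<Delta>) (d - i)"

definition g2 :: "nat \<Rightarrow> 'a set set \<Rightarrow> int" where
  "g2 d \<Delta> = h_num d \<Delta> 2 - h_num d \<Delta> 1"


section \<open>The class \<open>\<H>\<^sup>d\<close>\<close>

text \<open>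
  Identify the facet \<open>F\<close> with the facet \<open>\<phi> ` F\<close> along \<open>\<phi>\<close>, then remove the identified facet.
\<close>

definition glue :: "'a set \<Rightarrow> ('a \<Rightarrow> 'a) \<Rightarrow> 'a set set \<Rightarrow> 'a set set" where
  "glue F \<phi> \<Delta> = (\<lambda>G. (\<lambda>v. if v \<in> F then \<phi> v else v) ` G) ` \<Delta> - {\<phi> ` F}"

text \<open>
  Complexes on natural numbers suffice as representatives, as all complexes are finite.  The
  condition in the handle rule says that identified vertices have distance at least 3.  The
  last rule closes the class under isomorphism, so that in a connected sum the two
  summands may be assumed to have disjoint vertex sets.
\<close>

inductive walkup :: "nat \<Rightarrow> nat set set \<Rightarrow> bool" for d :: nat where
  simplex_boundary: "card V = d + 1 \<Longrightarrow> walkup d (Pow V - {V})"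
| subdivide: "\<lbrakk>walkup d \<Delta>; facet \<Delta> F; v \<notin> \<Union>\<Delta>\<rbrakk>
    \<Longrightarrow> walkup d ((\<Delta> - {F}) \<union> insert v ` {G. G \<subset> F})"
| connected_sum: "\<lbrakk>walkup d \<Delta>\<^sub>1; walkup d \<Delta>\<^sub>2; \<Union>\<Delta>\<^sub>1 \<inter> \<Union>\<Delta>\<^sub>2 = {};
     facet \<Delta>\<^sub>1 F\<^sub>1; facet \<Delta>\<^sub>2 F\<^sub>2; bij_betw \<phi> F\<^sub>1 F\<^sub>2\<rbrakk>
    \<Longrightarrow> walkup d (glue F\<^sub>1 \<phi> (\<Delta>\<^sub>1 \<union> \<Delta>\<^sub>2))"
| handle: "\<lbrakk>walkup d \<Delta>; facet \<Delta> F\<^sub>1; facet \<Delta> F\<^sub>2; bij_betw \<phi> F\<^sub>1 F\<^sub>2;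
     \<forall>v\<in>F\<^sub>1. \<forall>n<3. (v, \<phi> v) \<notin> skeleton1 \<Delta> ^^ n\<rbrakk>
    \<Longrightarrow> walkup d (glue F\<^sub>1 \<phi> \<Delta>)"
| relabel: "\<lbrakk>walkup d \<Delta>; inj_on f (\<Union>\<Delta>)\<rbrakk> \<Longrightarrow> walkup d (image f ` \<Delta>)"

definition in_walkup_class :: "nat \<Rightarrow> 'a set set \<Rightarrow> bool" where
  "in_walkup_class d \<Delta> \<longleftrightarrow> (\<exists>f :: 'a \<Rightarrow> nat. inj_on f (\<Union>\<Delta>) \<and> walkup d (image f ` \<Delta>))"

end

theory Submission
  imports Defs "HOL-Library.Z2"
begin

text \<open>
  Both halves rest on generic hyperconnectivity in Kalai's sense: given points \<open>p\<^sub>v\<close> in \<open>k\<^sup>d\<close>, a motion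
  assigns \<open>m\<^sub>v\<close> to each vertex with \<open>\<langle>m\<^sub>u, p\<^sub>w\<rangle> = \<langle>m\<^sub>w, p\<^sub>u\<rangle>\<close> on every edge; the trivial motions are
  \<open>v \<mapsto> B p\<^sub>v\<close> with \<open>B\<close> symmetric.  Fogelsanger's decomposition of minimal cycles modulo 2 shows that
  for generic points the vertex stars have only trivial motions.

  Given \<open>r\<close> independent 1-cocycles \<open>z\<^sub>j\<close> and symmetric matrices \<open>B\<^sub>j\<close>, the edge values
  \<open>\<langle>(\<Sum>j. z\<^sub>j(u, w) B\<^sub>j) p\<^sub>u, p\<^sub>w\<rangle>\<close> can only be realised by a motion if \<open>\<Sum>j. z\<^sub>j B\<^sub>j\<close> is a coboundary, as one sees
  star by star.  So the cokernel of the edge equations, of dimension \<open>g\<^sub>2\<close>, contains \<open>r\<close> copies of the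
  symmetric matrices; this is the inequality.  In the case of equality the equations of each
  star are independent, i.e. \<open>g\<^sub>2 = 0\<close> for all vertex links.

  A normal pseudomanifold with \<open>g\<^sub>2 = 0\<close> has no missing triangles and is separated by each of its missing
  facets, since otherwise crossing the facet would define a nontrivial cocycle.  Hence a complex with such vertex
  links is the boundary of a simplex or can be cut along a missing facet into a complex of the same
  kind with fewer missing facets, which undoes a handle or a connected sum.
\<close>

section \<open>Systems of linear equations\<close>

text \<open>The constant is the dimension of the space of symmetric matrices, that is of the trivial
  motions; it is the same in every characteristic. The points need coordinates in \<open>k\<close>
  itself, because the cocycles that multiply the symmetric matrices have values there. Tightness of
  the links is afterwards a mere count of vertices and edges, so it can be exploited with real
  points. Solidity of the stars rests on cycles modulo 2 whatever \<open>k\<close> is: of the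
  manifold it only needs that ridges lie in two facets and that larger links are connected. The
  obstacle is small dimension. Solidity of a star comes from its link, whose facet size must be at
  least 3; this fits \<open>d \<ge> 4\<close> for the inequality. In the equality case the same
  tools are applied inside the vertex links, whose facet size must then be at least 4, that is
  \<open>d \<ge> 5\<close>. Descending through links to split along a missing facet ends at
  surfaces, where the motions give no information on cocycles; there an Euler characteristic count
  modulo 2 takes over.\<close>

lemma inj_linear_card_le:
  fixes f :: "('i \<Rightarrow> 'k::field) \<Rightarrow> 'j \<Rightarrow> 'k"
  assumes "finite J" "finite I"
    and add: "\<And>x y j. j \<in> J \<Longrightarrow> f (\<lambda>i. x i + y i) j = f x j + f y j"
    and scale: "\<And>c x j. j \<in> J \<Longrightarrow> f (\<lambda>i. c * x i) j = c * f x j"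
    and inj: "\<And>x. (\<And>i. i \<notin> I \<Longrightarrow> x i = 0) \<Longrightarrow> (\<And>j. j \<in> J \<Longrightarrow> f x j = 0) \<Longrightarrow> (\<forall>i\<in>I. x i = 0)"
  shows "card I \<le> card J"
  using assms
proof (induction J arbitrary: I f rule: finite_induct)
  case empty
  show ?case
  proof (cases "I = {}")
    case False
    then obtain i where i: "i \<in> I" by blast
    have "\<forall>k\<in>I. (if k = i then 1 else 0 :: 'k) = 0"
      by (rule empty.prems(4)) (use i in auto)
    then show ?thesis using i by auto
  qed simp
next
  case (insert j J I f)
  show ?case
  proof (cases "\<exists>x. (\<forall>i. i \<notin> I \<longrightarrow> x i = 0) \<and> f x j \<noteq> 0")
    case False
    have "card I \<le> card J"
    proof (rule insert.IH[of I f])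
      fix x assume x: "\<And>i. i \<notin> I \<Longrightarrow> x i = 0" "\<And>j. j \<in> J \<Longrightarrow> f x j = 0"
      then show "\<forall>i\<in>I. x i = 0" using insert.prems(4)[of x] False by blast
    qed (use insert.prems in auto)
    then show ?thesis using insert.hyps by simp
  next
    case True
    then obtain w where w: "\<And>i. i \<notin> I \<Longrightarrow> w i = 0" "f w j \<noteq> 0" by blast
    have "\<exists>i\<in>I. w i \<noteq> 0"
    proof (rule ccontr)
      assume "\<not> ?thesis"
      then have "w = (\<lambda>i. 0 * w i)" using w(1) by auto
      then have "f w j = 0" using insert.prems(3)[of j 0 w] by simp
      then show False using w(2) by simp
    qed
    then obtain i0 where i0: "i0 \<in> I" "w i0 \<noteq> 0" by blast
    \<comment> \<open>\<open>x + c x * w\<close> solves equation \<open>j\<close>. For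
      \<open>x\<close> vanishing at \<open>i0\<close> nothing is lost by this correction: if the
      corrected vector is zero, its entry at \<open>i0\<close> gives \<open>c x = 0\<close>.\<close>
    define c where "c x = - (f x j / f w j)" for x
    define g where "g x = f (\<lambda>i. x i + c x * w i)" for x
    have c_add: "c (\<lambda>i. x i + y i) = c x + c y" for x y
      unfolding c_def using insert.prems(2)[of j x y] by (simp add: add_divide_distrib)
    have c_scale: "c (\<lambda>i. a * x i) = a * c x" for a x
      unfolding c_def using insert.prems(3)[of j a x] by simp
    have g: "g x k = f x k + c x * f w k" if "k \<in> insert j J" for x k
      unfolding g_def using insert.prems(2)[OF that, of x "\<lambda>i. c x * w i"]
        insert.prems(3)[OF that, of "c x" w] by simp
    have "card (I - {i0}) \<le> card J"
    proof (rule insert.IH[of "I - {i0}" g])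
      fix x y k assume "k \<in> J"
      then show "g (\<lambda>i. x i + y i) k = g x k + g y k"
        using insert.prems(2)[of k x y] by (simp add: g c_add algebra_simps)
    next
      fix a x k assume "k \<in> J"
      then show "g (\<lambda>i. a * x i) k = a * g x k"
        using insert.prems(3)[of k a x] by (simp add: g c_scale algebra_simps)
    next
      fix x assume x: "\<And>i. i \<notin> I - {i0} \<Longrightarrow> x i = 0" "\<And>j. j \<in> J \<Longrightarrow> g x j = 0"
      have j0: "g x j = 0"
        using w(2) by (simp add: g, simp add: c_def)
      have z: "\<forall>i\<in>I. x i + c x * w i = 0"
        by (rule insert.prems(4)) (use x j0 w(1) in \<open>auto simp: g_def\<close>)
      have "c x = 0" using z i0 x(1)[of i0] by fastforce
      then show "\<forall>i\<in>I - {i0}. x i = 0" using z by simp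
    qed (use insert.prems(1) in auto)
    then show ?thesis using insert.hyps insert.prems(1) i0 by simp
  qed
qed

text \<open>If the unit vector at \<open>j\<close> were not attained, equation \<open>j\<close>
  would follow from the others, since a solution of the others with nonzero \<open>j\<close>-th
  value could be rescaled to that unit vector. Dropping \<open>j\<close> would then contradict
  \<open>inj_linear_card_le\<close>.\<close>

lemma inj_linear_surj:
  fixes f :: "('i \<Rightarrow> 'k::field) \<Rightarrow> 'j \<Rightarrow> 'k"
  assumes J: "finite J" and I: "finite I"
    and add: "\<And>x y j. j \<in> J \<Longrightarrow> f (\<lambda>i. x i + y i) j = f x j + f y j"
    and scale: "\<And>c x j. j \<in> J \<Longrightarrow> f (\<lambda>i. c * x i) j = c * f x j"
    and inj: "\<And>x. (\<And>i. i \<notin> I \<Longrightarrow> x i = 0) \<Longrightarrow> (\<And>j. j \<in> J \<Longrightarrow> f x j = 0) \<Longrightarrow> (\<forall>i\<in>I. x i = 0)"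
    and card: "card J \<le> card I"
  shows "\<exists>x. (\<forall>i. i \<notin> I \<longrightarrow> x i = 0) \<and> (\<forall>j\<in>J. f x j = y j)"
proof -
  have unit: "\<exists>x. (\<forall>i. i \<notin> I \<longrightarrow> x i = 0) \<and> f x j = 1 \<and> (\<forall>k\<in>J - {j}. f x k = 0)" if j: "j \<in> J" for j
  proof (rule ccontr)
    assume no: "\<not> ?thesis"
    have "card I \<le> card (J - {j})"
    proof (rule inj_linear_card_le[of _ _ f])
      fix x assume x: "\<And>i. i \<notin> I \<Longrightarrow> x i = 0" "\<And>k. k \<in> J - {j} \<Longrightarrow> f x k = 0"
      have "f x j = 0"
      proof (rule ccontr)
        assume nz: "f x j \<noteq> 0"
        let ?y = "\<lambda>i. inverse (f x j) * x i"
        have "f ?y j = 1" using scale[OF j, of "inverse (f x j)" x] nz by simp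
        moreover have "f ?y k = 0" if "k \<in> J - {j}" for k
          using scale[of k "inverse (f x j)" x] that x(2)[of k] by simp
        ultimately show False using no x(1) by (metis mult_zero_right)
      qed
      then show "\<forall>i\<in>I. x i = 0" using inj[of x] x by blast
    qed (use J I add scale in auto)
    then show False using card j J by (metis card_Diff1_less not_less order_trans)
  qed
  have "\<exists>x. (\<forall>i. i \<notin> I \<longrightarrow> x i = 0) \<and> (\<forall>j\<in>J. f x j = (if j \<in> K then y j else 0))" if "finite K" "K \<subseteq> J" for K
    using that
  proof (induction K rule: finite_induct)
    case empty
    have "f (\<lambda>i. 0) j = 0" if "j \<in> J" for j
      using scale[OF that, of 0 "\<lambda>i. 0"] by simp
    then show ?case by (intro exI[of _ "\<lambda>i. 0"]) auto
  next
    case (insert j K)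
    then obtain x where x: "\<forall>i. i \<notin> I \<longrightarrow> x i = 0" "\<forall>k\<in>J. f x k = (if k \<in> K then y k else 0)" by auto
    obtain u where u: "\<forall>i. i \<notin> I \<longrightarrow> u i = 0" "f u j = 1" "\<forall>k\<in>J - {j}. f u k = 0"
      using unit[of j] insert.prems by blast
    let ?z = "\<lambda>i. x i + y j * u i"
    have "f ?z k = f x k + y j * f u k" if "k \<in> J" for k
      using add[OF that, of x "\<lambda>i. y j * u i"] scale[OF that, of "y j" u] by simp
    then show ?case using x u insert.hyps insert.prems
      by (intro exI[of _ ?z]) auto
  qed
  from this[of J] J show ?thesis by auto
qed

section \<open>Generic position over an infinite field, tested along lines\<close>

definition affine_line :: "('a \<Rightarrow> nat \<Rightarrow> 'k::field) \<Rightarrow> ('a \<Rightarrow> nat \<Rightarrow> 'k) \<Rightarrow> 'k \<Rightarrow> 'a \<Rightarrow> nat \<Rightarrow> 'k" where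
  "affine_line p q t = (\<lambda>v i. p v i + t * (q v i - p v i))"

text \<open>A substitute for Zariski openness that avoids multivariate polynomials.\<close>

definition line_open :: "(('a \<Rightarrow> nat \<Rightarrow> 'k::field) \<Rightarrow> bool) \<Rightarrow> bool" where
  "line_open P \<longleftrightarrow> (\<forall>p q. P p \<longrightarrow> finite {t. \<not> P (affine_line p q t)})"

lemma affine_line_rev: "affine_line q p (1 - t) = affine_line p q t"
  by (simp add: affine_line_def fun_eq_iff algebra_simps)

text \<open>A point good for finitely many properties and a point good for one more are joined by a
  line. Each property excludes finitely many parameters, the new one being read along the reversed
  line, and an infinite field leaves a parameter over.\<close>

lemma line_open_common_point:
  fixes \<P> :: "(('a \<Rightarrow> nat \<Rightarrow> 'k::field) \<Rightarrow> bool) set"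
  assumes inf: "infinite (UNIV :: 'k set)" and "finite \<P>"
    and "\<And>P. P \<in> \<P> \<Longrightarrow> line_open P \<and> (\<exists>p. P p)"
  shows "\<exists>p. \<forall>P\<in>\<P>. P p"
  using assms(2,3)
proof (induction \<P> rule: finite_induct)
  case (insert Q \<P>)
  then obtain p where p: "\<forall>P\<in>\<P>. P p" by auto
  obtain q where q: "Q q" and Q: "line_open Q" using insert.prems by auto
  have "finite (\<Union>P\<in>\<P>. {t. \<not> P (affine_line p q t)})"
    using insert.hyps(1) insert.prems p unfolding line_open_def by auto
  moreover have "finite ((\<lambda>t. 1 - t) ` {t. \<not> Q (affine_line q p t)})"
    using Q q unfolding line_open_def by auto
  ultimately have "finite ((\<Union>P\<in>\<P>. {t. \<not> P (affine_line p q t)}) \<union>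
      (\<lambda>t. 1 - t) ` {t. \<not> Q (affine_line q p t)})" by blast
  then obtain t where t: "t \<notin> (\<Union>P\<in>\<P>. {t. \<not> P (affine_line p q t)}) \<union>
      (\<lambda>t. 1 - t) ` {t. \<not> Q (affine_line q p t)}"
    using inf by (metis ex_new_if_finite)
  have "Q (affine_line p q t)"
  proof (rule ccontr)
    assume "\<not> ?thesis"
    then have "1 - t \<in> {t. \<not> Q (affine_line q p t)}" by (simp add: affine_line_rev)
    then have "1 - (1 - t) \<in> (\<lambda>t. 1 - t) ` {t. \<not> Q (affine_line q p t)}" by (rule imageI)
    then show False using t by simp
  qed
  then show ?case using t by (intro exI[of _ "affine_line p q t"]) auto
qed simp

text \<open>Stands in for the finiteness of the zeros of a determinant that is nonzero at
  \<open>t = 0\<close>. The equations need not match the unknowns in number, so the bound comes from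
  the independence of kernel vectors instead: there are at most \<open>card I\<close> bad
  parameters.\<close>

lemma pencil_inj_cofinite:
  fixes f g :: "('i \<Rightarrow> 'k::field) \<Rightarrow> 'j \<Rightarrow> 'k"
  assumes I: "finite I"
    and addf: "\<And>x y j. f (\<lambda>i. x i + y i) j = f x j + f y j"
    and scalef: "\<And>c x j. f (\<lambda>i. c * x i) j = c * f x j"
    and addg: "\<And>x y j. g (\<lambda>i. x i + y i) j = g x j + g y j"
    and scaleg: "\<And>c x j. g (\<lambda>i. c * x i) j = c * g x j"
    and inj: "\<And>x. (\<And>i. i \<notin> I \<Longrightarrow> x i = 0) \<Longrightarrow> (\<And>j. f x j = 0) \<Longrightarrow> (\<forall>i\<in>I. x i = 0)"
  shows "finite {t. \<exists>x. (\<forall>i. i \<notin> I \<longrightarrow> x i = 0) \<and> (\<forall>j. f x j + t * g x j = 0) \<and> (\<exists>i\<in>I. x i \<noteq> 0)}"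
    (is "finite ?T")
proof (rule ccontr)
  assume inf: "infinite ?T"
  have "\<exists>x. \<forall>t. t \<in> ?T \<longrightarrow> (\<forall>i. i \<notin> I \<longrightarrow> x t i = 0) \<and> (\<forall>j. f (x t) j + t * g (x t) j = 0) \<and> (\<exists>i\<in>I. x t i \<noteq> 0)"
    by (rule choice) blast
  then obtain x where x: "\<And>t i. t \<in> ?T \<Longrightarrow> i \<notin> I \<Longrightarrow> x t i = 0"
    "\<And>t j. t \<in> ?T \<Longrightarrow> f (x t) j + t * g (x t) j = 0" "\<And>t. t \<in> ?T \<Longrightarrow> \<exists>i\<in>I. x t i \<noteq> 0"
    by blast
  have f0: "f (\<lambda>i. 0) j = 0" for j using scalef[of 0 "\<lambda>i. 0" j] by simp
  have g0: "g (\<lambda>i. 0) j = 0" for j using scaleg[of 0 "\<lambda>i. 0" j] by simp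
  have fsum: "f (\<lambda>i. \<Sum>t\<in>S. c t * x t i) j = (\<Sum>t\<in>S. c t * f (x t) j)" if "finite S" for S c j
    using that by (induction S rule: finite_induct) (simp_all add: f0 addf scalef)
  have gsum: "g (\<lambda>i. \<Sum>t\<in>S. c t * x t i) j = (\<Sum>t\<in>S. c t * g (x t) j)" if "finite S" for S c j
    using that by (induction S rule: finite_induct) (simp_all add: g0 addg scaleg)
  have nz: "0 \<notin> ?T" using inj by force
  \<comment> \<open>the \<open>x t\<close> are eigenvectors for distinct eigenvalues of \<open>f\<inverse> g\<close>\<close>
  have indep: "\<forall>t\<in>S. c t = 0" if "finite S" "S \<subseteq> ?T" "\<And>i. (\<Sum>t\<in>S. c t * x t i) = 0" for S c
    using that
  proof (induction S arbitrary: c rule: finite_induct)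
    case (insert s S)
    have sT: "s \<in> ?T" and ST: "S \<subseteq> ?T" using insert.prems(1) by blast+
    let ?S = "insert s S"
    have tnz: "t \<noteq> 0" if "t \<in> ?S" for t using that insert.prems(1) nz by blast
    \<comment> \<open>Dividing the coefficients by \<open>t\<close> turns a relation under
      \<open>g\<close> into one under \<open>f\<close>, so \<open>y = 0\<close> is a second relation
      among the same vectors; subtracting \<open>s\<close> times it from the first eliminates
      \<open>x s\<close>.\<close>
    define y where "y = (\<lambda>i. \<Sum>t\<in>?S. (c t / t) * x t i)"
    have "f y j = 0" for j
    proof -
      have "f y j = (\<Sum>t\<in>?S. (c t / t) * f (x t) j)"
        unfolding y_def by (rule fsum) (use insert.hyps in simp)
      also have "\<dots> = (\<Sum>t\<in>?S. - (c t * g (x t) j))"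
      proof (rule sum.cong[OF refl])
        fix t assume t: "t \<in> ?S"
        have "t \<in> ?T" using t insert.prems(1) by blast
        then have "f (x t) j = - (t * g (x t) j)"
          using x(2)[of t j] eq_neg_iff_add_eq_0 by blast
        then show "(c t / t) * f (x t) j = - (c t * g (x t) j)" using tnz[OF t] by simp
      qed
      also have "\<dots> = - g (\<lambda>i. \<Sum>t\<in>?S. c t * x t i) j"
        using insert.hyps by (simp add: sum_negf gsum del: sum.insert)
      also have "\<dots> = 0" using insert.prems(2) by (simp add: g0)
      finally show ?thesis .
    qed
    moreover have "y i = 0" if "i \<notin> I" for i
      unfolding y_def
    proof (rule sum.neutral, rule ballI)
      fix t assume "t \<in> insert s S"
      then have "t \<in> ?T" using insert.prems(1) by blast
      then show "c t / t * x t i = 0" using x(1)[OF _ that] by simp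
    qed
    ultimately have yI: "\<forall>i\<in>I. y i = 0" using inj by blast
    have y0: "y i = 0" for i using yI \<open>\<And>i. i \<notin> I \<Longrightarrow> y i = 0\<close> by blast
    have "(\<Sum>t\<in>S. (c t * (1 - s / t)) * x t i) = 0" for i
    proof -
      have "(\<Sum>t\<in>?S. (c t * (1 - s / t)) * x t i) = (\<Sum>t\<in>?S. c t * x t i) - s * y i"
        unfolding y_def sum_distrib_left sum_subtractf[symmetric]
        by (rule sum.cong[OF refl]) (simp add: algebra_simps)
      also have "\<dots> = 0" using insert.prems(2) y0 by simp
      finally show ?thesis using insert.hyps tnz[of s] by simp
    qed
    then have "\<forall>t\<in>S. c t * (1 - s / t) = 0" by (rule insert.IH[OF ST])
    then have z: "c t = 0" if "t \<in> S" for t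
      using that insert.hyps(2) tnz[of t] by (auto simp: field_simps)
    obtain i where "i \<in> I" "x s i \<noteq> 0" using x(3)[OF sT] by blast
    moreover have "c s * x s i = 0"
      using insert.prems(2)[of i] insert.hyps z by simp
    ultimately show ?case using z by simp
  qed simp
  obtain S where S: "S \<subseteq> ?T" "finite S" "card S = Suc (card I)"
    using infinite_arbitrarily_large[OF inf, of "Suc (card I)"] by blast
  have "card S \<le> card I"
  proof (rule inj_linear_card_le[of _ _ "\<lambda>c i. \<Sum>t\<in>S. c t * x t i"])
    fix c :: "'k \<Rightarrow> 'k"
    assume c: "\<And>i. i \<in> I \<Longrightarrow> (\<Sum>t\<in>S. c t * x t i) = 0"
    have "(\<Sum>t\<in>S. c t * x t i) = 0" for i
    proof (cases "i \<in> I")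
      case False
      then have "\<forall>t\<in>S. c t * x t i = 0" using x(1) S(1) by (simp add: subset_iff)
      then show ?thesis by (rule sum.neutral)
    qed (rule c)
    then show "\<forall>t\<in>S. c t = 0" using indep[OF S(2,1)] by blast
  qed (use I S in \<open>auto simp: sum.distrib sum_distrib_left algebra_simps\<close>)
  then show False using S(3) by simp
qed

section \<open>Generic hyperconnectivity\<close>

definition ip :: "nat \<Rightarrow> (nat \<Rightarrow> 'k::field) \<Rightarrow> (nat \<Rightarrow> 'k) \<Rightarrow> 'k" where
  "ip n a b = (\<Sum>i<n. a i * b i)"

lemma ip_add_left: "ip n (\<lambda>i. a i + b i) c = ip n a c + ip n b c"
  and ip_add_right: "ip n c (\<lambda>i. a i + b i) = ip n c a + ip n c b"
  and ip_diff_left: "ip n (\<lambda>i. a i - b i) c = ip n a c - ip n b c"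
  and ip_diff_right: "ip n c (\<lambda>i. a i - b i) = ip n c a - ip n c b"
  and ip_scale_left: "ip n (\<lambda>i. s * a i) c = s * ip n a c"
  and ip_scale_right: "ip n c (\<lambda>i. s * a i) = s * ip n c a"
  and ip_zero_left: "ip n (\<lambda>i. 0) c = 0"
  and ip_zero_right: "ip n c (\<lambda>i. 0) = 0"
  by (simp_all add: ip_def algebra_simps sum.distrib sum_subtractf sum_distrib_left)

lemma ip_cong: "(\<And>i. i < n \<Longrightarrow> a i = a' i) \<Longrightarrow> (\<And>i. i < n \<Longrightarrow> b i = b' i) \<Longrightarrow> ip n a b = ip n a' b'"
  by (simp add: ip_def)

lemma ip_eq_0_left: "(\<And>i. i < n \<Longrightarrow> a i = 0) \<Longrightarrow> ip n a b = 0"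
  by (simp add: ip_def)

lemma ip_unit: "k < n \<Longrightarrow> ip n c (\<lambda>i. if i = k then 1 else 0) = c k"
  by (simp add: ip_def if_distrib sum.If_cases cong: if_cong)

definition sym_mat :: "nat \<Rightarrow> (nat \<Rightarrow> nat \<Rightarrow> 'k::field) \<Rightarrow> bool" where
  "sym_mat n B \<longleftrightarrow> (\<forall>i<n. \<forall>j<n. B i j = B j i)"

definition app_mat :: "nat \<Rightarrow> (nat \<Rightarrow> nat \<Rightarrow> 'k::field) \<Rightarrow> (nat \<Rightarrow> 'k) \<Rightarrow> nat \<Rightarrow> 'k" where
  "app_mat n B x = (\<lambda>i. ip n (B i) x)"

lemma app_mat_sum: "ip n (app_mat n B x) y = (\<Sum>i<n. \<Sum>j<n. B i j * x j * y i)"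
  by (simp add: app_mat_def ip_def sum_distrib_right)

lemma app_mat_transpose: "ip n (app_mat n B x) y = ip n (app_mat n (\<lambda>i j. B j i) y) x"
  unfolding app_mat_sum by (subst sum.swap) (simp add: mult_ac)

lemma sym_mat_ip:
  assumes "sym_mat n B"
  shows "ip n (app_mat n B x) y = ip n (app_mat n B y) x"
proof -
  have "ip n (app_mat n (\<lambda>i j. B j i) y) x = ip n (app_mat n B y) x"
    unfolding app_mat_sum using assms by (intro sum.cong refl) (simp add: sym_mat_def)
  then show ?thesis by (rule trans[OF app_mat_transpose])
qed

text \<open>Spanning is stated dually, by orthogonality. In this form it cancels the points from
  equations, and it is the injectivity of a linear system that \<open>pencil_inj_cofinite\<close>
  can treat.\<close>

definition spans :: "nat \<Rightarrow> 'a set \<Rightarrow> ('a \<Rightarrow> nat \<Rightarrow> 'k::field) \<Rightarrow> bool" where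
  "spans n F p \<longleftrightarrow> (\<forall>c. (\<forall>u\<in>F. ip n c (p u) = 0) \<longrightarrow> (\<forall>i<n. c i = 0))"

lemma spans_eqD:
  assumes "spans n F p" "\<And>u. u \<in> F \<Longrightarrow> ip n a (p u) = ip n b (p u)" "i < n"
  shows "a i = b i"
proof -
  have "\<forall>u\<in>F. ip n (\<lambda>i. a i - b i) (p u) = 0" using assms(2) by (simp add: ip_diff_left)
  then have "a i - b i = 0" using assms(1,3) unfolding spans_def by blast
  then show ?thesis by simp
qed

lemma spans_app_mat_eqD:
  assumes "spans n F p" "\<And>u i. u \<in> F \<Longrightarrow> i < n \<Longrightarrow> app_mat n A (p u) i = app_mat n B (p u) i"
    "i < n" "j < n"
  shows "A i j = B i j"
  by (rule spans_eqD[OF assms(1) _ assms(4)]) (use assms(2,3) in \<open>simp add: app_mat_def\<close>)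

lemma spans_sym_mat_eqD:
  assumes "spans n F p"
    and "\<And>u w. u \<in> F \<Longrightarrow> w \<in> F \<Longrightarrow> ip n (app_mat n A (p u)) (p w) = ip n (app_mat n B (p u)) (p w)"
    and "i < n" "j < n"
  shows "A i j = B i j"
proof (rule spans_app_mat_eqD[OF assms(1) _ assms(3,4)])
  fix u i assume "u \<in> F" "i < n"
  then show "app_mat n A (p u) i = app_mat n B (p u) i"
    using spans_eqD[OF assms(1), of "app_mat n A (p u)" "app_mat n B (p u)" i] assms(2) by blast
qed

text \<open>At most \<open>n\<close> spanning vectors form a basis, so a functional can be
  prescribed on them.\<close>

lemma spans_dual:
  assumes "spans n F p" "finite F" "card F \<le> n"
  shows "\<exists>c. \<forall>u\<in>F. ip n c (p u) = y u"
proof -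
  have "\<exists>x. (\<forall>i. i \<notin> {..<n} \<longrightarrow> x i = 0) \<and> (\<forall>u\<in>F. ip n x (p u) = y u)"
    by (rule inj_linear_surj)
      (use assms in \<open>auto simp: ip_add_left ip_scale_left spans_def\<close>)
  then show ?thesis by blast
qed

lemma line_open_spans:
  fixes F :: "'a set"
  shows "line_open (spans n F :: ('a \<Rightarrow> nat \<Rightarrow> 'k::field) \<Rightarrow> bool)"
  unfolding line_open_def
proof (intro allI impI)
  fix p q :: "'a \<Rightarrow> nat \<Rightarrow> 'k" assume p: "spans n F p"
  let ?f = "\<lambda>c u. if u \<in> F then ip n c (p u) else 0"
  let ?g = "\<lambda>c u. if u \<in> F then ip n c (\<lambda>i. q u i - p u i) else 0"
  let ?T = "{t. \<exists>x. (\<forall>i. i \<notin> {..<n} \<longrightarrow> x i = 0) \<and> (\<forall>j. ?f x j + t * ?g x j = 0) \<and> (\<exists>i\<in>{..<n}. x i \<noteq> 0)}"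
  have fin: "finite ?T"
  proof (rule pencil_inj_cofinite)
    fix x assume "\<And>i. i \<notin> {..<n} \<Longrightarrow> x i = 0" and x: "\<And>u. ?f x u = 0"
    have "\<forall>u\<in>F. ip n x (p u) = 0"
    proof
      fix u assume "u \<in> F" then show "ip n x (p u) = 0" using x[of u] by simp
    qed
    then show "\<forall>i\<in>{..<n}. x i = 0" using p unfolding spans_def by auto
  qed (auto simp: ip_add_left ip_scale_left)
  have sub: "t \<in> ?T" if t: "\<not> spans n F (affine_line p q t)" for t
  proof -
    obtain c i where c: "\<forall>u\<in>F. ip n c (affine_line p q t u) = 0" "i < n" "c i \<noteq> 0"
      using t unfolding spans_def by blast
    define x where "x = (\<lambda>i. if i < n then c i else 0)"
    have "ip n x b = ip n c b" for b by (rule ip_cong) (auto simp: x_def)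
    moreover have "ip n c (affine_line p q t u) = ip n c (p u) + t * ip n c (\<lambda>i. q u i - p u i)" for u
      by (simp add: affine_line_def ip_add_right ip_scale_right)
    ultimately show ?thesis using c by (intro CollectI exI[of _ x]) (auto simp: x_def)
  qed
  show "finite {t. \<not> spans n F (affine_line p q t)}"
  proof (rule finite_subset[OF subsetI fin])
    fix t assume "t \<in> {t. \<not> spans n F (affine_line p q t)}"
    then have "\<not> spans n F (affine_line p q t)" by (rule CollectD)
    then show "t \<in> ?T" by (rule sub)
  qed
qed

lemma spans_exists:
  assumes "finite F" "card F = n"
  shows "\<exists>p :: 'a \<Rightarrow> nat \<Rightarrow> 'k::field. spans n F p"
proof -
  obtain h where h: "bij_betw h F {..<n}"
    using ex_bij_betw_finite_nat[OF assms(1)] assms(2) by (auto simp: atLeast0LessThan)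
  let ?p = "\<lambda>u i. if i = h u then 1 else 0 :: 'k"
  have "ip n c (?p u) = c (h u)" if "u \<in> F" for c u
    by (rule ip_unit) (use h that in \<open>auto simp: bij_betw_def\<close>)
  moreover have "\<exists>u\<in>F. i = h u" if "i < n" for i
  proof -
    have "i \<in> h ` F" using h that by (auto simp: bij_betw_def)
    then show ?thesis by blast
  qed
  ultimately have "spans n F ?p"
    unfolding spans_def by (metis (no_types, lifting))
  then show ?thesis by blast
qed

definition motion :: "nat \<Rightarrow> 'a set set \<Rightarrow> ('a \<Rightarrow> nat \<Rightarrow> 'k::field) \<Rightarrow> ('a \<Rightarrow> nat \<Rightarrow> 'k) \<Rightarrow> bool" where
  "motion n E p m \<longleftrightarrow> (\<forall>u w. {u, w} \<in> E \<longrightarrow> ip n (m u) (p w) = ip n (m w) (p u))"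

text \<open>The injectivity of a linear system, hence open along lines. Solidity, which tolerates
  trivial motions, is not directly of this kind; \<open>pinned_solid\<close> and
  \<open>solid_pinned\<close> translate between the two.\<close>

definition pinned :: "nat \<Rightarrow> 'a set set \<Rightarrow> 'a set \<Rightarrow> ('a \<Rightarrow> nat \<Rightarrow> 'k::field) \<Rightarrow> bool" where
  "pinned n E F p \<longleftrightarrow>
     (\<forall>m. motion n E p m \<longrightarrow> (\<forall>u\<in>F. \<forall>i<n. m u i = 0) \<longrightarrow> (\<forall>u\<in>\<Union>E. \<forall>i<n. m u i = 0))"

definition solid :: "nat \<Rightarrow> 'a set set \<Rightarrow> ('a \<Rightarrow> nat \<Rightarrow> 'k::field) \<Rightarrow> 'a set \<Rightarrow> bool" where
  "solid n E p W \<longleftrightarrow> (\<forall>m. motion n E p m \<longrightarrow>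
     (\<exists>B. sym_mat n B \<and> (\<forall>u\<in>W. \<forall>i<n. m u i = app_mat n B (p u) i)))"

lemma motion_mono: "motion n E p m \<Longrightarrow> E' \<subseteq> E \<Longrightarrow> motion n E' p m"
  unfolding motion_def by blast

lemma solid_mono: "solid n E p W \<Longrightarrow> E \<subseteq> E' \<Longrightarrow> W' \<subseteq> W \<Longrightarrow> solid n E' p W'"
  unfolding solid_def motion_def by (meson subsetD)

lemma motion_diff_sym:
  assumes "motion n E p m" "sym_mat n B"
  shows "motion n E p (\<lambda>u i. m u i - app_mat n B (p u) i)"
  using assms(1) sym_mat_ip[OF assms(2)] unfolding motion_def by (simp add: ip_diff_left)

text \<open>On a basis every assignment has the form \<open>u \<mapsto> B p_u\<close>, with the rows
  of \<open>B\<close> found by \<open>spans_dual\<close>; the edge equations say that the bilinear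
  form of \<open>B\<close> is symmetric on that basis.\<close>

lemma solid_clique:
  assumes "spans n F p" "finite F" "card F \<le> n" and cl: "\<And>u w. u \<in> F \<Longrightarrow> w \<in> F \<Longrightarrow> u \<noteq> w \<Longrightarrow> {u, w} \<in> E"
  shows "solid n E p F"
  unfolding solid_def
proof (intro allI impI)
  fix m assume m: "motion n E p m"
  have "\<exists>B. \<forall>i. \<forall>u\<in>F. ip n (B i) (p u) = m u i"
  proof (rule choice, rule allI)
    fix i show "\<exists>c. \<forall>u\<in>F. ip n c (p u) = m u i"
      by (rule spans_dual[OF assms(1-3), of "\<lambda>u. m u i"])
  qed
  then obtain B where B: "\<And>i u. u \<in> F \<Longrightarrow> app_mat n B (p u) i = m u i" unfolding app_mat_def by blast
  have mm: "ip n (m u) (p w) = ip n (m w) (p u)" if "u \<in> F" "w \<in> F" for u w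
    using m cl[OF that] unfolding motion_def by (cases "u = w") auto
  have eq: "ip n (app_mat n B (p u)) (p w) = ip n (m u) (p w)" if "u \<in> F" for u w
    by (rule ip_cong) (simp_all add: B that)
  have "sym_mat n B"
    unfolding sym_mat_def
  proof (intro allI impI)
    fix i j assume ij: "i < n" "j < n"
    show "B i j = B j i"
    proof (rule spans_sym_mat_eqD[OF assms(1) _ ij, of B "\<lambda>i j. B j i"])
      fix u w assume "u \<in> F" "w \<in> F"
      then have "ip n (app_mat n B (p u)) (p w) = ip n (app_mat n B (p w)) (p u)"
        by (simp only: eq mm)
      also have "\<dots> = ip n (app_mat n (\<lambda>i j. B j i) (p u)) (p w)" by (rule app_mat_transpose)
      finally show "ip n (app_mat n B (p u)) (p w) = ip n (app_mat n (\<lambda>i j. B j i) (p u)) (p w)" .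
    qed
  qed
  then show "\<exists>B. sym_mat n B \<and> (\<forall>u\<in>F. \<forall>i<n. m u i = app_mat n B (p u) i)"
    using B by (intro exI[of _ B]) simp
qed

text \<open>By \<open>solid_clique\<close> a trivial motion agrees with \<open>m\<close> on
  \<open>F\<close>; subtracting it leaves a motion that pinning annihilates.\<close>

lemma pinned_solid:
  assumes "pinned n E F p" "spans n F p" "finite F" "card F \<le> n"
    and "\<And>u w. u \<in> F \<Longrightarrow> w \<in> F \<Longrightarrow> u \<noteq> w \<Longrightarrow> {u, w} \<in> E"
  shows "solid n E p (\<Union>E)"
  unfolding solid_def
proof (intro allI impI)
  fix m assume m: "motion n E p m"
  obtain B where B: "sym_mat n B" "\<forall>u\<in>F. \<forall>i<n. m u i = app_mat n B (p u) i"
    using solid_clique[OF assms(2-5)] m unfolding solid_def by blast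
  have "(\<forall>u\<in>F. \<forall>i<n. m u i - app_mat n B (p u) i = 0) \<longrightarrow>
      (\<forall>u\<in>\<Union>E. \<forall>i<n. m u i - app_mat n B (p u) i = 0)"
    using assms(1) motion_diff_sym[OF m B(1)] unfolding pinned_def by blast
  then have "\<forall>u\<in>\<Union>E. \<forall>i<n. m u i - app_mat n B (p u) i = 0"
    using B(2) by simp
  then show "\<exists>B. sym_mat n B \<and> (\<forall>u\<in>\<Union>E. \<forall>i<n. m u i = app_mat n B (p u) i)"
    using B(1) by auto
qed

lemma solid_pinned:
  assumes "solid n E p (\<Union>E)" "spans n F p" "F \<subseteq> \<Union>E"
  shows "pinned n E F p"
  unfolding pinned_def
proof (intro allI impI ballI)
  fix m u i assume m: "motion n E p m" "\<forall>u\<in>F. \<forall>i<n. m u i = 0" and u: "u \<in> \<Union>E" "i < n"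
  obtain B where B: "sym_mat n B" "\<forall>u\<in>\<Union>E. \<forall>i<n. m u i = app_mat n B (p u) i"
    using assms(1) m unfolding solid_def by blast
  have z: "app_mat n (\<lambda>i j. 0) x = (\<lambda>i. 0)" for x :: "nat \<Rightarrow> 'b"
    by (simp add: app_mat_def ip_zero_left)
  have "B a b = 0" if "a < n" "b < n" for a b
  proof (rule spans_app_mat_eqD[OF assms(2) _ that, of B "\<lambda>i j. 0"])
    fix u i assume "u \<in> F" "i < n"
    then have "m u i = 0" "m u i = app_mat n B (p u) i" using m(2) B(2) assms(3) by blast+
    then show "app_mat n B (p u) i = app_mat n (\<lambda>i j. 0) (p u) i" by (simp add: z)
  qed
  then have "app_mat n B (p u) i = 0"
    unfolding app_mat_def using u(2) by (intro ip_eq_0_left) blast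
  moreover have "m u i = app_mat n B (p u) i" using B(2) u by blast
  ultimately show "m u i = 0" by simp
qed

text \<open>A trivial motion is determined by its values on a spanning set, so two solid pieces that
  share one have the same matrix.\<close>

lemma solid_Un:
  assumes "solid n E p W" "solid n E p W'" "spans n F p" "F \<subseteq> W" "F \<subseteq> W'"
  shows "solid n E p (W \<union> W')"
  unfolding solid_def
proof (intro allI impI)
  fix m assume m: "motion n E p m"
  obtain B where B: "sym_mat n B" "\<forall>u\<in>W. \<forall>i<n. m u i = app_mat n B (p u) i"
    using assms(1) m unfolding solid_def by blast
  obtain C where C: "sym_mat n C" "\<forall>u\<in>W'. \<forall>i<n. m u i = app_mat n C (p u) i"
    using assms(2) m unfolding solid_def by blast
  have "C i j = B i j" if "i < n" "j < n" for i j
  proof (rule spans_app_mat_eqD[OF assms(3) _ that])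
    fix u i assume "u \<in> F" "i < n"
    then have "m u i = app_mat n C (p u) i" "m u i = app_mat n B (p u) i"
      using B(2) C(2) assms(4,5) by blast+
    then show "app_mat n C (p u) i = app_mat n B (p u) i" by simp
  qed
  then have "app_mat n C x i = app_mat n B x i" if "i < n" for x i
    unfolding app_mat_def using that by (intro ip_cong) auto
  then show "\<exists>B. sym_mat n B \<and> (\<forall>u\<in>W \<union> W'. \<forall>i<n. m u i = app_mat n B (p u) i)"
    using B C by (intro exI[of _ B]) auto
qed

lemma line_open_pinned:
  fixes E :: "'a set set"
  assumes "finite (\<Union>E)"
  shows "line_open (pinned n E F :: ('a \<Rightarrow> nat \<Rightarrow> 'k::field) \<Rightarrow> bool)"
  unfolding line_open_def
proof (intro allI impI)
  fix p q :: "'a \<Rightarrow> nat \<Rightarrow> 'k" assume p: "pinned n E F p"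
  define I where "I = \<Union>E \<times> {..<n}"
  \<comment> \<open>The edge equations are linear in the points, so along the line they are those at
    \<open>p\<close> plus \<open>t\<close> times those in the direction \<open>q - p\<close>. The
    pinning conditions, indexed by \<open>Inr\<close>, do not involve the points and enter only the
    constant part.\<close>
  define eqn where "eqn r x e = (case e of Inl (u, w) \<Rightarrow>
      if {u, w} \<in> E then ip n (\<lambda>i. x (u, i)) (r w) - ip n (\<lambda>i. x (w, i)) (r u) else 0 | Inr _ \<Rightarrow> 0)"
    for r :: "'a \<Rightarrow> nat \<Rightarrow> 'k" and x :: "'a \<times> nat \<Rightarrow> 'k" and e :: "'a \<times> 'a + 'a \<times> nat"
  define fx where "fx x e = (case e of Inl _ \<Rightarrow> 0 | Inr (u, i) \<Rightarrow> if u \<in> F \<and> i < n then x (u, i) else 0)"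
    for x :: "'a \<times> nat \<Rightarrow> 'k" and e :: "'a \<times> 'a + 'a \<times> nat"
  let ?f = "\<lambda>x e. eqn p x e + fx x e"
  let ?g = "eqn (\<lambda>u i. q u i - p u i)"
  let ?T = "{t. \<exists>x. (\<forall>i. i \<notin> I \<longrightarrow> x i = 0) \<and> (\<forall>j. ?f x j + t * ?g x j = 0) \<and> (\<exists>i\<in>I. x i \<noteq> 0)}"
  have eqn_add: "eqn r (\<lambda>i. x i + y i) e = eqn r x e + eqn r y e" for r x y e
    by (cases e) (auto simp: eqn_def ip_add_left)
  have eqn_scale: "eqn r (\<lambda>i. c * x i) e = c * eqn r x e" for r x c e
    by (cases e) (auto simp: eqn_def ip_scale_left algebra_simps)
  have fx_add: "fx (\<lambda>i. x i + y i) e = fx x e + fx y e" for x y e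
    by (cases e) (auto simp: fx_def)
  have fx_scale: "fx (\<lambda>i. c * x i) e = c * fx x e" for x c e
    by (cases e) (auto simp: fx_def)
  have fin: "finite ?T"
  proof (rule pencil_inj_cofinite)
    show "finite I" using assms by (simp add: I_def)
    fix x assume "\<And>i. i \<notin> I \<Longrightarrow> x i = 0" and x: "\<And>e. ?f x e = 0"
    have "motion n E p (\<lambda>u i. x (u, i))"
      unfolding motion_def
    proof (intro allI impI)
      fix u w assume "{u, w} \<in> E"
      then show "ip n (\<lambda>i. x (u, i)) (p w) = ip n (\<lambda>i. x (w, i)) (p u)"
        using x[of "Inl (u, w)"] by (simp add: eqn_def fx_def)
    qed
    moreover have "\<forall>u\<in>F. \<forall>i<n. x (u, i) = 0"
    proof (intro ballI allI impI)
      fix u i assume "u \<in> F" "i < n"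
      then show "x (u, i) = 0" using x[of "Inr (u, i)"] by (simp add: eqn_def fx_def)
    qed
    ultimately show "\<forall>i\<in>I. x i = 0" using p unfolding pinned_def I_def by auto
  qed (auto simp: eqn_add fx_add eqn_scale fx_scale algebra_simps)
  have sub: "t \<in> ?T" if t: "\<not> pinned n E F (affine_line p q t)" for t
  proof -
    obtain m u0 i0 where m: "motion n E (affine_line p q t) m" "\<forall>u\<in>F. \<forall>i<n. m u i = 0"
      "u0 \<in> \<Union>E" "i0 < n" "m u0 i0 \<noteq> 0"
      using t unfolding pinned_def by blast
    define x where "x = (\<lambda>(u, i). if u \<in> \<Union>E \<and> i < n then m u i else 0)"
    have x: "ip n (\<lambda>i. x (u, i)) b = ip n (m u) b" if "u \<in> \<Union>E" for u b
      by (rule ip_cong) (use that in \<open>auto simp: x_def\<close>)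
    have "?f x e + t * ?g x e = 0" for e
    proof (cases e)
      case (Inl uw)
      then obtain u w where e: "e = Inl (u, w)" by (cases uw) auto
      show ?thesis
      proof (cases "{u, w} \<in> E")
        case True
        then have "u \<in> \<Union>E" "w \<in> \<Union>E" by blast+
        have "ip n (m u) (affine_line p q t w) = ip n (m w) (affine_line p q t u)"
          using m(1) True unfolding motion_def by blast
        then have eq: "ip n (m u) (p w) + t * ip n (m u) (\<lambda>i. q w i - p w i) =
            ip n (m w) (p u) + t * ip n (m w) (\<lambda>i. q u i - p u i)"
          unfolding affine_line_def ip_add_right ip_scale_right by blast
        have "?f x e + t * ?g x e = (ip n (m u) (p w) + t * ip n (m u) (\<lambda>i. q w i - p w i)) -
            (ip n (m w) (p u) + t * ip n (m w) (\<lambda>i. q u i - p u i))"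
          using \<open>u \<in> \<Union>E\<close> \<open>w \<in> \<Union>E\<close>
          by (simp add: e eqn_def fx_def True x right_diff_distrib del: Union_iff)
        then show ?thesis unfolding eq by simp
      qed (simp add: e eqn_def fx_def)
    next
      case (Inr b)
      then show ?thesis using m(2) by (auto simp: eqn_def fx_def x_def split: prod.split)
    qed
    then show ?thesis using m(3-5)
      by (intro CollectI exI[of _ x] conjI bexI[of _ "(u0, i0)"]) (auto simp: x_def I_def)
  qed
  show "finite {t. \<not> pinned n E F (affine_line p q t)}"
  proof (rule finite_subset[OF subsetI fin])
    fix t assume "t \<in> {t. \<not> pinned n E F (affine_line p q t)}"
    then have "\<not> pinned n E F (affine_line p q t)" by (rule CollectD)
    then show "t \<in> ?T" by (rule sub)
  qed
qed

text \<open>Whatever some choice of points can pin is pinned by \<open>p\<close>. So degenerate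
  positions, such as two coinciding points, may be used to establish pinning and then be
  forgotten.\<close>

definition generic :: "nat \<Rightarrow> 'a set \<Rightarrow> ('a \<Rightarrow> nat \<Rightarrow> 'k::field) \<Rightarrow> bool" where
  "generic n V p \<longleftrightarrow> (\<forall>F\<subseteq>V. card F = n \<longrightarrow> spans n F p) \<and>
     (\<forall>E F. E \<subseteq> Pow V \<longrightarrow> F \<subseteq> V \<longrightarrow> (\<exists>q :: 'a \<Rightarrow> nat \<Rightarrow> 'k. pinned n E F q) \<longrightarrow> pinned n E F p)"

lemma generic_exists:
  fixes V :: "'a set"
  assumes "infinite (UNIV :: 'k::field set)" "finite V"
  shows "\<exists>p :: 'a \<Rightarrow> nat \<Rightarrow> 'k. generic n V p"
proof -
  let ?A = "(\<lambda>F. spans n F :: ('a \<Rightarrow> nat \<Rightarrow> 'k) \<Rightarrow> bool) ` {F. F \<subseteq> V \<and> card F = n}"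
  let ?B = "(\<lambda>(E, F). pinned n E F :: ('a \<Rightarrow> nat \<Rightarrow> 'k) \<Rightarrow> bool) `
    {(E, F). E \<subseteq> Pow V \<and> F \<subseteq> V \<and> (\<exists>q :: 'a \<Rightarrow> nat \<Rightarrow> 'k. pinned n E F q)}"
  have "finite {(E, F). E \<subseteq> Pow V \<and> F \<subseteq> V \<and> (\<exists>q :: 'a \<Rightarrow> nat \<Rightarrow> 'k. pinned n E F q)}"
    by (rule finite_subset[of _ "Pow (Pow V) \<times> Pow V"]) (use assms(2) in auto)
  moreover have "finite {F. F \<subseteq> V \<and> card F = n}"
    by (rule finite_subset[of _ "Pow V"]) (use assms(2) in auto)
  ultimately have "finite (?A \<union> ?B)" by blast
  then have "\<exists>p. \<forall>P\<in>?A \<union> ?B. P p"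
  proof (rule line_open_common_point[OF assms(1)])
    fix P assume "P \<in> ?A \<union> ?B"
    then show "line_open P \<and> (\<exists>p. P p)"
    proof
      assume "P \<in> ?A"
      then obtain F where F: "P = spans n F" "F \<subseteq> V" "card F = n" by blast
      then show ?thesis using spans_exists[of F n] line_open_spans finite_subset[OF _ assms(2)] by blast
    next
      assume "P \<in> ?B"
      then obtain E F and q :: "'a \<Rightarrow> nat \<Rightarrow> 'k"
        where E: "P = pinned n E F" "E \<subseteq> Pow V" "pinned n E F q"
        by (elim imageE CollectE case_prodE conjE exE) simp
      then have "finite (\<Union>E)" by (intro finite_subset[OF _ assms(2)]) blast
      then show ?thesis using E line_open_pinned by blast
    qed
  qed
  then obtain p where p: "\<forall>P\<in>?A \<union> ?B. P p" by blast
  have "generic n V p"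
    unfolding generic_def
  proof (intro conjI allI impI)
    fix F assume "F \<subseteq> V" "card F = n"
    then have "spans n F \<in> ?A \<union> ?B" by blast
    then show "spans n F p" using p by blast
  next
    fix E F assume "E \<subseteq> Pow V" "F \<subseteq> V" "\<exists>q :: 'a \<Rightarrow> nat \<Rightarrow> 'k. pinned n E F q"
    then have "(\<lambda>(E, F). pinned n E F) (E, F) \<in> ?B" by (intro imageI) simp
    then have "pinned n E F \<in> ?A \<union> ?B" by simp
    then show "pinned n E F p" using p by blast
  qed
  then show ?thesis by blast
qed

section \<open>Cycles modulo 2 and edge contraction\<close>

text \<open>From here on a complex is represented by the set \<open>S\<close> of its facets, and
  \<open>faces S\<close> is the complex itself; accordingly \<open>lk\<close> consists of the facets
  of the link.\<close>

definition faces :: "'a set set \<Rightarrow> 'a set set" where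
  "faces S = {G. \<exists>F\<in>S. G \<subseteq> F}"

definition lk :: "'a set set \<Rightarrow> 'a set \<Rightarrow> 'a set set" where
  "lk S G = (\<lambda>F. F - G) ` {F \<in> S. G \<subseteq> F}"

definition edges :: "'a set set \<Rightarrow> 'a set set" where
  "edges S = {e \<in> faces S. card e = 2}"

definition cnt :: "'a set set \<Rightarrow> 'a set \<Rightarrow> nat" where
  "cnt S R = card {F \<in> S. R \<subseteq> F}"

definition pure :: "nat \<Rightarrow> 'a set set \<Rightarrow> bool" where
  "pure n S \<longleftrightarrow> finite S \<and> (\<forall>F\<in>S. finite F \<and> card F = n)"

text \<open>\<open>S\<close> stands for the chain modulo 2 that is the sum of its facets;
  \<open>cnt S R\<close> is, modulo 2, the coefficient of its boundary at the ridge
  \<open>R\<close>.\<close>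

definition cyc :: "nat \<Rightarrow> 'a set set \<Rightarrow> bool" where
  "cyc n S \<longleftrightarrow> pure n S \<and> (\<forall>R. finite R \<longrightarrow> Suc (card R) = n \<longrightarrow> even (cnt S R))"

definition circuit :: "nat \<Rightarrow> 'a set set \<Rightarrow> bool" where
  "circuit n S \<longleftrightarrow> cyc n S \<and> S \<noteq> {} \<and> (\<forall>A\<subseteq>S. cyc n A \<longrightarrow> A = {} \<or> A = S)"

lemma pureD: "pure n S \<Longrightarrow> F \<in> S \<Longrightarrow> finite F" "pure n S \<Longrightarrow> F \<in> S \<Longrightarrow> card F = n" "pure n S \<Longrightarrow> finite S"
  by (auto simp: pure_def)

lemma pure_subset: "pure n S \<Longrightarrow> A \<subseteq> S \<Longrightarrow> pure n A"
  by (auto simp: pure_def intro: finite_subset)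

lemma pure_finite_Union: "pure n S \<Longrightarrow> finite (\<Union>S)"
  by (auto simp: pure_def)

lemma faces_finite: "pure n S \<Longrightarrow> G \<in> faces S \<Longrightarrow> finite G"
  by (auto simp: pure_def faces_def intro: finite_subset)

lemma faces_subset: "G \<in> faces S \<Longrightarrow> H \<subseteq> G \<Longrightarrow> H \<in> faces S"
  by (auto simp: faces_def)

lemma faces_mono: "A \<subseteq> S \<Longrightarrow> faces A \<subseteq> faces S"
  by (auto simp: faces_def)

lemma edges_mono: "A \<subseteq> S \<Longrightarrow> edges A \<subseteq> edges S"
  using faces_mono by (auto simp: edges_def)

lemma edges_pair: "{u, w} \<in> edges S \<longleftrightarrow> u \<noteq> w \<and> {u, w} \<in> faces S"
  by (auto simp: edges_def card_insert_if)

lemma edgesE: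
  assumes "e \<in> edges S"
  obtains u w where "e = {u, w}" "u \<noteq> w" "{u, w} \<in> faces S"
  using assms by (auto simp: edges_def card_2_iff)

lemma edges_facet: "F \<in> S \<Longrightarrow> u \<in> F \<Longrightarrow> w \<in> F \<Longrightarrow> u \<noteq> w \<Longrightarrow> {u, w} \<in> edges S"
  by (auto simp: edges_pair faces_def)

lemma Union_edges:
  assumes "pure n S" "2 \<le> n"
  shows "\<Union>(edges S) = \<Union>S"
proof
  show "\<Union>(edges S) \<subseteq> \<Union>S" by (auto simp: edges_def faces_def)
  show "\<Union>S \<subseteq> \<Union>(edges S)"
  proof
    fix u assume "u \<in> \<Union>S"
    then obtain F where F: "F \<in> S" "u \<in> F" by blast
    have "F \<noteq> {u}" using pureD(2)[OF assms(1) F(1)] assms(2) by auto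
    then obtain w where "w \<in> F" "w \<noteq> u" using F(2) by blast
    then show "u \<in> \<Union>(edges S)" using edges_facet[OF F(1,2)] by blast
  qed
qed

lemma edges_subset_Pow: "edges S \<subseteq> Pow (\<Union>S)"
  by (auto simp: edges_def faces_def)

lemma cnt_split:
  assumes "finite S" "A \<subseteq> S"
  shows "cnt S R = cnt A R + cnt (S - A) R"
proof -
  have "{F \<in> S. R \<subseteq> F} = {F \<in> A. R \<subseteq> F} \<union> {F \<in> S - A. R \<subseteq> F}" using assms(2) by blast
  then show ?thesis unfolding cnt_def using assms
    by (simp add: card_Un_disjoint finite_subset Int_def)
qed

lemma cnt_Un:
  assumes "finite A" "finite B" "A \<inter> B = {}"
  shows "cnt (A \<union> B) R = cnt A R + cnt B R"
  using cnt_split[of "A \<union> B" A R] assms by (simp add: Un_Diff Diff_triv Int_commute)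

lemma cnt_0: "finite S \<Longrightarrow> cnt S R = 0 \<longleftrightarrow> R \<notin> faces S"
  by (auto simp: cnt_def faces_def)

lemma odd_cnt_face: "odd (cnt S R) \<Longrightarrow> R \<in> faces S"
  by (cases "finite S") (auto simp: cnt_def faces_def dest: odd_card_imp_not_empty)

lemma cycD: "cyc n S \<Longrightarrow> pure n S" "cyc n S \<Longrightarrow> finite R \<Longrightarrow> Suc (card R) = n \<Longrightarrow> even (cnt S R)"
  by (auto simp: cyc_def)

lemma cyc_Diff: "cyc n S \<Longrightarrow> cyc n A \<Longrightarrow> A \<subseteq> S \<Longrightarrow> cyc n (S - A)"
  using cnt_split[of S A] pure_subset[of n S "S - A"]
  by (auto simp: cyc_def pureD)

lemma circuitD:
  assumes "circuit n S"
  shows "pure n S" "cyc n S" "S \<noteq> {}" "A \<subseteq> S \<Longrightarrow> cyc n A \<Longrightarrow> A \<noteq> {} \<Longrightarrow> A = S"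
  using assms by (auto simp: circuit_def cyc_def)

text \<open>The boundary of a boundary vanishes modulo 2: in a facet containing \<open>J\<close>
  exactly two ridges contain \<open>J\<close>, one for each of the two remaining vertices.\<close>

lemma even_boundary_of_boundary:
  assumes A: "pure n A" and J: "finite J" "card J + 2 = n"
  shows "even (card {R. finite R \<and> Suc (card R) = n \<and> J \<subseteq> R \<and> odd (cnt A R)})"
proof -
  define Q where "Q = {R \<in> Pow (\<Union>A). Suc (card R) = n \<and> J \<subseteq> R}"
  have finQ: "finite Q" and finA: "finite A" and finU: "finite (\<Union>A)"
    using pure_finite_Union[OF A] pureD[OF A] by (auto simp: Q_def)
  have "{R. finite R \<and> Suc (card R) = n \<and> J \<subseteq> R \<and> odd (cnt A R)} = {R \<in> Q. odd (cnt A R)}"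
  proof -
    have "R \<subseteq> \<Union>A" if "odd (cnt A R)" for R using odd_cnt_face[OF that] by (auto simp: faces_def)
    then show ?thesis using finite_subset[OF _ finU] by (auto simp: Q_def)
  qed
  moreover have "even (\<Sum>R\<in>Q. cnt A R)"
  proof -
    have "(\<Sum>R\<in>Q. cnt A R) = (\<Sum>R\<in>Q. \<Sum>F\<in>A. if R \<subseteq> F then 1 else 0)"
      unfolding cnt_def using finA by (simp add: sum.If_cases Int_def)
    also have "\<dots> = (\<Sum>F\<in>A. \<Sum>R\<in>Q. if R \<subseteq> F then 1 else 0)" by (rule sum.swap)
    also have "\<dots> = (\<Sum>F\<in>A. card {R \<in> Q. R \<subseteq> F})"
      using finQ by (simp add: sum.If_cases Int_def)
    also have "even \<dots>"
    proof (rule dvd_sum)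
      fix F assume F: "F \<in> A"
      note FF = pureD(1,2)[OF A F]
      show "even (card {R \<in> Q. R \<subseteq> F})"
      proof (cases "J \<subseteq> F")
        case True
        have "{R \<in> Q. R \<subseteq> F} = (\<lambda>a. insert a J) ` (F - J)"
        proof (intro set_eqI iffI)
          fix R assume "R \<in> {R \<in> Q. R \<subseteq> F}"
          then have R: "Suc (card R) = n" "J \<subseteq> R" "R \<subseteq> F" by (auto simp: Q_def)
          have "finite R" using R(3) FF(1) by (rule finite_subset)
          then have "card (R - J) = 1" using R(1,2) J by (simp add: card_Diff_subset)
          then obtain a where "R - J = {a}" by (auto simp: card_1_singleton_iff)
          then have "R = insert a J" "a \<in> F - J" using R by auto
          then show "R \<in> (\<lambda>a. insert a J) ` (F - J)" by blast
        next
          fix R assume "R \<in> (\<lambda>a. insert a J) ` (F - J)"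
          then show "R \<in> {R \<in> Q. R \<subseteq> F}" using True J F by (auto simp: Q_def)
        qed
        moreover have "inj_on (\<lambda>a. insert a J) (F - J)" by (auto simp: inj_on_def)
        ultimately have "card {R \<in> Q. R \<subseteq> F} = card (F - J)" by (simp add: card_image)
        also have "\<dots> = 2" using True J FF by (simp add: card_Diff_subset)
        finally show ?thesis by simp
      next
        case False
        then have "{R \<in> Q. R \<subseteq> F} = {}" by (auto simp: Q_def)
        then show ?thesis by (simp only: card.empty even_zero)
      qed
    qed
    finally show ?thesis .
  qed
  ultimately show ?thesis using even_sum_iff[OF finQ, of "cnt A"] by simp
qed

text \<open>
  Families whose push-forward under the contraction of \<open>y\<close> to \<open>x\<close> is a cycle modulo 2, and the
  cycle obtained from such a family by adding facets containing the edge \<open>x y\<close>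
  (Fogelsanger's decomposition).
\<close>

definition gcyc :: "nat \<Rightarrow> 'a \<Rightarrow> 'a \<Rightarrow> 'a set set \<Rightarrow> bool" where
  "gcyc n x y A \<longleftrightarrow> pure n A \<and> (\<forall>F\<in>A. \<not> (x \<in> F \<and> y \<in> F)) \<and>
     (\<forall>R. finite R \<longrightarrow> Suc (card R) = n \<longrightarrow> x \<notin> R \<longrightarrow> y \<notin> R \<longrightarrow> even (cnt A R)) \<and>
     (\<forall>K. finite K \<longrightarrow> card K + 2 = n \<longrightarrow> x \<notin> K \<longrightarrow> y \<notin> K \<longrightarrow>
        odd (cnt A (insert x K)) = odd (cnt A (insert y K)))"

definition fill_base :: "nat \<Rightarrow> 'a \<Rightarrow> 'a \<Rightarrow> 'a set set \<Rightarrow> 'a set set" where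
  "fill_base n x y A = {K. finite K \<and> card K + 2 = n \<and> x \<notin> K \<and> y \<notin> K \<and> odd (cnt A (insert x K))}"

definition fill :: "nat \<Rightarrow> 'a \<Rightarrow> 'a \<Rightarrow> 'a set set \<Rightarrow> 'a set set" where
  "fill n x y A = A \<union> (\<lambda>K. insert x (insert y K)) ` fill_base n x y A"

lemma gcyc_pure: "gcyc n x y A \<Longrightarrow> pure n A"
  by (simp add: gcyc_def)

lemma gcyc_off: "gcyc n x y A \<Longrightarrow> F \<in> A \<Longrightarrow> x \<in> F \<Longrightarrow> y \<notin> F"
  by (simp add: gcyc_def)

lemma gcyc_even:
  "gcyc n x y A \<Longrightarrow> finite R \<Longrightarrow> Suc (card R) = n \<Longrightarrow> x \<notin> R \<Longrightarrow> y \<notin> R \<Longrightarrow> even (cnt A R)"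
  by (simp add: gcyc_def)

lemma gcyc_odd:
  "gcyc n x y A \<Longrightarrow> finite K \<Longrightarrow> card K + 2 = n \<Longrightarrow> x \<notin> K \<Longrightarrow> y \<notin> K \<Longrightarrow>
     odd (cnt A (insert x K)) = odd (cnt A (insert y K))"
  by (simp add: gcyc_def)

lemma fill_base_face:
  assumes "gcyc n x y A" "K \<in> fill_base n x y A"
  shows "insert x K \<in> faces A" "insert y K \<in> faces A"
  using assms by (auto simp: fill_base_def gcyc_def intro!: odd_cnt_face)

lemma finite_fill_base:
  assumes "pure n A"
  shows "finite (fill_base n x y A)"
proof (rule finite_subset)
  show "fill_base n x y A \<subseteq> Pow (\<Union>A)"
  proof
    fix K assume "K \<in> fill_base n x y A"
    then have "insert x K \<in> faces A" by (auto simp: fill_base_def intro: odd_cnt_face)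
    then show "K \<in> Pow (\<Union>A)" by (auto simp: faces_def)
  qed
  show "finite (Pow (\<Union>A))" using pure_finite_Union[OF assms] by simp
qed

lemma fill_pure:
  assumes "gcyc n x y A" "x \<noteq> y"
  shows "pure n (fill n x y A)"
  using gcyc_pure[OF assms(1)] finite_fill_base[OF gcyc_pure[OF assms(1)], of x y] assms(2)
  by (auto simp: pure_def fill_def fill_base_def)

lemma cnt_fill:
  assumes "gcyc n x y A"
  shows "cnt (fill n x y A) R = cnt A R + card {K \<in> fill_base n x y A. R \<subseteq> insert x (insert y K)}"
proof -
  let ?f = "\<lambda>K. insert x (insert y K)"
  have fin: "finite A" "finite (fill_base n x y A)"
    using pureD(3)[OF gcyc_pure[OF assms]] finite_fill_base[OF gcyc_pure[OF assms]] by blast+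
  have "A \<inter> ?f ` fill_base n x y A = {}" using assms by (auto simp: gcyc_def)
  then have "cnt (fill n x y A) R = cnt A R + cnt (?f ` fill_base n x y A) R"
    unfolding fill_def using fin by (intro cnt_Un) auto
  moreover have "{F \<in> ?f ` fill_base n x y A. R \<subseteq> F} = ?f ` {K \<in> fill_base n x y A. R \<subseteq> ?f K}" by blast
  moreover have "inj_on ?f {K \<in> fill_base n x y A. R \<subseteq> ?f K}"
    by (rule inj_on_inverseI[where g = "\<lambda>F. F - {x, y}"]) (auto simp: fill_base_def)
  ultimately show ?thesis by (simp add: cnt_def card_image)
qed

lemma card_remove_Suc: "finite R \<Longrightarrow> x \<in> R \<Longrightarrow> Suc (card (R - {x})) = card R"
  using card.remove[of R x] by simp

text \<open>A ridge containing exactly one of \<open>x\<close>, \<open>y\<close> is corrected by at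
  most one added facet, and the second parity condition of \<open>gcyc\<close> lets that facet serve
  \<open>insert x K\<close> and \<open>insert y K\<close> at once. At a ridge containing both, the
  added facets are counted by the boundary of the boundary of \<open>A\<close>. Ridges avoiding both
  are not affected.\<close>

lemma fill_cyc:
  fixes x :: 'a
  assumes A: "gcyc n x y A" and xy: "x \<noteq> y"
  shows "cyc n (fill n x y A)"
  unfolding cyc_def
proof (intro conjI allI impI)
  fix R :: "'a set" assume R: "finite R" "Suc (card R) = n"
  let ?f = "\<lambda>K. insert x (insert y K)"
  have base: "finite K" "card K + 2 = n" "x \<notin> K" "y \<notin> K" if "K \<in> fill_base n x y A" for K
    using that by (auto simp: fill_base_def)
  show "even (cnt (fill n x y A) R)"
  proof (cases "x \<in> R")
    case x: True
    show ?thesis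
    proof (cases "y \<in> R")
      case y: True
      have "R \<notin> faces A" using gcyc_off[OF A] x y unfolding faces_def by blast
      then have A0: "cnt A R = 0" using cnt_0 pureD(3)[OF gcyc_pure[OF A]] by metis
      define J where "J = R - {y}"
      have J: "finite J" "card J + 2 = n" "x \<in> J" "y \<notin> J" "insert y J = R"
        using R x y xy card_remove_Suc[of R _] unfolding J_def by auto
      have "{R. finite R \<and> Suc (card R) = n \<and> J \<subseteq> R \<and> odd (cnt A R)} =
          insert x ` {K \<in> fill_base n x y A. R \<subseteq> ?f K}" (is "?L = ?R")
      proof (intro set_eqI iffI)
        fix Q assume "Q \<in> ?L"
        then have Q: "finite Q" "Suc (card Q) = n" "J \<subseteq> Q" "odd (cnt A Q)" by auto
        have "x \<in> Q" using Q(3) J(3) by blast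
        moreover have "y \<notin> Q"
          using odd_cnt_face[OF Q(4)] A \<open>x \<in> Q\<close> by (auto simp: gcyc_def faces_def)
        ultimately have "Q - {x} \<in> fill_base n x y A"
          using Q card_remove_Suc[OF Q(1) \<open>x \<in> Q\<close>] by (simp add: fill_base_def insert_absorb)
        moreover have "Q = insert x (Q - {x})" using \<open>x \<in> Q\<close> by blast
        moreover have "R \<subseteq> ?f (Q - {x})" using Q(3) J(5) by blast
        ultimately show "Q \<in> ?R" by blast
      next
        fix Q assume "Q \<in> ?R"
        then obtain K where K: "Q = insert x K" "K \<in> fill_base n x y A" "R \<subseteq> ?f K" by blast
        then show "Q \<in> ?L" using base[OF K(2)] J by (auto simp: fill_base_def)
      qed
      moreover have "inj_on (insert x) {K \<in> fill_base n x y A. R \<subseteq> ?f K}"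
        by (rule inj_onI) (simp add: fill_base_def insert_ident)
      ultimately have "even (card {K \<in> fill_base n x y A. R \<subseteq> ?f K})"
        using even_boundary_of_boundary[OF gcyc_pure[OF A] J(1,2)] by (simp add: card_image)
      then show ?thesis by (simp add: cnt_fill[OF A] A0)
    next
      case y: False
      define K where "K = R - {x}"
      have K: "finite K" "card K + 2 = n" "x \<notin> K" "y \<notin> K" "R = insert x K"
        using R x y card_remove_Suc[of R _] unfolding K_def by auto
      have "{L \<in> fill_base n x y A. R \<subseteq> ?f L} = (if odd (cnt A R) then {K} else {})"
      proof -
        have "L = K" if "L \<in> fill_base n x y A" "R \<subseteq> ?f L" for L
        proof -
          have "K \<subseteq> L" using that(2) K by blast
          then show ?thesis using base(1,2)[OF that(1)] K(2) by (metis add_right_cancel card_subset_eq)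
        qed
        then show ?thesis using K by (auto simp: fill_base_def)
      qed
      then show ?thesis by (simp add: cnt_fill[OF A])
    qed
  next
    case x: False
    show ?thesis
    proof (cases "y \<in> R")
      case y: True
      define K where "K = R - {y}"
      have K: "finite K" "card K + 2 = n" "x \<notin> K" "y \<notin> K" "R = insert y K"
        using R x y card_remove_Suc[of R _] unfolding K_def by auto
      have odd: "odd (cnt A R) = odd (cnt A (insert x K))" using A K by (auto simp: gcyc_def)
      have "{L \<in> fill_base n x y A. R \<subseteq> ?f L} = (if odd (cnt A R) then {K} else {})"
      proof -
        have "L = K" if "L \<in> fill_base n x y A" "R \<subseteq> ?f L" for L
        proof -
          have "K \<subseteq> L" using that(2) K by blast
          then show ?thesis using base(1,2)[OF that(1)] K(2) by (metis add_right_cancel card_subset_eq)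
        qed
        then show ?thesis using K odd by (auto simp: fill_base_def)
      qed
      then show ?thesis by (simp add: cnt_fill[OF A])
    next
      case y: False
      have "{L \<in> fill_base n x y A. R \<subseteq> ?f L} = {}"
      proof -
        have "\<not> R \<subseteq> ?f L" if "L \<in> fill_base n x y A" for L
        proof
          assume "R \<subseteq> ?f L"
          then have "R \<subseteq> L" using x y by blast
          then show False using base[OF that] R card_mono[of L R] by simp
        qed
        then show ?thesis by blast
      qed
      then have "cnt (fill n x y A) R = cnt A R" by (simp only: cnt_fill[OF A] card.empty add_0_right)
      then show ?thesis using gcyc_even[OF A R x y] by simp
    qed
  qed
qed (rule fill_pure[OF A xy])

lemma gcyc_Diff:
  assumes S: "gcyc n x y S" and A: "gcyc n x y A" and sub: "A \<subseteq> S"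
  shows "gcyc n x y (S - A)"
proof -
  have c: "cnt S R = cnt A R + cnt (S - A) R" for R
    by (rule cnt_split[OF pureD(3)[OF gcyc_pure[OF S]] sub])
  show ?thesis
    unfolding gcyc_def
  proof (intro conjI allI impI ballI)
    show "pure n (S - A)" by (rule pure_subset[OF gcyc_pure[OF S]]) blast
  next
    fix F assume "F \<in> S - A" then show "\<not> (x \<in> F \<and> y \<in> F)" using gcyc_off[OF S] by blast
  next
    fix R assume "finite R" "Suc (card R) = n" "x \<notin> R" "y \<notin> R"
    from gcyc_even[OF S this] gcyc_even[OF A this] c[of R]
    show "even (cnt (S - A) R)" by auto
  next
    fix K assume "finite K" "card K + 2 = n" "x \<notin> K" "y \<notin> K"
    from gcyc_odd[OF S this] gcyc_odd[OF A this] c[of "insert x K"] c[of "insert y K"]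
    show "odd (cnt (S - A) (insert x K)) = odd (cnt (S - A) (insert y K))" by auto
  qed
qed

lemma gcyc_Un:
  assumes S: "gcyc n x y S" and A: "gcyc n x y A" and dis: "A \<inter> S = {}"
  shows "gcyc n x y (S \<union> A)"
proof -
  have c: "cnt (S \<union> A) R = cnt S R + cnt A R" for R
    using gcyc_pure[OF S] gcyc_pure[OF A] dis by (intro cnt_Un) (auto simp: pure_def)
  have "pure n (S \<union> A)" using gcyc_pure[OF S] gcyc_pure[OF A] by (auto simp: pure_def)
  then show ?thesis using S A by (auto simp: gcyc_def c)
qed

text \<open>The facets of the cycle through \<open>insert x K\<close> are even in number, and only
  one possible facet among them contains \<open>y\<close>.\<close>

lemma odd_cnt_off_edge:
  assumes S: "cyc n S" and xy: "x \<noteq> y" and K: "finite K" "card K + 2 = n" "x \<notin> K" "y \<notin> K"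
  shows "odd (cnt {F \<in> S. \<not> (x \<in> F \<and> y \<in> F)} (insert x K)) \<longleftrightarrow> insert x (insert y K) \<in> S"
proof -
  let ?A = "{F \<in> S. \<not> (x \<in> F \<and> y \<in> F)}"
  have "even (cnt S (insert x K))" using K by (intro cycD(2)[OF S]) auto
  moreover have "cnt S (insert x K) = cnt ?A (insert x K) + cnt (S - ?A) (insert x K)"
    by (rule cnt_split) (use S in \<open>auto simp: cyc_def pure_def\<close>)
  moreover have "{F \<in> S - ?A. insert x K \<subseteq> F} = (if insert x (insert y K) \<in> S then {insert x (insert y K)} else {})"
  proof -
    have "F = insert x (insert y K)" if "F \<in> S" "x \<in> F" "y \<in> F" "K \<subseteq> F" for F
    proof (rule sym, rule card_subset_eq)
      show "finite F" using S that(1) by (auto simp: cyc_def pure_def)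
      show "insert x (insert y K) \<subseteq> F" using that by blast
      show "card (insert x (insert y K)) = card F"
        using K xy pureD(2)[OF cycD(1)[OF S] that(1)] by simp
    qed
    then have "{F \<in> S. x \<in> F \<and> y \<in> F \<and> K \<subseteq> F} = {F \<in> S. F = insert x (insert y K)}" by blast
    moreover have "{F \<in> S - ?A. insert x K \<subseteq> F} = {F \<in> S. x \<in> F \<and> y \<in> F \<and> K \<subseteq> F}" by blast
    ultimately have "{F \<in> S - ?A. insert x K \<subseteq> F} = {F \<in> S. F = insert x (insert y K)}" by simp
    also have "\<dots> = (if insert x (insert y K) \<in> S then {insert x (insert y K)} else {})" by auto
    finally show ?thesis .
  qed
  ultimately show ?thesis by (auto simp: cnt_def split: if_splits)
qed

lemma gcyc_off_edge:
  assumes S: "cyc n S" and xy: "x \<noteq> y"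
  shows "gcyc n x y {F \<in> S. \<not> (x \<in> F \<and> y \<in> F)}" (is "gcyc n x y ?A")
  unfolding gcyc_def
proof (intro conjI allI impI)
  show "pure n ?A" by (rule pure_subset[OF cycD(1)[OF S]]) blast
  show "\<forall>F\<in>?A. \<not> (x \<in> F \<and> y \<in> F)" by blast
next
  fix R assume R: "finite R" "Suc (card R) = n" "x \<notin> R" "y \<notin> R"
  have "\<not> (x \<in> F \<and> y \<in> F)" if "F \<in> S" "R \<subseteq> F" for F
  proof
    assume "x \<in> F \<and> y \<in> F"
    then have "insert x (insert y R) \<subseteq> F" using that by blast
    then have "card (insert x (insert y R)) \<le> card F"
      using pureD(1)[OF cycD(1)[OF S] that(1)] by (rule card_mono[rotated])
    then show False using R xy pureD(2)[OF cycD(1)[OF S] that(1)] by simp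
  qed
  then have "{F \<in> ?A. R \<subseteq> F} = {F \<in> S. R \<subseteq> F}" by blast
  then show "even (cnt ?A R)" using cycD(2)[OF S R(1,2)] by (simp add: cnt_def)
next
  fix K assume K: "finite K" "card K + 2 = n" "x \<notin> K" "y \<notin> K"
  have "{F \<in> S. \<not> (y \<in> F \<and> x \<in> F)} = ?A" by blast
  then show "odd (cnt ?A (insert x K)) = odd (cnt ?A (insert y K))"
    using odd_cnt_off_edge[OF S xy K] odd_cnt_off_edge[OF S xy[symmetric] K(1,2,4,3)]
    by (simp add: insert_commute)
qed

text \<open>By \<open>odd_cnt_off_edge\<close> the facets through both \<open>x\<close> and
  \<open>y\<close> are dictated by the others, so the cycle is recovered from its part off the
  edge.\<close>

lemma fill_off_edge:
  assumes S: "cyc n S" and xy: "x \<noteq> y"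
  shows "fill n x y {F \<in> S. \<not> (x \<in> F \<and> y \<in> F)} = S" (is "fill n x y ?A = S")
proof -
  have "insert x (insert y K) \<in> S" if "K \<in> fill_base n x y ?A" for K
    using that odd_cnt_off_edge[OF S xy, of K] by (auto simp: fill_base_def)
  moreover have "F \<in> (\<lambda>K. insert x (insert y K)) ` fill_base n x y ?A" if F: "F \<in> S" "x \<in> F" "y \<in> F" for F
  proof
    show eq: "F = insert x (insert y (F - {x, y}))" using F by blast
    have "card (F - {x, y}) = card F - 2"
      using F(2,3) xy pureD(1)[OF cycD(1)[OF S] F(1)] by (simp add: card_Diff_subset)
    moreover have "card {x, y} \<le> card F"
      using F pureD(1)[OF cycD(1)[OF S] F(1)] by (intro card_mono) auto
    ultimately have "card (F - {x, y}) + 2 = n"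
      using xy pureD(2)[OF cycD(1)[OF S] F(1)] by simp
    then show "F - {x, y} \<in> fill_base n x y ?A"
      using odd_cnt_off_edge[OF S xy, of "F - {x, y}"] eq F(1) pureD(1)[OF cycD(1)[OF S] F(1)]
      by (simp add: fill_base_def)
  qed
  ultimately show ?thesis unfolding fill_def by blast
qed

definition min_gcyc :: "nat \<Rightarrow> 'a \<Rightarrow> 'a \<Rightarrow> 'a set set \<Rightarrow> bool" where
  "min_gcyc n x y C \<longleftrightarrow> gcyc n x y C \<and> C \<noteq> {} \<and> (\<forall>A\<subseteq>C. gcyc n x y A \<longrightarrow> A = {} \<or> A = C)"

text \<open>Counts add over a subfamily and its complement, so one of the two keeps the odd parity
  at \<open>R\<close>; descent on the size.\<close>

lemma min_gcyc_exists:
  assumes "gcyc n x y B" "odd (cnt B R)"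
  shows "\<exists>C\<subseteq>B. min_gcyc n x y C \<and> odd (cnt C R)"
  using assms
proof (induction "card B" arbitrary: B rule: less_induct)
  case less
  have fin: "finite B" using gcyc_pure[OF less.prems(1)] by (simp add: pure_def)
  show ?case
  proof (cases "min_gcyc n x y B")
    case False
    have "B \<noteq> {}" using less.prems(2) by (auto simp: cnt_def)
    then obtain A where A: "A \<subseteq> B" "gcyc n x y A" "A \<noteq> {}" "A \<noteq> B"
      using False less.prems(1) by (auto simp: min_gcyc_def)
    have "odd (cnt A R) \<or> odd (cnt (B - A) R)"
      using cnt_split[OF fin A(1), of R] less.prems(2) by auto
    moreover have "card A < card B" "card (B - A) < card B"
      using A fin by (auto intro!: psubset_card_mono)
    ultimately obtain C where "C \<subseteq> A \<or> C \<subseteq> B - A" "min_gcyc n x y C \<and> odd (cnt C R)"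
      using less.hyps A(2) gcyc_Diff[OF less.prems(1) A(2,1)] by blast
    then show ?thesis using A(1) by blast
  qed (use less.prems in blast)
qed

text \<open>The point that makes the decomposition useful: an added facet need not belong to
  \<open>S\<close>, but each of its edges is \<open>x y\<close> or lies in \<open>insert x K\<close>
  or \<open>insert y K\<close>, which are faces of \<open>A\<close>. So all pieces live in the graph
  of \<open>S\<close>.\<close>

lemma edges_fill:
  assumes A: "gcyc n x y A" "A \<subseteq> S" and F: "F \<in> S" "x \<in> F" "y \<in> F" and "x \<noteq> y"
  shows "edges (fill n x y A) \<subseteq> edges S"
proof
  fix e assume e: "e \<in> edges (fill n x y A)"
  then obtain u w where uw: "e = {u, w}" "u \<noteq> w" "{u, w} \<in> faces (fill n x y A)" by (rule edgesE)
  then obtain G where G: "G \<in> fill n x y A" "{u, w} \<subseteq> G" by (auto simp: faces_def)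
  have "{u, w} \<in> faces S"
  proof (cases "G \<in> A")
    case False
    then obtain K where K: "G = insert x (insert y K)" "K \<in> fill_base n x y A"
      using G(1) by (auto simp: fill_def)
    have "{x, y} \<in> faces S" using F by (auto simp: faces_def)
    moreover have "insert x K \<in> faces S" "insert y K \<in> faces S"
      using fill_base_face[OF A(1) K(2)] faces_mono[OF A(2)] by auto
    moreover have "{u, w} \<subseteq> {x, y} \<or> {u, w} \<subseteq> insert x K \<or> {u, w} \<subseteq> insert y K"
      using G(2) K(1) by blast
    ultimately show ?thesis by (meson faces_subset)
  qed (use G A(2) in \<open>auto simp: faces_def\<close>)
  then show "e \<in> edges S" by (simp add: uw(1,2) edges_pair)
qed

lemma fill_off: "gcyc n x y A \<Longrightarrow> {F \<in> fill n x y A. \<not> (x \<in> F \<and> y \<in> F)} = A"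
  by (auto simp: fill_def gcyc_def)

text \<open>Without added facets \<open>A\<close> would be a subcycle of the circuit
  \<open>S\<close>, and a proper one because it avoids \<open>F\<close>.\<close>

lemma fill_base_nonempty:
  assumes S: "circuit n S" and F: "F \<in> S" "x \<in> F" "y \<in> F" and xy: "x \<noteq> y"
    and A: "gcyc n x y A" "A \<subseteq> S" "A \<noteq> {}"
  shows "fill_base n x y A \<noteq> {}"
proof
  assume "fill_base n x y A = {}"
  then have "fill n x y A = A" by (simp add: fill_def)
  then have "cyc n A" using fill_cyc[OF A(1) xy] by simp
  then have "A = S" using circuitD(4)[OF S] A by blast
  then show False using A(1) F by (auto simp: gcyc_def)
qed

text \<open>Otherwise the filling would be a nonempty subcycle of \<open>S\<close>, hence all of
  \<open>S\<close>, and \<open>A\<close> would be the whole part off the edge. The facet found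
  outside \<open>S\<close> is where another piece gets attached.\<close>

lemma fill_not_subset:
  assumes S: "circuit n S" and xy: "x \<noteq> y"
    and A: "gcyc n x y A" "A \<subseteq> S" "A \<noteq> {}" "A \<noteq> {F \<in> S. \<not> (x \<in> F \<and> y \<in> F)}"
  shows "\<exists>K\<in>fill_base n x y A. insert x (insert y K) \<notin> S"
proof (rule ccontr)
  assume "\<not> ?thesis"
  then have sub: "fill n x y A \<subseteq> S" using A(2) by (auto simp: fill_def)
  have "fill n x y A \<noteq> {}" using A(3) by (auto simp: fill_def)
  then have "fill n x y A = S" using circuitD(4)[OF S sub fill_cyc[OF A(1) xy]] by blast
  then show False using fill_off[OF A(1)] A(4) by simp
qed

section \<open>Contraction of an edge in cycles modulo 2\<close>

definition contract :: "'a \<Rightarrow> 'a \<Rightarrow> 'a set \<Rightarrow> 'a set" where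
  "contract x y F = (if y \<in> F then insert x (F - {y}) else F)"

lemma contract_inj_on:
  assumes C: "\<forall>F\<in>C. \<not> (x \<in> F \<and> y \<in> F)" and no: "\<not> (\<exists>Q. x \<notin> Q \<and> y \<notin> Q \<and> insert x Q \<in> C \<and> insert y Q \<in> C)"
  shows "inj_on (contract x y) C"
proof -
  have *: False if F: "F \<in> C" "y \<in> F" and G: "G \<in> C" "y \<notin> G" and e: "insert x (F - {y}) = G" for F G
  proof -
    have "x \<notin> F" using C F by blast
    moreover have "insert y (F - {y}) = F" using F(2) by blast
    ultimately show False using no F G e by (metis Diff_iff insertI1)
  qed
  show ?thesis
  proof (rule inj_onI)
    fix F G assume FG: "F \<in> C" "G \<in> C" and e: "contract x y F = contract x y G"
    show "F = G"
    proof (cases "y \<in> F \<longleftrightarrow> y \<in> G")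
      case True
      show ?thesis
      proof (cases "y \<in> F")
        case y: True
        then have "x \<notin> F" "x \<notin> G" using C FG True by blast+
        moreover have "insert x (F - {y}) = insert x (G - {y})" using e y True by (simp add: contract_def)
        ultimately have "F - {y} = G - {y}" by (simp add: insert_ident)
        then show ?thesis using y True by blast
      qed (use e True in \<open>simp add: contract_def\<close>)
    next
      case False
      then show ?thesis using *[of F G] *[of G F] FG e by (auto simp: contract_def)
    qed
  qed
qed

text \<open>An injective contraction adds the counts at \<open>insert x K\<close> and
  \<open>insert y K\<close> and keeps those at ridges avoiding both vertices; these give the two
  parity conditions of \<open>gcyc\<close>.\<close>

lemma cyc_contract_iff:
  fixes x :: 'a
  assumes A: "pure n A" "\<forall>F\<in>A. \<not> (x \<in> F \<and> y \<in> F)" and inj: "inj_on (contract x y) A" and xy: "x \<noteq> y"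
  shows "cyc n (contract x y ` A) \<longleftrightarrow> gcyc n x y A"
proof -
  have p: "pure n (contract x y ` A)"
    using A xy card_remove_Suc by (fastforce simp: pure_def contract_def)
  have cnt1: "cnt (contract x y ` A) R = card {F \<in> A. R \<subseteq> contract x y F}" for R
  proof -
    have "{F \<in> contract x y ` A. R \<subseteq> F} = contract x y ` {F \<in> A. R \<subseteq> contract x y F}" by blast
    moreover have "inj_on (contract x y) {F \<in> A. R \<subseteq> contract x y F}" using inj by (rule inj_on_subset) blast
    ultimately show ?thesis by (simp add: cnt_def card_image)
  qed
  have c1: "cnt (contract x y ` A) R = 0" if "y \<in> R" for R
  proof -
    have "{F \<in> A. R \<subseteq> contract x y F} = {}" using that xy by (auto simp: contract_def split: if_splits)
    then show ?thesis by (simp only: cnt1 card.empty)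
  qed
  have c2: "cnt (contract x y ` A) R = cnt A R" if "x \<notin> R" "y \<notin> R" for R
  proof -
    have "{F \<in> A. R \<subseteq> contract x y F} = {F \<in> A. R \<subseteq> F}" using that by (auto simp: contract_def split: if_splits)
    then show ?thesis by (simp add: cnt1) (simp add: cnt_def)
  qed
  have c3: "cnt (contract x y ` A) (insert x K) = cnt A (insert x K) + cnt A (insert y K)"
    if "x \<notin> K" "y \<notin> K" for K
  proof -
    have "{F \<in> A. insert x K \<subseteq> contract x y F} = {F \<in> A. insert x K \<subseteq> F} \<union> {F \<in> A. insert y K \<subseteq> F}"
      using that xy by (auto simp: contract_def split: if_splits)
    moreover have "{F \<in> A. insert x K \<subseteq> F} \<inter> {F \<in> A. insert y K \<subseteq> F} = {}" using A(2) by blast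
    ultimately show ?thesis
      using pureD(3)[OF A(1)] unfolding cnt1 by (simp only: cnt_def) (rule card_Un_disjoint, auto)
  qed
  show ?thesis
  proof
    assume c: "cyc n (contract x y ` A)"
    show "gcyc n x y A"
      unfolding gcyc_def
    proof (intro conjI allI impI)
      fix R assume "finite R" "Suc (card R) = n" "x \<notin> R" "y \<notin> R"
      then show "even (cnt A R)" using cycD(2)[OF c, of R] by (simp add: c2)
    next
      fix K assume "finite K" "card K + 2 = n" "x \<notin> K" "y \<notin> K"
      then show "odd (cnt A (insert x K)) = odd (cnt A (insert y K))"
        using cycD(2)[OF c, of "insert x K"] by (simp add: c3)
    qed (use A in blast)+
  next
    assume g: "gcyc n x y A"
    show "cyc n (contract x y ` A)"
      unfolding cyc_def
    proof (intro conjI allI impI p)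
      fix R :: "'a set" assume R: "finite R" "Suc (card R) = n"
      show "even (cnt (contract x y ` A) R)"
      proof (cases "y \<in> R \<or> x \<notin> R")
        case True
        then show ?thesis using c1 c2 g R by (cases "y \<in> R") (auto simp: gcyc_def)
      next
        case False
        then obtain K where K: "R = insert x K" "x \<notin> K" by (meson Set.set_insert)
        then have "finite K" "card K + 2 = n" "y \<notin> K" using R False by auto
        then show ?thesis using g K by (auto simp: gcyc_def c3)
      qed
    qed
  qed
qed

lemma circuit_contract:
  assumes C: "min_gcyc n x y C" and no: "\<not> (\<exists>Q. x \<notin> Q \<and> y \<notin> Q \<and> insert x Q \<in> C \<and> insert y Q \<in> C)" and xy: "x \<noteq> y"
  shows "circuit n (contract x y ` C)"
proof -
  have g: "gcyc n x y C" "C \<noteq> {}" using C by (auto simp: min_gcyc_def)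
  have off: "\<forall>F\<in>C. \<not> (x \<in> F \<and> y \<in> F)" using g by (simp add: gcyc_def)
  have inj: "inj_on (contract x y) C" by (rule contract_inj_on[OF off no])
  have iff: "cyc n (contract x y ` A) \<longleftrightarrow> gcyc n x y A" if "A \<subseteq> C" for A
    by (rule cyc_contract_iff[OF pure_subset[OF gcyc_pure[OF g(1)] that] _ inj_on_subset[OF inj that] xy])
      (use off that in blast)
  have "A = {} \<or> A = contract x y ` C" if A: "A \<subseteq> contract x y ` C" "cyc n A" for A
  proof -
    obtain B where "B \<subseteq> C" "A = contract x y ` B" using A(1) by (meson subset_imageE)
    then show ?thesis using iff A(2) C by (auto simp: min_gcyc_def)
  qed
  then show ?thesis using iff[of C] g by (auto simp: circuit_def)
qed

lemma pair_min_gcyc: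
  fixes x :: 'a
  assumes C: "min_gcyc n x y C" and Q: "x \<notin> Q" "y \<notin> Q" "insert x Q \<in> C" "insert y Q \<in> C" and xy: "x \<noteq> y"
  shows "C = {insert x Q, insert y Q}"
proof -
  have g: "gcyc n x y C" using C by (auto simp: min_gcyc_def)
  let ?A = "{insert x Q, insert y Q}"
  have neq: "insert x Q \<noteq> insert y Q" using Q xy by blast
  have QQ: "finite Q" "Suc (card Q) = n" using gcyc_pure[OF g] Q by (auto simp: pure_def)
  have "gcyc n x y ?A"
    unfolding gcyc_def
  proof (intro conjI allI impI)
    show "pure n ?A" by (rule pure_subset[OF gcyc_pure[OF g]]) (use Q in blast)
    show "\<forall>F\<in>?A. \<not> (x \<in> F \<and> y \<in> F)" using Q xy by auto
  next
    fix R assume R: "finite R" "Suc (card R) = n" "x \<notin> R" "y \<notin> R"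
    have "{F \<in> ?A. R \<subseteq> F} = (if R \<subseteq> Q then ?A else {})" using R by auto
    then show "even (cnt ?A R)" using neq by (simp add: cnt_def)
  next
    fix K assume K: "finite K" "card K + 2 = n" "x \<notin> K" "y \<notin> K"
    have h: "insert x K \<subseteq> insert x Q \<longleftrightarrow> K \<subseteq> Q" "\<not> insert x K \<subseteq> insert y Q"
      "insert y K \<subseteq> insert y Q \<longleftrightarrow> K \<subseteq> Q" "\<not> insert y K \<subseteq> insert x Q"
      using K Q xy by blast+
    have sel: "{F \<in> {A, B}. P F} = (if P A then {A} else {})" "{F \<in> {B, A}. P F} = (if P A then {A} else {})"
      if "\<not> P B" for P and A B :: "'a set"
      using that by auto
    have "{F \<in> ?A. insert x K \<subseteq> F} = (if K \<subseteq> Q then {insert x Q} else {})"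
      using sel(1)[of "\<lambda>F. insert x K \<subseteq> F", OF h(2)] by (simp only: h(1))
    moreover have "{F \<in> ?A. insert y K \<subseteq> F} = (if K \<subseteq> Q then {insert y Q} else {})"
      using sel(2)[of "\<lambda>F. insert y K \<subseteq> F", OF h(4)] by (simp only: h(3))
    ultimately have "cnt ?A (insert x K) = cnt ?A (insert y K)"
      unfolding cnt_def by (simp only:) (cases "K \<subseteq> Q", simp_all)
    then show "odd (cnt ?A (insert x K)) = odd (cnt ?A (insert y K))" by (simp only:)
  qed
  moreover have "?A \<subseteq> C" using Q by blast
  ultimately have "?A = {} \<or> ?A = C" using C unfolding min_gcyc_def by (elim conjE allE impE)
  then show ?thesis by blast
qed

section \<open>Circuits are generically solid\<close>

lemma generic_spans: "generic n V p \<Longrightarrow> F \<subseteq> V \<Longrightarrow> card F = n \<Longrightarrow> spans n F p"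
  unfolding generic_def by blast

lemma generic_pinned:
  fixes p q :: "'a \<Rightarrow> nat \<Rightarrow> 'k::field"
  assumes "generic n V p" "E \<subseteq> Pow V" "F \<subseteq> V" "pinned n E F q"
  shows "pinned n E F p"
  using assms unfolding generic_def by blast

lemma generic_mono:
  fixes p :: "'a \<Rightarrow> nat \<Rightarrow> 'k::field"
  assumes p: "generic n V p" and W: "W \<subseteq> V"
  shows "generic n W p"
  unfolding generic_def
proof (intro conjI allI impI)
  fix F assume "F \<subseteq> W" "card F = n"
  then show "spans n F p" using generic_spans[OF p] W by blast
next
  fix E F assume E: "E \<subseteq> Pow W" "F \<subseteq> W" "\<exists>q :: 'a \<Rightarrow> nat \<Rightarrow> 'k. pinned n E F q"
  then obtain q :: "'a \<Rightarrow> nat \<Rightarrow> 'k" where q: "pinned n E F q" by blast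
  have "E \<subseteq> Pow V" "F \<subseteq> V" using E(1,2) W by blast+
  then show "pinned n E F p" by (rule generic_pinned[OF p _ _ q])
qed

lemma generic_pinned_solid:
  fixes p q :: "'a \<Rightarrow> nat \<Rightarrow> 'k::field"
  assumes p: "generic n V p" and S: "pure n S" "\<Union>S \<subseteq> V" "2 \<le> n" and F: "F \<in> S" and q: "pinned n (edges S) F q"
  shows "solid n (edges S) p (\<Union>S)"
proof -
  note FF = pureD(1,2)[OF S(1) F]
  have FV: "F \<subseteq> V" using F S(2) by blast
  have "pinned n (edges S) F p"
    by (rule generic_pinned[OF p _ FV q]) (use edges_subset_Pow[of S] S(2) in blast)
  then have "solid n (edges S) p (\<Union>(edges S))"
    by (rule pinned_solid) (use generic_spans[OF p FV] FF F in \<open>auto intro: edges_facet\<close>)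
  then show ?thesis by (simp add: Union_edges[OF S(1,3)])
qed

text \<open>Together with \<open>x\<close> these \<open>n - 1\<close> vertices will force
  \<open>m x = m y\<close> once \<open>y\<close> is placed at \<open>p x\<close>. \<open>K\<close>
  supplies \<open>n - 2\<close> of them; the last one comes from a second facet through the ridge
  obtained by omitting some \<open>a\<close> in \<open>K\<close>, which exists because the filling
  is a cycle.\<close>

lemma fill_base_common_neighbours:
  assumes C: "gcyc n x y C" and xy: "x \<noteq> y" and n: "3 \<le> n" and K: "K \<in> fill_base n x y C"
  shows "\<exists>N. finite N \<and> Suc (card N) = n \<and> x \<notin> N \<and> y \<notin> N \<and> insert x N \<subseteq> \<Union>(fill n x y C) \<and>
    (\<forall>w\<in>N. {x, w} \<in> edges (fill n x y C) \<and> {y, w} \<in> edges (fill n x y C))"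
proof -
  let ?S = "fill n x y C"
  have KK: "finite K" "card K + 2 = n" "x \<notin> K" "y \<notin> K" using K by (auto simp: fill_base_def)
  have cyc: "cyc n ?S" by (rule fill_cyc[OF C xy])
  obtain a where a: "a \<in> K" using KK n by fastforce
  let ?R = "insert x (insert y (K - {a}))"
  let ?F = "insert x (insert y K)"
  have F: "?F \<in> ?S" using K by (auto simp: fill_def)
  have "Suc (card ?R) = n" "finite ?R"
    using KK xy card_remove_Suc[OF KK(1) a] by auto
  then have ev: "even (cnt ?S ?R)" using cycD(2)[OF cyc] by blast
  have "?F \<in> {G \<in> ?S. ?R \<subseteq> G}" using F by blast
  moreover have "{G \<in> ?S. ?R \<subseteq> G} \<noteq> {?F}"
  proof
    assume "{G \<in> ?S. ?R \<subseteq> G} = {?F}"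
    then have "cnt ?S ?R = 1" unfolding cnt_def by simp
    then show False using ev by simp
  qed
  ultimately obtain G where G: "G \<in> ?S" "?R \<subseteq> G" "G \<noteq> ?F" by blast
  note GG = pureD(1,2)[OF cycD(1)[OF cyc] G(1)]
  have "\<not> G \<subseteq> ?F"
  proof
    assume "G \<subseteq> ?F"
    moreover have "card G = card ?F" using GG(2) pureD(2)[OF cycD(1)[OF cyc] F] by simp
    ultimately have "G = ?F" using KK(1) by (intro card_subset_eq) auto
    then show False using G(3) by simp
  qed
  then obtain b where b: "b \<in> G" "b \<notin> ?F" by blast
  let ?N = "insert b K"
  have "{x, w} \<in> edges ?S \<and> {y, w} \<in> edges ?S" if "w \<in> ?N" for w
  proof (cases "w \<in> K")
    case True
    then have "w \<in> ?F" "x \<noteq> w" "y \<noteq> w" using KK by blast+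
    then show ?thesis using edges_facet[OF F, of x w] edges_facet[OF F, of y w] by blast
  next
    case False
    then have "w = b" using that by blast
    then have "w \<in> G" "x \<noteq> w" "y \<noteq> w" "x \<in> G" "y \<in> G" using b G(2) by blast+
    then show ?thesis using edges_facet[OF G(1), of x w] edges_facet[OF G(1), of y w] by blast
  qed
  moreover have "insert x ?N \<subseteq> \<Union>?S" using F G(1) b by blast
  ultimately show ?thesis using KK b n by (intro exI[of _ ?N]) auto
qed

lemma contract_edge_lift:
  assumes e: "{u, w} \<in> edges (contract x y ` C)" and C: "\<forall>F\<in>C. \<not> (x \<in> F \<and> y \<in> F)"
  shows "if u = x then {x, w} \<in> edges C \<or> {y, w} \<in> edges C
    else if w = x then {x, u} \<in> edges C \<or> {y, u} \<in> edges C else {u, w} \<in> edges C"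
proof -
  obtain F where F: "F \<in> C" "u \<in> contract x y F" "w \<in> contract x y F" and uw: "u \<noteq> w"
    using e by (auto simp: edges_pair faces_def)
  have "v \<in> F" if "v \<in> contract x y F" "v \<noteq> x" for v
    using that by (auto simp: contract_def split: if_splits)
  moreover have "x \<in> F \<or> y \<in> F" if "x \<in> contract x y F"
    using that by (auto simp: contract_def split: if_splits)
  moreover have "v \<noteq> y" if "v \<in> contract x y F" "v \<noteq> x" for v
    using that by (auto simp: contract_def split: if_splits)
  ultimately show ?thesis using F uw by (auto intro: edges_facet[OF F(1)])
qed

lemma Union_fill_contract:
  assumes C: "gcyc n x y C" and xy: "x \<noteq> y" and base: "fill_base n x y C \<noteq> {}"
  shows "\<Union>(fill n x y C) \<subseteq> insert y (\<Union>(contract x y ` C))"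
proof -
  let ?U = "contract x y ` C"
  have UC: "u \<in> \<Union>?U" if "u \<in> G" "G \<in> C" "u \<noteq> y" for u G
    using that by (auto simp: contract_def intro!: bexI[of _ G])
  obtain K where K: "K \<in> fill_base n x y C" using base by blast
  obtain G0 where "G0 \<in> C" "x \<in> G0" using fill_base_face(1)[OF C K] by (auto simp: faces_def)
  then have xU: "x \<in> \<Union>?U" using UC xy by blast
  have "insert x (insert y L) \<subseteq> insert y (\<Union>?U)" if L: "L \<in> fill_base n x y C" for L
  proof -
    obtain H where "H \<in> C" "insert y L \<subseteq> H" using fill_base_face(2)[OF C L] by (auto simp: faces_def)
    then show ?thesis using xU UC by blast
  qed
  moreover have "G \<subseteq> insert y (\<Union>?U)" if "G \<in> C" for G using UC that by blast
  ultimately show ?thesis unfolding fill_def by blast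
qed

text \<open>In this degenerate position \<open>y\<close> sits on top of \<open>x\<close>. The edge
  \<open>x y\<close> and the edges to \<open>n - 1\<close> common neighbours make
  \<open>m x - m y\<close> orthogonal to a spanning set, so \<open>m x = m y\<close>; what is left
  is a motion of the contraction at its own points.\<close>

lemma vertex_split_pinned:
  fixes p :: "'a \<Rightarrow> nat \<Rightarrow> 'k::field"
  assumes C: "gcyc n x y C" and xy: "x \<noteq> y" and n: "3 \<le> n" and base: "fill_base n x y C \<noteq> {}"
    and F: "F \<in> C" and p: "generic n V p" "\<Union>(fill n x y C) \<subseteq> V"
    and U: "solid n (edges (contract x y ` C)) p (\<Union>(contract x y ` C))" "pure n (contract x y ` C)"
  shows "pinned n (edges (fill n x y C)) F (p(y := p x))"
  unfolding pinned_def
proof (intro allI impI)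
  let ?q = "p(y := p x)"
  let ?U = "contract x y ` C"
  let ?S = "fill n x y C"
  fix m assume m: "motion n (edges ?S) ?q m" and m0: "\<forall>u\<in>F. \<forall>i<n. m u i = 0"
  have CS: "C \<subseteq> ?S" by (auto simp: fill_def)
  have off: "\<forall>F\<in>C. \<not> (x \<in> F \<and> y \<in> F)" using C by (simp add: gcyc_def)
  have Uoff: "y \<notin> \<Union>?U" using xy by (auto simp: contract_def split: if_splits)
  have mot: "ip n (m u) (?q w) = ip n (m w) (?q u)" if "{u, w} \<in> edges ?S" for u w
    using m that unfolding motion_def by blast
  obtain K where K: "K \<in> fill_base n x y C" using base by blast
  obtain N where N: "finite N" "Suc (card N) = n" "x \<notin> N" "y \<notin> N" "insert x N \<subseteq> \<Union>?S"
    "\<And>w. w \<in> N \<Longrightarrow> {x, w} \<in> edges ?S" "\<And>w. w \<in> N \<Longrightarrow> {y, w} \<in> edges ?S"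
    using fill_base_common_neighbours[OF C xy n K] by blast
  have span: "spans n (insert x N) p"
    by (rule generic_spans[OF p(1)]) (use N p(2) in auto)
  have xye: "{x, y} \<in> edges ?S"
  proof (rule edges_facet)
    show "insert x (insert y K) \<in> ?S" using K by (auto simp: fill_def)
  qed (use xy in auto)
  have mxy: "m x i = m y i" if "i < n" for i
  proof (rule spans_eqD[OF span _ that])
    fix u assume u: "u \<in> insert x N"
    show "ip n (m x) (p u) = ip n (m y) (p u)"
    proof (cases "u = x")
      case True
      then show ?thesis using mot[OF xye] xy by simp
    next
      case False
      then have "u \<in> N" "u \<noteq> y" using u N(4) by auto
      then show ?thesis using mot[OF N(6)[of u]] mot[OF N(7)[of u]] xy by simp
    qed
  qed
  have ipxy: "ip n (m x) v = ip n (m y) v" for v by (rule ip_cong) (simp_all add: mxy)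
  have mU: "motion n (edges ?U) p m"
    unfolding motion_def
  proof (intro allI impI)
    fix u w assume e: "{u, w} \<in> edges ?U"
    have "{u, w} \<subseteq> \<Union>?U" using e edges_subset_Pow[of ?U] by blast
    then have uw: "u \<noteq> y" "w \<noteq> y" using Uoff by blast+
    have "u \<noteq> w" using e by (simp add: edges_pair)
    note uw = uw this
    have lift: "{a, b} \<in> edges C \<Longrightarrow> {a, b} \<in> edges ?S" for a b using edges_mono[OF CS] by blast
    have x: "ip n (m x) (p v) = ip n (m v) (p x)" if v: "{x, v} \<in> edges C \<or> {y, v} \<in> edges C" "v \<noteq> y" for v
      using v(1)
    proof
      assume "{x, v} \<in> edges C"
      then show ?thesis using mot[OF lift[of x v]] v(2) xy by simp
    next
      assume "{y, v} \<in> edges C"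
      then show ?thesis using mot[OF lift[of y v]] v(2) xy ipxy by simp
    qed
    show "ip n (m u) (p w) = ip n (m w) (p u)"
      using contract_edge_lift[OF e off] x[of w] x[of u] mot[OF lift[of u w]] uw
      by (auto split: if_splits)
  qed
  have FU: "contract x y F \<in> ?U" using F by blast
  have "pinned n (edges ?U) (contract x y F) p"
  proof (rule solid_pinned)
    show "solid n (edges ?U) p (\<Union>(edges ?U))" using U n by (simp add: Union_edges)
    have "x \<in> \<Union>?S" using N(5) by blast
    moreover have "contract x y F \<subseteq> insert x F" by (auto simp: contract_def)
    moreover have "F \<subseteq> \<Union>?S" using F CS by blast
    ultimately have "contract x y F \<subseteq> V" using p(2) by blast
    then show "spans n (contract x y F) p"
      using generic_spans[OF p(1)] pureD(2)[OF U(2) FU] by blast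
    show "contract x y F \<subseteq> \<Union>(edges ?U)" using FU U(2) n by (simp add: Union_edges) blast
  qed
  moreover have "\<forall>u\<in>contract x y F. \<forall>i<n. m u i = 0"
    using m0 mxy by (auto simp: contract_def split: if_splits)
  ultimately have z: "\<forall>u\<in>\<Union>?U. \<forall>i<n. m u i = 0"
    using mU U(2) n unfolding pinned_def by (simp add: Union_edges)
  have xU: "x \<in> \<Union>?U"
  proof -
    have "insert y K \<in> faces C" by (rule fill_base_face(2)[OF C K])
    then obtain G where "G \<in> C" "y \<in> G" by (auto simp: faces_def)
    then show ?thesis by (auto simp: contract_def intro!: bexI[of _ G])
  qed
  have yz: "\<forall>i<n. m y i = 0" using z xU mxy by metis
  have "\<Union>(edges ?S) \<subseteq> insert y (\<Union>?U)"
    using edges_subset_Pow[of ?S] Union_fill_contract[OF C xy base] by blast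
  then show "\<forall>u\<in>\<Union>(edges ?S). \<forall>i<n. m u i = 0" using z yz by blast
qed

text \<open>On \<open>n + 1\<close> pairwise adjacent vertices, a motion vanishing on the basis
  \<open>insert x Q\<close> is killed at the last vertex \<open>y\<close> by its edges to that
  basis.\<close>

lemma double_facet_solid:
  assumes xy: "x \<noteq> y" and Q: "finite Q" "Suc (card Q) = n" "x \<notin> Q" "y \<notin> Q" and p: "generic n V p" "insert x (insert y Q) \<subseteq> V"
    and E: "\<And>u w. u \<in> insert x (insert y Q) \<Longrightarrow> w \<in> insert x (insert y Q) \<Longrightarrow> u \<noteq> w \<Longrightarrow> {u, w} \<in> E"
    "\<Union>E = insert x (insert y Q)"
  shows "solid n E p (insert x (insert y Q))"
proof -
  have span: "spans n (insert x Q) p" by (rule generic_spans[OF p(1)]) (use Q p in auto)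
  have "pinned n E (insert x Q) p"
    unfolding pinned_def
  proof (intro allI impI)
    fix m assume m: "motion n E p m" "\<forall>u\<in>insert x Q. \<forall>i<n. m u i = 0"
    have "\<forall>u\<in>insert x Q. ip n (m y) (p u) = 0"
    proof
      fix u assume u: "u \<in> insert x Q"
      then have "u \<noteq> y" using Q xy by blast
      then have "{y, u} \<in> E" using u by (intro E(1)) auto
      then have "ip n (m y) (p u) = ip n (m u) (p y)" using m(1) unfolding motion_def by blast
      also have "\<dots> = 0" using m(2) u by (intro ip_eq_0_left) blast
      finally show "ip n (m y) (p u) = 0" .
    qed
    then have "\<forall>i<n. m y i = 0" using span unfolding spans_def by blast
    then show "\<forall>u\<in>\<Union>E. \<forall>i<n. m u i = 0" using m(2) E(2) by auto
  qed
  then have "solid n E p (\<Union>E)"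
    by (rule pinned_solid) (use span Q E(1) in auto)
  then show ?thesis using E(2) by simp
qed

text \<open>Induction on the number of vertices, which the contraction of an edge \<open>x y\<close>
  lowers. Minimal \<open>gcyc\<close> families have solid fillings by vertex splitting, and they
  exhaust the part of \<open>S\<close> off the edge in an order in which every new filling shares a
  facet with the filling of what is already there.\<close>

theorem circuit_solid:
  fixes p :: "'a \<Rightarrow> nat \<Rightarrow> 'k::field"
  assumes inf: "infinite (UNIV :: 'k set)" and n: "3 \<le> n"
    and "circuit n S" "\<Union>S \<subseteq> V" "finite V" "generic n V p"
  shows "solid n (edges S) p (\<Union>S)"
  using assms(3-6)
proof (induction "card (\<Union>S)" arbitrary: S V p rule: less_induct)
  case less
  note S = less.prems(1)
  have S': "cyc n S" "S \<noteq> {}" "pure n S" using circuitD[OF S] by auto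
  define W where "W = \<Union>S"
  have finW: "finite W" unfolding W_def by (rule pure_finite_Union[OF S'(3)])
  have p: "generic n W p" using less.prems(2,4) generic_mono unfolding W_def by blast
  obtain F0 where F0: "F0 \<in> S" using S'(2) by blast
  have "\<exists>x y. x \<in> F0 \<and> y \<in> F0 \<and> x \<noteq> y"
  proof -
    have "\<not> card F0 \<le> 1" using pureD(2)[OF S'(3) F0] n by simp
    then show ?thesis using pureD(1)[OF S'(3) F0] by (auto simp: card_le_Suc0_iff_eq)
  qed
  then obtain x y where xy: "x \<in> F0" "y \<in> F0" "x \<noteq> y" by blast
  define S0 where "S0 = {F \<in> S. \<not> (x \<in> F \<and> y \<in> F)}"
  have S0: "gcyc n x y S0" "fill n x y S0 = S" "S0 \<subseteq> S"
    unfolding S0_def using gcyc_off_edge[OF S'(1) xy(3)] fill_off_edge[OF S'(1) xy(3)] by auto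
  have fillW: "\<Union>(fill n x y C) \<subseteq> W" if C: "gcyc n x y C" "C \<subseteq> S0" for C
  proof -
    have "edges (fill n x y C) \<subseteq> edges S"
      using edges_fill[OF C(1) _ F0 xy] C(2) S0(3) by blast
    then have "\<Union>(edges (fill n x y C)) \<subseteq> \<Union>(edges S)" by blast
    then show ?thesis
      using Union_edges[OF fill_pure[OF C(1) xy(3)]] Union_edges[OF S'(3)] n by (simp add: W_def)
  qed
  have piece: "solid n (edges S) p (\<Union>(fill n x y C))" if C: "min_gcyc n x y C" "C \<subseteq> S0" for C
  proof -
    have g: "gcyc n x y C" "C \<noteq> {}" using C(1) by (auto simp: min_gcyc_def)
    have CS: "C \<subseteq> S" using C(2) S0(3) by blast
    have sub: "edges (fill n x y C) \<subseteq> edges S" by (rule edges_fill[OF g(1) CS F0 xy])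
    have base: "fill_base n x y C \<noteq> {}" by (rule fill_base_nonempty[OF S F0 xy g(1) CS g(2)])
    have VW: "\<Union>(fill n x y C) \<subseteq> W" by (rule fillW[OF g(1) C(2)])
    have "solid n (edges (fill n x y C)) p (\<Union>(fill n x y C))"
    proof (cases "\<exists>Q. x \<notin> Q \<and> y \<notin> Q \<and> insert x Q \<in> C \<and> insert y Q \<in> C")
      case True
      then obtain Q where Q: "x \<notin> Q" "y \<notin> Q" "insert x Q \<in> C" "insert y Q \<in> C" by blast
      have CQ: "C = {insert x Q, insert y Q}" by (rule pair_min_gcyc[OF C(1) Q xy(3)])
      have QQ: "finite Q" "Suc (card Q) = n"
        using pureD(1,2)[OF gcyc_pure[OF g(1)] Q(3)] Q(1) by auto
      have "K \<subseteq> Q" if "K \<in> fill_base n x y C" for K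
        using fill_base_face(1)[OF g(1) that] that Q xy(3) by (auto simp: CQ faces_def fill_base_def)
      then have U: "\<Union>(fill n x y C) = insert x (insert y Q)" by (auto simp: fill_def CQ)
      have U2: "\<Union>(edges (fill n x y C)) = insert x (insert y Q)"
        using Union_edges[OF fill_pure[OF g(1) xy(3)]] n U by simp
      obtain K where K: "K \<in> fill_base n x y C" using base by blast
      have "insert x (insert y K) \<in> fill n x y C" using K by (auto simp: fill_def)
      then have exy: "{x, y} \<in> edges (fill n x y C)" using xy(3) by (intro edges_facet) auto
      have ex: "{u, w} \<in> edges (fill n x y C)" if "u \<in> insert x Q" "w \<in> insert x Q" "u \<noteq> w" for u w
        by (rule edges_facet[OF _ that]) (simp add: fill_def CQ)
      have ey: "{u, w} \<in> edges (fill n x y C)" if "u \<in> insert y Q" "w \<in> insert y Q" "u \<noteq> w" for u w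
        by (rule edges_facet[OF _ that]) (simp add: fill_def CQ)
      show ?thesis
        unfolding U
      proof (rule double_facet_solid[OF xy(3) QQ Q(1,2) p])
        show "insert x (insert y Q) \<subseteq> W" using VW U by simp
        fix u w assume "u \<in> insert x (insert y Q)" "w \<in> insert x (insert y Q)" "u \<noteq> w"
        then show "{u, w} \<in> edges (fill n x y C)"
          using ex[of u w] ey[of u w] exy by (auto simp: insert_commute)
      qed (rule U2)
    next
      case False
      let ?U = "contract x y ` C"
      have U: "circuit n ?U" by (rule circuit_contract[OF C(1) False xy(3)])
      have "?U \<subseteq> Pow (W - {y})"
        using C(2) S0(3) xy F0 by (auto simp: contract_def W_def split: if_splits)
      then have UW: "\<Union>?U \<subseteq> W - {y}" by blast
      have "y \<in> W" using F0 xy by (auto simp: W_def)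
      then have "card (\<Union>?U) < card W"
        using UW finW by (intro psubset_card_mono) auto
      then have sol: "solid n (edges ?U) p (\<Union>?U)"
        using less.hyps[OF _ U _ finW p] UW by (simp add: W_def) blast
      obtain F where F: "F \<in> C" using g(2) by blast
      have "pinned n (edges (fill n x y C)) F (p(y := p x))"
        by (rule vertex_split_pinned[OF g(1) xy(3) n base F p VW sol circuitD(1)[OF U]])
      then show ?thesis
        by (rule generic_pinned_solid[OF p fill_pure[OF g(1) xy(3)] VW _ _, rotated -1])
          (use n F in \<open>simp_all add: fill_def\<close>)
    qed
    then show ?thesis using sub solid_mono by blast
  qed
  define good where "good A \<longleftrightarrow> A \<subseteq> S0 \<and> A \<noteq> {} \<and> gcyc n x y A \<and> solid n (edges S) p (\<Union>(fill n x y A))" for A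
  have finS0: "finite S0" using S0(3) pureD(3)[OF S'(3)] by (rule finite_subset)
  have "\<exists>A. good A"
  proof -
    have "S0 \<noteq> {}"
    proof
      assume "S0 = {}"
      then have "fill n x y S0 = {}" by (auto simp: fill_def fill_base_def cnt_def)
      then show False using S0(2) S'(2) by simp
    qed
    have "fill_base n x y S0 \<noteq> {}" by (rule fill_base_nonempty[OF S F0 xy S0(1,3) \<open>S0 \<noteq> {}\<close>])
    then obtain K where "odd (cnt S0 (insert x K))" by (auto simp: fill_base_def)
    then obtain C where C: "C \<subseteq> S0" "min_gcyc n x y C" using min_gcyc_exists[OF S0(1)] by blast
    then have "good C" using piece[OF C(2,1)] C by (auto simp: good_def min_gcyc_def)
    then show ?thesis by blast
  qed
  then obtain A where A: "good A" "\<And>B. good B \<Longrightarrow> card B \<le> card A"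
    using ex_has_greatest_nat[of good _ card "Suc (card S0)"] finS0 card_mono
    by (metis (no_types, lifting) good_def le_imp_less_Suc)
  have A': "A \<subseteq> S0" "A \<noteq> {}" "gcyc n x y A" "solid n (edges S) p (\<Union>(fill n x y A))"
    using A(1) by (auto simp: good_def)
  have "A = S0"
  proof (rule ccontr)
    \<comment> \<open>Some added facet of \<open>A\<close> is not in \<open>S\<close>. At its ridge
      \<open>insert x K\<close> the count of \<open>S0\<close> is even and that of \<open>A\<close>
      odd, so that of \<open>S0 - A\<close> is odd: a minimal piece of the rest has the same facet
      added, and its \<open>n\<close> points are enough to glue.\<close>
    assume ne: "A \<noteq> S0"
    have "A \<subseteq> S" using A'(1) S0(3) by blast
    then obtain K where K: "K \<in> fill_base n x y A" "insert x (insert y K) \<notin> S"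
      using fill_not_subset[OF S xy(3) A'(3) _ A'(2)] ne by (auto simp: S0_def)
    have KK: "finite K" "card K + 2 = n" "x \<notin> K" "y \<notin> K" "odd (cnt A (insert x K))"
      using K(1) by (auto simp: fill_base_def)
    have "even (cnt S0 (insert x K))"
      using odd_cnt_off_edge[OF S'(1) xy(3) KK(1-4)] K(2) by (simp add: S0_def)
    then have "odd (cnt (S0 - A) (insert x K))"
      using cnt_split[OF finS0 A'(1), of "insert x K"] KK(5) by auto
    then obtain C where C: "C \<subseteq> S0 - A" "min_gcyc n x y C" "odd (cnt C (insert x K))"
      using min_gcyc_exists[OF gcyc_Diff[OF S0(1) A'(3,1)]] by blast
    have gC: "gcyc n x y C" "C \<noteq> {}" using C(2) by (auto simp: min_gcyc_def)
    have KC: "K \<in> fill_base n x y C" using KK C(3) by (auto simp: fill_base_def)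
    have CS0: "C \<subseteq> S0" using C(1) by blast
    let ?F = "insert x (insert y K)"
    have FA: "?F \<in> fill n x y A" and FC: "?F \<in> fill n x y C" using K(1) KC by (auto simp: fill_def)
    have "solid n (edges S) p (\<Union>(fill n x y A) \<union> \<Union>(fill n x y C))"
    proof (rule solid_Un[OF A'(4) piece[OF C(2) CS0]])
      show "spans n ?F p"
      proof (rule generic_spans[OF p])
        show "?F \<subseteq> W" using FA fillW[OF A'(3,1)] by blast
        show "card ?F = n" using KK xy by simp
      qed
    qed (use FA FC in blast)+
    moreover have "\<Union>(fill n x y (A \<union> C)) \<subseteq> \<Union>(fill n x y A) \<union> \<Union>(fill n x y C)"
    proof -
      have "fill_base n x y (A \<union> C) \<subseteq> fill_base n x y A \<union> fill_base n x y C"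
      proof
        fix L assume L: "L \<in> fill_base n x y (A \<union> C)"
        have "cnt (A \<union> C) (insert x L) = cnt A (insert x L) + cnt C (insert x L)"
          using C(1) A'(1) finS0 by (intro cnt_Un) (auto intro: finite_subset)
        then show "L \<in> fill_base n x y A \<union> fill_base n x y C" using L by (auto simp: fill_base_def)
      qed
      then show ?thesis by (auto simp: fill_def)
    qed
    ultimately have "solid n (edges S) p (\<Union>(fill n x y (A \<union> C)))" by (meson solid_mono order_refl)
    moreover have "gcyc n x y (A \<union> C)" by (rule gcyc_Un[OF A'(3) gC(1)]) (use C(1) in blast)
    ultimately have "good (A \<union> C)" using A' CS0 by (auto simp: good_def)
    then have "card (A \<union> C) \<le> card A" by (rule A(2))
    moreover have "card A < card (A \<union> C)"
      using C(1) gC(2) A'(1) CS0 finS0 by (intro psubset_card_mono) (auto intro: finite_subset)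
    ultimately show False by simp
  qed
  then show ?case using A'(4) S0(2) by simp
qed

section \<open>Counting edges\<close>

text \<open>The positions on and above the diagonal, hence the coordinates of a symmetric matrix;
  the number \<open>Suc n choose 2\<close> originates here.\<close>

definition pairs :: "nat \<Rightarrow> (nat \<times> nat) set" where
  "pairs n = {(i, j). i \<le> j \<and> j < n}"

lemma finite_pairs: "finite (pairs n)"
  by (rule finite_subset[of _ "{..<n} \<times> {..<n}"]) (auto simp: pairs_def)

lemma card_pairs: "card (pairs n) = Suc n choose 2"
proof (induction n)
  case 0
  have "pairs 0 = {}" by (auto simp: pairs_def)
  then show ?case by simp
next
  case (Suc n)
  have eq: "pairs (Suc n) = pairs n \<union> (\<lambda>i. (i, n)) ` {..n}"
    by (auto simp: pairs_def less_Suc_eq)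
  have "card (pairs (Suc n)) = card (pairs n) + card ((\<lambda>i. (i, n)) ` {..n})"
    unfolding eq by (rule card_Un_disjoint) (use finite_pairs[of n] in \<open>auto simp: pairs_def\<close>)
  also have "card ((\<lambda>i. (i, n)) ` {..n}) = Suc n" by (subst card_image) (auto simp: inj_on_def)
  finally show ?case using Suc by (simp add: numeral_2_eq_2)
qed

definition upper_mat :: "(nat \<times> nat \<Rightarrow> 'k) \<Rightarrow> nat \<Rightarrow> nat \<Rightarrow> 'k" where
  "upper_mat s = (\<lambda>a b. s (min a b, max a b))"

lemma sym_upper_mat: "sym_mat n (upper_mat s)"
  by (simp add: sym_mat_def upper_mat_def min.commute max.commute)

lemma app_mat_add: "app_mat n (\<lambda>a b. A a b + B a b) x = (\<lambda>i. app_mat n A x i + app_mat n B x i)"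
  by (simp add: app_mat_def ip_add_left)

lemma app_mat_scale: "app_mat n (\<lambda>a b. c * A a b) x = (\<lambda>i. c * app_mat n A x i)"
  by (simp add: app_mat_def ip_scale_left)

definition res :: "nat \<Rightarrow> ('a \<Rightarrow> nat \<Rightarrow> 'k::field) \<Rightarrow> ('a \<Rightarrow> nat \<Rightarrow> 'k) \<Rightarrow> 'a \<Rightarrow> 'a \<Rightarrow> 'k" where
  "res n p m u w = ip n (m u) (p w) - ip n (m w) (p u)"

lemma res_swap: "res n p m w u = - res n p m u w"
  by (simp add: res_def)

lemma motion_res: "motion n E p m \<longleftrightarrow> (\<forall>u w. {u, w} \<in> E \<longrightarrow> res n p m u w = 0)"
  by (simp add: motion_def res_def)

lemma res_add: "res n p (\<lambda>u i. m u i + m' u i) u w = res n p m u w + res n p m' u w"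
  by (simp add: res_def ip_add_left)

lemma res_diff: "res n p (\<lambda>u i. m u i - m' u i) u w = res n p m u w - res n p m' u w"
  by (simp add: res_def ip_diff_left)

lemma res_scale: "res n p (\<lambda>u i. c * m u i) u w = c * res n p m u w"
  by (simp add: res_def ip_scale_left algebra_simps)

lemma res_sym_mat: "sym_mat n B \<Longrightarrow> res n p (\<lambda>u. app_mat n B (p u)) u w = 0"
  using sym_mat_ip[of n B "p u" "p w"] by (simp add: res_def)

lemma res_cong:
  "(\<And>i. i < n \<Longrightarrow> m u i = m' u i) \<Longrightarrow> (\<And>i. i < n \<Longrightarrow> m w i = m' w i) \<Longrightarrow> res n p m u w = res n p m' u w"
  unfolding res_def by (intro arg_cong2[where f = "(-)"] ip_cong) auto

text \<open>Counting needs one equation per edge. The equation is antisymmetric in the two ends, so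
  an arbitrary order of them will do.\<close>

definition ori :: "'a set \<Rightarrow> 'a \<times> 'a" where
  "ori e = (SOME uw. e = {fst uw, snd uw})"

lemma ori: "card e = 2 \<Longrightarrow> e = {fst (ori e), snd (ori e)}"
  unfolding ori_def by (rule someI_ex) (auto simp: card_2_iff)

definition graph :: "'a set set \<Rightarrow> bool" where
  "graph E \<longleftrightarrow> finite E \<and> (\<forall>e\<in>E. card e = 2)"

lemma graph_finite_Union: "graph E \<Longrightarrow> finite (\<Union>E)"
  unfolding graph_def by (intro finite_Union) (auto intro: card_ge_0_finite)

lemma graph_edges: "pure n S \<Longrightarrow> graph (edges S)"
  unfolding graph_def using pure_finite_Union[of n S] edges_subset_Pow[of S]
  by (auto simp: edges_def intro: finite_subset)

lemma res_ori:
  assumes "graph E" "{u, w} \<in> E" "(\<lambda>(a, b). res n p m a b) (ori {u, w}) = c"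
  shows "res n p m u w = c \<or> res n p m u w = - c"
proof -
  have "{u, w} = {fst (ori {u, w}), snd (ori {u, w})}" using assms by (intro ori) (auto simp: graph_def)
  then have "ori {u, w} = (u, w) \<or> ori {u, w} = (w, u)" by (metis doubleton_eq_iff prod.collapse)
  then show ?thesis using assms(3) res_swap[of n p m w u] by auto
qed

text \<open>Linear independence of the edge equations in dual form: each of them can be violated
  alone. In this form it passes to subgraphs at once.\<close>

definition free :: "nat \<Rightarrow> 'a set set \<Rightarrow> ('a \<Rightarrow> nat \<Rightarrow> 'k::field) \<Rightarrow> bool" where
  "free n E p \<longleftrightarrow> (\<forall>e\<in>E. \<exists>m. motion n (E - {e}) p m \<and> \<not> motion n {e} p m)"

lemma free_mono: "free n E p \<Longrightarrow> E' \<subseteq> E \<Longrightarrow> free n E' p"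
  unfolding free_def by (meson Diff_mono motion_mono order_refl subsetD)

lemma spans_enumerate:
  assumes "spans n F p" "finite F" "card F = n"
  obtains h where "h ` {..<n} = F" "inj_on h {..<n}"
proof -
  obtain h where "bij_betw h {0..<n} F" using ex_bij_betw_nat_finite[OF assms(2)] assms(3) by auto
  then show ?thesis by (intro that[of h]) (auto simp: bij_betw_def atLeast0LessThan)
qed

text \<open>The additional equations remove the trivial motions: for \<open>m u = B p_u\<close> they
  are the entries of the form of \<open>B\<close> in the basis \<open>p (h i)\<close>, and by
  symmetry the pairs with \<open>i \<le> j\<close> suffice.\<close>

lemma motion_system_inj:
  assumes sol: "solid n E p (\<Union>E)" and E: "graph E" and F: "spans n (h ` {..<n}) p" "h ` {..<n} \<subseteq> \<Union>E"
    and z: "\<And>e. e \<in> E \<Longrightarrow> (\<lambda>(a, b). res n p m a b) (ori e) = 0"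
    and s: "\<And>i j. (i, j) \<in> pairs n \<Longrightarrow> ip n (m (h i)) (p (h j)) = 0"
    and u: "u \<in> \<Union>E" "k < n"
  shows "m u k = 0"
proof -
  have "motion n E p m"
    unfolding motion_res
  proof (intro allI impI)
    fix u w assume "{u, w} \<in> E"
    then show "res n p m u w = 0" using res_ori[OF E _ z] by fastforce
  qed
  then obtain B where B: "sym_mat n B" "\<And>u i. u \<in> \<Union>E \<Longrightarrow> i < n \<Longrightarrow> m u i = app_mat n B (p u) i"
    using sol unfolding solid_def by blast
  have hB: "ip n (m (h i)) c = ip n (app_mat n B (p (h i))) c" if "i < n" for i c
  proof (rule ip_cong)
    fix k assume "k < n"
    moreover have "h i \<in> \<Union>E" using F(2) that by blast
    ultimately show "m (h i) k = app_mat n B (p (h i)) k" by (rule B(2)[rotated])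
  qed simp
  have "B a b = 0" if "a < n" "b < n" for a b
  proof (rule spans_sym_mat_eqD[OF F(1) _ that, of B "\<lambda>a b. 0"])
    fix u w assume "u \<in> h ` {..<n}" "w \<in> h ` {..<n}"
    then obtain i j where ij: "u = h i" "w = h j" "i < n" "j < n" by auto
    have "ip n (app_mat n B (p (h i))) (p (h j)) = 0"
    proof (cases "i \<le> j")
      case True
      then show ?thesis using s[of i j] hB[OF ij(3)] ij by (simp add: pairs_def)
    next
      case False
      then show ?thesis using s[of j i] hB[OF ij(4)] ij sym_mat_ip[OF B(1), of "p (h i)"]
        by (simp add: pairs_def)
    qed
    then show "ip n (app_mat n B (p u)) (p w) = ip n (app_mat n (\<lambda>a b. 0) (p u)) (p w)"
      by (simp add: ij app_mat_def ip_zero_left)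
  qed
  then have "app_mat n B (p u) k = 0" unfolding app_mat_def using u(2) by (intro ip_eq_0_left) blast
  then show ?thesis using B(2) u by simp
qed

definition motion_system :: "nat \<Rightarrow> ('a \<Rightarrow> nat \<Rightarrow> 'k::field) \<Rightarrow> (nat \<Rightarrow> 'a) \<Rightarrow> ('a \<times> nat \<Rightarrow> 'k) \<Rightarrow> 'a set + nat \<times> nat \<Rightarrow> 'k" where
  "motion_system n p h x j = (case j of
     Inl e \<Rightarrow> (\<lambda>(a, b). res n p (\<lambda>u i. x (u, i)) a b) (ori e)
   | Inr (i, j) \<Rightarrow> ip n (\<lambda>k. x (h i, k)) (p (h j)))"

lemma motion_system_linear:
  "motion_system n p h (\<lambda>i. x i + y i) j = motion_system n p h x j + motion_system n p h y j"
  "motion_system n p h (\<lambda>i. c * x i) j = c * motion_system n p h x j"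
proof -
  show "motion_system n p h (\<lambda>i. x i + y i) j = motion_system n p h x j + motion_system n p h y j"
    using res_add[of n p "\<lambda>u i. x (u, i)" "\<lambda>u i. y (u, i)"]
    by (cases j) (auto simp: motion_system_def ip_add_left split: prod.split)
  show "motion_system n p h (\<lambda>i. c * x i) j = c * motion_system n p h x j"
    using res_scale[of n p c "\<lambda>u i. x (u, i)"]
    by (cases j) (auto simp: motion_system_def ip_scale_left split: prod.split)
qed

lemma card_system:
  assumes "finite E"
  shows "card (E <+> pairs n) = card E + (Suc n choose 2)" "finite (E <+> pairs n)"
  using assms by (simp_all add: finite_pairs card_Plus card_pairs)

text \<open>There are \<open>n\<close> unknowns per vertex, and the edge equations together with the
  \<open>Suc n choose 2\<close> pinning equations have only the zero solution.\<close>

lemma solid_card_le: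
  assumes sol: "solid n E p (\<Union>E)" and E: "graph E" and F: "spans n F p" "F \<subseteq> \<Union>E" "card F = n"
  shows "n * card (\<Union>E) \<le> card E + (Suc n choose 2)"
proof -
  have finF: "finite F" using F(2) graph_finite_Union[OF E] by (rule finite_subset)
  obtain h where h: "h ` {..<n} = F" "inj_on h {..<n}" by (rule spans_enumerate[OF F(1) finF F(3)])
  have "card (\<Union>E \<times> {..<n}) \<le> card (E <+> pairs n)"
  proof (rule inj_linear_card_le[where f = "motion_system n p h"])
    fix x assume x: "\<And>i. i \<notin> \<Union>E \<times> {..<n} \<Longrightarrow> x i = 0" "\<And>j. j \<in> E <+> pairs n \<Longrightarrow> motion_system n p h x j = 0"
    have "x (u, k) = 0" if "u \<in> \<Union>E" "k < n" for u k
    proof (rule motion_system_inj[OF sol E _ _ _ _ that, of h "\<lambda>u i. x (u, i)"])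
      fix e assume "e \<in> E"
      then show "(\<lambda>(a, b). res n p (\<lambda>u i. x (u, i)) a b) (ori e) = 0"
        using x(2)[OF InlI] by (simp add: motion_system_def)
    next
      fix i j assume "(i, j) \<in> pairs n"
      then show "ip n (\<lambda>k. x (h i, k)) (p (h j)) = 0"
        using x(2)[OF InrI[of "(i, j)"]] by (simp add: motion_system_def)
    qed (use F h in auto)
    then show "\<forall>i\<in>\<Union>E \<times> {..<n}. x i = 0" by auto
  qed (use E graph_finite_Union[OF E] in \<open>simp_all add: motion_system_linear card_system finite_pairs graph_def\<close>)
  then show ?thesis using E by (simp add: card_system graph_def card_cartesian_product mult.commute)
qed

text \<open>The converse inequality makes the injective system square, so it can be solved for the
  unit vector at \<open>e\<close>; the solution is a motion of all edges but
  \<open>e\<close>.\<close>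

lemma solid_tight_free:
  assumes sol: "solid n E p (\<Union>E)" and E: "graph E" and F: "spans n F p" "F \<subseteq> \<Union>E" "card F = n"
    and t: "card E + (Suc n choose 2) \<le> n * card (\<Union>E)"
  shows "free n E p"
  unfolding free_def
proof
  fix e assume e: "e \<in> E"
  have finF: "finite F" using F(2) graph_finite_Union[OF E] by (rule finite_subset)
  obtain h where h: "h ` {..<n} = F" "inj_on h {..<n}" by (rule spans_enumerate[OF F(1) finF F(3)])
  have "\<exists>x. (\<forall>i. i \<notin> \<Union>E \<times> {..<n} \<longrightarrow> x i = 0) \<and>
     (\<forall>j\<in>E <+> pairs n. motion_system n p h x j = (if j = Inl e then 1 else 0))"
  proof (rule inj_linear_surj)
    fix x assume x: "\<And>i. i \<notin> \<Union>E \<times> {..<n} \<Longrightarrow> x i = 0" "\<And>j. j \<in> E <+> pairs n \<Longrightarrow> motion_system n p h x j = 0"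
    have "x (u, k) = 0" if "u \<in> \<Union>E" "k < n" for u k
    proof (rule motion_system_inj[OF sol E _ _ _ _ that, of h "\<lambda>u i. x (u, i)"])
      fix e assume "e \<in> E"
      then show "(\<lambda>(a, b). res n p (\<lambda>u i. x (u, i)) a b) (ori e) = 0"
        using x(2)[OF InlI] by (simp add: motion_system_def)
    next
      fix i j assume "(i, j) \<in> pairs n"
      then show "ip n (\<lambda>k. x (h i, k)) (p (h j)) = 0"
        using x(2)[OF InrI[of "(i, j)"]] by (simp add: motion_system_def)
    qed (use F h in auto)
    then show "\<forall>i\<in>\<Union>E \<times> {..<n}. x i = 0" by auto
  qed (use E t graph_finite_Union[OF E] in \<open>simp_all add: motion_system_linear card_system finite_pairs graph_def card_cartesian_product mult.commute\<close>)
  then obtain x where x: "\<And>j. j \<in> E <+> pairs n \<Longrightarrow> motion_system n p h x j = (if j = Inl e then 1 else 0)"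
    by blast
  let ?m = "\<lambda>u i. x (u, i)"
  have r: "(\<lambda>(a, b). res n p ?m a b) (ori g) = (if g = e then 1 else 0)" if "g \<in> E" for g
    using x[OF InlI[OF that]] by (simp add: motion_system_def)
  have "motion n (E - {e}) p ?m"
    unfolding motion_res
  proof (intro allI impI)
    fix u w assume "{u, w} \<in> E - {e}"
    then show "res n p ?m u w = 0" using res_ori[OF E _ r, of u w] by auto
  qed
  moreover have "\<not> motion n {e} p ?m"
  proof
    assume "motion n {e} p ?m"
    moreover obtain u w where uw: "ori e = (u, w)" by fastforce
    moreover have "e = {u, w}" using ori[of e] e E uw by (simp add: graph_def)
    ultimately have "res n p ?m u w = 0" by (simp add: motion_res)
    then show False using r[OF e] uw by simp
  qed
  ultimately show "\<exists>m. motion n (E - {e}) p m \<and> \<not> motion n {e} p m" by blast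
qed

text \<open>The motions that witness freeness and the trivial motions are linearly independent
  assignments: the equation of \<open>e\<close> isolates the coefficient of \<open>M e\<close>, and
  a trivial motion that vanishes on a spanning set is zero.\<close>

lemma free_card_le:
  fixes p :: "'a \<Rightarrow> nat \<Rightarrow> 'k::field"
  assumes fr: "free n E p" and E: "graph E" and F: "spans n F p" "F \<subseteq> \<Union>E"
  shows "card E + (Suc n choose 2) \<le> n * card (\<Union>E)"
proof -
  have "\<exists>M. \<forall>e\<in>E. motion n (E - {e}) p (M e) \<and> \<not> motion n {e} p (M e)"
    using fr unfolding free_def by (rule bchoice)
  then obtain M where M: "\<And>e. e \<in> E \<Longrightarrow> motion n (E - {e}) p (M e)" "\<And>e. e \<in> E \<Longrightarrow> \<not> motion n {e} p (M e)"
    by blast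
  have finE: "finite E" using E by (simp add: graph_def)
  define tot where "tot x u i = (\<Sum>e\<in>E. x (Inl e) * M e u i) + app_mat n (upper_mat (\<lambda>s. x (Inr s))) (p u) i"
    for x :: "'a set + nat \<times> nat \<Rightarrow> 'k" and u i
  have res_sum: "res n p (\<lambda>u i. \<Sum>e\<in>G. x (Inl e) * M e u i) u w = (\<Sum>e\<in>G. x (Inl e) * res n p (M e) u w)"
    if "finite G" for G u w and x :: "'a set + nat \<times> nat \<Rightarrow> 'k"
    using that
  proof (induction G rule: finite_induct)
    case empty
    then show ?case by (simp add: res_def ip_zero_left)
  next
    case (insert e G)
    then show ?case using res_add[of n p "\<lambda>u i. x (Inl e) * M e u i" "\<lambda>u i. \<Sum>e\<in>G. x (Inl e) * M e u i"]
      by (simp add: res_scale)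
  qed
  have "card (E <+> pairs n) \<le> card (\<Union>E \<times> {..<n})"
  proof (rule inj_linear_card_le[where f = "\<lambda>x (u, i). tot x u i"])
    fix x :: "'a set + nat \<times> nat \<Rightarrow> 'k" assume x: "\<And>j. j \<in> \<Union>E \<times> {..<n} \<Longrightarrow> (\<lambda>(u, i). tot x u i) j = 0"
    have tot0: "tot x u i = 0" if "u \<in> \<Union>E" "i < n" for u i using x[of "(u, i)"] that by simp
    have xe: "x (Inl e) = 0" if e: "e \<in> E" for e
    proof -
      obtain u w where uw: "{u, w} = e" "res n p (M e) u w \<noteq> 0"
        using M(2)[OF e] by (auto simp: motion_res)
      have "0 = res n p (tot x) u w"
      proof -
        have "res n p (tot x) u w = res n p (\<lambda>u i. 0) u w"
        proof (rule res_cong)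
          have "u \<in> \<Union>E" "w \<in> \<Union>E" using e uw(1) by blast+
          then show "tot x u i = 0" "tot x w i = 0" if "i < n" for i using tot0 that by blast+
        qed
        then show ?thesis by (simp add: res_def ip_zero_left)
      qed
      also have "\<dots> = (\<Sum>g\<in>E. x (Inl g) * res n p (M g) u w)"
        unfolding tot_def res_add using res_sym_mat[OF sym_upper_mat, of n p] res_sum[OF finE, of x]
        by simp
      also have "\<dots> = (\<Sum>g\<in>E. if g = e then x (Inl e) * res n p (M e) u w else 0)"
      proof (rule sum.cong[OF refl])
        fix g assume g: "g \<in> E"
        show "x (Inl g) * res n p (M g) u w = (if g = e then x (Inl e) * res n p (M e) u w else 0)"
          using M(1)[OF g] e uw(1) by (auto simp: motion_res)
      qed
      also have "\<dots> = x (Inl e) * res n p (M e) u w" using finE e by simp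
      finally show ?thesis using uw(2) by simp
    qed
    have "app_mat n (upper_mat (\<lambda>s. x (Inr s))) (p u) i = 0" if "u \<in> F" "i < n" for u i
      using tot0[of u i] that F(2) xe by (auto simp: tot_def)
    then have B0: "upper_mat (\<lambda>s. x (Inr s)) a b = 0" if "a < n" "b < n" for a b
      using spans_app_mat_eqD[OF F(1) _ that, of "upper_mat (\<lambda>s. x (Inr s))" "\<lambda>a b. 0"]
      by (simp add: app_mat_def ip_zero_left)
    have "x (Inr (i, j)) = 0" if "(i, j) \<in> pairs n" for i j
      using B0[of i j] that by (auto simp: pairs_def upper_mat_def)
    then show "\<forall>j\<in>E <+> pairs n. x j = 0" using xe by auto
  next
    fix x y :: "'a set + nat \<times> nat \<Rightarrow> 'k" and j
    show "(\<lambda>(u, i). tot (\<lambda>i. x i + y i) u i) j = (\<lambda>(u, i). tot x u i) j + (\<lambda>(u, i). tot y u i) j"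
      using app_mat_add[of n "upper_mat (\<lambda>s. x (Inr s))" "upper_mat (\<lambda>s. y (Inr s))"]
      by (cases j) (simp add: tot_def upper_mat_def algebra_simps sum.distrib)
  next
    fix c and x :: "'a set + nat \<times> nat \<Rightarrow> 'k" and j
    show "(\<lambda>(u, i). tot (\<lambda>i. c * x i) u i) j = c * (\<lambda>(u, i). tot x u i) j"
      using app_mat_scale[of n c "upper_mat (\<lambda>s. x (Inr s))"]
      by (cases j) (simp add: tot_def upper_mat_def algebra_simps sum_distrib_left)
  qed (use finE graph_finite_Union[OF E] in \<open>simp_all add: card_system finite_pairs\<close>)
  then show ?thesis using finE by (simp add: card_system card_cartesian_product mult.commute)
qed

section \<open>Coning: from solid vertex links to solid vertex stars\<close>

definition star :: "'a set set \<Rightarrow> 'a \<Rightarrow> 'a set set" where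
  "star X v = {F \<in> X. v \<in> F}"

lemma star_subset: "star X v \<subseteq> X"
  by (auto simp: star_def)

lemma star_eq: "star X v = insert v ` lk X {v}"
proof
  show "star X v \<subseteq> insert v ` lk X {v}"
  proof
    fix F assume "F \<in> star X v"
    then have "F - {v} \<in> lk X {v}" "F = insert v (F - {v})" by (auto simp: star_def lk_def)
    then show "F \<in> insert v ` lk X {v}" by blast
  qed
  show "insert v ` lk X {v} \<subseteq> star X v" by (auto simp: star_def lk_def insert_absorb)
qed

text \<open>A cone raises the dimension by one. Place \<open>v\<close> at the last unit vector and
  the link in the hyperplane orthogonal to it: once \<open>m v\<close> vanishes, the cone edges kill
  the last coordinates, and the first \<open>n\<close> coordinates form a motion of the
  link.\<close>

lemma star_solid:
  fixes p :: "'a \<Rightarrow> nat \<Rightarrow> 'k::field"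
  assumes inf: "infinite (UNIV :: 'k set)" and n: "3 \<le> n" and X: "pure (Suc n) X"
    and c: "circuit n (lk X {v})" and p: "generic (Suc n) V p" "\<Union>X \<subseteq> V"
  shows "solid (Suc n) (edges (star X v)) p (\<Union>(star X v))"
proof -
  let ?L = "lk X {v}"
  have L: "pure n ?L" "?L \<noteq> {}" using circuitD[OF c] by auto
  have finL: "finite (\<Union>?L)" by (rule pure_finite_Union[OF L(1)])
  obtain r :: "'a \<Rightarrow> nat \<Rightarrow> 'k" where r: "generic n (\<Union>?L) r" using generic_exists[OF inf finL] by blast
  have sol: "solid n (edges ?L) r (\<Union>?L)" by (rule circuit_solid[OF inf n c order_refl finL r])
  obtain F where F: "F \<in> ?L" using L(2) by blast
  have n2: "2 \<le> n" using n by simp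
  have "spans n F r" using generic_spans[OF r _ pureD(2)[OF L(1) F]] F by blast
  then have pin: "pinned n (edges ?L) F r"
    using sol F by (intro solid_pinned) (auto simp: Union_edges[OF L(1) n2])
  have vL: "v \<notin> \<Union>?L" by (auto simp: lk_def)
  define q where "q u i = (if u = v then if i = n then 1 else 0 else if i < n then r u i else 0)" for u i
  have "pinned (Suc n) (edges (star X v)) (insert v F) q"
    unfolding pinned_def
  proof (intro allI impI)
    fix m assume m: "motion (Suc n) (edges (star X v)) q m" and m0: "\<forall>u\<in>insert v F. \<forall>i<Suc n. m u i = 0"
    have un: "m u n = 0" if "u \<in> \<Union>?L" for u
    proof -
      obtain G where G: "G \<in> ?L" "u \<in> G" using \<open>u \<in> \<Union>?L\<close> by blast
      then have "{u, v} \<in> edges (star X v)" using vL by (intro edges_facet[of "insert v G"]) (auto simp: star_eq)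
      then have "ip (Suc n) (m u) (q v) = ip (Suc n) (m v) (q u)" using m unfolding motion_def by blast
      also have "\<dots> = 0" using m0 by (intro ip_eq_0_left) auto
      finally show ?thesis by (simp add: ip_def q_def)
    qed
    have "motion n (edges ?L) r m"
      unfolding motion_def
    proof (intro allI impI)
      fix u w assume e: "{u, w} \<in> edges ?L"
      then have "{u, w} \<in> edges (star X v)"
        by (auto simp: edges_pair faces_def star_eq)
      then have "ip (Suc n) (m u) (q w) = ip (Suc n) (m w) (q u)" using m unfolding motion_def by blast
      moreover have "{u, w} \<subseteq> \<Union>?L" using e edges_subset_Pow[of ?L] by blast
      then have "u \<noteq> v" "w \<noteq> v" using vL by blast+
      ultimately show "ip n (m u) (r w) = ip n (m w) (r u)" by (simp add: ip_def q_def)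
    qed
    then have "\<forall>u\<in>\<Union>?L. \<forall>i<n. m u i = 0"
      using pin m0 unfolding pinned_def by (simp add: Union_edges[OF L(1) n2])
    then have "\<forall>u\<in>\<Union>?L. \<forall>i<Suc n. m u i = 0" using un by (auto simp: less_Suc_eq)
    moreover have "\<Union>(edges (star X v)) \<subseteq> insert v (\<Union>?L)"
    proof -
      have "\<Union>(star X v) \<subseteq> insert v (\<Union>?L)" unfolding star_eq by blast
      then show ?thesis using edges_subset_Pow[of "star X v"] by blast
    qed
    ultimately show "\<forall>u\<in>\<Union>(edges (star X v)). \<forall>i<Suc n. m u i = 0" using m0 by blast
  qed
  then show ?thesis
    by (rule generic_pinned_solid[OF p(1) pure_subset[OF X star_subset] _ _ _, rotated -1])
      (use F p(2) n star_subset[of X v] in \<open>auto simp: star_eq[symmetric]\<close>, simp add: star_eq)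
qed

section \<open>Cocycles and motions\<close>

text \<open>The vertices \<open>a\<close>, \<open>b\<close>, \<open>c\<close> may coincide; this
  yields \<open>z a a = 0\<close> and antisymmetry on edges.\<close>

definition cocycle :: "'a set set \<Rightarrow> ('a \<Rightarrow> 'a \<Rightarrow> 'k::field) \<Rightarrow> bool" where
  "cocycle X z \<longleftrightarrow> (\<forall>a b c. {a, b, c} \<in> faces X \<longrightarrow> z a b + z b c = z a c)"

definition conn :: "'a set set \<Rightarrow> bool" where
  "conn X \<longleftrightarrow> (\<forall>u\<in>\<Union>X. \<forall>w\<in>\<Union>X. (u, w) \<in> {(a, b). {a, b} \<in> edges X}\<^sup>*)"

lemma edges_star_subset: "edges (star X v) \<subseteq> edges X"
  by (rule edges_mono[OF star_subset])

lemma cocycle_refl: "cocycle X z \<Longrightarrow> {a} \<in> faces X \<Longrightarrow> z a a = 0"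
  unfolding cocycle_def using insert_absorb2 by (metis add_cancel_right_right)

lemma cocycle_swap:
  assumes "cocycle X z" "{a, b} \<in> faces X"
  shows "z b a = - z a b"
proof -
  have "z a b + z b a = z a a" using assms unfolding cocycle_def by (metis insert_commute insert_absorb2)
  moreover have "z a a = 0" by (rule cocycle_refl[OF assms(1) faces_subset[OF assms(2)]]) simp
  ultimately show ?thesis by (simp add: eq_neg_iff_add_eq_0 add.commute)
qed

lemma conn_const:
  assumes X: "conn X" and f: "\<And>u w. {u, w} \<in> edges X \<Longrightarrow> f u = f w" and uw: "u \<in> \<Union>X" "w \<in> \<Union>X"
  shows "f u = f w"
proof -
  have "(u, w) \<in> {(a, b). {a, b} \<in> edges X}\<^sup>*" using X uw unfolding conn_def by blast
  then show ?thesis by (induction rule: rtrancl_induct) (use f in auto)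
qed

lemma app_mat_cong:
  "(\<And>j. j < n \<Longrightarrow> A i j = B i j) \<Longrightarrow> app_mat n A x i = app_mat n B x i"
  unfolding app_mat_def by (intro ip_cong) auto

lemma ip_app_mat_cong:
  "(\<And>i j. i < n \<Longrightarrow> j < n \<Longrightarrow> A i j = B i j) \<Longrightarrow> ip n (app_mat n A x) y = ip n (app_mat n B x) y"
  by (intro ip_cong app_mat_cong) auto

lemma ip_app_mat_add:
  "ip n (app_mat n (\<lambda>i j. A i j + B i j) x) y = ip n (app_mat n A x) y + ip n (app_mat n B x) y"
  by (simp add: app_mat_add ip_add_left)

text \<open>
  A motion whose edge values come from a cocycle with values in the symmetric matrices is, on each
  star, the motion of a symmetric matrix up to the cocycle; comparing two stars along a common
  facet shows that the cocycle is a coboundary.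
\<close>

lemma cocycle_motion:
  fixes p :: "'a \<Rightarrow> nat \<Rightarrow> 'k::field"
  assumes span: "\<And>F. F \<in> X \<Longrightarrow> spans d F p"
    and star: "\<And>v. v \<in> \<Union>X \<Longrightarrow> solid d (edges (star X v)) p (\<Union>(star X v))"
    and sym: "\<And>u w. sym_mat d (Z u w)"
    and coc: "\<And>i j. i < d \<Longrightarrow> j < d \<Longrightarrow> cocycle X (\<lambda>u w. Z u w i j)"
    and eq: "\<And>u w. {u, w} \<in> edges X \<Longrightarrow> ip d (app_mat d (Z u w) (p u)) (p w) = res d p m u w"
  shows "\<exists>\<eta>. (\<forall>v\<in>\<Union>X. sym_mat d (\<eta> v) \<and> (\<forall>i<d. m v i = app_mat d (\<eta> v) (p v) i)) \<and>
    (\<forall>u w. {u, w} \<in> edges X \<longrightarrow> (\<forall>i<d. \<forall>j<d. \<eta> u i j - \<eta> w i j = Z u w i j))"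
proof -
  have coc3: "Z a b i j + Z b c i j = Z a c i j" if "{a, b, c} \<in> faces X" "i < d" "j < d" for a b c i j
    using coc[OF that(2,3)] that(1) unfolding cocycle_def by blast
  have "\<exists>B. sym_mat d B \<and> (\<forall>u\<in>\<Union>(star X v). \<forall>i<d. m u i - app_mat d (Z u v) (p u) i = app_mat d B (p u) i)"
    if v: "v \<in> \<Union>X" for v
  proof -
    \<comment> \<open>On the star of \<open>v\<close> the cocycle is the coboundary of
      \<open>u \<mapsto> Z u v\<close>, because \<open>u\<close>, \<open>w\<close>, \<open>v\<close>
      lie in a common facet. Subtracting its contribution leaves a genuine motion.\<close>
    have "motion d (edges (star X v)) p (\<lambda>u i. m u i - app_mat d (Z u v) (p u) i)"
      unfolding motion_res
    proof (intro allI impI)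
      fix u w assume e: "{u, w} \<in> edges (star X v)"
      then obtain F where F: "F \<in> X" "v \<in> F" "u \<in> F" "w \<in> F" by (auto simp: edges_def faces_def star_def)
      have eX: "{u, w} \<in> edges X" using e edges_star_subset by (rule subsetD[rotated])
      have f3: "{u, w, v} \<in> faces X" using F by (auto simp: faces_def)
      have "ip d (app_mat d (Z u v) (p u)) (p w) =
          ip d (app_mat d (\<lambda>i j. Z u w i j + Z w v i j) (p u)) (p w)"
        by (rule ip_app_mat_cong) (simp add: coc3[OF f3])
      also have "\<dots> = res d p m u w + ip d (app_mat d (Z w v) (p w)) (p u)"
        unfolding ip_app_mat_add eq[OF eX] sym_mat_ip[OF sym, of w v "p u" "p w"] by (rule refl)
      finally show "res d p (\<lambda>u i. m u i - app_mat d (Z u v) (p u) i) u w = 0"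
        by (simp add: res_diff) (simp add: res_def)
    qed
    then show ?thesis using star[OF v] unfolding solid_def by blast
  qed
  then have "\<forall>v\<in>\<Union>X. \<exists>B. sym_mat d B \<and> (\<forall>u\<in>\<Union>(star X v). \<forall>i<d. m u i - app_mat d (Z u v) (p u) i = app_mat d B (p u) i)"
    by blast
  from bchoice[OF this] obtain \<eta> where \<eta>: "\<And>v. v \<in> \<Union>X \<Longrightarrow> sym_mat d (\<eta> v)"
    "\<And>v u i. v \<in> \<Union>X \<Longrightarrow> u \<in> \<Union>(star X v) \<Longrightarrow> i < d \<Longrightarrow> m u i - app_mat d (Z u v) (p u) i = app_mat d (\<eta> v) (p u) i"
    by blast
  have "m v i = app_mat d (\<eta> v) (p v) i" if v: "v \<in> \<Union>X" and i: "i < d" for v i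
  proof -
    have vs: "v \<in> \<Union>(star X v)" and "{v} \<in> faces X" using v by (auto simp: star_def faces_def)
    then have "Z v v i j = 0" if "j < d" for j using cocycle_refl[OF coc[OF i that]] by blast
    then have "app_mat d (Z v v) (p v) i = 0" unfolding app_mat_def by (intro ip_eq_0_left) blast
    then show ?thesis using \<eta>(2)[OF v vs i] by simp
  qed
  moreover have "\<eta> v i j - \<eta> w i j = Z v w i j" if e: "{v, w} \<in> edges X" and ij: "i < d" "j < d" for v w i j
  proof -
    obtain F where F: "F \<in> X" "v \<in> F" "w \<in> F" using e by (auto simp: edges_def faces_def)
    have vX: "v \<in> \<Union>X" "w \<in> \<Union>X" using F by blast+
    have "\<eta> v i j = \<eta> w i j + Z v w i j"
    proof (rule spans_app_mat_eqD[OF span[OF F(1)] _ ij])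
      fix u i assume u: "u \<in> F" "i < d"
      have us: "u \<in> \<Union>(star X v)" "u \<in> \<Union>(star X w)" using F u by (auto simp: star_def)
      have "{u, v, w} \<in> faces X" using F u by (auto simp: faces_def)
      then have "app_mat d (Z u w) (p u) i = app_mat d (\<lambda>i j. Z u v i j + Z v w i j) (p u) i"
        using u(2) by (intro app_mat_cong) (simp add: coc3)
      then show "app_mat d (\<eta> v) (p u) i = app_mat d (\<lambda>i j. \<eta> w i j + Z v w i j) (p u) i"
        using \<eta>(2)[OF vX(1) us(1) u(2)] \<eta>(2)[OF vX(2) us(2) u(2)] by (simp add: app_mat_add algebra_simps)
    qed
    then show ?thesis by simp
  qed
  ultimately show ?thesis using \<eta>(1) by blast
qed

lemma sym_mat_zero: "sym_mat d (\<lambda>a b. 0)"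
  by (simp add: sym_mat_def)

lemma app_mat_zero: "app_mat d (\<lambda>a b. 0) x = (\<lambda>i. 0)"
  by (simp add: app_mat_def ip_zero_left)

text \<open>The case of the zero cocycle: the matrices of adjacent stars agree, and connectedness
  makes them all equal.\<close>

lemma stars_solid:
  fixes p :: "'a \<Rightarrow> nat \<Rightarrow> 'k::field"
  assumes span: "\<And>F. F \<in> X \<Longrightarrow> spans d F p"
    and star: "\<And>v. v \<in> \<Union>X \<Longrightarrow> solid d (edges (star X v)) p (\<Union>(star X v))"
    and conn: "conn X"
  shows "solid d (edges X) p (\<Union>X)"
  unfolding solid_def
proof (intro allI impI)
  fix m assume m: "motion d (edges X) p m"
  have "\<exists>\<eta>. (\<forall>v\<in>\<Union>X. sym_mat d (\<eta> v) \<and> (\<forall>i<d. m v i = app_mat d (\<eta> v) (p v) i)) \<and>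
    (\<forall>u w. {u, w} \<in> edges X \<longrightarrow> (\<forall>i<d. \<forall>j<d. \<eta> u i j - \<eta> w i j = 0))"
    by (rule cocycle_motion[OF span star, where Z = "\<lambda>u w i j. 0"])
      (use m in \<open>simp_all add: sym_mat_zero cocycle_def motion_res app_mat_zero ip_zero_left\<close>)
  then obtain \<eta> where \<eta>: "\<And>v. v \<in> \<Union>X \<Longrightarrow> sym_mat d (\<eta> v)" "\<And>v i. v \<in> \<Union>X \<Longrightarrow> i < d \<Longrightarrow> m v i = app_mat d (\<eta> v) (p v) i"
    "\<And>u w i j. {u, w} \<in> edges X \<Longrightarrow> i < d \<Longrightarrow> j < d \<Longrightarrow> \<eta> u i j = \<eta> w i j"
    by (metis eq_iff_diff_eq_0)
  show "\<exists>B. sym_mat d B \<and> (\<forall>u\<in>\<Union>X. \<forall>i<d. m u i = app_mat d B (p u) i)"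
  proof (cases "\<Union>X = {}")
    case True
    then show ?thesis using sym_mat_zero by blast
  next
    case False
    then obtain v where v: "v \<in> \<Union>X" by blast
    have "\<eta> u i j = \<eta> v i j" if "u \<in> \<Union>X" "i < d" "j < d" for u i j
      by (rule conn_const[OF conn, where f = "\<lambda>u. \<eta> u i j"]) (use \<eta>(3) that v in auto)
    then have "app_mat d (\<eta> u) x i = app_mat d (\<eta> v) x i" if "u \<in> \<Union>X" "i < d" for u x i
      using that by (intro app_mat_cong) auto
    then show ?thesis using \<eta>(1)[OF v] \<eta>(2) by (intro exI[of _ "\<eta> v"]) simp
  qed
qed

lemma cocycle_linear:
  "(\<And>j. j < r \<Longrightarrow> cocycle X (z j)) \<Longrightarrow> cocycle X (\<lambda>u w. \<Sum>j<r. c j * z j u w)"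
  unfolding cocycle_def by (simp add: sum.distrib[symmetric] distrib_left[symmetric])

text \<open>Independence is meant modulo coboundaries, that is for the classes in first
  cohomology.\<close>

definition indep_cocycles :: "'a set set \<Rightarrow> nat \<Rightarrow> (nat \<Rightarrow> 'a \<Rightarrow> 'a \<Rightarrow> 'k::field) \<Rightarrow> bool" where
  "indep_cocycles X r z \<longleftrightarrow> (\<forall>j<r. cocycle X (z j)) \<and>
     (\<forall>a \<eta>. (\<forall>u w. {u, w} \<in> edges X \<longrightarrow> (\<Sum>j<r. a j * z j u w) = \<eta> u - \<eta> w) \<longrightarrow> (\<forall>j<r. a j = 0))"

text \<open>This is \<open>\<Sum>j. z_j(u, w) B_j\<close> with unknown symmetric matrices
  \<open>B_j\<close>, whose entries on and above the diagonal are \<open>x (Inl (j, s))\<close>. The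
  unknowns of the form \<open>Inr\<close> are left for the motion.\<close>

definition cocycle_mat :: "nat \<Rightarrow> (nat \<Rightarrow> 'a \<Rightarrow> 'a \<Rightarrow> 'k::field) \<Rightarrow> ((nat \<times> nat \<times> nat) + 'b \<Rightarrow> 'k) \<Rightarrow> 'a \<Rightarrow> 'a \<Rightarrow> nat \<Rightarrow> nat \<Rightarrow> 'k" where
  "cocycle_mat r z x u w = upper_mat (\<lambda>s. \<Sum>j<r. x (Inl (j, s)) * z j u w)"

definition twisted_res ::
  "nat \<Rightarrow> nat \<Rightarrow> (nat \<Rightarrow> 'a \<Rightarrow> 'a \<Rightarrow> 'k::field) \<Rightarrow> ('a \<Rightarrow> nat \<Rightarrow> 'k) \<Rightarrow> ((nat \<times> nat \<times> nat) + 'a \<times> nat \<Rightarrow> 'k) \<Rightarrow> 'a \<Rightarrow> 'a \<Rightarrow> 'k" where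
  "twisted_res d r z p x u w = ip d (app_mat d (cocycle_mat r z x u w) (p u)) (p w) - res d p (\<lambda>u i. x (Inr (u, i))) u w"

definition twisted_system ::
  "nat \<Rightarrow> nat \<Rightarrow> (nat \<Rightarrow> 'a \<Rightarrow> 'a \<Rightarrow> 'k::field) \<Rightarrow> ('a \<Rightarrow> nat \<Rightarrow> 'k) \<Rightarrow> (nat \<Rightarrow> 'a) \<Rightarrow>
    ((nat \<times> nat \<times> nat) + 'a \<times> nat \<Rightarrow> 'k) \<Rightarrow> 'a set + nat \<times> nat \<Rightarrow> 'k" where
  "twisted_system d r z p h x j = (case j of
     Inl e \<Rightarrow> (\<lambda>(a, b). twisted_res d r z p x a b) (ori e)
   | Inr (i, j) \<Rightarrow> ip d (\<lambda>k. x (Inr (h i, k))) (p (h j)))"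

lemma twisted_res_linear:
  "twisted_res d r z p (\<lambda>i. x i + y i) u w = twisted_res d r z p x u w + twisted_res d r z p y u w"
  "twisted_res d r z p (\<lambda>i. c * x i) u w = c * twisted_res d r z p x u w"
proof -
  have "cocycle_mat r z (\<lambda>i. x i + y i) u w = (\<lambda>a b. cocycle_mat r z x u w a b + cocycle_mat r z y u w a b)"
    by (simp add: cocycle_mat_def upper_mat_def fun_eq_iff sum.distrib distrib_right)
  then show "twisted_res d r z p (\<lambda>i. x i + y i) u w = twisted_res d r z p x u w + twisted_res d r z p y u w"
    using res_add[of d p "\<lambda>u i. x (Inr (u, i))" "\<lambda>u i. y (Inr (u, i))" u w]
    by (simp add: twisted_res_def ip_app_mat_add)
  have "cocycle_mat r z (\<lambda>i. c * x i) u w = (\<lambda>a b. c * cocycle_mat r z x u w a b)"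
    by (simp add: cocycle_mat_def upper_mat_def fun_eq_iff sum_distrib_left mult.assoc)
  then show "twisted_res d r z p (\<lambda>i. c * x i) u w = c * twisted_res d r z p x u w"
    using res_scale[of d p c "\<lambda>u i. x (Inr (u, i))" u w]
    by (simp add: twisted_res_def app_mat_scale ip_scale_left right_diff_distrib)
qed

lemma twisted_system_linear:
  "twisted_system d r z p h (\<lambda>i. x i + y i) j = twisted_system d r z p h x j + twisted_system d r z p h y j"
  "twisted_system d r z p h (\<lambda>i. c * x i) j = c * twisted_system d r z p h x j"
  by (cases j; auto simp: twisted_system_def twisted_res_linear ip_add_left ip_scale_left split: prod.split)+

lemma cocycle_mat_cocycle:
  assumes "\<And>j. j < r \<Longrightarrow> cocycle X (z j)"
  shows "cocycle X (\<lambda>u w. cocycle_mat r z x u w a b)"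
  unfolding cocycle_mat_def upper_mat_def by (rule cocycle_linear[OF assms])

lemma sym_cocycle_mat: "sym_mat d (cocycle_mat r z x u w)"
  unfolding cocycle_mat_def by (rule sym_upper_mat)

lemma twisted_res_swap:
  assumes z: "\<And>j. j < r \<Longrightarrow> cocycle X (z j)" and e: "{u, w} \<in> faces X"
  shows "twisted_res d r z p x w u = - twisted_res d r z p x u w"
proof -
  have "cocycle_mat r z x w u a b = - 1 * cocycle_mat r z x u w a b" for a b
    using cocycle_swap[OF cocycle_mat_cocycle[OF z] e] by simp
  then have "ip d (app_mat d (cocycle_mat r z x w u) (p w)) (p u) =
      ip d (app_mat d (\<lambda>a b. - 1 * cocycle_mat r z x u w a b) (p w)) (p u)"
    by (intro ip_app_mat_cong)
  also have "\<dots> = - ip d (app_mat d (cocycle_mat r z x u w) (p u)) (p w)"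
    unfolding app_mat_scale ip_scale_left using sym_mat_ip[OF sym_cocycle_mat, of d r z x u w "p w" "p u"] by simp
  finally show ?thesis by (simp add: twisted_res_def res_swap[of d p _ u w])
qed

lemma twisted_res_ori:
  assumes z: "\<And>j. j < r \<Longrightarrow> cocycle X (z j)" and X: "pure d X" and e: "{u, w} \<in> edges X"
    and c: "(\<lambda>(a, b). twisted_res d r z p x a b) (ori {u, w}) = c"
  shows "twisted_res d r z p x u w = c \<or> twisted_res d r z p x u w = - c"
proof -
  have "{u, w} = {fst (ori {u, w}), snd (ori {u, w})}" using e by (intro ori) (auto simp: edges_def)
  then have "ori {u, w} = (u, w) \<or> ori {u, w} = (w, u)" by (metis doubleton_eq_iff prod.collapse)
  moreover have "{u, w} \<in> faces X" using e by (simp add: edges_def)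
  ultimately show ?thesis using c twisted_res_swap[where d = d and p = p and x = x and u = u and w = w, OF z] by auto
qed

text \<open>If a motion realises the edge values of the matrices, then by
  \<open>cocycle_motion\<close> each entry of \<open>\<Sum>j. z_j B_j\<close> is a coboundary, and
  independence kills every \<open>B_j\<close>. The remaining motion is trivial, since the stars are
  solid and \<open>X\<close> is connected, and the pinning equations make it zero.\<close>

lemma twisted_system_inj:
  fixes p :: "'a \<Rightarrow> nat \<Rightarrow> 'k::field" and z :: "nat \<Rightarrow> 'a \<Rightarrow> 'a \<Rightarrow> 'k"
  assumes X: "pure d X" "2 \<le> d" "conn X"
    and span: "\<And>F. F \<in> X \<Longrightarrow> spans d F p"
    and star: "\<And>v. v \<in> \<Union>X \<Longrightarrow> solid d (edges (star X v)) p (\<Union>(star X v))"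
    and z: "indep_cocycles X r z"
    and F0: "F0 \<in> X" "h ` {..<d} = F0"
    and x: "\<And>j. j \<in> edges X <+> pairs d \<Longrightarrow> twisted_system d r z p h x j = 0"
    and i: "i \<in> ({..<r} \<times> pairs d) <+> (\<Union>X \<times> {..<d})"
  shows "x i = 0"
proof -
  have coc: "\<And>j. j < r \<Longrightarrow> cocycle X (z j)" using z by (simp add: indep_cocycles_def)
  define m where "m = (\<lambda>u i. x (Inr (u, i)))"
  let ?Z = "cocycle_mat r z x"
  have "twisted_res d r z p x u w = 0" if e: "{u, w} \<in> edges X" for u w
    using twisted_res_ori[where p = p and x = x and c = 0, OF coc X(1) e] x[OF InlI[OF e]] by (simp add: twisted_system_def)
  then have eq: "ip d (app_mat d (?Z u w) (p u)) (p w) = res d p m u w" if "{u, w} \<in> edges X" for u w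
    using that by (simp add: twisted_res_def m_def)
  obtain \<eta> where \<eta>: "\<And>u w i j. {u, w} \<in> edges X \<Longrightarrow> i < d \<Longrightarrow> j < d \<Longrightarrow> \<eta> u i j - \<eta> w i j = ?Z u w i j"
    using cocycle_motion[OF span star sym_cocycle_mat cocycle_mat_cocycle[OF coc] eq] by blast
  have xl: "x (Inl (j, a, b)) = 0" if j: "j < r" and ab: "(a, b) \<in> pairs d" for j a b
  proof -
    have ab': "min a b = a" "max a b = b" "a < d" "b < d" using ab by (auto simp: pairs_def)
    have "\<forall>u w. {u, w} \<in> edges X \<longrightarrow> (\<Sum>j<r. x (Inl (j, a, b)) * z j u w) = \<eta> u a b - \<eta> w a b"
      using \<eta> ab' by (simp add: cocycle_mat_def upper_mat_def)
    then show ?thesis using z j unfolding indep_cocycles_def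
      by (elim conjE) (drule spec[of _ "\<lambda>j. x (Inl (j, a, b))"], drule spec[of _ "\<lambda>u. \<eta> u a b"], blast)
  qed
  have Z0: "?Z u w a b = 0" if "a < d" "b < d" for u w a b
    unfolding cocycle_mat_def upper_mat_def
    by (rule sum.neutral) (use that xl in \<open>auto simp: pairs_def\<close>)
  have F0V: "F0 \<subseteq> \<Union>X" using F0 by blast
  have xr: "m u k = 0" if u: "u \<in> \<Union>X" "k < d" for u k
  proof (rule motion_system_inj[where E = "edges X"])
    show "solid d (edges X) p (\<Union>(edges X))"
      using stars_solid[OF span star X(3)] by (simp add: Union_edges[OF X(1,2)])
    show "graph (edges X)" by (rule graph_edges[OF X(1)])
    show "spans d (h ` {..<d}) p" using span[OF F0(1)] F0(2) by simp
    show "h ` {..<d} \<subseteq> \<Union>(edges X)" using F0V F0(2) by (simp add: Union_edges[OF X(1,2)])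
    show "u \<in> \<Union>(edges X)" using u(1) by (simp only: Union_edges[OF X(1,2)])
  next
    fix e assume e: "e \<in> edges X"
    obtain u w where uw: "ori e = (u, w)" by fastforce
    have e': "e = {u, w}" using ori[of e] e uw by (simp add: edges_def)
    have "ip d (app_mat d (?Z u w) (p u)) (p w) = ip d (app_mat d (\<lambda>a b. 0) (p u)) (p w)"
      by (rule ip_app_mat_cong) (rule Z0)
    then have "res d p m u w = 0" using eq[of u w] e e' by (simp add: app_mat_zero ip_zero_left)
    then show "(\<lambda>(a, b). res d p m a b) (ori e) = 0" by (simp add: uw)
  next
    fix i j assume "(i, j) \<in> pairs d"
    then show "ip d (m (h i)) (p (h j)) = 0"
      using x[OF InrI[of "(i, j)"]] by (simp add: twisted_system_def m_def)
  qed (rule u(2))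
  have "x (Inr (u, k)) = 0" if "u \<in> \<Union>X" "k < d" for u k using xr[OF that] by (simp add: m_def)
  then show ?thesis using i xl by (elim PlusE SigmaE) auto
qed

text \<open>The inequality compares the unknowns of the injective \<open>twisted_system\<close> with
  its equations. In the case of equality the system is square, so the unit vector at any edge is
  attained.\<close>

theorem cocycle_count:
  fixes p :: "'a \<Rightarrow> nat \<Rightarrow> 'k::field" and z :: "nat \<Rightarrow> 'a \<Rightarrow> 'a \<Rightarrow> 'k"
  assumes X: "pure d X" "2 \<le> d" "conn X" "X \<noteq> {}"
    and span: "\<And>F. F \<in> X \<Longrightarrow> spans d F p"
    and star: "\<And>v. v \<in> \<Union>X \<Longrightarrow> solid d (edges (star X v)) p (\<Union>(star X v))"
    and z: "indep_cocycles X r z"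
  shows "r * (Suc d choose 2) + d * card (\<Union>X) \<le> card (edges X) + (Suc d choose 2)"
    and "card (edges X) + (Suc d choose 2) \<le> r * (Suc d choose 2) + d * card (\<Union>X) \<Longrightarrow>
      free d (edges (star X v)) p"
proof -
  obtain F0 where F0: "F0 \<in> X" using X(4) by blast
  obtain h where h: "h ` {..<d} = F0"
    by (rule spans_enumerate[OF span[OF F0] pureD(1,2)[OF X(1) F0]])
  have coc: "\<And>j. j < r \<Longrightarrow> cocycle X (z j)" using z by (simp add: indep_cocycles_def)
  let ?I = "({..<r} \<times> pairs d) <+> (\<Union>X \<times> {..<d})"
  let ?J = "edges X <+> pairs d"
  have finI: "finite ?I" using pure_finite_Union[OF X(1)] by (simp add: finite_pairs)
  have cardI: "card ?I = r * (Suc d choose 2) + d * card (\<Union>X)"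
    using pure_finite_Union[OF X(1)] by (simp add: card_Plus finite_pairs card_pairs card_cartesian_product)
  have finE: "finite (edges X)" using graph_edges[OF X(1)] by (simp add: graph_def)
  note J = card_system[OF finE, of d]
  have inj: "\<forall>i\<in>?I. x i = 0" if "\<And>j. j \<in> ?J \<Longrightarrow> twisted_system d r z p h x j = 0" for x
    using twisted_system_inj[OF X(1-3) span star z F0 h that] by blast
  have "card ?I \<le> card ?J"
    by (rule inj_linear_card_le[where f = "twisted_system d r z p h"])
      (use finI J inj in \<open>simp_all add: twisted_system_linear\<close>)
  then show "r * (Suc d choose 2) + d * card (\<Union>X) \<le> card (edges X) + (Suc d choose 2)"
    by (simp add: J cardI)
  assume eq: "card (edges X) + (Suc d choose 2) \<le> r * (Suc d choose 2) + d * card (\<Union>X)"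
  show "free d (edges (star X v)) p"
    unfolding free_def
  proof
    fix e assume e: "e \<in> edges (star X v)"
    have eX: "e \<in> edges X" using e edges_star_subset by (rule subsetD[rotated])
    have "\<exists>x. (\<forall>i. i \<notin> ?I \<longrightarrow> x i = 0) \<and> (\<forall>j\<in>?J. twisted_system d r z p h x j = (if j = Inl e then 1 else 0))"
      by (rule inj_linear_surj) (use finI J inj eq cardI in \<open>simp_all add: twisted_system_linear\<close>)
    then obtain x where x: "\<And>j. j \<in> ?J \<Longrightarrow> twisted_system d r z p h x j = (if j = Inl e then 1 else 0)" by blast
    let ?Z = "cocycle_mat r z x"
    define m where "m = (\<lambda>u i. x (Inr (u, i)))"
    \<comment> \<open>Inside the star of \<open>v\<close> the matrices are the coboundary of
      \<open>u \<mapsto> Z u v\<close>. Absorbing it turns the solution into an ordinary motion of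
      the star that fails only at \<open>e\<close>.\<close>
    define m' where "m' = (\<lambda>u i. m u i - app_mat d (?Z u v) (p u) i)"
    have t: "(\<lambda>(a, b). twisted_res d r z p x a b) (ori g) = (if g = e then 1 else 0)" if "g \<in> edges X" for g
      using x[OF InlI[OF that]] by (simp add: twisted_system_def)
    have r: "res d p m' u w = - twisted_res d r z p x u w" if g: "{u, w} \<in> edges (star X v)" for u w
    proof -
      obtain F where F: "F \<in> X" "v \<in> F" "u \<in> F" "w \<in> F" using g by (auto simp: edges_def faces_def star_def)
      have f3: "{u, w, v} \<in> faces X" using F by (auto simp: faces_def)
      have "?Z u v i j = ?Z u w i j + ?Z w v i j" for i j
        using cocycle_mat_cocycle[where z = z and X = X and r = r, OF coc] f3 unfolding cocycle_def by metis
      then have "ip d (app_mat d (?Z u v) (p u)) (p w) =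
          ip d (app_mat d (\<lambda>i j. ?Z u w i j + ?Z w v i j) (p u)) (p w)"
        by (intro ip_app_mat_cong)
      also have "\<dots> = ip d (app_mat d (?Z u w) (p u)) (p w) + ip d (app_mat d (?Z w v) (p w)) (p u)"
        unfolding ip_app_mat_add sym_mat_ip[OF sym_cocycle_mat, of d r z x w v "p u" "p w"] by (rule refl)
      finally show ?thesis
        unfolding m'_def res_diff twisted_res_def by (simp add: m_def) (simp add: res_def)
    qed
    have "motion d (edges (star X v) - {e}) p m'"
      unfolding motion_res
    proof (intro allI impI)
      fix u w assume g: "{u, w} \<in> edges (star X v) - {e}"
      then have "{u, w} \<in> edges X" using edges_star_subset[of X v] by blast
      then show "res d p m' u w = 0"
        using twisted_res_ori[OF coc X(1) _ t, of u w] r[of u w] g by auto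
    qed
    moreover have "\<not> motion d {e} p m'"
    proof
      assume "motion d {e} p m'"
      moreover obtain u w where uw: "ori e = (u, w)" by fastforce
      moreover have "e = {u, w}" using ori[of e] e uw by (simp add: edges_def)
      ultimately have "res d p m' u w = 0" by (simp add: motion_res)
      then show False using t[OF eX] r[of u w] uw e \<open>e = {u, w}\<close> by simp
    qed
    ultimately show "\<exists>m. motion d (edges (star X v) - {e}) p m \<and> \<not> motion d {e} p m" by blast
  qed
qed

section \<open>Normal complexes\<close>

lemma lk_lk:
  assumes "G \<inter> H = {}"
  shows "lk (lk X G) H = lk X (G \<union> H)"
proof (intro set_eqI iffI)
  fix K assume "K \<in> lk (lk X G) H"
  then obtain F where "F \<in> X" "G \<subseteq> F" "H \<subseteq> F - G" "K = (F - G) - H" by (auto simp: lk_def)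
  then show "K \<in> lk X (G \<union> H)" by (auto simp: lk_def intro!: image_eqI[of _ _ F])
next
  fix K assume "K \<in> lk X (G \<union> H)"
  then obtain F where F: "F \<in> X" "G \<union> H \<subseteq> F" "K = F - (G \<union> H)" by (auto simp: lk_def)
  then have "F - G \<in> lk X G" "H \<subseteq> F - G" "K = (F - G) - H" using assms by (auto simp: lk_def)
  then show "K \<in> lk (lk X G) H" unfolding lk_def[of "lk X G"] by blast
qed

lemma lk_empty: "lk X {} = X"
  by (auto simp: lk_def)

lemma faces_lk: "H \<in> faces (lk X G) \<longleftrightarrow> H \<inter> G = {} \<and> H \<union> G \<in> faces X"
proof
  assume "H \<in> faces (lk X G)"
  then obtain F where "F \<in> X" "G \<subseteq> F" "H \<subseteq> F - G" by (auto simp: faces_def lk_def)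
  then show "H \<inter> G = {} \<and> H \<union> G \<in> faces X" by (auto simp: faces_def)
next
  assume H: "H \<inter> G = {} \<and> H \<union> G \<in> faces X"
  then obtain F where "F \<in> X" "H \<union> G \<subseteq> F" by (auto simp: faces_def)
  then have "F - G \<in> lk X G" "H \<subseteq> F - G" using H by (auto simp: lk_def)
  then show "H \<in> faces (lk X G)" by (auto simp: faces_def)
qed

lemma pure_lk:
  assumes "pure n X" "finite G"
  shows "pure (n - card G) (lk X G)"
  using assms by (auto simp: pure_def lk_def card_Diff_subset)

lemma cnt_lk:
  assumes "H \<inter> G = {}"
  shows "cnt (lk X G) H = cnt X (H \<union> G)"
proof -
  have eq: "{F \<in> lk X G. H \<subseteq> F} = (\<lambda>F. F - G) ` {F \<in> X. H \<union> G \<subseteq> F}"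
    using assms by (auto simp: lk_def)
  have "inj_on (\<lambda>F. F - G) {F \<in> X. H \<union> G \<subseteq> F}"
    by (rule inj_on_inverseI[where g = "\<lambda>F. F \<union> G"]) auto
  then show ?thesis by (simp add: cnt_def eq card_image)
qed

lemma cnt_lk_0: "H \<inter> G \<noteq> {} \<Longrightarrow> cnt (lk X G) H = 0"
proof -
  assume "H \<inter> G \<noteq> {}"
  then have "{F \<in> lk X G. H \<subseteq> F} = {}" by (auto simp: lk_def)
  then show ?thesis by (simp only: cnt_def card.empty)
qed

lemma cyc_lkI:
  assumes X: "pure n X" and G: "finite G" "card G < n"
    and ev: "\<And>R. finite R \<Longrightarrow> Suc (card R) = n \<Longrightarrow> G \<subseteq> R \<Longrightarrow> even (cnt X R)"
  shows "cyc (n - card G) (lk X G)"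
  unfolding cyc_def
proof (intro conjI allI impI pure_lk X G(1))
  fix R :: "'a set" assume R: "finite R" "Suc (card R) = n - card G"
  show "even (cnt (lk X G) R)"
  proof (cases "R \<inter> G = {}")
    case True
    then show ?thesis using ev[of "R \<union> G"] R G by (simp add: cnt_lk card_Un_disjoint)
  qed (simp add: cnt_lk_0)
qed

lemma in_lk_iff: "G \<inter> K = {} \<Longrightarrow> K \<in> lk X G \<longleftrightarrow> K \<union> G \<in> X"
proof
  assume d: "G \<inter> K = {}"
  { assume "K \<in> lk X G"
    then obtain F where "F \<in> X" "G \<subseteq> F" "K = F - G" by (auto simp: lk_def)
    then show "K \<union> G \<in> X" by (simp add: Un_absorb2) }
  { assume "K \<union> G \<in> X"
    moreover have "K = K \<union> G - G" using d by blast
    ultimately show "K \<in> lk X G" unfolding lk_def by blast }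
qed

lemma Union_lk: "u \<in> \<Union>(lk X {v}) \<longleftrightarrow> u \<noteq> v \<and> {u, v} \<in> edges X"
proof -
  have "u \<in> \<Union>(lk X {v}) \<longleftrightarrow> {u} \<in> faces (lk X {v})" by (auto simp: faces_def)
  then show ?thesis by (auto simp: faces_lk edges_pair insert_commute)
qed

lemma edges_lk: "{a, b} \<in> edges (lk X {v}) \<longleftrightarrow> a \<noteq> b \<and> a \<noteq> v \<and> b \<noteq> v \<and> {a, b, v} \<in> faces X"
  by (auto simp: edges_pair faces_lk insert_commute)

text \<open>A normal pseudomanifold in terms of cycles modulo 2; \<open>G = {}\<close> covers the
  complex itself. Since links of links are links, the condition is inherited by links.\<close>

definition normal :: "nat \<Rightarrow> 'a set set \<Rightarrow> bool" where
  "normal n X \<longleftrightarrow> pure n X \<and> X \<noteq> {} \<and> (\<forall>G\<in>faces X. card G < n \<longrightarrow> circuit (n - card G) (lk X G))"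

text \<open>For normal complexes of facet size at least 4 this is \<open>g\<^sub>2 = 0\<close>.\<close>

definition tight :: "nat \<Rightarrow> 'a set set \<Rightarrow> bool" where
  "tight n X \<longleftrightarrow> card (edges X) + (Suc n choose 2) \<le> n * card (\<Union>X)"

lemma normal_circuit: "normal n X \<Longrightarrow> 0 < n \<Longrightarrow> circuit n X"
  unfolding normal_def by (elim conjE, drule bspec[of _ _ "{}"]) (auto simp: lk_empty faces_def)

lemma normal_lk_circuit: "normal n X \<Longrightarrow> G \<in> faces X \<Longrightarrow> card G < n \<Longrightarrow> circuit (n - card G) (lk X G)"
  unfolding normal_def by blast

lemma normal_pure: "normal n X \<Longrightarrow> pure n X"
  by (simp add: normal_def)

lemma normal_lk:
  assumes X: "normal n X" and G: "G \<in> faces X" "card G < n"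
  shows "normal (n - card G) (lk X G)"
  unfolding normal_def
proof (intro conjI ballI impI)
  have finG: "finite G" by (rule faces_finite[OF normal_pure[OF X] G(1)])
  show "pure (n - card G) (lk X G)" by (rule pure_lk[OF normal_pure[OF X] finG])
  show "lk X G \<noteq> {}" by (rule circuitD(3)[OF normal_lk_circuit[OF X G]])
  fix H assume H: "H \<in> faces (lk X G)" "card H < n - card G"
  then have HG: "H \<inter> G = {}" "H \<union> G \<in> faces X" by (auto simp: faces_lk)
  have "finite H" using faces_finite[OF normal_pure[OF X] HG(2)] by simp
  then have c: "card (G \<union> H) = card G + card H" using finG HG(1) by (subst card_Un_disjoint) auto
  have "circuit (n - card (G \<union> H)) (lk X (G \<union> H))"
    using normal_lk_circuit[OF X, of "G \<union> H"] HG(2) H(2) c by (simp add: Un_commute)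
  then show "circuit (n - card G - card H) (lk (lk X G) H)"
    using HG(1) c by (simp add: lk_lk Int_commute)
qed

lemma normal_lk_vertex:
  assumes "normal n X" "v \<in> \<Union>X" "1 < n"
  shows "normal (n - 1) (lk X {v})"
proof -
  have "{v} \<in> faces X" using assms(2) by (auto simp: faces_def)
  then show ?thesis using normal_lk[OF assms(1), of "{v}"] assms(3) by simp
qed

text \<open>Modulo 2 a cycle of points is a set of even size, and every pair of points is
  one.\<close>

lemma circuit_1_card:
  assumes "circuit 1 S"
  shows "card S = 2"
proof -
  have S: "finite S" "S \<noteq> {}" "cyc 1 S" using circuitD[OF assms] by (auto simp: pure_def)
  have cS: "cnt A {} = card A" for A :: "'a set set" by (simp add: cnt_def)
  have "even (card S)" using cycD(2)[OF S(3), of "{}"] by (simp add: cS)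
  then have "card S \<noteq> 1" "card S \<noteq> 0" using S by auto
  then have "2 \<le> card S" by linarith
  then obtain A where A: "A \<subseteq> S" "card A = 2" by (metis obtain_subset_with_card_n)
  have "cyc 1 A"
    unfolding cyc_def using pure_subset[OF cycD(1)[OF S(3)] A(1)] A(2) by (auto simp: cS card_eq_0_iff)
  moreover have "A \<noteq> {}" using A(2) by auto
  ultimately have "A = S" using circuitD(4)[OF assms A(1)] by blast
  then show ?thesis using A(2) by simp
qed

lemma normal_ridge:
  assumes "normal n X" "R \<in> faces X" "Suc (card R) = n"
  shows "cnt X R = 2"
proof -
  have c: "circuit 1 (lk X R)" using normal_lk_circuit[OF assms(1,2)] assms(3)
    by (metis diff_Suc_Suc diff_zero diff_add_inverse2 lessI plus_1_eq_Suc)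
  have "card (lk X R) = cnt X R" using cnt_lk[of "{}" R X] by (simp add: cnt_def)
  then show ?thesis using circuit_1_card[OF c] by simp
qed

text \<open>The facets meeting a connected component form a subcycle: the facets through a nonempty
  ridge all meet the component or all avoid it.\<close>

lemma circuit_conn:
  assumes X: "circuit n X" and n: "2 \<le> n"
  shows "conn X"
  unfolding conn_def
proof (intro ballI)
  fix u w assume u: "u \<in> \<Union>X" and w: "w \<in> \<Union>X"
  let ?r = "{(a, b). {a, b} \<in> edges X}"
  define C where "C = {w. (u, w) \<in> ?r\<^sup>*}"
  define A where "A = {F \<in> X. F \<inter> C \<noteq> {}}"
  have sub: "b \<in> C" if F: "F \<in> X" "a \<in> F" "a \<in> C" "b \<in> F" for F a b
  proof (cases "a = b")
    case False
    then have "(a, b) \<in> ?r" using F edges_facet by fast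
    then show ?thesis using F(3) unfolding C_def by (auto intro: rtrancl_into_rtrancl)
  qed (use F in simp)
  have "cyc n A"
    unfolding cyc_def
  proof (intro conjI allI impI)
    show "pure n A" by (rule pure_subset[OF circuitD(1)[OF X]]) (auto simp: A_def)
    fix R :: "'a set" assume R: "finite R" "Suc (card R) = n"
    then have "R \<noteq> {}" using n by auto
    show "even (cnt A R)"
    proof (cases "R \<inter> C = {}")
      case True
      have "\<not> R \<subseteq> F" if "F \<in> A" for F
        using that sub True \<open>R \<noteq> {}\<close> unfolding A_def by blast
      then have "{F \<in> A. R \<subseteq> F} = {}" by blast
      then show ?thesis by (simp only: cnt_def card.empty even_zero)
    next
      case False
      then have "{F \<in> A. R \<subseteq> F} = {F \<in> X. R \<subseteq> F}" unfolding A_def by blast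
      then show ?thesis using cycD(2)[OF circuitD(2)[OF X] R] by (simp add: cnt_def)
    qed
  qed
  moreover have "A \<noteq> {}"
  proof -
    obtain F where "F \<in> X" "u \<in> F" using u by blast
    moreover have "u \<in> C" by (simp add: C_def)
    ultimately show ?thesis unfolding A_def by blast
  qed
  moreover have "A \<subseteq> X" by (auto simp: A_def)
  ultimately have "A = X" using circuitD(4)[OF X] by blast
  obtain F where F: "F \<in> X" "w \<in> F" using w by blast
  then have "F \<inter> C \<noteq> {}" using \<open>A = X\<close> unfolding A_def by blast
  then have "w \<in> C" using sub F by blast
  then show "(u, w) \<in> ?r\<^sup>*" by (simp add: C_def)
qed

section \<open>Tightness under cones, subcomplexes and links\<close>

lemma star_counts:
  assumes L: "pure n (lk X {v})"
  shows "card (\<Union>(lk X {v})) + 1 = card (\<Union>(star X v)) \<or> lk X {v} = {}"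
    and "lk X {v} \<noteq> {} \<Longrightarrow> card (edges (star X v)) = card (edges (lk X {v})) + card (\<Union>(lk X {v}))"
proof -
  let ?L = "lk X {v}"
  have fin: "finite (\<Union>?L)" by (rule pure_finite_Union[OF L])
  have vL: "v \<notin> \<Union>?L" by (auto simp: lk_def)
  show "card (\<Union>?L) + 1 = card (\<Union>(star X v)) \<or> ?L = {}"
  proof (cases "?L = {}")
    case False
    then have "\<Union>(star X v) = insert v (\<Union>?L)" unfolding star_eq by blast
    then show ?thesis using fin vL by simp
  qed simp
  assume ne: "?L \<noteq> {}"
  have "edges (star X v) = edges ?L \<union> (\<lambda>u. {v, u}) ` \<Union>?L"
  proof (intro set_eqI iffI)
    fix e assume "e \<in> edges (star X v)"
    then obtain a b where e: "e = {a, b}" "a \<noteq> b" "{a, b} \<in> faces (star X v)" by (rule edgesE)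
    then obtain G where G: "G \<in> ?L" "{a, b} \<subseteq> insert v G" by (auto simp: faces_def star_eq)
    show "e \<in> edges ?L \<union> (\<lambda>u. {v, u}) ` \<Union>?L"
    proof (cases "v \<in> e")
      case True
      then obtain u where u: "e = {v, u}" "u \<noteq> v" using e(1,2) by auto
      then have "u \<in> G" using G(2) e(1) by blast
      then have "u \<in> \<Union>?L" using G(1) by blast
      then show ?thesis using u(1) by simp
    next
      case False
      then have "e \<subseteq> G" using G(2) e(1) by blast
      then show ?thesis using e(1,2) G(1) by (auto simp: edges_def faces_def)
    qed
  next
    fix e assume "e \<in> edges ?L \<union> (\<lambda>u. {v, u}) ` \<Union>?L"
    then show "e \<in> edges (star X v)"
    proof
      assume "e \<in> edges ?L"
      then show ?thesis by (auto simp: edges_def faces_def star_eq)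
    next
      assume "e \<in> (\<lambda>u. {v, u}) ` \<Union>?L"
      then obtain u G where "e = {v, u}" "u \<in> G" "G \<in> ?L" by blast
      then show ?thesis using vL edges_facet[of "insert v G" "star X v" v u] by (auto simp: star_eq)
    qed
  qed
  moreover have "edges ?L \<inter> (\<lambda>u. {v, u}) ` \<Union>?L = {}"
    using vL edges_subset_Pow[of ?L] by blast
  moreover have "inj_on (\<lambda>u. {v, u}) (\<Union>?L)" by (auto simp: inj_on_def doubleton_eq_iff)
  moreover have "finite (edges ?L)" using graph_edges[OF L] by (simp add: graph_def)
  ultimately show "card (edges (star X v)) = card (edges ?L) + card (\<Union>?L)"
    using fin by (simp add: card_Un_disjoint card_image)
qed

text \<open>From the link to its cone both sides of the tightness inequality grow by the number of
  vertices of the link plus \<open>n + 1\<close>.\<close>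

lemma tight_star_lk:
  assumes L: "pure n (lk X {v})" "lk X {v} \<noteq> {}" and t: "tight (Suc n) (star X v)"
  shows "tight n (lk X {v})"
proof -
  have b: "Suc (Suc n) choose 2 = (Suc n choose 2) + Suc n" by (simp add: numeral_2_eq_2)
  have V: "card (\<Union>(star X v)) = card (\<Union>(lk X {v})) + 1" using star_counts(1)[OF L(1)] L(2) by (metis)
  show ?thesis using t unfolding tight_def b V star_counts(2)[OF L] by simp
qed

lemma star_pure: "pure n X \<Longrightarrow> pure n (star X v)"
  using pure_subset star_subset by metis

lemma free_tight:
  assumes fr: "free n (edges X) p" and p: "generic n (\<Union>X) p" and Y: "pure n Y" "Y \<noteq> {}" "edges Y \<subseteq> edges X" and n: "2 \<le> n"
  shows "tight n Y"
proof -
  obtain F where F: "F \<in> Y" using Y(2) by blast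
  have UY: "\<Union>(edges Y) = \<Union>Y" by (rule Union_edges[OF Y(1) n])
  have "\<Union>(edges Y) \<subseteq> \<Union>(edges X)" using Y(3) by blast
  then have "\<Union>Y \<subseteq> \<Union>X" using edges_subset_Pow[of X] UY by blast
  then have "F \<subseteq> \<Union>X" using F by blast
  then have "spans n F p" by (rule generic_spans[OF p _ pureD(2)[OF Y(1) F]])
  then have "card (edges Y) + (Suc n choose 2) \<le> n * card (\<Union>(edges Y))"
    by (intro free_card_le[OF free_mono[OF fr Y(3)] graph_edges[OF Y(1)]]) (use F UY in auto)
  then show ?thesis by (simp add: tight_def UY)
qed

lemma tight_free:
  fixes p :: "'a \<Rightarrow> nat \<Rightarrow> 'k::field"
  assumes inf: "infinite (UNIV :: 'k set)" and X: "circuit n X" "tight n X" and n: "3 \<le> n" and p: "generic n (\<Union>X) p"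
  shows "free n (edges X) p"
proof -
  have P: "pure n X" by (rule circuitD(1)[OF X(1)])
  have UX: "\<Union>(edges X) = \<Union>X" by (rule Union_edges[OF P]) (use n in simp)
  obtain F where F: "F \<in> X" using circuitD(3)[OF X(1)] by blast
  have sol: "solid n (edges X) p (\<Union>(edges X))"
    using circuit_solid[OF inf n X(1) order_refl pure_finite_Union[OF P] p] by (simp add: UX)
  have "spans n F p" using generic_spans[OF p _ pureD(2)[OF P F]] F by blast
  then show ?thesis
    by (rule solid_tight_free[OF sol graph_edges[OF P]])
      (use F UX X(2) pureD(2)[OF P F] in \<open>auto simp: tight_def\<close>)
qed

text \<open>A tight circuit has independent edge equations at generic points, independence passes to
  subgraphs, and there it implies the count. No field occurs in the statement, so real points can be
  used.\<close>

lemma tight_subcomplex: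
  assumes X: "circuit n X" "tight n X" and n: "3 \<le> n" and Y: "pure n Y" "Y \<noteq> {}" "edges Y \<subseteq> edges X"
  shows "tight n Y"
proof -
  obtain p :: "'a \<Rightarrow> nat \<Rightarrow> real" where p: "generic n (\<Union>X) p"
    using generic_exists[OF infinite_UNIV_char_0 pure_finite_Union[OF circuitD(1)[OF X(1)]]] by blast
  show ?thesis
    by (rule free_tight[OF tight_free[OF infinite_UNIV_char_0 X n p] p Y]) (use n in simp)
qed

lemma tight_lk_vertex:
  assumes X: "normal n X" "tight n X" and n: "3 \<le> n" and v: "v \<in> \<Union>X"
  shows "tight (n - 1) (lk X {v})"
proof -
  have c: "circuit n X" by (rule normal_circuit[OF X(1)]) (use n in simp)
  have N: "normal (n - 1) (lk X {v})" by (rule normal_lk_vertex[OF X(1) v]) (use n in simp)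
  have "star X v \<noteq> {}" using v by (auto simp: star_def)
  then have "tight n (star X v)"
    by (rule tight_subcomplex[OF c X(2) n star_pure[OF normal_pure[OF X(1)]] _ edges_mono[OF star_subset]])
  moreover have "Suc (n - 1) = n" using n by simp
  ultimately show ?thesis using tight_star_lk[of "n - 1" X v] N by (simp add: normal_def)
qed

text \<open>The star of \<open>v\<close> contains \<open>a\<close> and \<open>b\<close> and is solid
  without the edge \<open>a b\<close>, so every motion of the other edges satisfies the equation of
  \<open>a b\<close>; this contradicts independence. With \<open>n \<ge> 4\<close> the link of
  \<open>v\<close> has facet size at least 3, as \<open>star_solid\<close> requires.\<close>

lemma tight_no_missing_triangle:
  assumes X: "normal n X" "tight n X" and n: "4 \<le> n"
    and e: "{v, a} \<in> edges X" "{v, b} \<in> edges X" "{a, b} \<in> edges X"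
  shows "{v, a, b} \<in> faces X"
proof (rule ccontr)
  assume no: "{v, a, b} \<notin> faces X"
  obtain p :: "'a \<Rightarrow> nat \<Rightarrow> real" where p: "generic n (\<Union>X) p"
    using generic_exists[OF infinite_UNIV_char_0 pure_finite_Union[OF normal_pure[OF X(1)]]] by blast
  have n3: "3 \<le> n" "3 \<le> n - 1" "Suc (n - 1) = n" "0 < n" "1 < n" using n by auto
  have v: "v \<in> \<Union>X" using e(1) edges_subset_Pow by blast
  have "circuit (n - 1) (lk X {v})"
    by (rule normal_circuit[OF normal_lk_vertex[OF X(1) v n3(5)]]) (use n in simp)
  then have sol: "solid n (edges (star X v)) p (\<Union>(star X v))"
    using star_solid[OF infinite_UNIV_char_0 n3(2), of X v "\<Union>X" p] normal_pure[OF X(1)] p n3(3) by simp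
  have "free n (edges X) p"
    by (rule tight_free[OF infinite_UNIV_char_0 normal_circuit[OF X(1) n3(4)] X(2) n3(1) p])
  then obtain m where m: "motion n (edges X - {{a, b}}) p m" "\<not> motion n {{a, b}} p m"
    using e(3) unfolding free_def by blast
  have "{a, b} \<notin> edges (star X v)"
  proof
    assume "{a, b} \<in> edges (star X v)"
    then obtain F where "F \<in> X" "v \<in> F" "{a, b} \<subseteq> F" by (auto simp: edges_def faces_def star_def)
    then show False using no by (auto simp: faces_def)
  qed
  then have "edges (star X v) \<subseteq> edges X - {{a, b}}" using edges_star_subset[of X v] by blast
  then have "motion n (edges (star X v)) p m" using m(1) motion_mono by blast
  then obtain B where B: "sym_mat n B" "\<And>u i. u \<in> \<Union>(star X v) \<Longrightarrow> i < n \<Longrightarrow> m u i = app_mat n B (p u) i"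
    using sol unfolding solid_def by blast
  have "a \<in> \<Union>(star X v)" "b \<in> \<Union>(star X v)" using e(1,2) by (auto simp: edges_def faces_def star_def)
  then have "res n p m a b = res n p (\<lambda>u. app_mat n B (p u)) a b"
    by (intro res_cong) (auto intro: B(2))
  then have "res n p m a b = 0" by (simp add: res_sym_mat[OF B(1)])
  moreover have "res n p m b a = 0" using calculation res_swap[of n p m a b] by simp
  ultimately have "motion n {{a, b}} p m" unfolding motion_res by (auto simp: doubleton_eq_iff)
  then show False using m(2) by simp
qed

text \<open>Induction through vertex links: as triangles are filled, a clique without its vertex
  \<open>w\<close> is a clique in the link of \<open>w\<close>, which is again normal and tight.
  Cliques of size \<open>n\<close> are left out because they may be missing facets.\<close>

lemma tight_clique_face:
  assumes "4 \<le> n" "normal n X" "tight n X" "finite c" "card c < n" "c \<subseteq> \<Union>X"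
    and "\<And>u w. u \<in> c \<Longrightarrow> w \<in> c \<Longrightarrow> u \<noteq> w \<Longrightarrow> {u, w} \<in> edges X"
  shows "c \<in> faces X"
  using assms
proof (induction n arbitrary: X c rule: nat_induct_at_least[of 4])
  case base
  note X = base.prems(1,2)
  note cl = base.prems(6)
  have "card c = 0 \<or> card c = 1 \<or> card c = 2 \<or> card c = 3" using base.prems(4) by linarith
  then show ?case
  proof (elim disjE)
    assume "card c = 0"
    then show ?thesis using base.prems(1,3) by (auto simp: normal_def faces_def)
  next
    assume "card c = 1"
    then obtain u where "c = {u}" by (auto simp: card_1_singleton_iff)
    then show ?thesis using base.prems(5) by (auto simp: faces_def)
  next
    assume "card c = 2"
    then obtain u w where "c = {u, w}" "u \<noteq> w" by (auto simp: card_2_iff)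
    then show ?thesis using cl[of u w] by (auto simp: edges_def)
  next
    assume "card c = 3"
    then obtain v a b where c: "c = {v, a, b}" "v \<noteq> a" "v \<noteq> b" "a \<noteq> b" by (auto simp: card_3_iff)
    then have "{v, a, b} \<in> faces X"
      by (intro tight_no_missing_triangle[OF X]) (auto intro!: cl)
    then show ?thesis using c by simp
  qed
next
  case (Suc n)
  note X = Suc.prems(1,2)
  note cl = Suc.prems(6)
  have n4: "4 \<le> Suc n" "3 \<le> Suc n" "1 < Suc n" using Suc.hyps by auto
  show ?case
  proof (cases "c = {}")
    case True
    then show ?thesis using Suc.prems(1) by (auto simp: normal_def faces_def)
  next
    case False
    then obtain w where w: "w \<in> c" by blast
    have wX: "w \<in> \<Union>X" using w Suc.prems(5) by blast
    have "c - {w} \<in> faces (lk X {w})"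
    proof (rule Suc.IH)
      show "normal n (lk X {w})" using normal_lk_vertex[OF X(1) wX n4(3)] by simp
      show "tight n (lk X {w})" using tight_lk_vertex[OF X n4(2) wX] by simp
      show "finite (c - {w})" using Suc.prems(3) by simp
      show "card (c - {w}) < n" using Suc.prems(3,4) w card_remove_Suc[of c w] by simp
      show "c - {w} \<subseteq> \<Union>(lk X {w})"
      proof
        fix u assume "u \<in> c - {w}"
        then show "u \<in> \<Union>(lk X {w})" using cl[of u w] w by (simp add: Union_lk del: Union_iff)
      qed
    next
      fix a b assume ab: "a \<in> c - {w}" "b \<in> c - {w}" "a \<noteq> b"
      have "{a, b, w} \<in> faces X"
        by (rule tight_no_missing_triangle[OF X n4(1)]) (use ab w in \<open>auto intro!: cl\<close>)
      then show "{a, b} \<in> edges (lk X {w})" using ab by (simp add: edges_lk)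
    qed
    then show ?thesis using w by (simp add: faces_lk insert_absorb)
  qed
qed

text \<open>Each ridge of a facet \<open>K\<close> lies in a second facet, and with so few vertices
  its new vertex is the only one outside \<open>K\<close>; this produces all
  \<open>m\<close>-subsets.\<close>

lemma circuit_few_vertices:
  assumes L: "circuit m L" and m: "1 \<le> m" and N: "\<Union>L \<subseteq> N" "finite N" "card N \<le> Suc m"
  shows "card N = Suc m \<and> L = {K. K \<subseteq> N \<and> card K = m}"
proof -
  have P: "pure m L" by (rule circuitD(1)[OF L])
  obtain K where K: "K \<in> L" using circuitD(3)[OF L] by blast
  note KK = pureD(1,2)[OF P K]
  have other: "\<exists>G\<in>L. K - {a} \<subseteq> G \<and> G \<noteq> K" if a: "a \<in> K" for a
  proof (rule ccontr)
    assume "\<not> ?thesis"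
    then have "{G \<in> L. K - {a} \<subseteq> G} = {K}" using K by blast
    moreover have "even (cnt L (K - {a}))"
      using cycD(2)[OF circuitD(2)[OF L]] KK card_remove_Suc[OF KK(1) a] by simp
    ultimately show False by (simp add: cnt_def)
  qed
  have KN: "K \<subseteq> N" using K N(1) by blast
  have notsub: "\<not> G \<subseteq> K" if "G \<in> L" "G \<noteq> K" for G
    using that KK pureD(2)[OF P that(1)] card_subset_eq by metis
  have "K \<noteq> {}" using KK m by auto
  then obtain a where "a \<in> K" by blast
  then obtain G where "G \<in> L" "K - {a} \<subseteq> G" "G \<noteq> K" using other by blast
  then obtain b where b: "b \<in> N" "b \<notin> K" using notsub N(1) by blast
  have N': "N = insert b K"
  proof (rule sym, rule card_seteq[OF N(2)])
    show "insert b K \<subseteq> N" using b KN by blast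
    show "card N \<le> card (insert b K)" using KK b N(3) by simp
  qed
  have "G \<in> L" if G: "G \<subseteq> N" "card G = m" for G
  proof (cases "G = K")
    case False
    then have "\<not> K \<subseteq> G" using G KK card_subset_eq[of G K] finite_subset[OF G(1) N(2)] by metis
    then obtain a where a: "a \<in> K" "a \<notin> G" by blast
    have cN: "card (N - {a}) = m" using N' KK b a card_remove_Suc[OF N(2), of a] by simp
    have sub: "H = N - {a}" if "H \<subseteq> N - {a}" "card H = m" for H
      using card_subset_eq[of "N - {a}" H] that cN N(2) by simp
    have "G = N - {a}" using sub G a by blast
    moreover obtain H where H: "H \<in> L" "K - {a} \<subseteq> H" "H \<noteq> K" using other[OF a(1)] by blast
    moreover have "a \<notin> H"
    proof
      assume "a \<in> H"
      then have "K \<subseteq> H" using H(2) by blast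
      then show False using H KK pureD(1,2)[OF P H(1)] card_subset_eq[of H K] by simp
    qed
    then have "H = N - {a}" using sub[of H] H(1) N(1) pureD(2)[OF P H(1)] by blast
    ultimately show ?thesis by simp
  qed (use K in simp)
  moreover have "G \<subseteq> N \<and> card G = m" if "G \<in> L" for G using that N(1) pureD(2)[OF P that] by blast
  ultimately have "L = {K. K \<subseteq> N \<and> card K = m}" by blast
  then show ?thesis using N' KK b by simp
qed

section \<open>Missing facets\<close>

definition missing :: "nat \<Rightarrow> 'a set set \<Rightarrow> 'a set \<Rightarrow> bool" where
  "missing n X T \<longleftrightarrow> finite T \<and> card T = n \<and> T \<notin> X \<and> (\<forall>v\<in>T. T - {v} \<in> faces X)"

lemma missing_edge:
  assumes T: "missing n X T" and n: "3 \<le> n" and uw: "u \<in> T" "w \<in> T" "u \<noteq> w"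
  shows "{u, w} \<in> edges X"
proof -
  have "card {u, w} < card T" using T n uw by (simp add: missing_def)
  then have "\<not> T \<subseteq> {u, w}" using card_mono[of "{u, w}" T] by auto
  then obtain v where v: "v \<in> T" "v \<noteq> u" "v \<noteq> w" by blast
  then have "T - {v} \<in> faces X" using T by (simp add: missing_def)
  then have "{u, w} \<in> faces X" by (rule faces_subset) (use uw v in blast)
  then show ?thesis using uw by (simp add: edges_pair)
qed

lemma missing_face:
  assumes T: "missing n X T" and G: "G \<subseteq> T" "card G < n"
  shows "G \<in> faces X"
proof -
  have "G \<noteq> T" using T G by (auto simp: missing_def)
  then obtain v where "v \<in> T" "v \<notin> G" using G by blast
  then have "T - {v} \<in> faces X" "G \<subseteq> T - {v}" using T G by (auto simp: missing_def)
  then show ?thesis by (rule faces_subset)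
qed

text \<open>Contracting \<open>x y\<close> loses at most one vertex, but it loses the edge
  \<open>x y\<close> and one further edge per common neighbour. As the contraction is again a
  circuit, \<open>solid_card_le\<close> bounds its edges from below, and tightness of
  \<open>X\<close> leaves room for fewer than \<open>n\<close> common neighbours.\<close>

lemma contraction_common_neighbours:
  assumes X: "circuit n X" "tight n X" and n: "3 \<le> n" and F: "F \<in> X" "x \<in> F" "y \<in> F" and xy: "x \<noteq> y"
    and C: "min_gcyc n x y C" "fill n x y C = X"
  shows "card {w. {x, w} \<in> edges X \<and> {y, w} \<in> edges X} < n"
proof -
  let ?N = "{w. {x, w} \<in> edges X \<and> {y, w} \<in> edges X}"
  have P: "pure n X" by (rule circuitD(1)[OF X(1)])
  have finX: "finite (\<Union>X)" by (rule pure_finite_Union[OF P])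
  have g: "gcyc n x y C" "C \<noteq> {}" using C(1) by (auto simp: min_gcyc_def)
  have NX: "?N \<subseteq> \<Union>X" using edges_subset_Pow[of X] by blast
  have finN: "finite ?N" by (rule finite_subset[OF NX finX])
  have CX: "C \<subseteq> X" using C(2) by (auto simp: fill_def)
  have base: "fill_base n x y C \<noteq> {}" by (rule fill_base_nonempty[OF X(1) F xy g(1) CX g(2)])
  show ?thesis
  proof (cases "\<exists>Q. x \<notin> Q \<and> y \<notin> Q \<and> insert x Q \<in> C \<and> insert y Q \<in> C")
    case True
    then obtain Q where Q: "x \<notin> Q" "y \<notin> Q" "insert x Q \<in> C" "insert y Q \<in> C" by blast
    have CQ: "C = {insert x Q, insert y Q}" by (rule pair_min_gcyc[OF C(1) Q xy])
    have QQ: "finite Q" "Suc (card Q) = n"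
      using pureD(1,2)[OF P, of "insert x Q"] Q CX by auto
    have "contract x y ` C = {insert x Q}" using Q xy unfolding CQ contract_def by auto
    then have "\<Union>X \<subseteq> insert y (insert x Q)"
      using Union_fill_contract[OF g(1) xy base] C(2) by simp
    moreover have "x \<notin> ?N" "y \<notin> ?N" by (simp_all add: edges_pair)
    ultimately have "?N \<subseteq> Q" using NX by blast
    then have "card ?N \<le> card Q" by (rule card_mono[OF QQ(1)])
    then show ?thesis using QQ(2) by simp
  next
    case False
    let ?U = "contract x y ` C"
    have U: "circuit n ?U" by (rule circuit_contract[OF C(1) False xy])
    have off: "\<forall>F\<in>C. \<not> (x \<in> F \<and> y \<in> F)" using g(1) by (simp add: gcyc_def)
    have yU: "y \<notin> \<Union>?U" using xy by (auto simp: contract_def split: if_splits)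
    have finU: "finite (\<Union>?U)" by (rule pure_finite_Union[OF circuitD(1)[OF U]])
    have "card (\<Union>X) \<le> card (insert y (\<Union>?U))"
      using Union_fill_contract[OF g(1) xy base] C(2) finU by (intro card_mono) auto
    then have VU: "card (\<Union>X) \<le> card (\<Union>?U) + 1" using finU yU by simp
    \<comment> \<open>Edges that may be dropped before contracting: \<open>x y\<close> collapses,
      and for a common neighbour \<open>w\<close> the edge \<open>y w\<close> has the same image as
      \<open>x w\<close>.\<close>
    define D where "D = insert {x, y} ((\<lambda>w. {y, w}) ` ?N)"
    have eXY: "{x, y} \<in> edges X" by (rule edges_facet[OF F(1,2,3) xy])
    have DX: "D \<subseteq> edges X" using eXY by (auto simp: D_def)
    have finE: "finite (edges X)" using graph_edges[OF P] by (simp add: graph_def)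
    have cD: "card D = Suc (card ?N)"
    proof -
      have "inj_on (\<lambda>w. {y, w}) ?N" by (auto simp: inj_on_def doubleton_eq_iff)
      moreover have "{x, y} \<notin> (\<lambda>w. {y, w}) ` ?N"
      proof
        assume "{x, y} \<in> (\<lambda>w. {y, w}) ` ?N"
        then obtain w where "{x, y} = {y, w}" "w \<in> ?N" by blast
        then have "x \<in> ?N" using xy by (auto simp: doubleton_eq_iff)
        then show False by (simp add: edges_pair)
      qed
      ultimately show ?thesis using finN by (simp add: D_def card_image)
    qed
    have "edges ?U \<subseteq> contract x y ` (edges X - D)"
    proof
      fix e assume e: "e \<in> edges ?U"
      then obtain a b where ab: "e = {a, b}" "a \<noteq> b" by (auto elim: edgesE)
      have eU: "e \<subseteq> \<Union>?U" using e edges_subset_Pow[of ?U] by blast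
      have ny: "y \<notin> e" using eU yU by blast
      have CE: "edges C \<subseteq> edges X" by (rule edges_mono[OF CX])
      show "e \<in> contract x y ` (edges X - D)"
      proof (cases "x \<in> e")
        case False
        then have "e \<in> edges X" using contract_edge_lift[of a b x y C, OF _ off] e ab CE by auto
        moreover have "e \<notin> D" using ny by (auto simp: D_def)
        moreover have "contract x y e = e" using ny by (simp add: contract_def)
        ultimately show ?thesis by (metis DiffI imageI)
      next
        case True
        then obtain w where w: "e = {x, w}" "w \<noteq> x" using ab by auto
        have wy: "w \<noteq> y" using ny w by blast
        have "{x, w} \<in> edges C \<or> {y, w} \<in> edges C"
          using contract_edge_lift[of x w x y C, OF _ off] e w by auto
        then have alt: "{x, w} \<in> edges X \<or> {y, w} \<in> edges X" using CE by blast
        show ?thesis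
        proof (cases "{x, w} \<in> edges X")
          case True
          moreover have "{x, w} \<notin> D" using ny w by (auto simp: D_def)
          moreover have "contract x y {x, w} = e" using ny w by (simp add: contract_def)
          ultimately show ?thesis by (metis DiffI imageI)
        next
          case False
          then have yw: "{y, w} \<in> edges X" using alt by blast
          have "{y, w} \<notin> D"
          proof
            assume "{y, w} \<in> D"
            then have "{y, w} = {x, y} \<or> (\<exists>v\<in>?N. {y, w} = {y, v})" unfolding D_def by blast
            then have "w = x \<or> w \<in> ?N" by (auto simp: doubleton_eq_iff)
            then show False using w(2) False by simp
          qed
          moreover have "contract x y {y, w} = e" using w wy by (auto simp: contract_def)
          ultimately show ?thesis using yw by (metis DiffI imageI)
        qed
      qed
    qed
    then have "card (edges ?U) \<le> card (contract x y ` (edges X - D))"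
      using finE by (intro card_mono) auto
    also have "\<dots> \<le> card (edges X - D)" using finE by (intro card_image_le) auto
    also have "\<dots> = card (edges X) - Suc (card ?N)"
      using finite_subset[OF DX finE] DX cD by (simp add: card_Diff_subset)
    finally have EU: "card (edges ?U) \<le> card (edges X) - Suc (card ?N)" .
    have DE: "Suc (card ?N) \<le> card (edges X)" using card_mono[OF finE DX] cD by simp
    obtain p :: "'a \<Rightarrow> nat \<Rightarrow> real" where p: "generic n (\<Union>?U) p"
      using generic_exists[OF infinite_UNIV_char_0 finU] by blast
    have UU: "\<Union>(edges ?U) = \<Union>?U" by (rule Union_edges[OF circuitD(1)[OF U]]) (use n in simp)
    obtain G where G: "G \<in> ?U" using circuitD(3)[OF U] by blast
    have "n * card (\<Union>(edges ?U)) \<le> card (edges ?U) + (Suc n choose 2)"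
    proof (rule solid_card_le)
      show "solid n (edges ?U) p (\<Union>(edges ?U))"
        using circuit_solid[OF infinite_UNIV_char_0 n U order_refl finU p] by (simp only: UU)
      show "graph (edges ?U)" by (rule graph_edges[OF circuitD(1)[OF U]])
      show "G \<subseteq> \<Union>(edges ?U)" using G unfolding UU by blast
      show "card G = n" by (rule pureD(2)[OF circuitD(1)[OF U] G])
      then show "spans n G p" using generic_spans[OF p] G by blast
    qed
    then have "n * card (\<Union>?U) + Suc (card ?N) \<le> card (edges X) + (Suc n choose 2)"
      using EU DE by (simp only: UU)
    moreover have "card (edges X) + (Suc n choose 2) \<le> n * card (\<Union>X)" using X(2) by (simp add: tight_def)
    moreover have "n * card (\<Union>X) \<le> n * card (\<Union>?U) + n" using mult_le_mono2[OF VU, of n] by simp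
    ultimately show ?thesis by linarith
  qed
qed

text \<open>By \<open>edges_fill\<close> and \<open>tight_clique_face\<close>, an added facet
  outside \<open>X\<close> would be a missing facet through \<open>x\<close> and \<open>y\<close>.
  So a filled minimal piece is a subcycle, hence all of \<open>X\<close>; then
  \<open>contraction_common_neighbours\<close> leaves the link of the edge too few vertices to be
  anything but the boundary of a simplex.\<close>

lemma edge_link_simplex:
  assumes X: "normal n X" "tight n X" and n: "4 \<le> n" and F: "F \<in> X" "x \<in> F" "y \<in> F" and xy: "x \<noteq> y"
    and no: "\<And>T. missing n X T \<Longrightarrow> x \<in> T \<Longrightarrow> y \<in> T \<Longrightarrow> False"
  shows "\<exists>N. finite N \<and> Suc (card N) = n \<and> lk X {x, y} = {K. K \<subseteq> N \<and> card K = n - 2}"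
proof -
  have n3: "0 < n" "3 \<le> n" "2 < n" using n by auto
  have c: "circuit n X" by (rule normal_circuit[OF X(1) n3(1)])
  have cyc: "cyc n X" and P: "pure n X" using circuitD[OF c] by auto
  define S0 where "S0 = {G \<in> X. \<not> (x \<in> G \<and> y \<in> G)}"
  have S0: "gcyc n x y S0" "fill n x y S0 = X" "S0 \<subseteq> X"
    unfolding S0_def using gcyc_off_edge[OF cyc xy] fill_off_edge[OF cyc xy] by auto
  have "S0 \<noteq> {}"
  proof
    assume "S0 = {}"
    then have "fill n x y S0 = {}" by (auto simp: fill_def fill_base_def cnt_def)
    then show False using S0(2) F(1) by simp
  qed
  then have "fill_base n x y S0 \<noteq> {}" by (rule fill_base_nonempty[OF c F xy S0(1,3)])
  then obtain K0 where "odd (cnt S0 (insert x K0))" by (auto simp: fill_base_def)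
  then obtain C where C: "C \<subseteq> S0" "min_gcyc n x y C" using min_gcyc_exists[OF S0(1)] by blast
  have g: "gcyc n x y C" "C \<noteq> {}" using C(2) by (auto simp: min_gcyc_def)
  have CX: "C \<subseteq> X" using C(1) S0(3) by blast
  have sub: "edges (fill n x y C) \<subseteq> edges X" by (rule edges_fill[OF g(1) CX F xy])
  have "insert x (insert y K) \<in> X" if K: "K \<in> fill_base n x y C" for K
  proof (rule ccontr)
    let ?T = "insert x (insert y K)"
    assume nX: "?T \<notin> X"
    have TC: "?T \<in> fill n x y C" using K by (auto simp: fill_def)
    have T: "finite ?T" "card ?T = n" using pureD(1,2)[OF fill_pure[OF g(1) xy] TC] by auto
    have e: "{u, w} \<in> edges X" if "u \<in> ?T" "w \<in> ?T" "u \<noteq> w" for u w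
      using edges_facet[OF TC that] sub by blast
    have "?T - {v} \<in> faces X" if v: "v \<in> ?T" for v
    proof (rule tight_clique_face[OF n X])
      show "finite (?T - {v})" using T(1) by simp
      show "card (?T - {v}) < n" using card_remove_Suc[OF T(1) v] T(2) by simp
      show "?T - {v} \<subseteq> \<Union>X"
      proof
        fix u assume u: "u \<in> ?T - {v}"
        then have "{u, v} \<in> edges X" using e[of u v] v by blast
        then show "u \<in> \<Union>X" using edges_subset_Pow[of X] by blast
      qed
    qed (use e in blast)
    then have "missing n X ?T" using T nX by (simp add: missing_def)
    then show False using no by blast
  qed
  then have "fill n x y C \<subseteq> X" using CX by (auto simp: fill_def)
  moreover have "fill n x y C \<noteq> {}" using g(2) by (auto simp: fill_def)
  ultimately have fX: "fill n x y C = X" using circuitD(4)[OF c _ fill_cyc[OF g(1) xy]] by blast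
  let ?N = "{w. {x, w} \<in> edges X \<and> {y, w} \<in> edges X}"
  have finN: "finite ?N"
    by (rule finite_subset[OF _ pure_finite_Union[OF P]]) (use edges_subset_Pow[of X] in blast)
  have xyf: "{x, y} \<in> faces X" using F by (auto simp: faces_def)
  have L: "circuit (n - 2) (lk X {x, y})" using normal_lk_circuit[OF X(1) xyf] xy n3(3) by (simp add: numeral_2_eq_2)
  have "\<Union>(lk X {x, y}) \<subseteq> ?N"
  proof
    fix w assume "w \<in> \<Union>(lk X {x, y})"
    then obtain G where "G \<in> X" "{x, y} \<subseteq> G" "w \<in> G - {x, y}" by (auto simp: lk_def)
    then show "w \<in> ?N" using edges_facet[of G X x w] edges_facet[of G X y w] by blast
  qed
  moreover have "card ?N \<le> Suc (n - 2)"
    using contraction_common_neighbours[OF c X(2) n3(2) F xy C(2) fX] by simp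
  ultimately have "card ?N = Suc (n - 2) \<and> lk X {x, y} = {K. K \<subseteq> ?N \<and> card K = n - 2}"
    by (intro circuit_few_vertices[OF L _ _ finN]) (use n in auto)
  then show ?thesis using finN n by (intro exI[of _ ?N]) auto
qed

text \<open>The boundary of \<open>A\<close> modulo 2 is that of the simplex \<open>T\<close>: if
  \<open>X\<close> is a cycle, \<open>T\<close> separates it into \<open>A\<close> and
  \<open>X - A\<close>, and each part becomes a cycle when \<open>T\<close> is added.\<close>

definition splits :: "nat \<Rightarrow> 'a set set \<Rightarrow> 'a set \<Rightarrow> 'a set set \<Rightarrow> bool" where
  "splits n X T A \<longleftrightarrow> A \<subseteq> X \<and> (\<forall>R. finite R \<longrightarrow> Suc (card R) = n \<longrightarrow> odd (cnt A R) = (R \<subseteq> T))"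

text \<open>The rank is the distance from \<open>v0\<close>, and the edges to the parents form a
  spanning tree along which ranks decrease.\<close>

lemma spanning_ranks:
  assumes X: "conn X" and v0: "v0 \<in> \<Union>X"
  shows "\<exists>par (\<rho> :: 'a \<Rightarrow> nat). \<forall>v\<in>\<Union>X - {v0}. {v, par v} \<in> edges X \<and> \<rho> (par v) < \<rho> v"
proof -
  let ?r = "{(a, b). {a, b} \<in> edges X}"
  define \<rho> where "\<rho> v = (LEAST k. (v0, v) \<in> ?r ^^ k)" for v
  have "\<exists>u. {v, u} \<in> edges X \<and> \<rho> u < \<rho> v" if v: "v \<in> \<Union>X - {v0}" for v
  proof -
    have "(v0, v) \<in> ?r\<^sup>*" using X v v0 unfolding conn_def by blast
    then obtain k where "(v0, v) \<in> ?r ^^ k" using rtrancl_imp_relpow by blast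
    then have k: "(v0, v) \<in> ?r ^^ \<rho> v" unfolding \<rho>_def by (rule LeastI)
    have "\<rho> v \<noteq> 0"
    proof
      assume "\<rho> v = 0"
      then have "v0 = v" using k by simp
      then show False using v by simp
    qed
    then obtain j where j: "\<rho> v = Suc j" by (cases "\<rho> v") auto
    then obtain u where u: "(v0, u) \<in> ?r ^^ j" "(u, v) \<in> ?r" using k by auto
    have "\<rho> u \<le> j" unfolding \<rho>_def using u(1) by (rule Least_le)
    then show ?thesis using u(2) j by (auto simp: insert_commute)
  qed
  then have "\<forall>v\<in>\<Union>X - {v0}. \<exists>u. {v, u} \<in> edges X \<and> \<rho> u < \<rho> v" by blast
  from bchoice[OF this] show ?thesis by blast
qed

lemma if_add: "(if b then x + y else 0) = (if b then x else 0) + (if b then y else (0 :: 'b :: monoid_add))"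
  by simp

lemma if_mult: "(if b then c * x else 0) = c * (if b then x else (0 :: 'b :: mult_zero))"
  by simp

lemma of_nat_bit: "of_nat k = (if even k then 0 else 1 :: bit)"
  by (induction k) auto

text \<open>
  Counting dimensions over the field with two elements: if \<open>T\<close> did not bound, the facets together
  with \<open>T\<close> would span too large a space of 1-cycles.
\<close>

lemma surface_splits:
  assumes X: "normal 3 X" "tight 3 X" and T: "missing 3 X T"
  shows "\<exists>A. splits 3 X T A"
proof (rule ccontr)
  assume no: "\<nexists>A. splits 3 X T A"
  have P: "pure 3 X" by (rule normal_pure[OF X(1)])
  have finX: "finite X" by (rule pureD(3)[OF P])
  have c: "circuit 3 X" by (rule normal_circuit[OF X(1)]) simp
  let ?E = "edges X"
  have gE: "graph ?E" by (rule graph_edges[OF P])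
  have finE: "finite ?E" using gE by (simp add: graph_def)
  have finV: "finite (\<Union>X)" by (rule pure_finite_Union[OF P])
  have TX: "T \<notin> X" and finT: "finite T" "card T = 3" using T by (auto simp: missing_def)
  have sub2: "card {e \<in> ?E. e \<subseteq> F} = 3" if "F \<in> insert T X" for F
  proof -
    have "finite F" "card F = 3" using that finT pureD(1,2)[OF P] by auto
    moreover have "{e \<in> ?E. e \<subseteq> F} = {e. e \<subseteq> F \<and> card e = 2}"
    proof -
      have "e \<in> ?E" if e: "e \<subseteq> F" "card e = 2" for e
      proof (cases "F = T")
        case True
        obtain u w where "e = {u, w}" "u \<noteq> w" using e(2) by (auto simp: card_2_iff)
        then show ?thesis using missing_edge[OF T] e(1) True by simp
      next
        case False
        then show ?thesis using e \<open>F \<in> insert T X\<close> by (auto simp: edges_def faces_def)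
      qed
      then show ?thesis by (auto simp: edges_def)
    qed
    ultimately show ?thesis using n_subsets[of F 2] by (simp add: numeral_3_eq_3 numeral_2_eq_2)
  qed
  have f2: "3 * card X = 2 * card ?E"
  proof -
    have "(\<Sum>e\<in>?E. \<Sum>F\<in>X. if e \<subseteq> F then 1 else 0 :: nat) = (\<Sum>F\<in>X. \<Sum>e\<in>?E. if e \<subseteq> F then 1 else 0)"
      by (rule sum.swap)
    then have "(\<Sum>e\<in>?E. cnt X e) = (\<Sum>F\<in>X. card {e \<in> ?E. e \<subseteq> F})"
      using finX finE by (simp add: cnt_def sum.If_cases Int_def)
    moreover have "cnt X e = 2" if "e \<in> ?E" for e
      by (rule normal_ridge[OF X(1)]) (use that in \<open>auto simp: edges_def\<close>)
    ultimately show ?thesis using sub2 by simp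
  qed
  obtain F0 where F0: "F0 \<in> X" using circuitD(3)[OF c] by blast
  obtain v0 where v0: "v0 \<in> \<Union>X" 
  proof -
    have "F0 \<noteq> {}" using pureD(2)[OF P F0] by auto
    then show ?thesis using F0 that by blast
  qed
  have "conn X" by (rule circuit_conn[OF c]) simp
  then obtain par and \<rho> :: "'a \<Rightarrow> nat" where par: "\<And>v. v \<in> \<Union>X - {v0} \<Longrightarrow> {v, par v} \<in> ?E"
    "\<And>v. v \<in> \<Union>X - {v0} \<Longrightarrow> \<rho> (par v) < \<rho> v"
    using spanning_ranks[OF _ v0] by blast
  define tree where "tree = (\<lambda>v. {v, par v}) ` (\<Union>X - {v0})"
  have inj: "inj_on (\<lambda>v. {v, par v}) (\<Union>X - {v0})"
  proof (rule inj_onI, rule ccontr)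
    fix v w assume v: "v \<in> \<Union>X - {v0}" and w: "w \<in> \<Union>X - {v0}" and e: "{v, par v} = {w, par w}" and "v \<noteq> w"
    then have "v = par w" "w = par v" by (auto simp: doubleton_eq_iff)
    then show False using par(2)[OF v] par(2)[OF w] by simp
  qed
  have ctree: "card tree = card (\<Union>X) - 1"
    unfolding tree_def using v0 finV by (simp add: card_image[OF inj])
  have treeE: "tree \<subseteq> ?E" using par(1) by (auto simp: tree_def)
  define bd where "bd x e = (\<Sum>F\<in>insert T X. if e \<subseteq> F then x F else 0)" for x :: "'a set \<Rightarrow> bit" and e
  have bd_add: "bd (\<lambda>i. x i + y i) e = bd x e + bd y e" for x y e
    unfolding bd_def sum.distrib[symmetric] by (rule sum.cong[OF refl]) (rule if_add)
  have bd_scale: "bd (\<lambda>i. c * x i) e = c * bd x e" for c x e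
    unfolding bd_def sum_distrib_left by (rule sum.cong[OF refl]) (rule if_mult)
  have cycle: "(\<Sum>e\<in>{e \<in> ?E. v \<in> e}. bd x e) = 0" for x v
  proof -
    have "(\<Sum>e\<in>{e \<in> ?E. v \<in> e}. bd x e) = (\<Sum>F\<in>insert T X. \<Sum>e\<in>{e \<in> ?E. v \<in> e}. if e \<subseteq> F then x F else 0)"
      unfolding bd_def by (rule sum.swap)
    also have "\<dots> = (\<Sum>F\<in>insert T X. of_nat (card {e \<in> ?E. v \<in> e \<and> e \<subseteq> F}) * x F)"
      using finE by (intro sum.cong refl) (simp add: sum.If_cases Int_def conj_assoc)
    also have "\<dots> = 0"
    proof (rule sum.neutral, rule ballI)
      fix F assume F: "F \<in> insert T X"
      have FF: "finite F" "card F = 3" using F finT pureD(1,2)[OF P] by auto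
      have "even (card {e \<in> ?E. v \<in> e \<and> e \<subseteq> F})"
      proof (cases "v \<in> F")
        case False
        then have "{e \<in> ?E. v \<in> e \<and> e \<subseteq> F} = {}" by blast
        then show ?thesis by (simp only: card.empty even_zero)
      next
        case True
        have "{e \<in> ?E. v \<in> e \<and> e \<subseteq> F} = (\<lambda>u. {v, u}) ` (F - {v})"
        proof (intro set_eqI iffI)
          fix e assume e: "e \<in> {e \<in> ?E. v \<in> e \<and> e \<subseteq> F}"
          then obtain a b where "e = {a, b}" "a \<noteq> b" by (auto elim: edgesE)
          then show "e \<in> (\<lambda>u. {v, u}) ` (F - {v})" using e by auto
        next
          fix e assume "e \<in> (\<lambda>u. {v, u}) ` (F - {v})"
          then obtain u where u: "e = {v, u}" "u \<in> F" "u \<noteq> v" by blast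
          have "e \<in> ?E"
          proof (cases "F = T")
            case True
            then show ?thesis using missing_edge[OF T] u \<open>v \<in> F\<close> by simp
          next
            case False
            then show ?thesis using edges_facet[of F X v u] F u \<open>v \<in> F\<close> by simp
          qed
          then show "e \<in> {e \<in> ?E. v \<in> e \<and> e \<subseteq> F}" using u True by simp
        qed
        moreover have "inj_on (\<lambda>u. {v, u}) (F - {v})" by (auto simp: inj_on_def doubleton_eq_iff)
        ultimately show ?thesis using FF True by (simp add: card_image)
      qed
      then have "of_nat (card {e \<in> ?E. v \<in> e \<and> e \<subseteq> F}) = (0 :: bit)" by (simp add: of_nat_bit)
      then show "of_nat (card {e \<in> ?E. v \<in> e \<and> e \<subseteq> F}) * x F = 0" by simp
    qed
    finally show ?thesis .
  qed
  \<comment> \<open>A 1-cycle supported on the tree is zero: take a vertex \<open>v\<close> of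
    maximal rank whose edge to its parent has nonzero coefficient. All other edges at
    \<open>v\<close> have coefficient 0, while the coefficients at \<open>v\<close> add up to
    0.\<close>
  have tree0: "bd x e = 0" if off: "\<And>e. e \<in> ?E - tree \<Longrightarrow> bd x e = 0" and e: "e \<in> ?E" for x e
  proof (rule ccontr)
    assume "bd x e \<noteq> 0"
    moreover from this have "e \<in> tree" using off[of e] e by blast
    then obtain v where "e = {v, par v}" "v \<in> \<Union>X - {v0}" unfolding tree_def by blast
    ultimately have ne: "{v \<in> \<Union>X - {v0}. bd x {v, par v} \<noteq> 0} \<noteq> {}" (is "?B \<noteq> {}")
      by blast
    have "finite ?B" by (rule finite_subset[OF _ finV]) blast
    then have fin: "finite (\<rho> ` ?B)" by (rule finite_imageI)
    then have "Max (\<rho> ` ?B) \<in> \<rho> ` ?B" using ne by (intro Max_in) auto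
    then obtain v where v': "Max (\<rho> ` ?B) = \<rho> v" "v \<in> ?B" by (rule imageE)
    note v = v'(2) v'(1)[symmetric]
    have vmax: "\<rho> w \<le> \<rho> v" if "w \<in> ?B" for w
      unfolding v(2) by (rule Max_ge[OF fin imageI[OF that]])
    have "bd x g = 0" if g: "g \<in> {e \<in> ?E. v \<in> e} - {{v, par v}}" for g
    proof (rule ccontr)
      assume nz: "bd x g \<noteq> 0"
      then have "g \<in> tree" using off g by blast
      then obtain w where w: "w \<in> \<Union>X - {v0}" "g = {w, par w}" by (auto simp: tree_def)
      then have "w \<in> ?B" using nz by simp
      then have "\<rho> w \<le> \<rho> v" by (rule vmax)
      moreover have "v = w \<or> v = par w" using g w by blast
      ultimately show False using g w par(2)[OF w(1)] by auto
    qed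
    then have "(\<Sum>g\<in>{e \<in> ?E. v \<in> e}. bd x g) = bd x {v, par v}"
      using finE par(1)[of v] v(1) by (subst sum.remove[of _ "{v, par v}"]) auto
    then show False using cycle v(1) by simp
  qed
  \<comment> \<open>The unknowns are the facets and \<open>T\<close>. The equations are the edges
    off the tree and \<open>x F0 = 0\<close>, which excludes the cycle \<open>X\<close>;
    \<open>F0\<close> has three elements, so as a label it cannot collide with an edge. With
    \<open>F\<close>, \<open>E\<close>, \<open>V\<close> for the numbers of facets, edges and
    vertices this gives \<open>F + 1 \<le> E - V + 2\<close>, against \<open>3 F = 2 E\<close> and
    \<open>E + 6 \<le> 3 V\<close>.\<close>
  have "card (insert T X) \<le> card (insert F0 (?E - tree))"
  proof (rule inj_linear_card_le[where f = "\<lambda>x e. if e = F0 then x F0 else bd x e"])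
    fix x :: "'a set \<Rightarrow> bit" assume x: "\<And>j. j \<in> insert F0 (?E - tree) \<Longrightarrow> (if j = F0 then x F0 else bd x j) = 0"
    have F0E: "F0 \<notin> ?E" using pureD(2)[OF P F0] by (auto simp: edges_def)
    have bd0: "bd x e = 0" if "e \<in> ?E" for e
    proof (rule tree0[OF _ that])
      fix e assume "e \<in> ?E - tree"
      then show "bd x e = 0" using x[of e] F0E by (auto split: if_splits)
    qed
    define A where "A = {F \<in> X. x F = 1}"
    have bd_eq: "bd x e = of_nat (cnt A e) + (if e \<subseteq> T then x T else 0)" for e
    proof -
      have "(\<Sum>F\<in>X. if e \<subseteq> F then x F else 0) = (\<Sum>F\<in>X. if F \<in> A \<and> e \<subseteq> F then 1 else 0)"
        by (rule sum.cong) (auto simp: A_def)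
      also have "\<dots> = of_nat (cnt A e)"
      proof -
        have "X \<inter> {F. F \<in> A \<and> e \<subseteq> F} = {F \<in> A. e \<subseteq> F}" by (auto simp: A_def)
        then show ?thesis using finX by (simp add: sum.If_cases cnt_def)
      qed
      finally have s: "(\<Sum>F\<in>X. if e \<subseteq> F then x F else 0) = of_nat (cnt A e)" .
      show ?thesis unfolding bd_def sum.insert[OF finX TX] s by (rule add.commute)
    qed
    have AX: "A \<subseteq> X" by (auto simp: A_def)
    have par0: "odd (cnt A e) \<longleftrightarrow> x T = 1 \<and> e \<subseteq> T" if e: "finite e" "Suc (card e) = 3" for e
    proof (cases "e \<in> ?E")
      case True
      show ?thesis using bd0[OF True] bd_eq[of e] by (auto simp: of_nat_bit split: if_splits)
    next
      case False
      have c2: "card e = 2" using e by simp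
      then have "e \<notin> faces A" using False faces_mono[OF AX] by (auto simp: edges_def)
      then have "even (cnt A e)" using odd_cnt_face by blast
      moreover have "\<not> e \<subseteq> T"
      proof
        assume "e \<subseteq> T"
        moreover obtain u w where "e = {u, w}" "u \<noteq> w" using c2 by (auto simp: card_2_iff)
        ultimately show False using False missing_edge[OF T, of u w] by simp
      qed
      ultimately show ?thesis by simp
    qed
    have xT: "x T = 0"
    proof (rule ccontr)
      assume "x T \<noteq> 0"
      then have "splits 3 X T A" using par0 AX by (simp add: splits_def)
      then show False using no by blast
    qed
    then have "cyc 3 A" unfolding cyc_def using pure_subset[OF P AX] par0 by simp
    then have "A = {} \<or> A = X" using circuitD(4)[OF c AX] by blast
    moreover have "x F0 = 0" using x[of F0] by simp
    then have "F0 \<notin> A" by (simp add: A_def)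
    ultimately have "A = {}" using F0 by blast
    then have "x F = 0" if "F \<in> X" for F using that unfolding A_def by auto
    then show "\<forall>F\<in>insert T X. x F = 0" using xT by simp
  next
    fix x y :: "'a set \<Rightarrow> bit" and j
    show "(if j = F0 then x F0 + y F0 else bd (\<lambda>i. x i + y i) j) = (if j = F0 then x F0 else bd x j) + (if j = F0 then y F0 else bd y j)"
      by (simp only: bd_add split: if_split) blast
  next
    fix c and x :: "'a set \<Rightarrow> bit" and j
    show "(if j = F0 then c * x F0 else bd (\<lambda>i. c * x i) j) = c * (if j = F0 then x F0 else bd x j)"
      by (simp only: bd_scale split: if_split) blast
  qed (use finX finE in simp_all)
  also have "\<dots> \<le> Suc (card (?E - tree))" using finE by (intro card_insert_le_m1) auto
  also have "card (?E - tree) = card ?E - (card (\<Union>X) - 1)"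
    using finE treeE ctree by (simp add: card_Diff_subset finite_subset)
  finally have "card X \<le> card ?E - (card (\<Union>X) - 1)" using TX finX by simp
  moreover have "card (\<Union>X) - 1 \<le> card ?E" using card_mono[OF finE treeE] ctree by simp
  moreover have "Suc 3 choose 2 = 6" by (simp add: numeral_3_eq_3 numeral_2_eq_2)
  then have "card ?E + 6 \<le> 3 * card (\<Union>X)" using X(2) by (simp add: tight_def)
  ultimately show False using f2 by linarith
qed

section \<open>The two sides of a missing facet, from local to global\<close>

lemma even_card_symdiff:
  assumes "finite A" "finite B"
  shows "even (card ((A - B) \<union> (B - A))) = (even (card A) = even (card B))"
proof -
  have "card A = card (A - B) + card (A \<inter> B)" "card B = card (B - A) + card (A \<inter> B)"
    using card_Diff_subset_Int[of A B] card_Diff_subset_Int[of B A] assms card_mono[of A "A \<inter> B"] card_mono[of B "A \<inter> B"]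
    by (auto simp: Int_commute)
  moreover have "card ((A - B) \<union> (B - A)) = card (A - B) + card (B - A)"
    using assms by (intro card_Un_disjoint) auto
  ultimately show ?thesis by auto
qed

lemma missing_lk:
  assumes T: "missing (Suc n) X T" and w: "w \<in> T"
  shows "missing n (lk X {w}) (T - {w})"
  unfolding missing_def
proof (intro conjI ballI)
  have fin: "finite T" "card T = Suc n" "T \<notin> X" using T by (auto simp: missing_def)
  show "finite (T - {w})" using fin by simp
  show "card (T - {w}) = n" using fin w by simp
  show "T - {w} \<notin> lk X {w}" using fin(3) w by (simp add: in_lk_iff insert_absorb)
  fix v assume v: "v \<in> T - {w}"
  then have "T - {v} \<in> faces X" using T by (simp add: missing_def)
  moreover have "T - {w} - {v} \<union> {w} = T - {v}" using v w by blast
  ultimately show "T - {w} - {v} \<in> faces (lk X {w})" by (simp only: faces_lk) blast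
qed

text \<open>Such a \<open>D\<close> induces a subcycle of the link of \<open>G\<close>, which is a
  circuit. This propagates a choice from one facet at \<open>G\<close> to all of them.\<close>

lemma link_alternative:
  assumes X: "normal n X" and G: "G \<in> faces X" "card G < n" and D: "D \<subseteq> {F \<in> X. G \<subseteq> F}"
    and ev: "\<And>R. finite R \<Longrightarrow> Suc (card R) = n \<Longrightarrow> G \<subseteq> R \<Longrightarrow> even (cnt D R)"
  shows "D = {} \<or> D = {F \<in> X. G \<subseteq> F}"
proof (cases "D = {}")
  case False
  have P: "pure n X" by (rule normal_pure[OF X])
  have finG: "finite G" by (rule faces_finite[OF P G(1)])
  have PD: "pure n D" by (rule pure_subset[OF P]) (use D in blast)
  have "cyc (n - card G) (lk D G)" by (rule cyc_lkI[OF PD finG G(2) ev])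
  moreover have "lk D G \<subseteq> lk X G" using D by (auto simp: lk_def)
  moreover have "lk D G \<noteq> {}" using False D by (auto simp: lk_def)
  ultimately have eq: "lk D G = lk X G" using circuitD(4)[OF normal_lk_circuit[OF X G]] by blast
  have "F \<in> D" if F: "F \<in> X" "G \<subseteq> F" for F
  proof -
    have "F - G \<in> lk D G" unfolding eq using F by (auto simp: lk_def)
    moreover have "F - G \<union> G = F" using F(2) by blast
    ultimately show ?thesis by (metis Diff_disjoint in_lk_iff)
  qed
  then show ?thesis using D by blast
qed simp

text \<open>The condition of \<open>splits\<close> at ridges meeting \<open>T\<close> only: a
  consistent side of \<open>T\<close> in its neighbourhood. Cutting along \<open>T\<close> needs no
  more than this; its extension over \<open>X\<close> is the business of
  \<open>sides_splits\<close>.\<close>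

definition sides :: "nat \<Rightarrow> 'a set set \<Rightarrow> 'a set \<Rightarrow> 'a set set \<Rightarrow> bool" where
  "sides n X T P \<longleftrightarrow> P \<subseteq> X \<and>
     (\<forall>R. finite R \<longrightarrow> Suc (card R) = n \<longrightarrow> R \<inter> T \<noteq> {} \<longrightarrow> odd (cnt P R) = (R \<subseteq> T))"

definition sides_at :: "nat \<Rightarrow> 'a set set \<Rightarrow> 'a set \<Rightarrow> 'a \<Rightarrow> 'a set set \<Rightarrow> bool" where
  "sides_at n X T w Q \<longleftrightarrow> Q \<subseteq> star X w \<and>
     (\<forall>R. finite R \<longrightarrow> Suc (card R) = n \<longrightarrow> w \<in> R \<longrightarrow> odd (cnt Q R) = (R \<subseteq> T))"

lemma splits_lk_sides_at:
  assumes X: "pure (Suc n) X" and w: "w \<in> T" and A: "splits n (lk X {w}) (T - {w}) A"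
  shows "sides_at (Suc n) X T w {F \<in> X. w \<in> F \<and> F - {w} \<in> A}" (is "sides_at _ _ _ _ ?Q")
  unfolding sides_at_def
proof (intro conjI allI impI)
  show "?Q \<subseteq> star X w" by (auto simp: star_def)
  have AL: "A \<subseteq> lk X {w}" using A by (simp add: splits_def)
  have lkQ: "lk ?Q {w} = A"
  proof
    show "lk ?Q {w} \<subseteq> A" by (auto simp: lk_def)
    show "A \<subseteq> lk ?Q {w}"
    proof
      fix K assume K: "K \<in> A"
      then obtain F where "F \<in> X" "w \<in> F" "K = F - {w}" using AL by (auto simp: lk_def)
      then show "K \<in> lk ?Q {w}" using K by (auto simp: lk_def)
    qed
  qed
  fix R assume R: "finite R" "Suc (card R) = Suc n" "w \<in> R"
  have RR: "finite (R - {w})" "Suc (card (R - {w})) = n" using R card_remove_Suc[of R w] by auto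
  have "R - {w} \<union> {w} = R" using R(3) by blast
  then have "cnt ?Q R = cnt A (R - {w})" using cnt_lk[of "R - {w}" "{w}" ?Q] lkQ by simp
  moreover have "odd (cnt A (R - {w})) = (R - {w} \<subseteq> T - {w})" using A RR by (simp add: splits_def)
  moreover have "R - {w} \<subseteq> T - {w} \<longleftrightarrow> R \<subseteq> T" using w by blast
  ultimately show "odd (cnt ?Q R) = (R \<subseteq> T)" by simp
qed

text \<open>At ridges through \<open>w\<close> and \<open>w'\<close> both families have the same
  parity, so their symmetric difference has no boundary there and \<open>link_alternative\<close>
  applies.\<close>

lemma sides_at_agree:
  assumes X: "normal n X" and w: "w \<in> T" "w' \<in> T" "{w, w'} \<in> faces X" and n: "3 \<le> n"
    and Q: "sides_at n X T w Q" "sides_at n X T w' Q'"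
  shows "(\<forall>F\<in>X. w \<in> F \<longrightarrow> w' \<in> F \<longrightarrow> (F \<in> Q) = (F \<in> Q')) \<or>
    (\<forall>F\<in>X. w \<in> F \<longrightarrow> w' \<in> F \<longrightarrow> (F \<in> Q) \<noteq> (F \<in> Q'))"
proof -
  let ?G = "{w, w'}"
  define D where "D = {F \<in> X. ?G \<subseteq> F \<and> (F \<in> Q) \<noteq> (F \<in> Q')}"
  have QX: "Q \<subseteq> X" "Q' \<subseteq> X" using Q by (auto simp: sides_at_def star_def)
  have finX: "finite X" by (rule pureD(3)[OF normal_pure[OF X]])
  have "D = {} \<or> D = {F \<in> X. ?G \<subseteq> F}"
  proof (rule link_alternative[OF X w(3)])
    show "card ?G < n" using n by (cases "w = w'") auto
    show "D \<subseteq> {F \<in> X. ?G \<subseteq> F}" by (auto simp: D_def)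
    fix R assume R: "finite R" "Suc (card R) = n" "?G \<subseteq> R"
    have "{F \<in> D. R \<subseteq> F} = ({F \<in> Q. R \<subseteq> F} - {F \<in> Q'. R \<subseteq> F}) \<union> ({F \<in> Q'. R \<subseteq> F} - {F \<in> Q. R \<subseteq> F})"
      using R(3) QX by (auto simp: D_def)
    then have "even (cnt D R) = (even (cnt Q R) = even (cnt Q' R))"
      unfolding cnt_def using finite_subset[OF QX(1) finX] finite_subset[OF QX(2) finX]
      by (simp add: even_card_symdiff)
    moreover have "odd (cnt Q R) = (R \<subseteq> T)" "odd (cnt Q' R) = (R \<subseteq> T)"
      using Q R unfolding sides_at_def by auto
    ultimately show "even (cnt D R)" by (metis (full_types))
  qed
  then show ?thesis
  proof
    assume "D = {}"
    then have "\<forall>F\<in>X. w \<in> F \<longrightarrow> w' \<in> F \<longrightarrow> (F \<in> Q) = (F \<in> Q')" unfolding D_def by blast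
    then show ?thesis ..
  next
    assume D: "D = {F \<in> X. ?G \<subseteq> F}"
    have "(F \<in> Q) \<noteq> (F \<in> Q')" if "F \<in> X" "w \<in> F" "w' \<in> F" for F
    proof -
      have "F \<in> D" unfolding D using that by simp
      then show ?thesis by (simp add: D_def)
    qed
    then show ?thesis by blast
  qed
qed

lemma sides_at_flip:
  assumes X: "cyc n X" and Q: "sides_at n X T w Q"
  shows "sides_at n X T w (star X w - Q)"
  unfolding sides_at_def
proof (intro conjI allI impI)
  fix R assume R: "finite R" "Suc (card R) = n" "w \<in> R"
  have "finite (star X w)" using pureD(3)[OF cycD(1)[OF X]] star_subset by (rule finite_subset[rotated])
  moreover have "Q \<subseteq> star X w" using Q by (simp add: sides_at_def)
  ultimately have "cnt (star X w) R = cnt Q R + cnt (star X w - Q) R" by (rule cnt_split)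
  moreover have "{F \<in> star X w. R \<subseteq> F} = {F \<in> X. R \<subseteq> F}" using R(3) by (auto simp: star_def)
  then have "even (cnt (star X w) R)" using cycD(2)[OF X R(1,2)] by (simp add: cnt_def)
  moreover have "odd (cnt Q R) = (R \<subseteq> T)" using Q R by (simp add: sides_at_def)
  ultimately show "odd (cnt (star X w - Q) R) = (R \<subseteq> T)" by (metis even_add)
qed blast

text \<open>The local sides are flipped so as to agree with the one at \<open>w0\<close>. For two
  further vertices of \<open>T\<close> the set \<open>{w0, w, w'}\<close> lies in a facet, because
  it has fewer than \<open>n\<close> elements, and that facet rules out complementarity along
  \<open>w w'\<close>.\<close>

lemma sides_exist:
  assumes X: "normal n X" and n: "4 \<le> n" and T: "missing n X T"
    and loc: "\<And>w. w \<in> T \<Longrightarrow> \<exists>Q. sides_at n X T w Q"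
  shows "\<exists>P. sides n X T P"
proof -
  have n0: "0 < n" "3 \<le> n" using n by auto
  have c: "cyc n X" by (rule circuitD(2)[OF normal_circuit[OF X n0(1)]])
  have Tc: "finite T" "card T = n" using T by (auto simp: missing_def)
  then obtain w0 where w0: "w0 \<in> T" using n0 by fastforce
  obtain Q0 where Q0: "sides_at n X T w0 Q0" using loc[OF w0] by blast
  have face: "G \<in> faces X" if "G \<subseteq> T" "card G < n" for G by (rule missing_face[OF T that])
  have "\<exists>Q. sides_at n X T w Q \<and> (\<forall>F\<in>X. w0 \<in> F \<longrightarrow> w \<in> F \<longrightarrow> (F \<in> Q0) = (F \<in> Q))" if w: "w \<in> T" for w
  proof -
    obtain Q where Q: "sides_at n X T w Q" using loc[OF w] by blast
    have "{w0, w} \<in> faces X" by (rule face) (use w w0 n in \<open>auto simp: card_insert_if\<close>)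
    from sides_at_agree[OF X w0 w this n0(2) Q0 Q] show ?thesis
    proof
      assume "\<forall>F\<in>X. w0 \<in> F \<longrightarrow> w \<in> F \<longrightarrow> (F \<in> Q0) \<noteq> (F \<in> Q)"
      then have "\<forall>F\<in>X. w0 \<in> F \<longrightarrow> w \<in> F \<longrightarrow> (F \<in> Q0) = (F \<in> star X w - Q)" by (auto simp: star_def)
      then show ?thesis using sides_at_flip[OF c Q] by blast
    qed (use Q in blast)
  qed
  then have "\<forall>w\<in>T. \<exists>Q. sides_at n X T w Q \<and> (\<forall>F\<in>X. w0 \<in> F \<longrightarrow> w \<in> F \<longrightarrow> (F \<in> Q0) = (F \<in> Q))" by blast
  from bchoice[OF this] obtain Q where Q: "\<And>w. w \<in> T \<Longrightarrow> sides_at n X T w (Q w)"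
    "\<And>w F. w \<in> T \<Longrightarrow> F \<in> X \<Longrightarrow> w0 \<in> F \<Longrightarrow> w \<in> F \<Longrightarrow> (F \<in> Q0) = (F \<in> Q w)" by blast
  have agree: "(F \<in> Q w) = (F \<in> Q w')" if w: "w \<in> T" "w' \<in> T" and F: "F \<in> X" "w \<in> F" "w' \<in> F" for w w' F
  proof -
    have "card {w0, w, w'} \<le> 3" by (simp add: card_insert_if)
    then have "{w0, w, w'} \<in> faces X" by (intro face) (use w w0 n in auto)
    then obtain F1 where F1: "F1 \<in> X" "w0 \<in> F1" "w \<in> F1" "w' \<in> F1" by (auto simp: faces_def)
    have "(F1 \<in> Q w) = (F1 \<in> Q w')" using Q(2)[OF w(1) F1(1,2,3)] Q(2)[OF w(2) F1(1,2,4)] by simp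
    moreover have "{w, w'} \<in> faces X" using F by (auto simp: faces_def)
    ultimately show ?thesis
      using sides_at_agree[OF X w _ n0(2) Q(1)[OF w(1)] Q(1)[OF w(2)]] F F1 by blast
  qed
  define P where "P = {F \<in> X. \<exists>w\<in>T. w \<in> F \<and> F \<in> Q w}"
  have "sides n X T P"
    unfolding sides_def
  proof (intro conjI allI impI)
    fix R assume R: "finite R" "Suc (card R) = n" "R \<inter> T \<noteq> {}"
    then obtain w where w: "w \<in> R" "w \<in> T" by blast
    have "(F \<in> P) = (F \<in> Q w)" if "R \<subseteq> F" for F
    proof -
      have "Q w \<subseteq> X" using Q(1)[OF w(2)] by (auto simp: sides_at_def star_def)
      moreover have "w \<in> F" using that w by blast
      ultimately show ?thesis using agree[OF _ w(2)] w(2) unfolding P_def by blast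
    qed
    then have "{F \<in> P. R \<subseteq> F} = {F \<in> Q w. R \<subseteq> F}" by blast
    then have "cnt P R = cnt (Q w) R" by (simp only: cnt_def)
    then show "odd (cnt P R) = (R \<subseteq> T)" using Q(1)[OF w(2)] R w(1) by (simp add: sides_at_def)
  qed (auto simp: P_def)
  then show ?thesis by blast
qed

text \<open>A ridge through \<open>u\<close> and \<open>v\<close> meets \<open>T\<close> without
  being contained in it, so \<open>P\<close> has no boundary around this edge and
  \<open>link_alternative\<close> applies.\<close>

lemma sides_edge:
  assumes X: "normal n X" and n: "3 \<le> n" and P: "sides n X T P" and uv: "u \<in> T" "v \<notin> T"
    and F: "F \<in> X" "u \<in> F" "v \<in> F" and F': "F' \<in> X" "u \<in> F'" "v \<in> F'"
  shows "(F \<in> P) = (F' \<in> P)"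
proof -
  let ?D = "{F \<in> P. {u, v} \<subseteq> F}"
  have PX: "P \<subseteq> X" using P by (simp add: sides_def)
  have "?D = {} \<or> ?D = {F \<in> X. {u, v} \<subseteq> F}"
  proof (rule link_alternative[OF X])
    show "{u, v} \<in> faces X" using F by (auto simp: faces_def)
    show "card {u, v} < n" using n by (auto simp: card_insert_if)
    show "?D \<subseteq> {F \<in> X. {u, v} \<subseteq> F}" using PX by blast
    fix R assume R: "finite R" "Suc (card R) = n" "{u, v} \<subseteq> R"
    have "{F \<in> ?D. R \<subseteq> F} = {F \<in> P. R \<subseteq> F}" using R(3) by blast
    then have "cnt ?D R = cnt P R" by (simp only: cnt_def)
    moreover have "R \<inter> T \<noteq> {}" "\<not> R \<subseteq> T" using R(3) uv by blast+
    then have "even (cnt P R)" using P R(1,2) unfolding sides_def by blast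
    ultimately show "even (cnt ?D R)" by (simp only:)
  qed
  then show ?thesis using F F' by blast
qed

text \<open>By \<open>cocycle_count\<close>, a cocycle that is not a coboundary would force
  \<open>Suc n choose 2\<close> more edges than tightness admits.\<close>

lemma tight_coboundary:
  fixes z :: "'a \<Rightarrow> 'a \<Rightarrow> real"
  assumes X: "normal n X" "tight n X" and n: "4 \<le> n" and z: "cocycle X z"
  shows "\<exists>\<eta>. \<forall>u w. {u, w} \<in> edges X \<longrightarrow> z u w = \<eta> u - \<eta> w"
proof (rule ccontr)
  assume no: "\<not> ?thesis"
  have n': "0 < n" "2 \<le> n" "3 \<le> n - 1" "Suc (n - 1) = n" "1 < n" "0 < n - 1" using n by auto
  have c: "circuit n X" by (rule normal_circuit[OF X(1) n'(1)])
  have P: "pure n X" by (rule normal_pure[OF X(1)])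
  obtain p :: "'a \<Rightarrow> nat \<Rightarrow> real" where p: "generic n (\<Union>X) p"
    using generic_exists[OF infinite_UNIV_char_0 pure_finite_Union[OF P]] by blast
  have "indep_cocycles X 1 (\<lambda>j. z)"
    unfolding indep_cocycles_def
  proof (intro conjI allI impI z)
    fix a :: "nat \<Rightarrow> real" and \<eta> and j :: nat assume e: "\<forall>u w. {u, w} \<in> edges X \<longrightarrow> (\<Sum>j<1. a j * z u w) = \<eta> u - \<eta> w" and j: "j < 1"
    show "a j = 0"
    proof (rule ccontr)
      assume "a j \<noteq> 0"
      then have "\<forall>u w. {u, w} \<in> edges X \<longrightarrow> z u w = \<eta> u / a 0 - \<eta> w / a 0"
        using e j by (auto simp: field_simps)
      then have "\<exists>\<eta>. \<forall>u w. {u, w} \<in> edges X \<longrightarrow> z u w = \<eta> u - \<eta> w"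
        by (rule exI[of _ "\<lambda>u. \<eta> u / a 0"])
      then show False using no by simp
    qed
  qed
  moreover have "spans n F p" if "F \<in> X" for F
    using generic_spans[OF p _ pureD(2)[OF P that]] that by blast
  moreover have "solid n (edges (star X v)) p (\<Union>(star X v))" if "v \<in> \<Union>X" for v
    using star_solid[OF infinite_UNIV_char_0 n'(3), of X v "\<Union>X" p] P p
      normal_circuit[OF normal_lk_vertex[OF X(1) that n'(5)] n'(6)] n'(4) by simp
  ultimately have "1 * (Suc n choose 2) + n * card (\<Union>X) \<le> card (edges X) + (Suc n choose 2)"
    by (intro cocycle_count(1)[OF P n'(2) circuit_conn[OF c n'(2)] circuitD(3)[OF c]])
  moreover have "0 < Suc n choose 2" using n by simp
  ultimately show False using X(2) unfolding tight_def by linarith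
qed

lemma sides_splits:
  assumes X: "normal n X" "tight n X" and n: "4 \<le> n" and T: "missing n X T" and P: "sides n X T P"
  shows "\<exists>A. splits n X T A"
proof -
  have n3: "3 \<le> n" "0 < n" using n by auto
  have PX: "P \<subseteq> X" using P by (simp add: sides_def)
  define plus where "plus u v \<longleftrightarrow> (\<exists>F\<in>P. u \<in> F \<and> v \<in> F)" for u v
  have plus: "plus u v \<longleftrightarrow> F \<in> P" if "u \<in> T" "v \<notin> T" "F \<in> X" "u \<in> F" "v \<in> F" for u v F
    using sides_edge[OF X(1) n3(1) P that(1,2) _ _ _ that(3-5)] that PX unfolding plus_def by blast
  \<comment> \<open>Counts crossings of \<open>T\<close> on the side \<open>P\<close>. On a facet in
    \<open>P\<close> it is the coboundary of the indicator function of \<open>T\<close>, on any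
    other facet it is 0; this gives the cocycle condition.\<close>
  define z :: "'a \<Rightarrow> 'a \<Rightarrow> real" where "z u v =
    (if u \<in> T \<and> v \<notin> T \<and> plus u v then 1 else if v \<in> T \<and> u \<notin> T \<and> plus v u then -1 else 0)" for u v
  have zF: "z u v = (if F \<in> P then of_bool (u \<in> T) - of_bool (v \<in> T) else 0)" if "F \<in> X" "u \<in> F" "v \<in> F" for u v F
    using plus[of u v F] plus[of v u F] that by (auto simp: z_def)
  have "cocycle X z"
    unfolding cocycle_def
  proof (intro allI impI)
    fix a b c assume "{a, b, c} \<in> faces X"
    then obtain F where "F \<in> X" "a \<in> F" "b \<in> F" "c \<in> F" by (auto simp: faces_def)
    then show "z a b + z b c = z a c" by (simp add: zF)
  qed
  then obtain \<eta> where \<eta>: "\<And>u w. {u, w} \<in> edges X \<Longrightarrow> z u w = \<eta> u - \<eta> w"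
    using tight_coboundary[OF X n] by blast
  have Tc: "finite T" "card T = n" "T \<notin> X" using T by (auto simp: missing_def)
  then obtain t0 where t0: "t0 \<in> T" using n3 by fastforce
  have \<eta>T: "\<eta> u = \<eta> t0" if "u \<in> T" for u
  proof (cases "u = t0")
    case False
    have "z u t0 = 0" using that t0 by (simp add: z_def)
    then show ?thesis using \<eta>[OF missing_edge[OF T n3(1) that t0 False]] by simp
  qed simp
  have \<eta>F: "\<eta> u - \<eta> v = (if F \<in> P then of_bool (u \<in> T) - of_bool (v \<in> T) else 0)" if "F \<in> X" "u \<in> F" "v \<in> F" for u v F
    using \<eta>[of u v] zF[OF that] edges_facet[OF that] by (cases "u = v") auto
  \<comment> \<open>The potential \<open>\<eta>\<close> is constant on \<open>T\<close> and smaller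
    by one next to \<open>T\<close> on the side \<open>P\<close>. It is constant on the vertices of
    a facet outside \<open>T\<close>, so this level selects facets consistently far away from
    \<open>T\<close> as well.\<close>
  define A where "A = {F \<in> X. \<forall>v\<in>F - T. \<eta> v = \<eta> t0 - 1}"
  have AF: "F \<in> A \<longleftrightarrow> \<eta> v = \<eta> t0 - 1" if F: "F \<in> X" "v \<in> F" "v \<notin> T" for F v
  proof -
    have "\<eta> u = \<eta> v" if "u \<in> F - T" for u using \<eta>F[OF F(1), of u v] that F by (auto split: if_splits)
    then have "(\<forall>u\<in>F - T. \<eta> u = \<eta> t0 - 1) \<longleftrightarrow> \<eta> v = \<eta> t0 - 1" using F(2,3) by (metis DiffI)
    then show ?thesis using F(1) by (simp add: A_def)
  qed
  have AP: "F \<in> A \<longleftrightarrow> F \<in> P" if F: "F \<in> X" "u \<in> F" "u \<in> T" for F u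
  proof -
    have "F \<noteq> T" using F(1) Tc(3) by blast
    then have "\<not> F \<subseteq> T" using card_subset_eq[OF Tc(1), of F] Tc(2) pureD(2)[OF normal_pure[OF X(1)] F(1)] by auto
    then obtain v where v: "v \<in> F" "v \<notin> T" by blast
    have "\<eta> t0 - \<eta> v = (if F \<in> P then 1 else 0)" using \<eta>F[OF F(1,2) v(1)] \<eta>T[OF F(3)] F(3) v(2) by simp
    then show ?thesis using AF[OF F(1) v] by (auto split: if_splits)
  qed
  have "splits n X T A"
    unfolding splits_def
  proof (intro conjI allI impI)
    fix R :: "'a set" assume R: "finite R" "Suc (card R) = n"
    show "odd (cnt A R) = (R \<subseteq> T)"
    proof (cases "R \<subseteq> T")
      case True
      have "R \<noteq> {}" using R n by auto
      then obtain u where u: "u \<in> R" "u \<in> T" using True by blast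
      have "{F \<in> A. R \<subseteq> F} = {F \<in> P. R \<subseteq> F}"
        using AP u PX unfolding A_def by blast
      then have "cnt A R = cnt P R" by (simp only: cnt_def)
      moreover have "odd (cnt P R) = (R \<subseteq> T)" using P R u unfolding sides_def by blast
      ultimately show ?thesis by simp
    next
      case False
      then obtain v where v: "v \<in> R" "v \<notin> T" by blast
      have "{F \<in> A. R \<subseteq> F} = (if \<eta> v = \<eta> t0 - 1 then {F \<in> X. R \<subseteq> F} else {})"
        using AF v unfolding A_def by auto
      moreover have "even (cnt X R)"
        by (rule cycD(2)[OF circuitD(2)[OF normal_circuit[OF X(1) n3(2)]] R])
      ultimately have "even (cnt A R)" unfolding cnt_def by (simp split: if_splits)
      then show ?thesis using False by simp
    qed
  qed (auto simp: A_def)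
  then show ?thesis by blast
qed

text \<open>Induction through vertex links: splittings of the links of the vertices of
  \<open>T\<close> give local sides, these fit together around \<open>T\<close>, and the vanishing
  of cocycles extends the choice over \<open>X\<close>.\<close>

theorem missing_splits:
  assumes "3 \<le> n" "normal n X" "tight n X" "missing n X T"
  shows "\<exists>A. splits n X T A"
  using assms
proof (induction n arbitrary: X T rule: nat_induct_at_least[of 3])
  case base
  then show ?case by (intro surface_splits)
next
  case (Suc n)
  note X = Suc.prems(1,2) and T = Suc.prems(3)
  have n: "4 \<le> Suc n" "3 \<le> Suc n" "1 < Suc n" using Suc.hyps by auto
  have "\<exists>Q. sides_at (Suc n) X T w Q" if w: "w \<in> T" for w
  proof -
    have "{w} \<in> faces X" by (rule missing_face[OF T]) (use w n in auto)
    then have wX: "w \<in> \<Union>X" by (auto simp: faces_def)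
    have "normal n (lk X {w})" using normal_lk_vertex[OF X(1) wX n(3)] by simp
    moreover have "tight n (lk X {w})" using tight_lk_vertex[OF X n(2) wX] by simp
    ultimately obtain A where "splits n (lk X {w}) (T - {w}) A"
      using Suc.IH missing_lk[OF T w] by blast
    then show ?thesis using splits_lk_sides_at[OF normal_pure[OF X(1)] w] by blast
  qed
  then obtain P where "sides (Suc n) X T P" using sides_exist[OF X(1) n(1) T] by blast
  then show ?case by (rule sides_splits[OF X n(1) T])
qed

text \<open>For \<open>G\<close> inside \<open>T\<close>, no nonempty subcycle lies in
  \<open>lk A G\<close>: it would be all of \<open>lk X G\<close>, but a ridge of \<open>T\<close>
  through \<open>G\<close> has one of its two facets outside \<open>A\<close>. Of a proper nonempty
  subcycle of the new link and its complement, one avoids \<open>T - G\<close> and is excluded in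
  this way.\<close>

lemma splits_normal:
  assumes X: "normal n X" and n: "2 \<le> n" and T: "missing n X T" and A: "splits n X T A"
  shows "normal n (insert T A)"
  unfolding normal_def
proof (intro conjI ballI impI)
  let ?Y = "insert T A"
  have AX: "A \<subseteq> X" and Aodd: "\<And>R. finite R \<Longrightarrow> Suc (card R) = n \<Longrightarrow> odd (cnt A R) = (R \<subseteq> T)"
    using A by (auto simp: splits_def)
  have Tc: "finite T" "card T = n" "T \<notin> X" using T by (auto simp: missing_def)
  have P: "pure n X" by (rule normal_pure[OF X])
  have finA: "finite A" using AX pureD(3)[OF P] by (rule finite_subset)
  show PY: "pure n ?Y" using pure_subset[OF P AX] Tc by (auto simp: pure_def)
  show "?Y \<noteq> {}" by simp
  have ev: "even (cnt ?Y R)" if R: "finite R" "Suc (card R) = n" for R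
  proof -
    have "{F \<in> ?Y. R \<subseteq> F} = (if R \<subseteq> T then insert T {F \<in> A. R \<subseteq> F} else {F \<in> A. R \<subseteq> F})" by auto
    moreover have "T \<notin> {F \<in> A. R \<subseteq> F}" using AX Tc(3) by blast
    ultimately show ?thesis using Aodd[OF R] finA unfolding cnt_def by (auto split: if_splits)
  qed
  fix G assume G: "G \<in> faces ?Y" "card G < n"
  have finG: "finite G" by (rule faces_finite[OF PY G(1)])
  have cG: "cyc (n - card G) (lk ?Y G)" by (rule cyc_lkI[OF PY finG G(2) ev])
  have neG: "lk ?Y G \<noteq> {}"
  proof -
    obtain F where "F \<in> ?Y" "G \<subseteq> F" using G(1) by (auto simp: faces_def)
    then show ?thesis unfolding lk_def by blast
  qed
  show "circuit (n - card G) (lk ?Y G)"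
  proof (cases "G \<subseteq> T")
    case False
    then have "lk ?Y G = lk A G" by (auto simp: lk_def)
    moreover have "lk A G \<subseteq> lk X G" using AX by (auto simp: lk_def)
    moreover have GX: "G \<in> faces X" using G(1) False AX by (auto simp: faces_def)
    ultimately have "lk ?Y G = lk X G"
      using circuitD(4)[OF normal_lk_circuit[OF X GX G(2)], of "lk ?Y G"] cG neG by simp
    then show ?thesis using normal_lk_circuit[OF X GX G(2)] by simp
  next
    case True
    have GX: "G \<in> faces X" by (rule missing_face[OF T True G(2)])
    have cX: "circuit (n - card G) (lk X G)" by (rule normal_lk_circuit[OF X GX G(2)])
    have key: False if Z: "cyc (n - card G) Z" "Z \<noteq> {}" "Z \<subseteq> lk A G" for Z
    proof -
      have "lk A G \<subseteq> lk X G" using AX by (auto simp: lk_def)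
      then have "Z = lk X G" using circuitD(4)[OF cX _ Z(1,2)] Z(3) by blast
      then have sub: "lk X G \<subseteq> lk A G" using Z(3) by simp
      have "G \<noteq> T" using G(2) Tc by blast
      then obtain v where v: "v \<in> T" "v \<notin> G" using True by blast
      have R: "finite (T - {v})" "Suc (card (T - {v})) = n" using Tc card_remove_Suc[OF Tc(1) v(1)] by auto
      have "T - {v} \<in> faces X" using T v by (simp add: missing_def)
      then have "cnt X (T - {v}) = 2" by (rule normal_ridge[OF X _ R(2)])
      moreover have "odd (cnt A (T - {v}))" using Aodd[OF R] by blast
      moreover have "cnt X (T - {v}) = cnt A (T - {v}) + cnt (X - A) (T - {v})"
        by (rule cnt_split[OF pureD(3)[OF P] AX])
      ultimately have "odd (cnt (X - A) (T - {v}))" by (metis even_add even_numeral)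
      then have "T - {v} \<in> faces (X - A)" by (rule odd_cnt_face)
      then obtain F where F: "F \<in> X" "F \<notin> A" "T - {v} \<subseteq> F" by (auto simp: faces_def)
      then have GF: "G \<subseteq> F" using v(2) True by blast
      then have "F - G \<in> lk A G" using sub F(1) by (auto simp: lk_def)
      then have "F - G \<union> G \<in> A" by (subst in_lk_iff[symmetric]) auto
      moreover have "F - G \<union> G = F" using GF by blast
      ultimately show False using F(2) by simp
    qed
    have lkY: "lk ?Y G = insert (T - G) (lk A G)" using True by (auto simp: lk_def)
    have "Z = lk ?Y G" if Z: "Z \<subseteq> lk ?Y G" "cyc (n - card G) Z" "Z \<noteq> {}" for Z
    proof (rule ccontr)
      assume ne: "Z \<noteq> lk ?Y G"
      show False
      proof (cases "T - G \<in> Z")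
        case True
        have "cyc (n - card G) (lk ?Y G - Z)" by (rule cyc_Diff[OF cG Z(2,1)])
        moreover have "lk ?Y G - Z \<noteq> {}" using ne Z(1) by blast
        moreover have "lk ?Y G - Z \<subseteq> lk A G" unfolding lkY using True by blast
        ultimately show False by (rule key)
      next
        case False
        then have "Z \<subseteq> lk A G" using Z(1) unfolding lkY by blast
        then show False by (rule key[OF Z(2,3)])
      qed
    qed
    then show ?thesis using cG neG unfolding circuit_def by blast
  qed
qed

text \<open>The edges of \<open>T\<close> belong to \<open>X\<close> already, so capping with
  \<open>T\<close> stays inside the graph of \<open>X\<close>.\<close>

lemma splits_tight:
  assumes X: "normal n X" "tight n X" and n: "3 \<le> n" and T: "missing n X T" and A: "splits n X T A"
  shows "tight n (insert T A)"
proof (rule tight_subcomplex[OF _ X(2) n])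
  show "circuit n X" by (rule normal_circuit[OF X(1)]) (use n in simp)
  have "normal n (insert T A)" by (rule splits_normal[OF X(1) _ T A]) (use n in simp)
  then show "pure n (insert T A)" by (rule normal_pure)
  have AX: "A \<subseteq> X" using A by (simp add: splits_def)
  show "edges (insert T A) \<subseteq> edges X"
  proof
    fix e assume "e \<in> edges (insert T A)"
    then obtain u w where uw: "e = {u, w}" "u \<noteq> w" "{u, w} \<in> faces (insert T A)" by (rule edgesE)
    then have "{u, w} \<subseteq> T \<or> {u, w} \<in> faces A" by (auto simp: faces_def)
    then show "e \<in> edges X"
      using missing_edge[OF T n, of u w] uw faces_mono[OF AX] by (auto simp: edges_pair)
  qed
qed simp

section \<open>Invariance under injective relabelling of vertices\<close>

lemma relabel_subset_iff:
  assumes "inj_on g V" "R \<subseteq> V" "F \<subseteq> V"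
  shows "g ` R \<subseteq> g ` F \<longleftrightarrow> R \<subseteq> F"
proof
  assume sub: "g ` R \<subseteq> g ` F"
  show "R \<subseteq> F"
  proof
    fix a assume a: "a \<in> R"
    then obtain b where "b \<in> F" "g a = g b" using sub by blast
    moreover have "a \<in> V" "b \<in> V" using a \<open>b \<in> F\<close> assms(2,3) by blast+
    ultimately show "a \<in> F" using inj_onD[OF assms(1)] by blast
  qed
qed blast

lemma relabel_inj: "inj_on g (\<Union>S) \<Longrightarrow> inj_on (image g) S"
  by (rule inj_onI) (metis Union_upper inj_on_image_eq_iff)

lemma relabel_pure:
  assumes g: "inj_on g (\<Union>S)" and S: "pure n S"
  shows "pure n (image g ` S)"
proof -
  have "card (g ` F) = n" "finite (g ` F)" if F: "F \<in> S" for F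
  proof -
    have "inj_on g F" using g by (rule inj_on_subset) (use F in blast)
    then show "card (g ` F) = n" "finite (g ` F)" using pureD(1,2)[OF S F] by (simp_all add: card_image)
  qed
  then show ?thesis using pureD(3)[OF S] unfolding pure_def by blast
qed

lemma relabel_cnt:
  assumes g: "inj_on g (\<Union>S)" and R: "R \<subseteq> \<Union>S"
  shows "cnt (image g ` S) (g ` R) = cnt S R"
proof -
  have "g ` R \<subseteq> g ` F \<longleftrightarrow> R \<subseteq> F" if "F \<in> S" for F
    by (rule relabel_subset_iff[OF g R]) (use that in blast)
  then have "{F \<in> image g ` S. g ` R \<subseteq> F} = image g ` {F \<in> S. R \<subseteq> F}" by blast
  moreover have "inj_on (image g) {F \<in> S. R \<subseteq> F}"
    using relabel_inj[OF g] by (rule inj_on_subset) blast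
  ultimately show ?thesis by (simp add: cnt_def card_image)
qed

lemma relabel_cyc:
  fixes S :: "'a set set" and g :: "'a \<Rightarrow> 'b"
  assumes g: "inj_on g (\<Union>S)" and S: "cyc n S"
  shows "cyc n (image g ` S)"
  unfolding cyc_def
proof (intro conjI allI impI)
  show "pure n (image g ` S)" by (rule relabel_pure[OF g cycD(1)[OF S]])
  fix Q :: "'b set" assume Q: "finite Q" "Suc (card Q) = n"
  show "even (cnt (image g ` S) Q)"
  proof (cases "Q \<subseteq> g ` \<Union>S")
    case True
    then obtain R where R: "R \<subseteq> \<Union>S" "Q = g ` R" by (meson subset_imageE)
    have inj: "inj_on g R" using g R(1) by (rule inj_on_subset)
    then have "finite R" "Suc (card R) = n" using Q R(2) by (auto simp: finite_image_iff card_image)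
    then show ?thesis using relabel_cnt[OF g R(1)] cycD(2)[OF S] R(2) by simp
  next
    case False
    then have "{F \<in> image g ` S. Q \<subseteq> F} = {}" by blast
    then show ?thesis by (simp only: cnt_def card.empty even_zero)
  qed
qed

lemma relabel_inv:
  assumes g: "inj_on g (\<Union>S)" and A: "A \<subseteq> S"
  shows "image (inv_into (\<Union>S) g) ` image g ` A = A"
proof -
  have "inv_into (\<Union>S) g ` g ` F = F" if "F \<in> A" for F
    using inv_into_image_cancel[OF g] A that by blast
  then show ?thesis by (force simp: image_image)
qed

lemma relabel_cyc_iff:
  assumes g: "inj_on g (\<Union>S)" and A: "A \<subseteq> S"
  shows "cyc n (image g ` A) \<longleftrightarrow> cyc n A"
proof
  assume c: "cyc n (image g ` A)"
  have "inj_on (inv_into (\<Union>S) g) (\<Union>(image g ` A))"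
    by (rule inj_on_inv_into) (use A in blast)
  from relabel_cyc[OF this c] show "cyc n A" by (simp only: relabel_inv[OF g A])
next
  assume "cyc n A"
  moreover have "inj_on g (\<Union>A)" using g by (rule inj_on_subset) (use A in blast)
  ultimately show "cyc n (image g ` A)" by (rule relabel_cyc[rotated])
qed

lemma relabel_circuit:
  assumes g: "inj_on g (\<Union>S)" and S: "circuit n S"
  shows "circuit n (image g ` S)"
  unfolding circuit_def
proof (intro conjI allI impI)
  show "cyc n (image g ` S)" by (rule relabel_cyc[OF g circuitD(2)[OF S]])
  show "image g ` S \<noteq> {}" using circuitD(3)[OF S] by blast
  fix B assume B: "B \<subseteq> image g ` S" "cyc n B"
  then obtain A where A: "A \<subseteq> S" "B = image g ` A" by (meson subset_imageE)
  then have "cyc n A" using B(2) relabel_cyc_iff[OF g A(1)] by simp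
  then show "B = {} \<or> B = image g ` S" using circuitD(4)[OF S A(1)] A(2) by blast
qed

lemma relabel_lk:
  assumes g: "inj_on g (\<Union>S)" and G: "G \<subseteq> \<Union>S"
  shows "lk (image g ` S) (g ` G) = image g ` lk S G"
proof -
  have sub: "g ` G \<subseteq> g ` F \<longleftrightarrow> G \<subseteq> F" if "F \<in> S" for F
    by (rule relabel_subset_iff[OF g G]) (use that in blast)
  have diff: "g ` F - g ` G = g ` (F - G)" if "F \<in> S" for F
    using inj_on_image_set_diff[OF g, of F G] that G by (simp add: Union_upper le_supI1 subset_iff) blast
  show ?thesis
  proof (intro set_eqI iffI)
    fix K assume "K \<in> lk (image g ` S) (g ` G)"
    then obtain F where "F \<in> S" "g ` G \<subseteq> g ` F" "K = g ` F - g ` G" by (auto simp: lk_def)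
    then show "K \<in> image g ` lk S G" using sub diff by (auto simp: lk_def)
  next
    fix K assume "K \<in> image g ` lk S G"
    then obtain F where "F \<in> S" "G \<subseteq> F" "K = g ` (F - G)" by (auto simp: lk_def)
    then have "K = g ` F - g ` G" "g ` F \<in> image g ` S" "g ` G \<subseteq> g ` F" using diff by auto
    then show "K \<in> lk (image g ` S) (g ` G)" unfolding lk_def by blast
  qed
qed

lemma relabel_faces: "faces (image g ` S) = image g ` faces S"
proof (intro set_eqI iffI)
  fix G assume "G \<in> faces (image g ` S)"
  then obtain F where F: "F \<in> S" "G \<subseteq> g ` F" by (auto simp: faces_def)
  then obtain H where "H \<subseteq> F" "G = g ` H" by (meson subset_imageE)
  then show "G \<in> image g ` faces S" using F by (auto simp: faces_def)
next
  fix G assume "G \<in> image g ` faces S"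
  then show "G \<in> faces (image g ` S)" by (auto simp: faces_def)
qed

lemma relabel_normal:
  assumes g: "inj_on g (\<Union>S)" and S: "normal n S"
  shows "normal n (image g ` S)"
  unfolding normal_def
proof (intro conjI ballI impI)
  show "pure n (image g ` S)" by (rule relabel_pure[OF g normal_pure[OF S]])
  show "image g ` S \<noteq> {}" using S by (simp add: normal_def)
  fix G assume G: "G \<in> faces (image g ` S)" "card G < n"
  then obtain H where H: "H \<in> faces S" "G = g ` H" by (auto simp: relabel_faces)
  have HS: "H \<subseteq> \<Union>S" using H(1) by (auto simp: faces_def)
  have cH: "card G = card H" using H(2) card_image[OF inj_on_subset[OF g HS]] by simp
  have "\<Union>(lk S H) \<subseteq> \<Union>S" by (auto simp: lk_def)
  then have "inj_on g (\<Union>(lk S H))" using g by (rule inj_on_subset[rotated])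
  from relabel_circuit[OF this normal_lk_circuit[OF S H(1)]]
  show "circuit (n - card G) (lk (image g ` S) G)"
    using G(2) H(2) cH relabel_lk[OF g HS] by simp
qed

lemma relabel_edges:
  assumes g: "inj_on g (\<Union>S)"
  shows "edges (image g ` S) = image g ` edges S"
proof -
  have "card (g ` e) = card e" if "e \<in> faces S" for e
    by (rule card_image[OF inj_on_subset[OF g]]) (use that in \<open>auto simp: faces_def\<close>)
  then show ?thesis unfolding edges_def relabel_faces by force
qed

lemma relabel_tight:
  assumes g: "inj_on g (\<Union>S)" and S: "tight n S"
  shows "tight n (image g ` S)"
proof -
  have "inj_on g (\<Union>(edges S))" using g by (rule inj_on_subset) (use edges_subset_Pow[of S] in blast)
  then have "card (edges (image g ` S)) = card (edges S)"
    unfolding relabel_edges[OF g] by (intro card_image relabel_inj)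
  moreover have "\<Union>(image g ` S) = g ` \<Union>S" by blast
  then have "card (\<Union>(image g ` S)) = card (\<Union>S)" by (simp only: card_image[OF g])
  ultimately show ?thesis using S by (simp only: tight_def)
qed

text \<open>By connectedness a proper nonempty subcycle shares a vertex with its complement, and at
  that vertex it would induce a proper nonempty subcycle of the link.\<close>

lemma circuit_from_links:
  assumes L: "pure m L" "L \<noteq> {}" and m: "2 \<le> m" and conn: "conn L"
    and lks: "\<And>v. v \<in> \<Union>L \<Longrightarrow> circuit (m - 1) (lk L {v})"
  shows "circuit m L"
proof -
  have link_cnt: "cnt Z R = cnt (lk Z {v}) (R - {v})" if "v \<in> R" for Z :: "'a set set" and R v
    using cnt_lk[of "R - {v}" "{v}" Z] that by (simp add: insert_absorb)
  have "cyc m L"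
    unfolding cyc_def
  proof (intro conjI allI impI L(1))
    fix R :: "'a set" assume R: "finite R" "Suc (card R) = m"
    show "even (cnt L R)"
    proof (cases "R \<in> faces L")
      case True
      have "R \<noteq> {}" using R m by auto
      then obtain v where v: "v \<in> R" by blast
      have "v \<in> \<Union>L" using v True by (auto simp: faces_def)
      then have "even (cnt (lk L {v}) (R - {v}))"
        by (intro cycD(2)[OF circuitD(2)[OF lks]]) (use R v card_remove_Suc[of R v] in auto)
      then show ?thesis using link_cnt[OF v] by simp
    next
      case False
      then show ?thesis using odd_cnt_face by blast
    qed
  qed
  moreover have "Z = {} \<or> Z = L" if Z: "Z \<subseteq> L" "cyc m Z" for Z
  proof (rule ccontr)
    assume ne: "\<not> ?thesis"
    have "\<exists>v. v \<in> \<Union>Z \<and> v \<in> \<Union>(L - Z)"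
    proof (rule ccontr)
      assume no: "\<not> ?thesis"
      have nonempty: "F \<noteq> {}" if "F \<in> L" for F using pureD(2)[OF L(1) that] m by auto
      obtain F F' where F: "F \<in> Z" "F' \<in> L - Z" using ne Z(1) by blast
      have "F \<noteq> {}" "F' \<noteq> {}" using nonempty F Z(1) by auto
      then obtain u w where uw: "u \<in> F" "w \<in> F'" by blast
      have "(u \<in> \<Union>Z) = (w \<in> \<Union>Z)"
      proof (rule conn_const[OF conn, of "\<lambda>u. u \<in> \<Union>Z"])
        fix a b assume "{a, b} \<in> edges L"
        then obtain G where "G \<in> L" "a \<in> G" "b \<in> G" by (auto simp: edges_def faces_def)
        then show "(a \<in> \<Union>Z) = (b \<in> \<Union>Z)" using no by blast
      qed (use uw F Z(1) in blast)+
      then show False using no uw F by blast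
    qed
    then obtain v F F' where v: "F \<in> Z" "v \<in> F" "F' \<in> L" "F' \<notin> Z" "v \<in> F'" by blast
    have vL: "v \<in> \<Union>L" using v by blast
    have "cyc (m - card {v}) (lk Z {v})"
      by (rule cyc_lkI[OF cycD(1)[OF Z(2)]]) (use m cycD(2)[OF Z(2)] in auto)
    moreover have "lk Z {v} \<subseteq> lk L {v}" using Z(1) by (auto simp: lk_def)
    moreover have "lk Z {v} \<noteq> {}" using v(1,2) by (auto simp: lk_def)
    ultimately have eq: "lk Z {v} = lk L {v}" using circuitD(4)[OF lks[OF vL]] by simp
    have "F' - {v} \<in> lk L {v}" using v by (auto simp: lk_def)
    then have "F' - {v} \<in> lk Z {v}" by (simp add: eq)
    then have "F' - {v} \<union> {v} \<in> Z" by (subst (asm) in_lk_iff) auto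
    then show False using v(4,5) by (simp add: insert_absorb)
  qed
  ultimately show ?thesis using L(2) unfolding circuit_def by blast
qed

text \<open>A purely local condition, so it survives cutting and passes to components. Connectedness
  is kept apart because a cut may destroy it.\<close>

definition loc_tight :: "nat \<Rightarrow> 'a set set \<Rightarrow> bool" where
  "loc_tight n X \<longleftrightarrow> pure n X \<and> X \<noteq> {} \<and> (\<forall>v\<in>\<Union>X. normal (n - 1) (lk X {v}) \<and> tight (n - 1) (lk X {v}))"

lemma loc_tightD:
  assumes "loc_tight n X" "v \<in> \<Union>X"
  shows "normal (n - 1) (lk X {v})" "tight (n - 1) (lk X {v})"
  using assms unfolding loc_tight_def by blast+

lemma loc_tight_normal:
  assumes X: "loc_tight n X" "conn X" and n: "2 \<le> n"
  shows "normal n X"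
  unfolding normal_def
proof (intro conjI ballI impI)
  show P: "pure n X" "X \<noteq> {}" using X(1) by (auto simp: loc_tight_def)
  fix G assume G: "G \<in> faces X" "card G < n"
  have n1: "0 < n - 1" using n by simp
  show "circuit (n - card G) (lk X G)"
  proof (cases "G = {}")
    case True
    have "circuit n X"
      by (rule circuit_from_links[OF P n X(2) normal_circuit[OF loc_tightD(1)[OF X(1)] n1]])
    then show ?thesis using True by (simp add: lk_empty)
  next
    case False
    then obtain v where v: "v \<in> G" by blast
    have finG: "finite G" by (rule faces_finite[OF P(1) G(1)])
    have "v \<in> \<Union>X" using v G(1) by (auto simp: faces_def)
    then have N: "normal (n - 1) (lk X {v})" by (rule loc_tightD(1)[OF X(1)])
    have "G - {v} \<in> faces (lk X {v})" using G(1) v by (simp add: faces_lk insert_absorb)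
    moreover have cG: "Suc (card (G - {v})) = card G" by (rule card_remove_Suc[OF finG v])
    then have "card (G - {v}) < n - 1" using G(2) by linarith
    ultimately have "circuit (n - 1 - card (G - {v})) (lk (lk X {v}) (G - {v}))"
      by (rule normal_lk_circuit[OF N])
    moreover have "lk (lk X {v}) (G - {v}) = lk X G" using v by (subst lk_lk) (auto simp: insert_absorb)
    moreover have "n - 1 - card (G - {v}) = n - card G" using cG by linarith
    ultimately show ?thesis by simp
  qed
qed

text \<open>The faces of the cone through \<open>v\<close> come from the link of \<open>v\<close>.
  That \<open>T\<close> is a face of \<open>X\<close> follows from \<open>tight_clique_face\<close>
  in the link of one of its vertices \<open>u\<close>: all edges and triangles of \<open>T\<close>
  are faces, and that link has facet size \<open>n - 1 \<ge> 4\<close>.\<close>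

lemma missing_cone:
  assumes X: "loc_tight n X" and n: "5 \<le> n" and v: "v \<in> \<Union>X" and T: "missing (n - 1) (lk X {v}) T"
  shows "missing n X (insert v T)"
proof -
  let ?L = "lk X {v}"
  have n': "4 \<le> n - 1" "3 \<le> n - 1" "Suc (n - 1) = n" using n by auto
  have Tc: "finite T" "card T = n - 1" "T \<notin> ?L" using T by (auto simp: missing_def)
  have e3: "{u, w, v} \<in> faces X" if "u \<in> T" "w \<in> T" "u \<noteq> w" for u w
    using missing_edge[OF T n'(2) that] by (simp add: edges_lk)
  have vT: "v \<notin> T"
  proof
    assume vT: "v \<in> T"
    have "T \<noteq> {v}" using Tc(2) n by auto
    then obtain u where "u \<in> T" "u \<noteq> v" using vT by blast
    then have "{v, u} \<in> edges ?L" using missing_edge[OF T n'(2) vT] by blast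
    then show False by (simp add: edges_lk)
  qed
  have TX: "T \<in> faces X"
  proof -
    have "T \<noteq> {}" using Tc(2) n by auto
    then obtain u where u: "u \<in> T" by blast
    have adj: "{w, u} \<in> edges X" if "w \<in> T - {u}" for w
    proof -
      have "{w, u} \<in> faces X" by (rule faces_subset[OF e3[of w u]]) (use that u in auto)
      then show ?thesis using that by (auto simp: edges_pair)
    qed
    have uX: "u \<in> \<Union>X"
    proof -
      have "{u} \<in> faces ?L" by (rule missing_face[OF T]) (use u n in auto)
      then have "{u} \<union> {v} \<in> faces X" unfolding faces_lk by (rule conjunct2)
      then show ?thesis by (auto simp: faces_def)
    qed
    have N: "normal (n - 1) (lk X {u})" "tight (n - 1) (lk X {u})" using loc_tightD[OF X uX] by auto
    have "T - {u} \<in> faces (lk X {u})"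
    proof (rule tight_clique_face[OF n'(1) N])
      show "finite (T - {u})" using Tc by simp
      show "card (T - {u}) < n - 1" using card_remove_Suc[OF Tc(1) u] Tc(2) by simp
      show "T - {u} \<subseteq> \<Union>(lk X {u})"
      proof
        fix w assume w: "w \<in> T - {u}"
        then show "w \<in> \<Union>(lk X {u})" unfolding Union_lk using adj[OF w] by simp
      qed
    next
      fix a b assume ab: "a \<in> T - {u}" "b \<in> T - {u}" "a \<noteq> b"
      have "{a, b, u} \<in> faces ?L"
        by (rule missing_face[OF T]) (use ab u n in \<open>auto simp: card_insert_if\<close>)
      then have "{a, b, u} \<in> faces X" using faces_subset[of "{a, b, u} \<union> {v}" X] by (auto simp: faces_lk)
      then show "{a, b} \<in> edges (lk X {u})" using ab by (simp add: edges_lk)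
    qed
    then show ?thesis using u by (simp add: faces_lk insert_absorb)
  qed
  show ?thesis
    unfolding missing_def
  proof (intro conjI ballI)
    show "finite (insert v T)" "card (insert v T) = n" using Tc vT n'(3) by auto
    show "insert v T \<notin> X" using Tc(3) vT by (simp add: in_lk_iff)
    fix u assume u: "u \<in> insert v T"
    show "insert v T - {u} \<in> faces X"
    proof (cases "u = v")
      case True
      then show ?thesis using TX vT by simp
    next
      case False
      then have "T - {u} \<in> faces ?L" using T u by (simp add: missing_def)
      then have "T - {u} \<union> {v} \<in> faces X" by (simp add: faces_lk)
      moreover have "T - {u} \<union> {v} = insert v T - {u}" using False by blast
      ultimately show ?thesis by simp
    qed
  qed
qed

lemma simplex_boundary_cyc:
  assumes V: "finite V" "card V = Suc n"
  shows "cyc n {K. K \<subseteq> V \<and> card K = n}"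
  unfolding cyc_def
proof (intro conjI allI impI)
  have "finite {K. K \<subseteq> V \<and> card K = n}" by (rule finite_subset[of _ "Pow V"]) (use V in auto)
  then show "pure n {K. K \<subseteq> V \<and> card K = n}" using V(1) by (auto simp: pure_def intro: finite_subset)
  fix R :: "'a set" assume R: "finite R" "Suc (card R) = n"
  show "even (cnt {K. K \<subseteq> V \<and> card K = n} R)"
  proof (cases "R \<subseteq> V")
    case False
    then have "{F \<in> {K. K \<subseteq> V \<and> card K = n}. R \<subseteq> F} = {}" by blast
    then show ?thesis by (simp only: cnt_def card.empty even_zero)
  next
    case True
    have "{F \<in> {K. K \<subseteq> V \<and> card K = n}. R \<subseteq> F} = (\<lambda>a. insert a R) ` (V - R)"
    proof (intro set_eqI iffI)
      fix F assume F: "F \<in> {F \<in> {K. K \<subseteq> V \<and> card K = n}. R \<subseteq> F}"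
      then have "card (F - R) = 1" using R by (auto simp: card_Diff_subset)
      then obtain a where "F - R = {a}" by (auto simp: card_1_singleton_iff)
      then have "F = insert a R" "a \<in> V - R" using F by auto
      then show "F \<in> (\<lambda>a. insert a R) ` (V - R)" by blast
    qed (use True R in auto)
    moreover have "inj_on (\<lambda>a. insert a R) (V - R)" by (auto simp: inj_on_def)
    ultimately have "cnt {K. K \<subseteq> V \<and> card K = n} R = card (V - R)" by (simp add: cnt_def card_image)
    also have "\<dots> = 2" using True R V by (auto simp: card_Diff_subset)
    finally show ?thesis by simp
  qed
qed

text \<open>By \<open>missing_cone\<close> the vertex links have no missing facets either, so
  \<open>edge_link_simplex\<close> applies in them: the link of a triangle \<open>t\<close> of a
  facet \<open>F\<close> is the boundary of a simplex and yields a vertex \<open>b\<close> that can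
  replace any vertex of \<open>F\<close> outside \<open>t\<close>. Since ridges lie in only two
  facets, different triangles lead to the same \<open>b\<close>.\<close>

theorem no_missing_simplex:
  assumes X: "loc_tight n X" "conn X" and n: "5 \<le> n" and no: "\<nexists>T. missing n X T"
  shows "\<exists>V. finite V \<and> card V = Suc n \<and> X = {K. K \<subseteq> V \<and> card K = n}"
proof -
  have n': "4 \<le> n - 1" "2 \<le> n" "0 < n" using n by auto
  have N: "normal n X" by (rule loc_tight_normal[OF X n'(2)])
  have P: "pure n X" by (rule normal_pure[OF N])
  obtain F where F: "F \<in> X" using N by (auto simp: normal_def)
  note FF = pureD(1,2)[OF P F]
  have tri: "\<exists>b. b \<notin> F \<and> (\<forall>a\<in>F - t. insert b (F - {a}) \<in> X)" if t: "t \<subseteq> F" "card t = 3" for t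
  proof -
    obtain v x y where vxy: "t = {v, x, y}" "v \<noteq> x" "v \<noteq> y" "x \<noteq> y" using t(2) by (auto simp: card_3_iff)
    have v: "v \<in> \<Union>X" using F t vxy by blast
    let ?L = "lk X {v}"
    have L: "normal (n - 1) ?L" "tight (n - 1) ?L" using loc_tightD[OF X(1) v] by auto
    have FL: "F - {v} \<in> ?L" using F t(1) vxy(1) by (auto simp: lk_def)
    have "\<exists>N. finite N \<and> Suc (card N) = n - 1 \<and> lk ?L {x, y} = {K. K \<subseteq> N \<and> card K = n - 1 - 2}"
    proof (rule edge_link_simplex[OF L n'(1) FL])
      show "x \<in> F - {v}" "y \<in> F - {v}" using t(1) vxy by auto
      show "x \<noteq> y" by (rule vxy(4))
      fix T assume "missing (n - 1) ?L T"
      then show False using missing_cone[OF X(1) n v] no by blast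
    qed
    then obtain N where N: "finite N" "Suc (card N) = n - 1" "lk ?L {x, y} = {K. K \<subseteq> N \<and> card K = n - 1 - 2}"
      by blast
    have "lk ?L {x, y} = lk X ({v} \<union> {x, y})" by (rule lk_lk) (use vxy in auto)
    moreover have "{v} \<union> {x, y} = t" using vxy(1) by blast
    ultimately have lkt: "lk ?L {x, y} = lk X t" by (simp only:)
    have "F - t \<in> lk X t" using F t(1) by (auto simp: lk_def)
    then have Ft: "F - t \<subseteq> N" "card (F - t) = n - 3" using N(3) lkt by auto
    have "card (N - (F - t)) = 1" using N(1,2) Ft FF n by (subst card_Diff_subset) auto
    then obtain b where b: "N - (F - t) = {b}" by (auto simp: card_1_singleton_iff)
    have new: "insert b (F - t - {a}) \<in> lk X t" if a: "a \<in> F - t" for a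
    proof -
      have "insert b (F - t - {a}) \<subseteq> N" using b Ft(1) by blast
      moreover have "b \<notin> F - t" using b by blast
      then have "card (insert b (F - t - {a})) = n - 3"
        using FF(1) a Ft(2) card_remove_Suc[of "F - t" a] by simp
      ultimately show ?thesis using N(3) lkt by simp
    qed
    have "F - t \<noteq> {}"
    proof
      assume "F - t = {}"
      then have "card (F - t) = 0" by (simp only: card.empty)
      then show False using Ft(2) n by simp
    qed
    then obtain a0 where a0: "a0 \<in> F - t" by blast
    have "b \<notin> t" using new[OF a0] by (auto simp: lk_def)
    then have bF: "b \<notin> F" using b by blast
    have "insert b (F - {a}) \<in> X" if a: "a \<in> F - t" for a
    proof -
      have "insert b (F - t - {a}) \<union> t \<in> X"
        using new[OF a] \<open>b \<notin> t\<close> by (subst in_lk_iff[symmetric]) auto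
      moreover have "insert b (F - t - {a}) \<union> t = insert b (F - {a})" using a t(1) by blast
      ultimately show ?thesis by simp
    qed
    then show ?thesis using bF by blast
  qed
  have uniq: "b = b'" if b: "b \<notin> F" "b' \<notin> F" and a: "a \<in> F" and bX: "insert b (F - {a}) \<in> X" "insert b' (F - {a}) \<in> X" for a b b'
  proof (rule ccontr)
    assume ne: "b \<noteq> b'"
    have "F - {a} \<in> faces X" using F by (auto simp: faces_def)
    moreover have "Suc (card (F - {a})) = n" using card_remove_Suc[OF FF(1) a] FF(2) by simp
    ultimately have "card {G \<in> X. F - {a} \<subseteq> G} = 2" using normal_ridge[OF N] by (simp add: cnt_def)
    moreover have "{F, insert b (F - {a}), insert b' (F - {a})} \<subseteq> {G \<in> X. F - {a} \<subseteq> G}" using F bX by blast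
    moreover have "finite {G \<in> X. F - {a} \<subseteq> G}" using pureD(3)[OF P] by simp
    ultimately have "card {F, insert b (F - {a}), insert b' (F - {a})} \<le> 2" by (metis card_mono)
    moreover have "F \<noteq> insert b (F - {a})" "F \<noteq> insert b' (F - {a})" using b by blast+
    moreover have "insert b (F - {a}) \<noteq> insert b' (F - {a})" using b ne by blast
    ultimately show False by simp
  qed
  obtain t0 where t0: "t0 \<subseteq> F" "card t0 = 3" using obtain_subset_with_card_n[of 3 F] FF n by auto
  obtain b0 where b0: "b0 \<notin> F" "\<And>a. a \<in> F - t0 \<Longrightarrow> insert b0 (F - {a}) \<in> X" using tri[OF t0] by blast
  have all: "insert b0 (F - {a}) \<in> X" if a: "a \<in> F" for a
  proof (cases "a \<in> t0")
    case True
    have "card (F - t0) = n - 3" using t0 FF by (subst card_Diff_subset) (auto intro: finite_subset)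
    then have "0 < card (F - t0)" using n by linarith
    then have "F - t0 \<noteq> {}" by (metis card.empty less_irrefl)
    then obtain a' where a': "a' \<in> F - t0" by blast
    have "a \<noteq> a'" using a' True by blast
    then have "card (F - {a, a'}) = n - 2" using a a' FF by (subst card_Diff_subset) auto
    \<comment> \<open>As \<open>n \<ge> 5\<close>, some triangle avoids both \<open>a\<close> and
      \<open>a'\<close>. Its vertex \<open>b\<close> can replace either of them, and the replacement
      at \<open>a'\<close> identifies \<open>b\<close> with \<open>b0\<close>.\<close>
    then have "3 \<le> card (F - {a, a'})" using n by linarith
    then obtain t where t: "t \<subseteq> F - {a, a'}" "card t = 3" by (rule obtain_subset_with_card_n)
    have "t \<subseteq> F" using t(1) by blast
    then obtain b where b: "b \<notin> F" "\<And>a. a \<in> F - t \<Longrightarrow> insert b (F - {a}) \<in> X" using tri[OF _ t(2)] by blast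
    have "insert b (F - {a'}) \<in> X" using b(2)[of a'] a' t(1) by blast
    then have "b = b0" using uniq[OF b(1) b0(1), of a'] b0(2)[OF a'] a' by blast
    moreover have "insert b (F - {a}) \<in> X" using b(2)[of a] a t(1) by blast
    ultimately show ?thesis by simp
  qed (use b0(2) a in blast)
  let ?V = "insert b0 F"
  have V: "finite ?V" "card ?V = Suc n" using FF b0(1) by auto
  have "K \<in> X" if K: "K \<subseteq> ?V" "card K = n" for K
  proof (cases "b0 \<in> K")
    case False
    then have "K \<subseteq> F" using K(1) by blast
    then have "K = F" using card_subset_eq[OF FF(1)] K(2) FF(2) by simp
    then show ?thesis using F by simp
  next
    case True
    have "\<not> F \<subseteq> K"
    proof
      assume "F \<subseteq> K"
      then have "?V \<subseteq> K" using True by blast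
      then show False using card_mono[of K ?V] K V finite_subset[OF K(1) V(1)] by simp
    qed
    then obtain a where a: "a \<in> F" "a \<notin> K" by blast
    have "K \<subseteq> insert b0 (F - {a})" using K(1) a(2) by blast
    moreover have "card (insert b0 (F - {a})) = n" using FF b0(1) card_remove_Suc[OF FF(1) a(1)] by simp
    ultimately have "K = insert b0 (F - {a})" using card_subset_eq[of "insert b0 (F - {a})" K] FF(1) K(2) by simp
    then show ?thesis using all[OF a(1)] by simp
  qed
  then have sub: "{K. K \<subseteq> ?V \<and> card K = n} \<subseteq> X" by blast
  have "F \<in> {K. K \<subseteq> ?V \<and> card K = n}" using FF by blast
  then have "{K. K \<subseteq> ?V \<and> card K = n} = X"
    using circuitD(4)[OF normal_circuit[OF N n'(3)] sub simplex_boundary_cyc[OF V]] by blast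
  then show ?thesis using V by blast
qed

section \<open>Cutting along a missing facet\<close>

lemma splits_complement:
  assumes X: "cyc n X" and A: "splits n X T A"
  shows "splits n X T (X - A)"
  unfolding splits_def
proof (intro conjI allI impI)
  fix R :: "'a set" assume R: "finite R" "Suc (card R) = n"
  have "cnt X R = cnt A R + cnt (X - A) R"
    by (rule cnt_split[OF pureD(3)[OF cycD(1)[OF X]]]) (use A in \<open>simp add: splits_def\<close>)
  moreover have "even (cnt X R)" by (rule cycD(2)[OF X R])
  moreover have "odd (cnt A R) = (R \<subseteq> T)" using A R by (simp add: splits_def)
  ultimately show "odd (cnt (X - A) R) = (R \<subseteq> T)" by (metis even_add)
qed blast

lemma sides_splits_lk:
  assumes P: "sides (Suc n) X T P" and w: "w \<in> T"
  shows "splits n (lk X {w}) (T - {w}) (lk P {w})"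
  unfolding splits_def
proof (intro conjI allI impI)
  show "lk P {w} \<subseteq> lk X {w}" using P by (auto simp: sides_def lk_def)
  fix R :: "'a set" assume R: "finite R" "Suc (card R) = n"
  show "odd (cnt (lk P {w}) R) = (R \<subseteq> T - {w})"
  proof (cases "w \<in> R")
    case True
    then show ?thesis by (auto simp: cnt_lk_0)
  next
    case False
    have "odd (cnt P (R \<union> {w})) = (R \<union> {w} \<subseteq> T)"
      using P R False w unfolding sides_def by (elim conjE allE[of _ "R \<union> {w}"]) auto
    then show ?thesis using False w by (simp add: cnt_lk) blast
  qed
qed

text \<open>
  Cutting \<open>X\<close> along the missing facet \<open>T\<close>, whose second copy is \<open>dup ` T\<close>; the facets in \<open>P\<close>
  keep their vertices in \<open>T\<close>, the other facets get the copies.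
\<close>

locale cut =
  fixes n :: nat and X :: "'a set set" and T :: "'a set" and P :: "'a set set" and dup :: "'a \<Rightarrow> 'a"
  assumes n: "5 \<le> n" and loc: "loc_tight n X" and con: "conn X" and T: "missing n X T" and P: "sides n X T P"
    and dup: "inj_on dup T" "dup ` T \<inter> \<Union>X = {}"
begin

definition cp :: "'a \<Rightarrow> 'a" where
  "cp v = (if v \<in> T then dup v else v)"

definition coll :: "'a \<Rightarrow> 'a" where
  "coll v = (if v \<in> dup ` T then inv_into T dup v else v)"

definition lift :: "'a set \<Rightarrow> 'a set" where
  "lift F = (if F \<in> P then F else cp ` F)"

text \<open>Both copies of \<open>T\<close> are added as facets and cap off the boundaries created
  by the cut.\<close>

definition X' :: "'a set set" where
  "X' = lift ` X \<union> {T, dup ` T}"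

lemma ns: "2 \<le> n" "3 \<le> n" "0 < n" "1 < n" "4 \<le> n - 1" "Suc (n - 1) = n" "2 \<le> n - 1" "3 \<le> n - 1"
  using n by auto

lemma norm: "normal n X"
  by (rule loc_tight_normal[OF loc con ns(1)])

lemma pureX: "pure n X"
  by (rule normal_pure[OF norm])

lemma Tc: "finite T" "card T = n" "T \<notin> X"
  using T by (auto simp: missing_def)

lemma TV: "T \<subseteq> \<Union>X"
proof
  fix v assume "v \<in> T"
  then have "{v} \<in> faces X" by (intro missing_face[OF T]) (use n in auto)
  then show "v \<in> \<Union>X" by (auto simp: faces_def)
qed

lemma T_ne: "T \<noteq> {}"
  using Tc n by auto

lemma dupT: "v \<in> T \<Longrightarrow> dup v \<notin> \<Union>X" "v \<in> T \<Longrightarrow> dup v \<notin> T"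
  using dup(2) TV by blast+

lemma coll_dup: "v \<in> T \<Longrightarrow> coll (dup v) = v"
  using dup(1) by (simp add: coll_def)

lemma coll_id: "v \<in> \<Union>X \<Longrightarrow> coll v = v"
  using dup(2) unfolding coll_def by (auto simp del: Union_iff)

lemma coll_cp: "v \<in> \<Union>X \<Longrightarrow> coll (cp v) = v"
  using coll_dup coll_id by (simp add: cp_def del: Union_iff)

lemma cp_inj: "inj_on cp (\<Union>X)"
  by (rule inj_on_inverseI[of _ coll]) (rule coll_cp)

lemma PX: "P \<subseteq> X"
  using P by (simp add: sides_def)

lemma FX: "F \<in> X \<Longrightarrow> F \<subseteq> \<Union>X" by blast

lemma coll_lift: "F \<in> X \<Longrightarrow> coll ` lift F = F"
proof -
  assume F: "F \<in> X"
  have "coll v = v" "coll (cp v) = v" if "v \<in> F" for v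
    using coll_id[of v] coll_cp[of v] F that by blast+
  then show ?thesis by (force simp: lift_def image_image)
qed

lemma lift_eq_cp: "F \<in> X \<Longrightarrow> F \<inter> T = {} \<Longrightarrow> lift F = F"
  by (force simp: lift_def cp_def)

lemma card_lift: "F \<in> X \<Longrightarrow> finite (lift F) \<and> card (lift F) = n"
  using pureD(1,2)[OF pureX] card_image[OF inj_on_subset[OF cp_inj FX]] by (simp add: lift_def)

lemma cdupT: "finite (dup ` T)" "card (dup ` T) = n"
  using Tc dup(1) by (auto simp: card_image)

lemma pureX': "pure n X'"
  using card_lift Tc cdupT pureD(3)[OF pureX] by (auto simp: pure_def X'_def)

lemma lift_off: "v \<in> \<Union>X \<Longrightarrow> v \<notin> T \<Longrightarrow> F \<in> X \<Longrightarrow> v \<in> lift F \<longleftrightarrow> v \<in> F"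
  using dupT(1) by (auto simp: lift_def cp_def image_iff simp del: Union_iff)

lemma lift_T: "v \<in> T \<Longrightarrow> F \<in> X \<Longrightarrow> v \<in> lift F \<longleftrightarrow> v \<in> F \<and> F \<in> P"
  using dupT(2) by (auto simp: lift_def cp_def image_iff)

lemma lift_dup: "v \<in> T \<Longrightarrow> F \<in> X \<Longrightarrow> dup v \<in> lift F \<longleftrightarrow> v \<in> F \<and> F \<notin> P"
proof -
  assume v: "v \<in> T" and F: "F \<in> X"
  have "dup v \<notin> F" using dupT(1)[OF v] F by blast
  moreover have "dup v \<in> cp ` F \<longleftrightarrow> v \<in> F"
  proof
    assume "dup v \<in> cp ` F"
    then obtain u where u: "u \<in> F" "dup v = cp u" by blast
    then have "coll (dup v) = u" using coll_cp[of u] F by auto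
    then show "v \<in> F" using coll_dup[OF v] u(1) by simp
  next
    assume "v \<in> F"
    then show "dup v \<in> cp ` F" using v by (force simp: cp_def)
  qed
  ultimately show ?thesis by (simp add: lift_def)
qed

lemma UX': "\<Union>X' \<subseteq> \<Union>X \<union> dup ` T"
proof -
  have "cp v \<in> \<Union>X \<union> dup ` T" if "v \<in> \<Union>X" for v using that by (simp add: cp_def del: Union_iff)
  then have "lift F \<subseteq> \<Union>X \<union> dup ` T" if "F \<in> X" for F
    using that FX[OF that] unfolding lift_def by (auto simp del: Union_iff)
  then show ?thesis using TV unfolding X'_def by blast
qed

lemma facetX':
  assumes "G \<in> X'"
  shows "(\<exists>F\<in>X. G = lift F) \<or> G = T \<or> G = dup ` T"
  using assms by (auto simp: X'_def)

lemma no_mix: "G \<in> X' \<Longrightarrow> u \<in> T \<Longrightarrow> w \<in> T \<Longrightarrow> u \<in> G \<Longrightarrow> dup w \<in> G \<Longrightarrow> False"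
  using facetX'[of G] lift_T[of u] lift_dup[of w] dupT(2) by blast

text \<open>By \<open>sides_edge\<close> an edge leaving \<open>T\<close> has a definite side, so
  the copy of \<open>u\<close> that occurs in it tells the side of every facet through this
  edge.\<close>

lemma plain_edge:
  assumes "G \<in> X'" "u \<in> T" "v \<in> \<Union>X" "v \<notin> T" "u \<in> G" "v \<in> G" "F \<in> X" "u \<in> F" "v \<in> F"
  shows "F \<in> P"
proof -
  have "G \<noteq> T" "G \<noteq> dup ` T" using assms dup(2) by blast+
  then obtain H where H: "H \<in> X" "G = lift H" using facetX'[OF assms(1)] by blast
  then have "u \<in> H" "H \<in> P" "v \<in> H" using assms lift_T lift_off by blast+
  then show ?thesis using sides_edge[OF norm ns(2) P assms(2,4) H(1)] assms(7-9) by blast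
qed

lemma dup_edge:
  assumes "G \<in> X'" "u \<in> T" "v \<in> \<Union>X" "v \<notin> T" "dup u \<in> G" "v \<in> G" "F \<in> X" "u \<in> F" "v \<in> F"
  shows "F \<notin> P"
proof -
  have "G \<noteq> T" "G \<noteq> dup ` T" using assms dup(2) by blast+
  then obtain H where H: "H \<in> X" "G = lift H" using facetX'[OF assms(1)] by blast
  then have "u \<in> H" "H \<notin> P" "v \<in> H" using assms lift_dup lift_off by blast+
  then show ?thesis using sides_edge[OF norm ns(2) P assms(2,4) H(1)] assms(7-9) by blast
qed

text \<open>This link is merely relabelled: by \<open>sides_edge\<close> a vertex of
  \<open>T\<close> in it is seen from one side of \<open>T\<close> only, so a single map
  \<open>g\<close> describes \<open>lift\<close> on all facets at \<open>v\<close>.\<close>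

lemma lk_off:
  assumes v: "v \<in> \<Union>X" "v \<notin> T"
  shows "normal (n - 1) (lk X' {v}) \<and> tight (n - 1) (lk X' {v})"
proof -
  let ?L = "lk X {v}"
  define g where "g u = (if \<exists>F\<in>P. u \<in> F \<and> v \<in> F then u else cp u)" for u
  have UL: "\<Union>?L \<subseteq> \<Union>X" by (auto simp: lk_def)
  have g: "g u = (if F \<in> P then u else cp u)" if F: "F \<in> X" "v \<in> F" "u \<in> F" for u F
  proof (cases "u \<in> T")
    case True
    have "(\<exists>F\<in>P. u \<in> F \<and> v \<in> F) = (F \<in> P)"
      using sides_edge[OF norm ns(2) P True v(2)] F PX by blast
    then show ?thesis by (simp add: g_def)
  next
    case False
    then show ?thesis by (simp add: g_def cp_def)
  qed
  have "coll (g u) = u" if "u \<in> \<Union>X" for u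
    using that coll_id[OF that] coll_cp[OF that] by (simp add: g_def)
  then have inj: "inj_on g (\<Union>?L)" using UL by (intro inj_on_inverseI[of _ coll]) blast
  have gF: "lift F - {v} = g ` (F - {v})" if F: "F \<in> X" "v \<in> F" for F
  proof -
    have "g ` (F - {v}) = (if F \<in> P then F - {v} else cp ` (F - {v}))" using g[OF F] by auto
    moreover have "cp ` (F - {v}) = cp ` F - {v}"
    proof -
      have "inj_on cp F" using cp_inj FX[OF F(1)] by (rule inj_on_subset)
      then have "cp ` (F - {v}) = cp ` F - cp ` {v}" using F(2) by (intro inj_on_image_set_diff) auto
      then show ?thesis using v(2) by (simp add: cp_def)
    qed
    ultimately show ?thesis by (simp add: lift_def)
  qed
  have "lk X' {v} = image g ` ?L"
  proof (intro set_eqI iffI)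
    fix K assume "K \<in> lk X' {v}"
    then obtain G where G: "G \<in> X'" "v \<in> G" "K = G - {v}" by (auto simp: lk_def)
    have "G \<noteq> T" "G \<noteq> dup ` T" using G(2) v dup(2) by blast+
    then obtain F where F: "F \<in> X" "G = lift F" using facetX'[OF G(1)] by blast
    then have "v \<in> F" using lift_off[OF v F(1)] G(2) by simp
    then have "F - {v} \<in> ?L" "K = g ` (F - {v})" using F G(3) gF by (auto simp: lk_def)
    then show "K \<in> image g ` ?L" by blast
  next
    fix K assume "K \<in> image g ` ?L"
    then obtain F where F: "F \<in> X" "v \<in> F" "K = g ` (F - {v})" by (auto simp: lk_def)
    then have "K = lift F - {v}" "lift F \<in> X'" "v \<in> lift F"
      using gF lift_off[OF v F(1)] by (auto simp: X'_def)
    then show "K \<in> lk X' {v}" by (auto simp: lk_def)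
  qed
  then show ?thesis
    using relabel_normal[OF inj loc_tightD(1)[OF loc v(1)]] relabel_tight[OF inj loc_tightD(2)[OF loc v(1)]] by simp
qed

lemma missing_lkT:
  assumes "v \<in> T"
  shows "missing (n - 1) (lk X {v}) (T - {v})"
  using missing_lk[of "n - 1" X T v] T assms ns(6) by simp

lemma splits_lkT:
  assumes "v \<in> T"
  shows "splits (n - 1) (lk X {v}) (T - {v}) (lk P {v})"
  using sides_splits_lk[of "n - 1" X T P v] P assms ns(6) by simp

text \<open>The link becomes the part of the old link on the side \<open>P\<close>, capped by
  \<open>T - {v}\<close>, as in \<open>splits_normal\<close> and \<open>splits_tight\<close>; the
  complementary part appears at \<open>dup v\<close>.\<close>

lemma lk_T:
  assumes v: "v \<in> T"
  shows "normal (n - 1) (lk X' {v}) \<and> tight (n - 1) (lk X' {v})"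
proof -
  have vX: "v \<in> \<Union>X" using v TV by blast
  have "lk X' {v} = insert (T - {v}) (lk P {v})"
  proof (intro set_eqI iffI)
    fix K assume "K \<in> lk X' {v}"
    then obtain G where G: "G \<in> X'" "v \<in> G" "K = G - {v}" by (auto simp: lk_def)
    have "G \<noteq> dup ` T" using G(2) v dupT(2) by blast
    then consider "G = T" | F where "F \<in> X" "G = lift F" using facetX'[OF G(1)] by blast
    then show "K \<in> insert (T - {v}) (lk P {v})"
    proof cases
      case (2 F)
      then have "F \<in> P" "v \<in> F" using lift_T[OF v] G(2) by auto
      then show ?thesis using 2(2) G(3) by (auto simp: lift_def lk_def)
    qed (use G(3) in simp)
  next
    fix K assume "K \<in> insert (T - {v}) (lk P {v})"
    then consider "K = T - {v}" | F where "F \<in> P" "v \<in> F" "K = F - {v}" by (auto simp: lk_def)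
    then show "K \<in> lk X' {v}"
    proof cases
      case 1
      then show ?thesis using v by (auto simp: lk_def X'_def)
    next
      case (2 F)
      then have "F \<in> X'" using PX unfolding X'_def lift_def by (auto intro!: image_eqI[of _ _ F])
      then show ?thesis using 2 by (auto simp: lk_def)
    qed
  qed
  then show ?thesis
    using splits_normal[OF loc_tightD(1)[OF loc vX] ns(7) missing_lkT[OF v] splits_lkT[OF v]]
      splits_tight[OF loc_tightD[OF loc vX] ns(8) missing_lkT[OF v] splits_lkT[OF v]] by simp
qed

lemma lk_dup:
  assumes v: "v \<in> T"
  shows "normal (n - 1) (lk X' {dup v}) \<and> tight (n - 1) (lk X' {dup v})"
proof -
  have vX: "v \<in> \<Union>X" using v TV by blast
  let ?L = "lk X {v}"
  let ?Y = "insert (T - {v}) (?L - lk P {v})"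
  have c: "cyc (n - 1) ?L" by (rule circuitD(2)[OF normal_circuit[OF loc_tightD(1)[OF loc vX]]]) (use n in simp)
  have sp: "splits (n - 1) ?L (T - {v}) (?L - lk P {v})"
    by (rule splits_complement[OF c splits_lkT[OF v]])
  have memb: "F - {v} \<in> ?L - lk P {v} \<longleftrightarrow> F \<notin> P" if F: "F \<in> X" "v \<in> F" for F
  proof -
    have "F - {v} \<in> lk P {v} \<longleftrightarrow> F - {v} \<union> {v} \<in> P" by (rule in_lk_iff) blast
    moreover have "F - {v} \<union> {v} = F" using F(2) by blast
    moreover have "F - {v} \<in> ?L" using F by (auto simp: lk_def)
    ultimately show ?thesis by auto
  qed
  have UY: "\<Union>?Y \<subseteq> \<Union>X" using TV by (auto simp: lk_def)
  have inj: "inj_on cp (\<Union>?Y)" using cp_inj UY by (rule inj_on_subset)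
  have cpd: "cp ` F - {dup v} = cp ` (F - {v})" if F: "F \<subseteq> \<Union>X" "v \<in> F" for F
  proof -
    have "inj_on cp F" using cp_inj F(1) by (rule inj_on_subset)
    then have "cp ` (F - {v}) = cp ` F - cp ` {v}" using F(2) by (intro inj_on_image_set_diff) auto
    then show ?thesis using v by (simp add: cp_def)
  qed
  have cpT: "cp ` T = dup ` T" by (simp add: cp_def)
  have "lk X' {dup v} = image cp ` ?Y"
  proof (intro set_eqI iffI)
    fix K assume "K \<in> lk X' {dup v}"
    then obtain G where G: "G \<in> X'" "dup v \<in> G" "K = G - {dup v}" by (auto simp: lk_def)
    have "G \<noteq> T" using G(2) v dupT(2) by blast
    then consider "G = dup ` T" | F where "F \<in> X" "G = lift F" using facetX'[OF G(1)] by blast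
    then show "K \<in> image cp ` ?Y"
    proof cases
      case 1
      then have "K = cp ` (T - {v})" using G(3) cpd[OF TV v] cpT by simp
      then show ?thesis by blast
    next
      case (2 F)
      then have F: "v \<in> F" "F \<notin> P" using lift_dup[OF v] G(2) by auto
      then have "K = cp ` (F - {v})" using 2 G(3) cpd[OF FX[OF 2(1)] F(1)] by (simp add: lift_def)
      then show ?thesis using memb[OF 2(1) F(1)] F(2) by blast
    qed
  next
    fix K assume "K \<in> image cp ` ?Y"
    then obtain H where H: "K = cp ` H" "H = T - {v} \<or> H \<in> ?L - lk P {v}" by blast
    from H(2) show "K \<in> lk X' {dup v}"
    proof
      assume "H = T - {v}"
      then have "K = dup ` T - {dup v}" using H(1) cpd[OF TV v] cpT by simp
      moreover have "dup ` T \<in> X'" "dup v \<in> dup ` T" using v by (auto simp: X'_def)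
      ultimately show ?thesis by (auto simp: lk_def)
    next
      assume HL: "H \<in> ?L - lk P {v}"
      then obtain F where F: "F \<in> X" "v \<in> F" "H = F - {v}" by (auto simp: lk_def)
      then have "F \<notin> P" using memb HL by blast
      then have "lift F = cp ` F" by (simp add: lift_def)
      moreover have "K = cp ` F - {dup v}" using H(1) F(3) cpd[OF FX[OF F(1)] F(2)] by simp
      moreover have "dup v \<in> cp ` F" using F(2) v by (force simp: cp_def)
      moreover have "lift F \<in> X'" using F(1) by (simp add: X'_def)
      ultimately show ?thesis by (auto simp: lk_def)
    qed
  qed
  moreover have "normal (n - 1) ?Y"
    by (rule splits_normal[OF loc_tightD(1)[OF loc vX] ns(7) missing_lkT[OF v] sp])
  moreover have "tight (n - 1) ?Y"
    by (rule splits_tight[OF loc_tightD[OF loc vX] ns(8) missing_lkT[OF v] sp])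
  ultimately show ?thesis using relabel_normal[OF inj] relabel_tight[OF inj] by simp
qed

theorem loc_tight_cut: "loc_tight n X'"
  unfolding loc_tight_def
proof (intro conjI ballI pureX')
  show "X' \<noteq> {}" by (simp add: X'_def)
  fix v assume "v \<in> \<Union>X'"
  then have "v \<in> \<Union>X \<or> v \<in> dup ` T" using UX' by blast
  then have "normal (n - 1) (lk X' {v}) \<and> tight (n - 1) (lk X' {v})"
    using lk_off lk_T lk_dup by (cases "v \<in> T") (auto simp del: Union_iff)
  then show "normal (n - 1) (lk X' {v})" "tight (n - 1) (lk X' {v})" by auto
qed

lemma coll_dupT: "coll ` dup ` T = T" "coll ` T = T"
proof -
  show "coll ` dup ` T = T" using coll_dup by (force simp: image_image)
  have "coll v = v" if "v \<in> T" for v using coll_id[of v] TV that by blast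
  then show "coll ` T = T" by force
qed

text \<open>Collapsing undoes \<open>lift\<close> and identifies the two caps, whose common image
  \<open>T\<close> is the facet that \<open>glue\<close> removes.\<close>

theorem glue_cut: "glue (dup ` T) coll (faces X') = faces X"
proof -
  have "(\<lambda>v. if v \<in> dup ` T then coll v else v) = coll" by (auto simp: coll_def fun_eq_iff)
  then have "glue (dup ` T) coll (faces X') = image coll ` faces X' - {T}"
    by (simp only: glue_def coll_dupT)
  also have "\<dots> = faces X"
  proof (intro set_eqI iffI)
    fix G assume "G \<in> image coll ` faces X' - {T}"
    then obtain H H' where H: "G = coll ` H" "H \<subseteq> H'" "H' \<in> X'" "G \<noteq> T" by (auto simp: faces_def)
    then have sub: "G \<subseteq> coll ` H'" by blast
    from facetX'[OF H(3)] have "(\<exists>F\<in>X. G \<subseteq> F) \<or> G \<subseteq> T" using sub coll_lift coll_dupT by metis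
    then show "G \<in> faces X"
    proof
      assume GT: "G \<subseteq> T"
      then have "G \<subset> T" using H(4) by blast
      then have "card G < n" using psubset_card_mono[OF Tc(1)] Tc(2) by blast
      then show ?thesis by (rule missing_face[OF T GT])
    qed (simp add: faces_def)
  next
    fix G assume "G \<in> faces X"
    then obtain F where F: "F \<in> X" "G \<subseteq> F" by (auto simp: faces_def)
    have "G \<subseteq> coll ` lift F" using coll_lift[OF F(1)] F(2) by simp
    then obtain H where "H \<subseteq> lift F" "G = coll ` H" by (meson subset_imageE)
    moreover have "lift F \<in> X'" using F(1) by (simp add: X'_def)
    moreover have "G \<noteq> T"
    proof
      assume "G = T"
      then have "T = F" using card_subset_eq[OF pureD(1)[OF pureX F(1)]] F(2) pureD(2)[OF pureX F(1)] Tc(2) by blast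
      then show False using F(1) Tc(3) by simp
    qed
    ultimately show "G \<in> image coll ` faces X' - {T}" by (auto simp: faces_def)
  qed
  finally show ?thesis .
qed

lemma edgeX':
  assumes "{a, b} \<in> edges X'"
  obtains G where "G \<in> X'" "a \<in> G" "b \<in> G"
  using assms by (auto simp: edges_def faces_def)

text \<open>No facet of \<open>X'\<close> meets both copies of \<open>T\<close>, so a common
  neighbour \<open>a\<close> of \<open>dup w\<close> and \<open>w\<close> lies in neither; but then
  the edge from \<open>w\<close> to \<open>a\<close> would be on both sides of
  \<open>T\<close>.\<close>

theorem distance_cut: "\<forall>v\<in>dup ` T. \<forall>k<3. (v, coll v) \<notin> skeleton1 (faces X') ^^ k"
proof (intro ballI allI impI)
  fix v and k :: nat assume "v \<in> dup ` T" and k: "k < 3"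
  then obtain w where w: "w \<in> T" "v = dup w" by blast
  have cv: "coll v = w" using coll_dup w by simp
  have adj: "\<exists>G\<in>X'. a \<in> G \<and> b \<in> G" if "(a, b) \<in> skeleton1 (faces X')" for a b
    using that by (auto simp: skeleton1_def faces_def)
  have "k = 0 \<or> k = 1 \<or> k = 2" using k by auto
  then show "(v, coll v) \<notin> skeleton1 (faces X') ^^ k"
  proof (elim disjE)
    assume "k = 0"
    moreover have "dup w \<noteq> w" using dupT(2)[OF w(1)] w(1) by metis
    ultimately show ?thesis using cv w(2) by simp
  next
    assume "k = 1"
    then show ?thesis using adj[of v w] cv w no_mix[OF _ w(1) w(1)] by auto
  next
    assume k2: "k = 2"
    show ?thesis
    proof
      assume "(v, coll v) \<in> skeleton1 (faces X') ^^ k"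
      then obtain a where a: "(dup w, a) \<in> skeleton1 (faces X')" "(a, w) \<in> skeleton1 (faces X')"
        using cv w by (auto simp: k2 numeral_2_eq_2)
      obtain G H where G: "G \<in> X'" "dup w \<in> G" "a \<in> G" and H: "H \<in> X'" "a \<in> H" "w \<in> H"
        using adj[OF a(1)] adj[OF a(2)] by blast
      show False
      proof (cases "a \<in> T")
        case True
        then show False using no_mix[OF G(1) True w(1)] G by blast
      next
        case False
        show False
        proof (cases "a \<in> dup ` T")
          case True
          then show False using no_mix[OF H(1) w(1)] H by blast
        next
          case nd: False
          have "a \<in> \<Union>X'" using G by blast
          then have aX: "a \<in> \<Union>X" using UX' nd by blast
          have "G \<noteq> T" "G \<noteq> dup ` T" using G(3) False nd by blast+
          then obtain F where F: "F \<in> X" "G = lift F" using facetX'[OF G(1)] by blast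
          then have Fm: "a \<in> F" "w \<in> F" "F \<notin> P"
            using G lift_off[OF aX False F(1)] lift_dup[OF w(1) F(1)] by auto
          then have "F \<in> P" using plain_edge[OF H(1) w(1) aX False H(3,2) F(1)] by blast
          then show False using Fm by blast
        qed
      qed
    qed
  qed
qed

text \<open>Vertices of a missing facet are pairwise adjacent, and no edge joins the two copies of
  \<open>T\<close>. So \<open>M\<close> is recovered from its image under \<open>coll\<close> up to
  the choice of a copy.\<close>

lemma missing_type:
  assumes M: "missing n X' M"
  shows "(M = coll ` M \<and> M \<inter> dup ` T = {}) \<or> (M = cp ` coll ` M \<and> M \<inter> T = {})"
proof -
  have MX: "M \<subseteq> \<Union>X'"
  proof
    fix v assume "v \<in> M"
    then have "{v} \<in> faces X'" by (intro missing_face[OF M]) (use n in auto)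
    then show "v \<in> \<Union>X'" by (auto simp: faces_def)
  qed
  then have sub: "M \<subseteq> \<Union>X \<union> dup ` T" using UX' by blast
  have "M \<inter> T = {} \<or> M \<inter> dup ` T = {}"
  proof (rule ccontr)
    assume "\<not> ?thesis"
    then obtain u w where uw: "u \<in> M" "u \<in> T" "w \<in> T" "dup w \<in> M" by blast
    then have "u \<noteq> dup w" using dupT(2) by blast
    then have "{u, dup w} \<in> edges X'" using missing_edge[OF M ns(2)] uw by blast
    then show False using no_mix uw by (elim edgeX') blast
  qed
  then show ?thesis
  proof
    assume a: "M \<inter> dup ` T = {}"
    then have "coll v = v" if "v \<in> M" for v using coll_id[of v] sub that by blast
    then have "coll ` M = M" by force
    then show ?thesis using a by simp
  next
    assume a: "M \<inter> T = {}"
    have "cp (coll v) = v" if v: "v \<in> M" for v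
    proof (cases "v \<in> dup ` T")
      case True
      then show ?thesis using coll_dup by (auto simp: cp_def)
    next
      case False
      then have "coll v = v" using coll_id[of v] sub v by blast
      then show ?thesis using a v by (auto simp: cp_def)
    qed
    then have "cp ` coll ` M = M" by (force simp: image_image)
    then show ?thesis using a by simp
  qed
qed

text \<open>An image inside \<open>T\<close> would make \<open>M\<close> one of the caps, which are
  facets. The last claim recovers which copy of \<open>T\<close> is used by \<open>M\<close>: a
  facet through an edge of the image that leaves \<open>T\<close> shows the side.\<close>

lemma missing_coll:
  assumes M: "missing n X' M"
  shows "missing n X (coll ` M)" and "coll ` M \<noteq> T" and "\<not> coll ` M \<subseteq> T"
    and "u \<in> coll ` M \<Longrightarrow> u \<in> T \<Longrightarrow> v \<in> coll ` M \<Longrightarrow> v \<notin> T \<Longrightarrow> F \<in> X \<Longrightarrow> u \<in> F \<Longrightarrow> v \<in> F \<Longrightarrow>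
      (F \<in> P) = (M \<inter> dup ` T = {})"
proof -
  have Mc: "finite M" "card M = n" "M \<notin> X'" using M by (auto simp: missing_def)
  have MX: "M \<subseteq> \<Union>X'"
  proof
    fix v assume "v \<in> M"
    then have "{v} \<in> faces X'" by (intro missing_face[OF M]) (use n in auto)
    then show "v \<in> \<Union>X'" by (auto simp: faces_def)
  qed
  have cU: "coll v \<in> \<Union>X" if "v \<in> \<Union>X'" for v
  proof (cases "v \<in> dup ` T")
    case True
    then obtain w where w: "w \<in> T" "v = dup w" by blast
    then have "coll v \<in> T" using coll_dup by simp
    then show ?thesis using TV by blast
  next
    case False
    then have "v \<in> \<Union>X" using that UX' by blast
    then show ?thesis using coll_id[of v] by simp
  qed
  have inj: "inj_on coll M"
  proof -
    from missing_type[OF M] show ?thesis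
    proof
      assume "M = coll ` M \<and> M \<inter> dup ` T = {}"
      then have "card (coll ` M) = card M" by simp
      then show ?thesis by (rule eq_card_imp_inj_on[OF Mc(1)])
    next
      assume a: "M = cp ` coll ` M \<and> M \<inter> T = {}"
      have "card M = card (cp ` coll ` M)" using a by simp
      also have "\<dots> \<le> card (coll ` M)" by (rule card_image_le) (use Mc in simp)
      finally have "card (coll ` M) = card M" using card_image_le[OF Mc(1), of coll] by simp
      then show ?thesis by (rule eq_card_imp_inj_on[OF Mc(1)])
    qed
  qed
  have cM: "finite (coll ` M)" "card (coll ` M) = n" using Mc inj by (auto simp: card_image)
  have TX': "T \<in> X'" "dup ` T \<in> X'" by (auto simp: X'_def)
  show nsub: "\<not> coll ` M \<subseteq> T"
  proof
    assume sub: "coll ` M \<subseteq> T"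
    have e: "coll ` M = T" by (rule card_subset_eq[OF Tc(1) sub]) (simp only: cM Tc)
    have "cp ` T = dup ` T" by (simp add: cp_def)
    then have "M = T \<or> M = dup ` T" using missing_type[OF M] unfolding e by blast
    then show False using Mc(3) TX' by blast
  qed
  then show "coll ` M \<noteq> T" by blast
  have sgn: "(F \<in> P) = (M \<inter> dup ` T = {})"
    if uv: "u \<in> coll ` M" "u \<in> T" "v \<in> coll ` M" "v \<notin> T" and F: "F \<in> X" "u \<in> F" "v \<in> F" for u v F
  proof -
    have vX: "v \<in> \<Union>X" using F by blast
    from missing_type[OF M] show ?thesis
    proof
      assume a: "M = coll ` M \<and> M \<inter> dup ` T = {}"
      then have "u \<in> M" "v \<in> M" using uv(1,3) by blast+
      moreover have "u \<noteq> v" using uv by blast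
      ultimately have "{u, v} \<in> edges X'" by (rule missing_edge[OF M ns(2)])
      then obtain G where "G \<in> X'" "u \<in> G" "v \<in> G" by (rule edgeX')
      then have "F \<in> P" using plain_edge[OF _ uv(2) vX uv(4) _ _ F] by blast
      then show ?thesis using a by simp
    next
      assume a: "M = cp ` coll ` M \<and> M \<inter> T = {}"
      then have "cp u \<in> M" "cp v \<in> M" using uv(1,3) by blast+
      then have m: "dup u \<in> M" "v \<in> M" using uv by (auto simp: cp_def)
      have "dup u \<noteq> v" using dupT(1)[OF uv(2)] vX by blast
      then have "{dup u, v} \<in> edges X'" by (rule missing_edge[OF M ns(2) m])
      then obtain G where "G \<in> X'" "dup u \<in> G" "v \<in> G" by (rule edgeX')
      then have "F \<notin> P" using dup_edge[OF _ uv(2) vX uv(4) _ _ F] by blast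
      moreover have "M \<inter> dup ` T \<noteq> {}" using m(1) uv(2) by blast
      ultimately show ?thesis by simp
    qed
  qed
  then show "u \<in> coll ` M \<Longrightarrow> u \<in> T \<Longrightarrow> v \<in> coll ` M \<Longrightarrow> v \<notin> T \<Longrightarrow> F \<in> X \<Longrightarrow> u \<in> F \<Longrightarrow> v \<in> F \<Longrightarrow>
      (F \<in> P) = (M \<inter> dup ` T = {})" by blast
  show "missing n X (coll ` M)"
    unfolding missing_def
  proof (intro conjI ballI cM)
    show "coll ` M \<notin> X"
    proof
      assume FXm: "coll ` M \<in> X"
      obtain v where v: "v \<in> coll ` M" "v \<notin> T" using nsub by blast
      \<comment> \<open>If the image were a facet, its own side would be the one that
        \<open>M\<close> uses, so its lift would be \<open>M\<close>, although \<open>M\<close> is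
        not a facet of \<open>X'\<close>.\<close>
      have "lift (coll ` M) = M"
      proof (cases "coll ` M \<inter> T = {}")
        case True
        have "M \<inter> dup ` T = {}" using True coll_dup by (force simp: image_iff)
        have "coll ` M = M"
          using missing_type[OF M]
        proof
          assume a: "M = cp ` coll ` M \<and> M \<inter> T = {}"
          have "cp x = x" if "x \<in> coll ` M" for x using that True by (auto simp: cp_def)
          then have "cp ` coll ` M = coll ` M" by force
          then show ?thesis using a by simp
        qed simp
        then show ?thesis using lift_eq_cp[OF FXm True] by simp
      next
        case False
        then obtain u where u: "u \<in> coll ` M" "u \<in> T" by blast
        have s: "(coll ` M \<in> P) = (M \<inter> dup ` T = {})" by (rule sgn[OF u v FXm u(1) v(1)])
        from missing_type[OF M] show ?thesis
        proof
          assume "M = coll ` M \<and> M \<inter> dup ` T = {}"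
          then show ?thesis using s by (simp add: lift_def)
        next
          assume a: "M = cp ` coll ` M \<and> M \<inter> T = {}"
          then have "dup u \<in> M" using u by (metis cp_def imageI)
          then have "M \<inter> dup ` T \<noteq> {}" using u(2) by blast
          then show ?thesis using s a by (simp add: lift_def)
        qed
      qed
      then have "M \<in> X'" using FXm unfolding X'_def by blast
      then show False using Mc(3) by blast
    qed
    fix w assume "w \<in> coll ` M"
    then obtain m where m: "m \<in> M" "w = coll m" by blast
    have e: "coll ` M - {w} = coll ` (M - {m})"
      using inj_on_image_set_diff[OF inj, of M "{m}"] m by simp
    have "M - {m} \<in> faces X'" using M m by (simp add: missing_def)
    then obtain G where G: "G \<in> X'" "M - {m} \<subseteq> G" by (auto simp: faces_def)
    then have "coll ` (M - {m}) \<subseteq> coll ` G" by blast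
    then have "(\<exists>F\<in>X. coll ` (M - {m}) \<subseteq> F) \<or> coll ` (M - {m}) \<subseteq> T"
      using facetX'[OF G(1)] coll_lift coll_dupT by metis
    then show "coll ` M - {w} \<in> faces X"
      unfolding e
    proof
      assume s: "coll ` (M - {m}) \<subseteq> T"
      have "card (coll ` (M - {m})) \<le> card (M - {m})" by (rule card_image_le) (use Mc in simp)
      also have "\<dots> < n" using card_remove_Suc[OF Mc(1) m(1)] Mc(2) by simp
      finally show "coll ` (M - {m}) \<in> faces X" by (rule missing_face[OF T s])
    qed (simp add: faces_def)
  qed
qed

text \<open>The measure for repeated cutting: collapsing embeds the missing facets of
  \<open>X'\<close> into those of \<open>X\<close>, and \<open>T\<close> is not hit.\<close>

theorem card_missing_cut: "card {M. missing n X' M} < card {M. missing n X M}"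
proof -
  have fin: "finite {M. missing n X M}"
  proof (rule finite_subset[of _ "Pow (\<Union>X)"])
    show "{M. missing n X M} \<subseteq> Pow (\<Union>X)"
    proof (intro subsetI CollectI PowI)
      fix M v assume M: "M \<in> {M. missing n X M}" "v \<in> M"
      then have "{v} \<in> faces X" by (intro missing_face[of n X M]) (use n in auto)
      then show "v \<in> \<Union>X" by (auto simp: faces_def)
    qed
    show "finite (Pow (\<Union>X))" using pure_finite_Union[OF pureX] by simp
  qed
  have "inj_on (image coll) {M. missing n X' M}"
  proof (rule inj_onI)
    fix M M' assume "M \<in> {M. missing n X' M}" "M' \<in> {M. missing n X' M}" and e: "coll ` M = coll ` M'"
    then have M: "missing n X' M" "missing n X' M'" by auto
    note t = missing_type[OF M(1)] missing_type[OF M(2)]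
    show "M = M'"
    proof (cases "coll ` M \<inter> T = {}")
      case True
      have "cp x = x" if "x \<in> coll ` M" for x using that True by (auto simp: cp_def)
      then have "cp ` coll ` M = coll ` M" by force
      then show ?thesis using t e by metis
    next
      case False
      then obtain u where u: "u \<in> coll ` M" "u \<in> T" by blast
      obtain v where v: "v \<in> coll ` M" "v \<notin> T" using missing_coll(3)[OF M(1)] by blast
      have "u \<noteq> v" using u v by blast
      then have "{u, v} \<in> edges X" using missing_edge[OF missing_coll(1)[OF M(1)] ns(2)] u v by blast
      then obtain F where F: "F \<in> X" "u \<in> F" "v \<in> F" by (auto simp: edges_def faces_def)
      have "(M \<inter> dup ` T = {}) = (M' \<inter> dup ` T = {})"
        using missing_coll(4)[OF M(1) u v F] missing_coll(4)[OF M(2), of u v F] u v F e by simp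
      moreover have "M \<inter> dup ` T \<noteq> {}" if "M = cp ` coll ` M"
      proof -
        have "dup u \<in> M" using that u by (metis cp_def imageI)
        then show ?thesis using u(2) by blast
      qed
      moreover have "M' \<inter> dup ` T \<noteq> {}" if "M' = cp ` coll ` M'"
      proof -
        have "dup u \<in> M'" using that u e by (metis cp_def imageI)
        then show ?thesis using u(2) by blast
      qed
      ultimately show ?thesis using t e by metis
    qed
  qed
  then have "card {M. missing n X' M} = card (image coll ` {M. missing n X' M})" by (simp add: card_image)
  also have "\<dots> \<le> card ({M. missing n X M} - {T})"
    by (rule card_mono) (use fin missing_coll(1,2) in auto)
  also have "\<dots> < card {M. missing n X M}" by (rule card_Diff1_less[OF fin]) (use T in simp)
  finally show ?thesis .
qed

lemma conn_facet: "G \<in> X' \<Longrightarrow> a \<in> G \<Longrightarrow> b \<in> G \<Longrightarrow> (a, b) \<in> {(a, b). {a, b} \<in> edges X'}\<^sup>*"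
  using edges_facet[of G X' a b] by (cases "a = b") auto

text \<open>A path of \<open>X\<close> starting at \<open>t\<close> is followed facet by facet
  through the lifts. Where it passes through \<open>T\<close> it may have to switch between the
  copies, which is harmless since \<open>C\<close> contains both. So the cut has at most two
  components.\<close>

lemma reach:
  assumes v: "v \<in> \<Union>X'" and t: "t \<in> T"
  shows "(t, v) \<in> {(a, b). {a, b} \<in> edges X'}\<^sup>* \<or> (dup t, v) \<in> {(a, b). {a, b} \<in> edges X'}\<^sup>*"
proof -
  let ?r = "{(a, b). {a, b} \<in> edges X'}"
  define C where "C = {v. (t, v) \<in> ?r\<^sup>* \<or> (dup t, v) \<in> ?r\<^sup>*}"
  have TX': "T \<in> X'" "dup ` T \<in> X'" by (auto simp: X'_def)
  have TC: "w \<in> C" "dup w \<in> C" if "w \<in> T" for w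
    using conn_facet[OF TX'(1) t that] conn_facet[OF TX'(2) imageI[OF t] imageI[OF that]] by (auto simp: C_def)
  have step: "b \<in> C" if "G \<in> X'" "a \<in> G" "b \<in> G" "a \<in> C" for G a b
    using conn_facet[OF that(1-3)] that(4) unfolding C_def by (auto intro: rtrancl_trans)
  have main: "u \<in> T \<or> u \<in> C" if u: "u \<in> \<Union>X" for u
  proof -
    have "(t, u) \<in> {(a, b). {a, b} \<in> edges X}\<^sup>*" using con u t TV unfolding conn_def by blast
    then show ?thesis
    proof (induction rule: rtrancl_induct)
      case base
      then show ?case using t by blast
    next
      case (step a b)
      then obtain F where F: "F \<in> X" "a \<in> F" "b \<in> F" by (auto simp: edges_def faces_def)
      have L: "lift F \<in> X'" using F(1) by (simp add: X'_def)
      show ?case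
      proof (cases "b \<in> T")
        case False
        have bX: "b \<in> \<Union>X" using F by blast
        have bL: "b \<in> lift F" using lift_off[OF bX False F(1)] F(3) by simp
        have "\<exists>a'\<in>lift F. a' \<in> C"
        proof (cases "a \<in> T")
          case True
          then show ?thesis using TC[OF True] lift_T[OF True F(1)] lift_dup[OF True F(1)] F(2) by blast
        next
          case nT: False
          have "a \<in> \<Union>X" using F by blast
          then have "a \<in> lift F" using lift_off nT F(1,2) by simp
          then show ?thesis using step.IH nT by blast
        qed
        then show ?thesis using \<open>\<And>G a b. \<lbrakk>G \<in> X'; a \<in> G; b \<in> G; a \<in> C\<rbrakk> \<Longrightarrow> b \<in> C\<close> L bL by blast
      qed simp
    qed
  qed
  have "v \<in> \<Union>X \<or> v \<in> dup ` T" using v UX' by blast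
  then have "v \<in> C" using main TC by blast
  then show ?thesis by (simp add: C_def)
qed

end

section \<open>Components, and the induction on the number of missing facets\<close>

definition component :: "'a set set \<Rightarrow> 'a \<Rightarrow> 'a set set" where
  "component X v = {F \<in> X. \<exists>u\<in>F. (v, u) \<in> {(a, b). {a, b} \<in> edges X}\<^sup>*}"

lemma component_subset: "component X v \<subseteq> X"
  by (auto simp: component_def)

lemma component_reach:
  assumes "F \<in> component X v" "w \<in> F"
  shows "(v, w) \<in> {(a, b). {a, b} \<in> edges X}\<^sup>*"
proof -
  obtain u where u: "F \<in> X" "u \<in> F" "(v, u) \<in> {(a, b). {a, b} \<in> edges X}\<^sup>*"
    using assms(1) by (auto simp: component_def)
  show ?thesis
  proof (cases "u = w")
    case False
    then have "{u, w} \<in> edges X" using edges_facet[OF u(1,2) assms(2)] by blast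
    then show ?thesis using u(3) by (auto intro: rtrancl_into_rtrancl)
  qed (use u in simp)
qed

lemma component_closed: "F \<in> component X v \<Longrightarrow> w \<in> F \<Longrightarrow> G \<in> X \<Longrightarrow> w \<in> G \<Longrightarrow> G \<in> component X v"
  using component_reach[of F X v w] by (auto simp: component_def)

lemma conn_component: "conn (component X v)"
  unfolding conn_def
proof (intro ballI)
  let ?r = "{(a, b). {a, b} \<in> edges X}"
  let ?s = "{(a, b). {a, b} \<in> edges (component X v)}"
  fix u w assume u: "u \<in> \<Union>(component X v)" and w: "w \<in> \<Union>(component X v)"
  have "sym ?r" by (auto simp: sym_def insert_commute)
  then have "sym (?r\<^sup>*)" by (rule sym_rtrancl)
  moreover have vu: "(v, u) \<in> ?r\<^sup>*" "(v, w) \<in> ?r\<^sup>*" using u w component_reach by fast+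
  ultimately have "(u, w) \<in> ?r\<^sup>*" by (meson rtrancl_trans symE)
  then have "(u, w) \<in> ?s\<^sup>* \<and> w \<in> \<Union>(component X v)"
  proof (induction rule: rtrancl_induct)
    case base
    then show ?case using u by blast
  next
    case (step a b)
    then obtain F where F: "F \<in> X" "a \<in> F" "b \<in> F" "a \<noteq> b" by (auto simp: edges_pair faces_def)
    obtain G where "G \<in> component X v" "a \<in> G" using step.IH by blast
    then have FC: "F \<in> component X v" using component_closed F by metis
    then have "{a, b} \<in> edges (component X v)" using edges_facet F by metis
    then show ?case using step.IH FC F(3) by (auto intro: rtrancl_into_rtrancl)
  qed
  then show "(u, w) \<in> ?s\<^sup>*" by blast
qed

lemma lk_component:
  assumes "w \<in> \<Union>(component X v)"
  shows "lk (component X v) {w} = lk X {w}"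
proof -
  obtain G where G: "G \<in> component X v" "w \<in> G" using assms by blast
  have "{F \<in> component X v. {w} \<subseteq> F} = {F \<in> X. {w} \<subseteq> F}"
    using component_subset[of X v] component_closed[OF G] by blast
  then show ?thesis by (simp only: lk_def)
qed

lemma loc_tight_component:
  assumes X: "loc_tight n X" and v: "v \<in> \<Union>X"
  shows "loc_tight n (component X v)"
  unfolding loc_tight_def
proof (intro conjI ballI)
  have P: "pure n X" using X unfolding loc_tight_def by blast
  show "pure n (component X v)" by (rule pure_subset[OF P component_subset])
  show "component X v \<noteq> {}" using v by (auto simp: component_def)
  fix w assume w: "w \<in> \<Union>(component X v)"
  then have "w \<in> \<Union>X" using component_subset by fast
  then show "normal (n - 1) (lk (component X v) {w})" "tight (n - 1) (lk (component X v) {w})"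
    using loc_tightD[OF X] lk_component[OF w] by simp_all
qed

text \<open>\<open>M\<close> shares a vertex with a facet of the component, so as a facet of
  \<open>X\<close> it would belong to the component.\<close>

lemma missing_component:
  assumes n: "2 \<le> n" and M: "missing n (component X v) M"
  shows "missing n X M"
proof -
  have Mc: "finite M" "card M = n" "M \<notin> component X v" "\<And>w. w \<in> M \<Longrightarrow> M - {w} \<in> faces (component X v)"
    using M by (auto simp: missing_def)
  have "M \<notin> X"
  proof
    assume MX: "M \<in> X"
    have "M \<noteq> {}" using Mc(2) n by auto
    then obtain w where w: "w \<in> M" by blast
    have "M \<noteq> {w}" using Mc(2) n by auto
    then obtain u where u: "u \<in> M" "u \<noteq> w" using w by blast
    obtain G where "G \<in> component X v" "M - {w} \<subseteq> G" using Mc(4)[OF w] by (auto simp: faces_def)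
    then have "M \<in> component X v" using component_closed[of G X v u M] MX u by blast
    then show False using Mc(3) by blast
  qed
  then show ?thesis using Mc faces_mono[OF component_subset[of X v]] unfolding missing_def by blast
qed

lemma missing_finite:
  assumes X: "pure n X" and n: "2 \<le> n"
  shows "finite {M. missing n X M}"
proof (rule finite_subset)
  show "{M. missing n X M} \<subseteq> Pow (\<Union>X)"
  proof (intro subsetI PowI)
    fix M v assume M: "M \<in> {M. missing n X M}" "v \<in> M"
    then have "{v} \<in> faces X" by (intro missing_face[of n X M]) (use n in auto)
    then show "v \<in> \<Union>X" by (auto simp: faces_def)
  qed
  show "finite (Pow (\<Union>X))" using pure_finite_Union[OF X] by simp
qed

lemma Union_faces: "\<Union>(faces X) = \<Union>X"
  by (auto simp: faces_def)

lemma facet_faces: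
  assumes X: "pure n X" and F: "F \<in> X"
  shows "facet (faces X) F"
  unfolding facet_def
proof (intro conjI ballI impI)
  show "F \<in> faces X" using F by (auto simp: faces_def)
  fix G assume G: "G \<in> faces X" "F \<subseteq> G"
  then obtain H where H: "H \<in> X" "G \<subseteq> H" by (auto simp: faces_def)
  then have "F = H" using card_subset_eq[OF pureD(1)[OF X H(1)], of F] pureD(2)[OF X] F G(2) by auto
  then show "G = F" using G(2) H(2) by blast
qed

lemma faces_simplex_boundary:
  assumes V: "finite V" "card V = Suc n"
  shows "faces {K. K \<subseteq> V \<and> card K = n} = Pow V - {V}"
proof (intro set_eqI iffI)
  fix G assume "G \<in> faces {K. K \<subseteq> V \<and> card K = n}"
  then obtain K where K: "K \<subseteq> V" "card K = n" "G \<subseteq> K" by (auto simp: faces_def)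
  then have "K \<noteq> V" using V by auto
  then show "G \<in> Pow V - {V}" using K by blast
next
  fix G assume G: "G \<in> Pow V - {V}"
  then obtain a where a: "a \<in> V" "a \<notin> G" by blast
  then have "card (V - {a}) = n" using V by simp
  then show "G \<in> faces {K. K \<subseteq> V \<and> card K = n}" using G a by (auto simp: faces_def intro!: exI[of _ "V - {a}"])
qed

text \<open>Every cut undoes one operation: a connected sum if the two caps end up in different
  components, a handle otherwise. Components of the cut have no more missing facets than the cut
  itself, so the induction applies to them.\<close>

theorem loc_tight_walkup:
  fixes X :: "nat set set"
  assumes n: "5 \<le> n" and "loc_tight n X" "conn X"
  shows "walkup n (faces X)"
  using assms(2,3)
proof (induction "card {M. missing n X M}" arbitrary: X rule: less_induct)
  case less
  note loc = less.prems(1) and con = less.prems(2)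
  have n': "2 \<le> n" "4 \<le> n" "3 \<le> n - 1" "Suc (n - 1) = n" using n by auto
  show ?case
  proof (cases "\<exists>T. missing n X T")
    case False
    then obtain V where V: "finite V" "card V = Suc n" "X = {K. K \<subseteq> V \<and> card K = n}"
      using no_missing_simplex[OF loc con n] by blast
    show ?thesis
      using walkup.simplex_boundary[of V n] V(2) faces_simplex_boundary[OF V(1,2)] V(3) by simp
  next
    case True
    then obtain T where T: "missing n X T" by blast
    have N: "normal n X" by (rule loc_tight_normal[OF loc con n'(1)])
    have P: "pure n X" by (rule normal_pure[OF N])
    have "\<exists>Q. sides_at n X T w Q" if w: "w \<in> T" for w
    proof -
      have "{w} \<in> faces X" by (rule missing_face[OF T]) (use w n in auto)
      then have wX: "w \<in> \<Union>X" by (auto simp: faces_def)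
      have "missing (n - 1) (lk X {w}) (T - {w})" using missing_lk[of "n - 1" X T w] T w n'(4) by simp
      then obtain A where "splits (n - 1) (lk X {w}) (T - {w}) A"
        using missing_splits[OF n'(3) loc_tightD[OF loc wX]] by blast
      then show ?thesis using splits_lk_sides_at[of "n - 1" X w T A] P w n'(4) by auto
    qed
    then obtain Q where Q: "sides n X T Q" using sides_exist[OF N n'(2) T] by blast
    define dup where "dup v = v + Suc (Max (\<Union>X))" for v
    have fresh: "dup v \<notin> \<Union>X" for v
      using Max_ge[OF pure_finite_Union[OF P], of "dup v"] by (auto simp: dup_def simp del: Union_iff)
    interpret cut n X T Q dup
      by unfold_locales (use n loc con T Q fresh in \<open>auto simp: inj_on_def dup_def simp del: Union_iff\<close>)
    obtain t where t: "t \<in> T" using T_ne by blast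
    have TX': "T \<in> X'" "dup ` T \<in> X'" by (auto simp: X'_def)
    have bij: "bij_betw coll (dup ` T) T"
      unfolding bij_betw_def
    proof
      show "inj_on coll (dup ` T)" by (rule inj_on_inverseI[of _ dup]) (auto simp: coll_dup)
      show "coll ` dup ` T = T" by (rule coll_dupT(1))
    qed
    have IH: "walkup n (faces (component X' v))" if v: "v \<in> \<Union>X'" for v
    proof (rule less.hyps[OF _ loc_tight_component[OF loc_tight_cut v] conn_component])
      have "{M. missing n (component X' v) M} \<subseteq> {M. missing n X' M}"
      proof (rule subsetI)
        fix M assume "M \<in> {M. missing n (component X' v) M}"
        then have "missing n (component X' v) M" by (rule CollectD)
        then show "M \<in> {M. missing n X' M}" by (intro CollectI missing_component[OF n'(1), of X' v M])
      qed
      then have "card {M. missing n (component X' v) M} \<le> card {M. missing n X' M}"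
        by (rule card_mono[OF missing_finite[OF pureX' n'(1)]])
      then show "card {M. missing n (component X' v) M} < card {M. missing n X M}"
        using card_missing_cut by linarith
    qed
    have tX': "t \<in> \<Union>X'" "dup t \<in> \<Union>X'" using TX' t by blast+
    let ?X1 = "component X' t" and ?X2 = "component X' (dup t)"
    have un: "X' = ?X2 \<union> ?X1"
    proof
      show "X' \<subseteq> ?X2 \<union> ?X1"
      proof
        fix G assume G: "G \<in> X'"
        then have "G \<noteq> {}" using pureD(2)[OF pureX' G] n by auto
        then obtain v where v: "v \<in> G" by blast
        then have "v \<in> \<Union>X'" using G by blast
        from reach[OF this t] show "G \<in> ?X2 \<union> ?X1" using G v by (auto simp: component_def)
      qed
      show "?X2 \<union> ?X1 \<subseteq> X'" by (intro Un_least component_subset)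
    qed
    have in1: "T \<in> ?X1" and in2: "dup ` T \<in> ?X2" using TX' t by (auto simp: component_def)
    have pure12: "pure n ?X1" "pure n ?X2" using pure_subset[OF pureX' component_subset] by auto
    show ?thesis
    proof (cases "\<Union>?X2 \<inter> \<Union>?X1 = {}")
      case True
      have "walkup n (glue (dup ` T) coll (faces ?X2 \<union> faces ?X1))"
        by (rule walkup.connected_sum[OF IH[OF tX'(2)] IH[OF tX'(1)] _ facet_faces[OF pure12(2) in2]
            facet_faces[OF pure12(1) in1] bij]) (simp only: Union_faces True)
      moreover have "faces ?X2 \<union> faces ?X1 = faces X'" by (subst un) (auto simp: faces_def)
      ultimately show ?thesis by (simp only: glue_cut)
    next
      case False
      then obtain G H v where GH: "G \<in> ?X2" "H \<in> ?X1" "v \<in> G" "v \<in> H" by blast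
      have GX: "G \<in> X'" using GH(1) component_subset by (rule subsetD[rotated])
      have G1: "G \<in> ?X1" by (rule component_closed[OF GH(2,4) GX GH(3)])
      have "?X2 \<subseteq> ?X1"
      proof
        fix F assume F: "F \<in> ?X2"
        let ?r = "{(a, b). {a, b} \<in> edges X'}"
        have "F \<noteq> {}" using pureD(2)[OF pure12(2) F] n by auto
        then obtain u where u: "u \<in> F" by blast
        have "sym (?r\<^sup>*)" by (rule sym_rtrancl) (auto simp: sym_def insert_commute)
        moreover have "(t, v) \<in> ?r\<^sup>*" by (rule component_reach[OF G1 GH(3)])
        moreover have "(dup t, v) \<in> ?r\<^sup>*" by (rule component_reach[OF GH(1,3)])
        moreover have "(dup t, u) \<in> ?r\<^sup>*" by (rule component_reach[OF F u])
        ultimately have "(t, u) \<in> ?r\<^sup>*" by (meson rtrancl_trans symE)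
        then show "F \<in> ?X1" using F u component_subset[of X' "dup t"] by (auto simp: component_def)
      qed
      then have "?X1 = X'" using un by blast
      then have "walkup n (faces X')" using IH[OF tX'(1)] by simp
      then have "walkup n (glue (dup ` T) coll (faces X'))"
        by (rule walkup.handle[OF _ facet_faces[OF pureX' TX'(2)] facet_faces[OF pureX' TX'(1)] bij distance_cut])
      then show ?thesis by (simp only: glue_cut)
    qed
  qed
qed

section \<open>Homology manifolds\<close>

lemma sum_fun_apply: "sum f A x = (\<Sum>a\<in>A. f a x)"
  for f :: "'a \<Rightarrow> 'b \<Rightarrow> 'k::field"
  by (induction A rule: infinite_finite_induct) simp_all

definition unit_fun :: "'b \<Rightarrow> 'b \<Rightarrow> 'k::field" where
  "unit_fun v = (\<lambda>w. if w = v then 1 else 0)"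

lemma finite_support_span:
  fixes c :: "'b \<Rightarrow> 'k::field"
  assumes "finite L" "\<And>v. c v \<noteq> 0 \<Longrightarrow> v \<in> L"
  shows "c \<in> fun_space.span (unit_fun ` L)"
proof -
  have "c = (\<Sum>v\<in>L. fun_scale (c v) (unit_fun v))"
  proof
    fix x
    have "(\<Sum>v\<in>L. c v * unit_fun v x) = (\<Sum>v\<in>L. if v = x then c x else 0)"
      by (rule sum.cong) (auto simp: unit_fun_def)
    then show "c x = (\<Sum>v\<in>L. fun_scale (c v) (unit_fun v)) x"
      using assms by (auto simp: sum_fun_apply fun_scale_def)
  qed
  also have "\<dots> \<in> fun_space.span (unit_fun ` L)"
    by (intro fun_space.span_sum fun_space.span_scale fun_space.span_base imageI)
  finally show ?thesis .
qed

lemma complex_finite_Union: "simplicial_complex K \<Longrightarrow> finite (\<Union>K)"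
  by (auto simp: simplicial_complex_def)

lemma chains_finite_span:
  assumes K: "simplicial_complex K"
  shows "\<exists>S. finite S \<and> (chains K i :: ('a list \<Rightarrow> 'k::field) set) \<subseteq> fun_space.span S"
proof -
  let ?L = "{vs. set vs \<subseteq> \<Union>K \<and> length vs = nat (i + 1)}"
  have fin: "finite ?L" by (rule finite_lists_length_eq[OF complex_finite_Union[OF K]])
  have "c \<in> fun_space.span (unit_fun ` ?L)" if c: "c \<in> chains K i" for c :: "'a list \<Rightarrow> 'k"
  proof (rule finite_support_span[OF fin])
    fix vs assume "c vs \<noteq> 0"
    then have "set vs \<in> K" "int (length vs) = i + 1" using c by (auto simp: chains_def)
    then show "vs \<in> ?L" by auto
  qed
  then show ?thesis using fin by (intro exI[of _ "unit_fun ` ?L"]) auto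
qed

text \<open>\<open>C\<close> completes a basis of \<open>Bd\<close> to one of \<open>Cy\<close>, so
  it represents a basis of the quotient.\<close>

lemma quotient_basis:
  assumes sub: "Bd \<subseteq> Cy" and S: "Cy \<subseteq> fun_space.span S" "finite S"
  obtains B C where "B \<subseteq> Bd" "C \<subseteq> Cy" "B \<inter> C = {}" "fun_space.independent (B \<union> C)" "Bd \<subseteq> fun_space.span B"
    "Cy \<subseteq> fun_space.span (B \<union> C)" "finite C" "card C = fun_space.dim Cy - fun_space.dim Bd"
proof -
  obtain B where "{} \<subseteq> B" and B: "B \<subseteq> Bd" "fun_space.independent B" "Bd \<subseteq> fun_space.span B"
    by (rule fun_space.maximal_independent_subset_extend[OF empty_subsetI fun_space.independent_empty])
  have "B \<subseteq> Cy" using B(1) sub by (rule subset_trans)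
  obtain A where A: "B \<subseteq> A" "A \<subseteq> Cy" "fun_space.independent A" "Cy \<subseteq> fun_space.span A"
    by (rule fun_space.maximal_independent_subset_extend[OF \<open>B \<subseteq> Cy\<close> B(2)])
  have finA: "finite A" using fun_space.independent_span_bound[OF S(2) A(3)] A(2) S(1) by blast
  have "card A = fun_space.dim Cy" by (rule fun_space.basis_card_eq_dim[OF A(2,4,3)])
  moreover have "card B = fun_space.dim Bd" by (rule fun_space.basis_card_eq_dim[OF B(1,3,2)])
  moreover have "card (A - B) = card A - card B"
    by (rule card_Diff_subset[OF finite_subset[OF A(1) finA] A(1)])
  moreover have "B \<union> (A - B) = A" using A(1) by blast
  ultimately show ?thesis using that[of B "A - B"] A B(1,3) finA by auto
qed

lemma homology_basis:
  assumes K: "simplicial_complex K"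
  obtains B C :: "('a list \<Rightarrow> 'k::field) set" where "B \<subseteq> boundaries K i" "C \<subseteq> cycles K i" "B \<inter> C = {}"
    "fun_space.independent (B \<union> C)" "boundaries K i \<subseteq> fun_space.span B"
    "cycles K i \<subseteq> fun_space.span (B \<union> C)" "finite C" "card C = reduced_betti TYPE('k) K i"
proof -
  obtain S :: "('a list \<Rightarrow> 'k) set" where S: "finite S" "chains K i \<subseteq> fun_space.span S"
    using chains_finite_span[OF K] by blast
  have "cycles K i \<subseteq> fun_space.span S" using S(2) by (auto simp: cycles_def)
  from quotient_basis[OF boundaries_subset_cycles[OF K] this S(1)] show ?thesis
    using that unfolding reduced_betti_def by blast
qed

section \<open>Homology in degrees 0 and 1 through vertices and edges\<close>

lemma chains_swap: "c \<in> chains K i \<Longrightarrow> c (us @ y # x # ws) = - c (us @ x # y # ws)"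
  unfolding chains_def by blast

lemma chains_support:
  assumes "c \<in> chains K i" "c vs \<noteq> 0"
  shows "distinct vs" "set vs \<in> K" "int (length vs) = i + 1"
  using assms unfolding chains_def by blast+

definition point_diff :: "'a \<Rightarrow> 'a \<Rightarrow> 'a list \<Rightarrow> 'k::field" where
  "point_diff u w = (\<lambda>vs. if vs = [u] then 1 else if vs = [w] then -1 else 0)"

lemma point_diff_cycle:
  assumes K: "simplicial_complex K" and uw: "u \<in> \<Union>K" "w \<in> \<Union>K" "u \<noteq> w"
  shows "(point_diff u w :: 'a list \<Rightarrow> 'k::field) \<in> cycles K 0"
proof -
  have sing: "{v} \<in> K" if "v \<in> \<Union>K" for v
    using that K unfolding simplicial_complex_def by (metis UnionE empty_subsetI insert_subset)
  have "boundary_map K (point_diff u w :: 'a list \<Rightarrow> 'k) vs = 0" for vs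
  proof (cases vs)
    case Nil
    have "boundary_map K (point_diff u w :: 'a list \<Rightarrow> 'k) [] =
        (\<Sum>v\<in>\<Union>K. (if v = u then 1 else 0) + (if v = w then - 1 else 0))"
      unfolding boundary_map_def by (rule sum.cong) (use uw in \<open>auto simp: point_diff_def\<close>)
    also have "\<dots> = 0"
      using complex_finite_Union[OF K] uw by (simp add: sum.distrib del: Union_iff)
    finally show ?thesis by (simp only: Nil)
  next
    case (Cons a list)
    then show ?thesis unfolding boundary_map_def by (intro sum.neutral) (simp add: point_diff_def)
  qed
  then show ?thesis
    using sing[OF uw(1)] sing[OF uw(2)]
    by (auto simp: cycles_def chains_def point_diff_def fun_eq_iff append_eq_Cons_conv split: if_splits)
qed

lemma span_zero_functional:
  fixes c :: "'b \<Rightarrow> 'k::field"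
  assumes "c \<in> fun_space.span S"
    and M: "\<And>x y. M (x + y) = M x + M y" "\<And>a x. M (fun_scale a x) = a * (M x :: 'k)"
    and "\<And>x. x \<in> S \<Longrightarrow> M x = 0"
  shows "M c = 0"
proof -
  have "M 0 = 0" using M(2)[of 0 0] by (simp add: fun_scale_def zero_fun_def)
  then have "fun_space.subspace {x. M x = 0}" unfolding fun_space.subspace_def using M by auto
  then have "fun_space.span S \<subseteq> {x. M x = 0}" by (intro fun_space.span_minimal) (use assms(4) in auto)
  then show ?thesis using assms(1) by blast
qed

text \<open>Adding up the coefficients over the component of \<open>u\<close> is a functional that
  vanishes on boundaries; it would not vanish on the cycle \<open>[u] - [w]\<close> if
  \<open>w\<close> were outside that component.\<close>

lemma betti_0_connected:
  assumes K: "simplicial_complex K" and b: "reduced_betti TYPE('k::field) K 0 = 0" and uw: "u \<in> \<Union>K" "w \<in> \<Union>K"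
  shows "(u, w) \<in> (skeleton1 K)\<^sup>*"
proof (rule ccontr)
  assume no: "(u, w) \<notin> (skeleton1 K)\<^sup>*"
  define U where "U = {v \<in> \<Union>K. (u, v) \<in> (skeleton1 K)\<^sup>*}"
  have fin: "finite (\<Union>K)" by (rule complex_finite_Union[OF K])
  have finU: "finite U" by (rule finite_subset[OF _ fin]) (auto simp: U_def)
  have uU: "u \<in> U" and wU: "w \<notin> U" using uw no by (auto simp: U_def)
  obtain B C :: "('a list \<Rightarrow> 'k) set" where BC: "B \<subseteq> boundaries K 0" "cycles K 0 \<subseteq> fun_space.span (B \<union> C)"
    "finite C" "card C = 0"
    using homology_basis[OF K, where 'k = 'k and i = 0] b by metis
  let ?D = "point_diff u w :: 'a list \<Rightarrow> 'k"
  have ne: "u \<noteq> w" using uU wU by blast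
  have "?D \<in> fun_space.span B" using BC(2-4) point_diff_cycle[OF K uw ne, where 'k = 'k] by auto
  then have "(\<Sum>v\<in>U. ?D [v]) = 0"
  proof (rule span_zero_functional)
    fix x assume "x \<in> B"
    then obtain c where c: "c \<in> chains K 1" "x = boundary_map K c" using BC(1) by (auto simp: boundaries_def)
    have out: "c [y, v] = 0" if "v \<in> U" "y \<in> \<Union>K - U" for v y
    proof (rule ccontr)
      assume "c [y, v] \<noteq> 0"
      then have "distinct [y, v]" "set [y, v] \<in> K" using chains_support[OF c(1)] by blast+
      then have "(v, y) \<in> skeleton1 K" by (auto simp: skeleton1_def insert_commute)
      then have "y \<in> U" using that by (auto simp: U_def intro: rtrancl_into_rtrancl)
      then show False using that by blast
    qed
    have "(\<Sum>v\<in>U. x [v]) = (\<Sum>v\<in>U. \<Sum>y\<in>U. c [y, v])"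
    proof (rule sum.cong[OF refl])
      fix v assume "v \<in> U"
      then show "x [v] = (\<Sum>y\<in>U. c [y, v])"
        unfolding c(2) boundary_map_def using fin out
        by (intro sum.mono_neutral_right) (auto simp: U_def)
    qed
    also have "\<dots> = 0"
    proof (rule double_sum_alternating[where g = "\<lambda>y v. c [y, v]"])
      show "c [y, v] = - c [v, y]" for y v using chains_swap[OF c(1), of "[]" y v "[]"] by simp
      show "c [v, v] = 0" for v using chains_support(1)[OF c(1), of "[v, v]"] by auto
    qed
    finally show "(\<Sum>v\<in>U. x [v]) = 0" .
  qed (simp_all add: sum.distrib fun_scale_def sum_distrib_left)
  moreover have "(\<Sum>v\<in>U. ?D [v]) = (\<Sum>v\<in>U. if v = u then 1 else 0)"
    by (rule sum.cong) (use wU in \<open>auto simp: point_diff_def\<close>)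
  ultimately show False using finU uU by simp
qed

text \<open>Without edges the boundaries in degree 0 vanish, so the cycles form a line. A single
  vertex carries no nonzero reduced cycle, and three vertices carry two independent ones.\<close>

lemma betti_0_two_points:
  assumes K: "simplicial_complex K" "\<And>F. F \<in> K \<Longrightarrow> card F \<le> 1" and b: "reduced_betti TYPE('k::field) K 0 = 1"
  shows "card (\<Union>K) = 2"
proof -
  have fin: "finite (\<Union>K)" by (rule complex_finite_Union[OF K(1)])
  obtain B C :: "('a list \<Rightarrow> 'k) set" where BC: "B \<subseteq> boundaries K 0" "C \<subseteq> cycles K 0"
    "fun_space.independent (B \<union> C)" "cycles K 0 \<subseteq> fun_space.span (B \<union> C)" "finite C" "card C = 1"
    using homology_basis[OF K(1), where 'k = 'k and i = 0] b by metis
  have "x = 0" if x: "x \<in> boundaries K 0" for x :: "'a list \<Rightarrow> 'k"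
  proof -
    obtain c where c: "c \<in> chains K 1" "x = boundary_map K c" using x by (auto simp: boundaries_def)
    have "c vs = 0" for vs
    proof (rule ccontr)
      assume "c vs \<noteq> 0"
      from chains_support[OF c(1) this] K(2)[of "set vs"] show False by (simp add: distinct_card)
    qed
    then show ?thesis by (simp add: c(2) boundary_map_def fun_eq_iff)
  qed
  moreover have no0: "0 \<notin> B \<union> C" using BC(3) fun_space.dependent_zero by blast
  ultimately have "B = {}" using BC(1) by blast
  obtain c where c: "C = {c}" using BC(6) by (auto simp: card_1_singleton_iff)
  have cC: "c \<in> cycles K 0" "c \<noteq> 0" using BC(2) no0 c by auto
  have span: "\<exists>a. x = fun_scale a c" if "x \<in> cycles K 0" for x
    using BC(4) that \<open>B = {}\<close> c by (auto simp: fun_space.span_singleton)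
  have "card (\<Union>K) \<noteq> 0 \<and> card (\<Union>K) \<noteq> 1"
  proof -
    have "\<exists>u\<in>\<Union>K. \<exists>w\<in>\<Union>K. u \<noteq> w"
    proof (rule ccontr)
      assume no: "\<not> ?thesis"
      have "c vs = 0" for vs
      proof (rule ccontr)
        assume nz: "c vs \<noteq> 0"
        have ch: "c \<in> chains K 0" using cC(1) by (simp add: cycles_def)
        have "length vs = 1" "set vs \<in> K" using chains_support[OF ch nz] by auto
        then obtain v where v: "vs = [v]" by (auto simp: length_Suc_conv)
        then have vK: "v \<in> \<Union>K" using \<open>set vs \<in> K\<close> by (intro UnionI) auto
        have "\<Union>K = {v}" using no vK by blast
        moreover have "boundary_map K c [] = 0" using cC(1) by (simp add: cycles_def)
        ultimately show False using nz v by (simp add: boundary_map_def)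
      qed
      then show False using cC(2) by (auto simp: fun_eq_iff)
    qed
    then show ?thesis using fin card_le_Suc0_iff_eq[OF fin] by (metis One_nat_def card_0_eq empty_iff le_refl)
  qed
  moreover have "\<not> 3 \<le> card (\<Union>K)"
  proof
    assume "3 \<le> card (\<Union>K)"
    then obtain S where S: "S \<subseteq> \<Union>K" "card S = 3" by (rule obtain_subset_with_card_n)
    obtain u v w where uvw': "S = {u, v, w}" "u \<noteq> v" "u \<noteq> w" "v \<noteq> w"
      using S(2) by (auto simp: card_3_iff)
    have uvw: "u \<in> \<Union>K" "v \<in> \<Union>K" "w \<in> \<Union>K" "u \<noteq> v" "u \<noteq> w" "v \<noteq> w"
      using S(1) uvw' by blast+
    obtain a where a: "point_diff u v = fun_scale a c" using span[OF point_diff_cycle[OF K(1) uvw(1,2,4)]] by blast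
    obtain a' where a': "point_diff u w = fun_scale a' c" using span[OF point_diff_cycle[OF K(1) uvw(1,3,5)]] by blast
    have "point_diff u v [v] = a * c [v]" "point_diff u w [v] = a' * c [v]" "point_diff u w [w] = a' * c [w]"
      using a a' by (simp_all add: fun_scale_def)
    then show False using uvw by (auto simp: point_diff_def)
  qed
  ultimately show ?thesis by linarith
qed

definition edge_chain :: "'a \<Rightarrow> 'a \<Rightarrow> 'a list \<Rightarrow> 'k::field" where
  "edge_chain u w = (\<lambda>vs. if u = w then 0 else if vs = [u, w] then 1 else if vs = [w, u] then -1 else 0)"

text \<open>Sorted by the first vertex, with the opposite edge in cyclic order. Since
  \<open>boundary_map\<close> sums over first vertices, the boundary can be read off.\<close>

definition triangle_chain :: "'a \<Rightarrow> 'a \<Rightarrow> 'a \<Rightarrow> 'a list \<Rightarrow> 'k::field" where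
  "triangle_chain a b c = (\<lambda>vs. case vs of [] \<Rightarrow> 0 | v # xs \<Rightarrow>
     if v = a then edge_chain b c xs else if v = b then edge_chain c a xs else if v = c then edge_chain a b xs else 0)"

lemma edge_chain_swap: "edge_chain w u = - edge_chain u w"
  by (auto simp: edge_chain_def fun_eq_iff)

lemma edge_chain_alt: "(edge_chain u w :: 'a list \<Rightarrow> 'k::field) (us @ y # x # ws) = - edge_chain u w (us @ x # y # ws)"
  by (cases us) (auto simp: edge_chain_def)

lemma edge_chain_support:
  assumes "edge_chain u w vs \<noteq> 0"
  shows "u \<noteq> w \<and> (vs = [u, w] \<or> vs = [w, u])"
proof (rule ccontr)
  assume "\<not> ?thesis"
  then show False using assms unfolding edge_chain_def by presburger
qed

lemma triangle_chain_chain: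
  assumes K: "{a, b, c} \<in> K" and abc: "a \<noteq> b" "a \<noteq> c" "b \<noteq> c"
  shows "(triangle_chain a b c :: 'a list \<Rightarrow> 'k::field) \<in> chains K 2"
  unfolding chains_def
proof (intro CollectI conjI allI impI)
  fix vs assume "triangle_chain a b c vs \<noteq> (0 :: 'k)"
  then have "vs \<in> {[a, b, c], [a, c, b], [b, c, a], [b, a, c], [c, a, b], [c, b, a]}"
    by (auto simp: triangle_chain_def split: list.splits if_splits dest!: edge_chain_support)
  then show "distinct vs" "set vs \<in> K" "int (length vs) = 2 + 1"
    using K abc by (auto simp: insert_commute)
next
  fix us x y ws
  show "triangle_chain a b c (us @ y # x # ws) = - (triangle_chain a b c (us @ x # y # ws) :: 'k)"
  proof (cases us)
    case Nil
    then show ?thesis using abc by (auto simp: triangle_chain_def edge_chain_def)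
  next
    case (Cons v us')
    then show ?thesis using edge_chain_alt[where 'k = 'k, of _ _ us' y x ws] by (simp add: triangle_chain_def)
  qed
qed

lemma boundary_triangle_chain:
  assumes K: "simplicial_complex K" "{a, b, c} \<in> K" and abc: "a \<noteq> b" "a \<noteq> c" "b \<noteq> c"
  shows "boundary_map K (triangle_chain a b c :: 'a list \<Rightarrow> 'k::field) = edge_chain a b + edge_chain b c + edge_chain c a"
proof
  fix vs
  have V: "a \<in> \<Union>K" "b \<in> \<Union>K" "c \<in> \<Union>K" using K(2) by blast+
  have "boundary_map K (triangle_chain a b c :: 'a list \<Rightarrow> 'k) vs =
      (\<Sum>v\<in>\<Union>K. (if v = a then edge_chain b c vs else 0) + (if v = b then edge_chain c a vs else 0) +
        (if v = c then edge_chain a b vs else 0))"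
    unfolding boundary_map_def by (rule sum.cong) (use abc in \<open>auto simp: triangle_chain_def\<close>)
  also have "\<dots> = edge_chain b c vs + edge_chain c a vs + edge_chain a b vs"
    using complex_finite_Union[OF K(1)] V by (simp add: sum.distrib del: Union_iff)
  finally show "boundary_map K (triangle_chain a b c :: 'a list \<Rightarrow> 'k) vs =
      (edge_chain a b + edge_chain b c + edge_chain c a) vs" by (simp add: add_ac)
qed

lemma chains_1_span:
  assumes c: "c \<in> chains K 1" and K: "simplicial_complex K"
  shows "c \<in> fun_space.span {edge_chain u w |u w. u \<noteq> w \<and> {u, w} \<in> K}"
proof -
  define E where "E = {e \<in> K. card e = 2}"
  have finE: "finite E" using K by (simp add: simplicial_complex_def E_def)
  have oe: "e = {fst (ori e), snd (ori e)}" if "e \<in> E" for e by (rule ori) (use that in \<open>simp add: E_def\<close>)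
  have odist: "fst (ori e) \<noteq> snd (ori e)" if e: "e \<in> E" for e
  proof
    assume "fst (ori e) = snd (ori e)"
    then obtain x where "e = {x}" using oe[OF e] by auto
    then show False using e by (simp add: E_def)
  qed
  let ?t = "\<lambda>e. fun_scale (c [fst (ori e), snd (ori e)]) (edge_chain (fst (ori e)) (snd (ori e)))"
  have "c = (\<Sum>e\<in>E. ?t e)"
  proof
    fix vs
    have z: "?t e vs = 0" if "e \<in> E" "set vs \<noteq> e" for e
    proof -
      have "edge_chain (fst (ori e)) (snd (ori e)) vs = (0 :: 'b)"
      proof (rule ccontr)
        assume "\<not> ?thesis"
        then have "set vs = {fst (ori e), snd (ori e)}" using edge_chain_support by fastforce
        then show False using oe[OF that(1)] that(2) by simp
      qed
      then show ?thesis by (simp add: fun_scale_def)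
    qed
    show "c vs = (\<Sum>e\<in>E. ?t e) vs"
    proof (cases "set vs \<in> E \<and> length vs = 2")
      case True
      have "(\<Sum>e\<in>E. ?t e vs) = (\<Sum>e\<in>{set vs}. ?t e vs)"
        by (rule sum.mono_neutral_right) (use finE True z in auto)
      also have "\<dots> = c vs"
      proof -
        obtain x y where xy: "vs = [x, y]" using True by (auto simp: length_Suc_conv numeral_2_eq_2)
        obtain u w where uw: "ori (set vs) = (u, w)" by fastforce
        have "{x, y} = {u, w}" "u \<noteq> w" using oe[of "set vs"] odist[of "set vs"] True xy uw by auto
        then have "(x = u \<and> y = w) \<or> (x = w \<and> y = u)" by (auto simp: doubleton_eq_iff)
        then show ?thesis
          using uw \<open>u \<noteq> w\<close> chains_swap[OF c, of "[]" u w "[]"]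
          unfolding xy by (auto simp: fun_scale_def edge_chain_def)
      qed
      finally show ?thesis by (simp add: sum_fun_apply)
    next
      case False
      have "c vs = 0"
      proof (rule ccontr)
        assume nz: "c vs \<noteq> 0"
        from chains_support[OF c nz] False show False by (auto simp: E_def distinct_card)
      qed
      moreover have "?t e vs = 0" if e: "e \<in> E" for e
      proof (rule ccontr)
        assume nz: "?t e vs \<noteq> 0"
        then have "edge_chain (fst (ori e)) (snd (ori e)) vs \<noteq> (0 :: 'b)" by (auto simp: fun_scale_def)
        then have "length vs = 2" using edge_chain_support by fastforce
        moreover have "set vs = e" using z[OF e] nz by blast
        ultimately show False using False e by simp
      qed
      ultimately show ?thesis by (simp add: sum_fun_apply)
    qed
  qed
  also have "\<dots> \<in> fun_space.span {edge_chain u w |u w. u \<noteq> w \<and> {u, w} \<in> K}"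
  proof (intro fun_space.span_sum fun_space.span_scale fun_space.span_base)
    fix e assume e: "e \<in> E"
    then have "{fst (ori e), snd (ori e)} \<in> K" using oe[OF e] by (simp add: E_def)
    then show "edge_chain (fst (ori e)) (snd (ori e)) \<in> {edge_chain u w |u w. u \<noteq> w \<and> {u, w} \<in> K}"
      using odist[OF e] by blast
  qed
  finally show ?thesis .
qed

text \<open>The cocycles are the coordinate functionals of the homology classes in \<open>C\<close>,
  extended by means of a basis of the whole function space. They vanish on boundaries, in particular
  on those of triangles.\<close>

theorem betti_1_cocycles:
  fixes K :: "'a set set"
  assumes K: "simplicial_complex K" and X: "faces X = K"
  shows "\<exists>z :: nat \<Rightarrow> 'a \<Rightarrow> 'a \<Rightarrow> 'k::field. indep_cocycles X (reduced_betti TYPE('k) K 1) z"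
proof -
  obtain B C :: "('a list \<Rightarrow> 'k) set" where BC: "B \<subseteq> boundaries K 1" "C \<subseteq> cycles K 1" "B \<inter> C = {}"
    "fun_space.independent (B \<union> C)" "boundaries K 1 \<subseteq> fun_space.span B"
    "finite C" "card C = reduced_betti TYPE('k) K 1"
    using homology_basis[OF K, where 'k = 'k and i = 1] by metis
  define r where "r = reduced_betti TYPE('k) K 1"
  obtain g where g: "bij_betw g {..<r} C"
    using ex_bij_betw_nat_finite[OF BC(6)] BC(7) by (auto simp: r_def atLeast0LessThan)
  let ?A = "fun_space.extend_basis (B \<union> C)"
  have A: "fun_space.independent ?A" "fun_space.span ?A = UNIV" "B \<union> C \<subseteq> ?A"
    using fun_space.independent_extend_basis[OF BC(4)] fun_space.span_extend_basis[OF BC(4)]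
      fun_space.extend_basis_superset[OF BC(4)] by auto
  define \<zeta> where "\<zeta> j c = fun_space.representation ?A c (g j)" for j c
  have \<zeta>_add: "\<zeta> j (x + y) = \<zeta> j x + \<zeta> j y" for j x y
    using fun_space.representation_add[OF A(1), of y x] A(2) by (simp add: \<zeta>_def)
  have \<zeta>_scale: "\<zeta> j (fun_scale a x) = a * \<zeta> j x" for j a x
    using fun_space.representation_scale[OF A(1), of x a] A(2) by (simp add: \<zeta>_def)
  have \<zeta>_neg: "\<zeta> j (- x) = - \<zeta> j x" for j x
    using fun_space.representation_neg[OF A(1), of x] A(2) by (simp add: \<zeta>_def)
  have \<zeta>_0: "\<zeta> j 0 = 0" for j by (simp add: \<zeta>_def fun_space.representation_zero)
  have gC: "g j \<in> C" if "j < r" for j using g that by (auto simp: bij_betw_def)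
  have \<zeta>_C: "\<zeta> j (g i) = (if i = j then 1 else 0)" if "i < r" "j < r" for i j
  proof -
    have "g j = g i \<longleftrightarrow> i = j" using g that by (auto simp: bij_betw_def inj_on_def)
    moreover have "g i \<in> ?A" using gC[OF that(1)] A(3) by blast
    ultimately show ?thesis by (simp add: \<zeta>_def fun_space.representation_basis[OF A(1)])
  qed
  have \<zeta>_B: "\<zeta> j x = 0" if "j < r" "x \<in> boundaries K 1" for j x
  proof -
    have xB: "x \<in> fun_space.span B" using that(2) BC(5) by blast
    have "g j \<notin> B" using gC[OF that(1)] BC(3) by blast
    moreover have "fun_space.representation ?A x = fun_space.representation B x"
      by (rule fun_space.representation_extend[OF A(1) xB]) (use A(3) in blast)
    ultimately show ?thesis using fun_space.representation_ne_zero[of B x "g j"] unfolding \<zeta>_def by metis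
  qed
  define z where "z j u w = \<zeta> j (edge_chain u w)" for j u w
  have coc: "cocycle X (z j)" if j: "j < r" for j
    unfolding cocycle_def
  proof (intro allI impI)
    fix a b c assume abc: "{a, b, c} \<in> faces X"
    have e0: "edge_chain u u = (0 :: 'a list \<Rightarrow> 'k)" for u by (simp add: edge_chain_def fun_eq_iff)
    have sw: "z j u w = - z j w u" for u w unfolding z_def by (subst edge_chain_swap) (rule \<zeta>_neg)
    have z0: "z j u u = 0" for u by (simp add: z_def e0 \<zeta>_0)
    show "z j a b + z j b c = z j a c"
    proof (cases "a = b \<or> b = c \<or> a = c")
      case True
      then show ?thesis using z0 sw[of a b] by auto
    next
      case False
      then have d: "a \<noteq> b" "a \<noteq> c" "b \<noteq> c" by auto
      have abK: "{a, b, c} \<in> K" using abc X by simp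
      have "boundary_map K (triangle_chain a b c :: 'a list \<Rightarrow> 'k) \<in> boundaries K 1"
        using triangle_chain_chain[OF abK d] by (auto simp: boundaries_def)
      then have "\<zeta> j (edge_chain a b + edge_chain b c + edge_chain c a) = 0"
        using \<zeta>_B[OF j] by (simp add: boundary_triangle_chain[OF K abK d])
      then have "z j a b + z j b c + z j c a = 0" by (simp add: \<zeta>_add z_def)
      then show ?thesis using sw[of c a] by simp
    qed
  qed
  have "a i = 0"
    if eq: "\<forall>u w. {u, w} \<in> edges X \<longrightarrow> (\<Sum>j<r. a j * z j u w) = \<eta> u - \<eta> w" and i: "i < r" for a \<eta> i
  proof -
    have finV: "finite (\<Union>K)" by (rule complex_finite_Union[OF K])
    \<comment> \<open>If the combination is the coboundary of \<open>\<eta>\<close>, then adding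
      \<open>\<eta>\<close> applied to the boundary gives a functional that vanishes on every edge,
      hence on all 1-chains. On the cycle \<open>g i\<close> the added term is 0 and the rest is
      \<open>a i\<close>.\<close>
    define M where "M c = (\<Sum>j<r. a j * \<zeta> j c) + (\<Sum>v\<in>\<Union>K. \<eta> v * boundary_map K c [v])" for c
    have "M (g i) = 0"
    proof (rule span_zero_functional[where M = M and c = "g i"])
      have gi: "g i \<in> cycles K 1" using gC[OF i] BC(2) by blast
      then show "g i \<in> fun_space.span {edge_chain u w |u w. u \<noteq> w \<and> {u, w} \<in> K}"
        by (intro chains_1_span[OF _ K]) (simp add: cycles_def)
    next
      show "M (x + y) = M x + M y" for x y
        by (simp add: M_def \<zeta>_add boundary_map_def sum.distrib distrib_left)
      show "M (fun_scale s x) = s * M x" for s x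
      proof -
        have "boundary_map K (fun_scale s x) vs = s * boundary_map K x vs" for vs
          by (simp add: boundary_map_def fun_scale_def sum_distrib_left)
        then show ?thesis by (simp add: M_def \<zeta>_scale sum_distrib_left distrib_left mult_ac)
      qed
    next
      fix x :: "'a list \<Rightarrow> 'k" assume "x \<in> {edge_chain u w |u w. u \<noteq> w \<and> {u, w} \<in> K}"
      then obtain u w where uw: "x = edge_chain u w" "u \<noteq> w" "{u, w} \<in> K" by blast
      have V: "u \<in> \<Union>K" "w \<in> \<Union>K" using uw(3) by blast+
      have "(\<Sum>y\<in>\<Union>K. x [y, v]) = (\<Sum>y\<in>\<Union>K. (if y = u then of_bool (v = w) else 0) + (if y = w then - of_bool (v = u) else 0))" for v
        by (rule sum.cong) (use uw in \<open>auto simp: edge_chain_def\<close>)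
      then have "boundary_map K x [v] = of_bool (v = w) - of_bool (v = u)" for v
        unfolding boundary_map_def using finV V by (simp add: sum.distrib del: Union_iff)
      then have "(\<Sum>v\<in>\<Union>K. \<eta> v * boundary_map K x [v]) = (\<Sum>v\<in>\<Union>K. (if v = w then \<eta> w else 0) - (if v = u then \<eta> u else 0))"
        by (intro sum.cong refl) (auto simp: right_diff_distrib)
      also have "\<dots> = \<eta> w - \<eta> u" using finV V by (simp add: sum_subtractf del: Union_iff)
      finally have "(\<Sum>v\<in>\<Union>K. \<eta> v * boundary_map K x [v]) = \<eta> w - \<eta> u" .
      moreover have "(\<Sum>j<r. a j * \<zeta> j x) = \<eta> u - \<eta> w"
        using eq uw X by (simp add: z_def edges_pair)
      ultimately show "M x = 0" by (simp add: M_def)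
    qed
    moreover have "boundary_map K (g i) = 0" using gC[OF i] BC(2) by (auto simp: cycles_def)
    then have "M (g i) = (\<Sum>j<r. a j * \<zeta> j (g i))" by (simp add: M_def)
    moreover have "(\<Sum>j<r. a j * \<zeta> j (g i)) = (\<Sum>j<r. if j = i then a i else 0)"
      by (rule sum.cong) (auto simp: \<zeta>_C[OF i])
    ultimately show ?thesis using i by simp
  qed
  then have "indep_cocycles X r z" unfolding indep_cocycles_def using coc by blast
  then show ?thesis by (auto simp: r_def)
qed

section \<open>From homology manifolds to normal complexes\<close>

lemma complex_facets:
  assumes K: "simplicial_complex K"
  shows "faces {F. facet K F} = K"
proof (intro set_eqI iffI)
  fix G assume "G \<in> faces {F. facet K F}"
  then obtain F where "F \<in> K" "G \<subseteq> F" by (auto simp: faces_def facet_def)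
  then show "G \<in> K" using K unfolding simplicial_complex_def by blast
next
  fix G assume G: "G \<in> K"
  have fin: "finite {F \<in> K. G \<subseteq> F}" using K by (simp add: simplicial_complex_def)
  have "{F \<in> K. G \<subseteq> F} \<noteq> {}" using G by blast
  from finite_has_maximal[OF fin this] obtain F where F: "F \<in> {F \<in> K. G \<subseteq> F}"
    "\<forall>H\<in>{F \<in> K. G \<subseteq> F}. F \<subseteq> H \<longrightarrow> F = H" by (rule bexE)
  have "facet K F"
    unfolding facet_def
  proof (intro conjI ballI impI)
    show "F \<in> K" using F(1) by blast
    fix H assume H: "H \<in> K" "F \<subseteq> H"
    then have "H \<in> {F \<in> K. G \<subseteq> F}" using F(1) by blast
    then show "H = F" using F(2) H(2) by blast
  qed
  then show "G \<in> faces {F. facet K F}" using F(1) by (auto simp: faces_def)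
qed

lemma link_faces:
  assumes "simplicial_complex K" "faces X = K"
  shows "link K F = faces (lk X F)"
proof -
  have "G \<in> K" if "G \<union> F \<in> K" for G
    using that assms(1) unfolding simplicial_complex_def by blast
  then show ?thesis using assms(2) by (auto simp: link_def faces_lk)
qed

lemma faces_complex:
  assumes "pure n X" "X \<noteq> {}"
  shows "simplicial_complex (faces X)"
proof -
  have "faces X \<subseteq> Pow (\<Union>X)" by (auto simp: faces_def)
  then have "finite (faces X)" using pure_finite_Union[OF assms(1)] finite_subset by blast
  then show ?thesis
    unfolding simplicial_complex_def using assms faces_finite[OF assms(1)] by (auto simp: faces_def)
qed

lemma conn_skeleton1:
  assumes "\<And>u w. u \<in> \<Union>X \<Longrightarrow> w \<in> \<Union>X \<Longrightarrow> (u, w) \<in> (skeleton1 (faces X))\<^sup>*"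
  shows "conn X"
proof -
  have "skeleton1 (faces X) = {(a, b). {a, b} \<in> edges X}" by (auto simp: skeleton1_def edges_pair)
  then show ?thesis using assms unfolding conn_def by simp
qed

lemma circuit_1I:
  assumes S: "pure 1 S" and c: "card (\<Union>S) = 2"
  shows "circuit 1 S"
proof -
  have "S = (\<lambda>v. {v}) ` \<Union>S"
  proof (intro set_eqI iffI)
    fix F assume F: "F \<in> S"
    then obtain v where "F = {v}" using pureD(2)[OF S F] by (auto simp: card_1_singleton_iff)
    then show "F \<in> (\<lambda>v. {v}) ` \<Union>S" using F by blast
  next
    fix F assume "F \<in> (\<lambda>v. {v}) ` \<Union>S"
    then obtain v G where v: "F = {v}" "G \<in> S" "v \<in> G" by blast
    then have "G = {v}" using pureD(2)[OF S v(2)] by (auto simp: card_1_singleton_iff)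
    then show "F \<in> S" using v by simp
  qed
  then have cS: "card S = 2" using c card_image[of "\<lambda>v. {v}" "\<Union>S"] by simp
  have cyc_iff: "cyc 1 A \<longleftrightarrow> even (card A)" if "A \<subseteq> S" for A
    using pure_subset[OF S that] by (auto simp: cyc_def cnt_def)
  have "A = {} \<or> A = S" if A: "A \<subseteq> S" "cyc 1 A" for A
  proof -
    have fin: "finite S" by (rule pureD(3)[OF S])
    have "card A \<le> 2" "even (card A)" using card_mono[OF fin A(1)] cS A cyc_iff by auto
    then have "card A = 0 \<or> card A = 2" by (auto elim!: evenE)
    then show ?thesis using card_subset_eq[OF fin A(1)] cS finite_subset[OF A(1) fin] by auto
  qed
  moreover have "cyc 1 S" using cyc_iff[of S] cS by simp
  moreover have "S \<noteq> {}" using cS by auto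
  ultimately show ?thesis unfolding circuit_def by blast
qed

text \<open>Only degree 0 of the homology of links enters: it makes links of ridges pairs of points
  and larger links connected. From there \<open>circuit_from_links\<close> climbs to ever smaller
  faces, and finally to the complex itself.\<close>

theorem homology_manifold_normal:
  assumes m: "homology_manifold TYPE('k::field) d \<Delta>" and con: "connected_complex \<Delta>" and d: "2 \<le> d"
  shows "normal d {F. facet \<Delta> F}"
proof -
  let ?X = "{F. facet \<Delta> F}"
  have K: "simplicial_complex \<Delta>" and cd: "\<And>F. facet \<Delta> F \<Longrightarrow> card F = d"
    and sph: "\<And>F. F \<in> \<Delta> \<Longrightarrow> F \<noteq> {} \<Longrightarrow> homology_sphere_like TYPE('k) (int d - 1 - int (card F)) (link \<Delta> F)"
    using m by (auto simp: homology_manifold_def)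
  have fX: "faces ?X = \<Delta>" by (rule complex_facets[OF K])
  have P: "pure d ?X"
  proof -
    have "?X \<subseteq> \<Delta>" by (auto simp: facet_def)
    then have "finite ?X" "\<And>F. F \<in> ?X \<Longrightarrow> finite F"
      using K finite_subset unfolding simplicial_complex_def by auto
    then show ?thesis using cd by (simp add: pure_def)
  qed
  have ne: "?X \<noteq> {}"
  proof
    assume "?X = {}"
    then have "\<Delta> = {}" using fX by (auto simp: faces_def)
    then show False using K by (simp add: simplicial_complex_def)
  qed
  have lks: "circuit (d - card G) (lk ?X G)" if "G \<in> \<Delta>" "G \<noteq> {}" "card G < d" for G
    using that
  proof (induction "d - card G" arbitrary: G rule: less_induct)
    case less
    note G = less.prems
    have finG: "finite G" using K G(1) by (simp add: simplicial_complex_def)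
    let ?L = "lk ?X G"
    define q where "q = d - card G"
    have PL: "pure q ?L" unfolding q_def by (rule pure_lk[OF P finG])
    have GX: "G \<in> faces ?X" using G(1) fX by simp
    have neL: "?L \<noteq> {}" using GX by (auto simp: faces_def lk_def)
    have KL: "simplicial_complex (faces ?L)" by (rule faces_complex[OF PL neL])
    have b: "reduced_betti TYPE('k) (faces ?L) 0 = (if 0 = int q - 1 then 1 else 0)"
      using sph[OF G(1,2)] link_faces[OF K fX, of G] G(3) by (simp add: homology_sphere_like_def q_def)
    have "circuit q ?L"
    proof (cases "q = 1")
      case True
      have "card F \<le> 1" if F: "F \<in> faces ?L" for F
      proof -
        obtain H where H: "H \<in> ?L" "F \<subseteq> H" using F by (auto simp: faces_def)
        show ?thesis using card_mono[OF pureD(1)[OF PL H(1)] H(2)] pureD(2)[OF PL H(1)] True by simp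
      qed
      then have "card (\<Union>(faces ?L)) = 2" using b True by (intro betti_0_two_points[OF KL]) auto
      then show ?thesis using circuit_1I PL True by (simp add: Union_faces)
    next
      case False
      then have q2: "2 \<le> q" using G(3) by (simp add: q_def)
      have "conn ?L"
        by (rule conn_skeleton1) (use b False betti_0_connected[OF KL, where 'k = 'k] q2 in \<open>simp add: Union_faces del: Union_iff\<close>)
      then show ?thesis
      proof (rule circuit_from_links[OF PL neL q2])
        fix v assume "v \<in> \<Union>?L"
        then have "{v} \<in> faces ?L" by (auto simp: faces_def)
        then have v: "v \<notin> G" "insert v G \<in> \<Delta>" using fX by (auto simp: faces_lk)
        have "card (insert v G) < d" using q2 finG v(1) by (simp add: q_def)
        then have "circuit (d - card (insert v G)) (lk ?X (insert v G))"
          using finG v by (intro less.hyps) auto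
        moreover have "lk ?L {v} = lk ?X (insert v G)" using v(1) by (subst lk_lk) auto
        moreover have "d - card (insert v G) = q - 1" using finG v(1) by (simp add: q_def)
        ultimately show "circuit (q - 1) (lk ?L {v})" by simp
      qed
    qed
    then show ?case by (simp only: q_def)
  qed
  show ?thesis
    unfolding normal_def
  proof (intro conjI ballI impI P ne)
    fix G assume G: "G \<in> faces ?X" "card G < d"
    show "circuit (d - card G) (lk ?X G)"
    proof (cases "G = {}")
      case False
      then show ?thesis using lks G fX by simp
    next
      case True
      have "\<Union>?X = \<Union>\<Delta>" using Union_faces[of ?X] fX by simp
      have "conn ?X"
      proof (rule conn_skeleton1)
        fix u w assume "u \<in> \<Union>?X" "w \<in> \<Union>?X"
        then have "u \<in> \<Union>\<Delta>" "w \<in> \<Union>\<Delta>" using \<open>\<Union>?X = \<Union>\<Delta>\<close> by blast+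
        then have "(u, w) \<in> (skeleton1 \<Delta>)\<^sup>*" using con unfolding connected_complex_def by blast
        then show "(u, w) \<in> (skeleton1 (faces ?X))\<^sup>*" by (simp only: fX)
      qed
      then have "circuit d ?X"
      proof (rule circuit_from_links[OF P ne d])
        fix v assume "v \<in> \<Union>?X"
        then have "{v} \<in> faces ?X" by (auto simp: faces_def)
        then show "circuit (d - 1) (lk ?X {v})" using lks[of "{v}"] fX d by simp
      qed
      then show ?thesis using True by (simp add: lk_empty)
    qed
  qed
qed

section \<open>The number \<open>g2\<close> in terms of vertices and edges, and the
  conclusion\<close>

lemma coeff_shift_power:
  "coeff ([:-1, 1:] ^ m) k = (if k \<le> m then of_nat (m choose k) * (-1) ^ (m - k) else (0 :: int))"
proof (cases "k \<le> m")
  case False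
  have "degree ([:-1, 1:] ^ m :: int poly) \<le> m" by (rule order_trans[OF degree_power_le]) simp
  then show ?thesis using False by (simp add: coeff_eq_0)
qed (simp add: coeff_linear_poly_power)

text \<open>Faces of size \<open>i\<close> contribute only to coefficients of degree at most
  \<open>d - i\<close>, so the sums for the first and second h-number break off after the vertices
  and the edges, respectively.\<close>

lemma g2_eq:
  assumes X: "pure d X" "X \<noteq> {}" and d: "2 \<le> d"
  shows "g2 d (faces X) = int (card (edges X)) - int d * int (card (\<Union>X)) + int (Suc d choose 2)"
proof -
  let ?f = "\<lambda>i. of_nat (f_num (faces X) (int i - 1)) :: int"
  have c: "coeff (h_poly d (faces X)) k = (\<Sum>i\<le>d. ?f i * coeff ([:-1, 1:] ^ (d - i)) k)" for k
    unfolding h_poly_def coeff_sum by (simp add: of_nat_poly)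
  have f0: "f_num (faces X) (- 1) = 1"
  proof -
    have "{F \<in> faces X. int (card F) = 0} = {{}}"
      using X faces_finite[OF X(1)] by (auto simp: faces_def card_eq_0_iff)
    then show ?thesis by (simp add: f_num_def)
  qed
  have f1: "f_num (faces X) 0 = card (\<Union>X)"
  proof -
    have "{F \<in> faces X. int (card F) = 1} = (\<lambda>v. {v}) ` \<Union>X"
      by (auto simp: faces_def card_1_singleton_iff)
    then show ?thesis by (simp add: f_num_def card_image)
  qed
  have f2: "f_num (faces X) 1 = card (edges X)"
    by (simp add: f_num_def edges_def)
  have h1: "h_num d (faces X) 1 = int (card (\<Union>X)) - int d"
  proof -
    have "h_num d (faces X) 1 = (\<Sum>i\<in>{0, 1}. ?f i * coeff ([:-1, 1:] ^ (d - i)) (d - 1))"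
      unfolding h_num_def c by (rule sum.mono_neutral_right) (use d in \<open>auto simp: coeff_shift_power\<close>)
    also have "\<dots> = int (card (\<Union>X)) - int d"
      using d binomial_symmetric[of 1 d] by (simp add: coeff_shift_power f0 f1)
    finally show ?thesis .
  qed
  have h2: "h_num d (faces X) 2 = int (card (edges X)) - int (d - 1) * int (card (\<Union>X)) + int (d choose 2)"
  proof -
    have "h_num d (faces X) 2 = (\<Sum>i\<in>{0, 1, 2}. ?f i * coeff ([:-1, 1:] ^ (d - i)) (d - 2))"
      unfolding h_num_def c by (rule sum.mono_neutral_right) (use d in \<open>auto simp: coeff_shift_power\<close>)
    also have "\<dots> = int (d choose 2) - int (d - 1) * int (card (\<Union>X)) + int (card (edges X))"
    proof -
      have "d - Suc 0 - (d - 2) = 1" "d - (d - 2) = 2" using d by auto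
      moreover have "(d - 1) choose (d - 2) = d - 1"
        using binomial_symmetric[of 1 "d - 1"] d by (simp add: numeral_2_eq_2)
      moreover have "d choose (d - 2) = d choose 2" using binomial_symmetric[of 2 d] d by simp
      ultimately show ?thesis
        using d by (simp add: coeff_shift_power f0 f1 f2 of_nat_diff) (simp add: algebra_simps)
    qed
    finally show ?thesis by simp
  qed
  have "Suc d choose 2 = (d choose 2) + d" by (simp add: numeral_2_eq_2)
  then show ?thesis unfolding g2_def h1 h2 using d by (simp add: algebra_simps of_nat_diff)
qed

lemma loc_tight_relabel:
  assumes X: "loc_tight n X" and g: "inj_on g (\<Union>X)"
  shows "loc_tight n (image g ` X)"
  unfolding loc_tight_def
proof (intro conjI ballI)
  have P: "pure n X" "X \<noteq> {}" using X unfolding loc_tight_def by blast+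
  show "pure n (image g ` X)" by (rule relabel_pure[OF g P(1)])
  show "image g ` X \<noteq> {}" using P(2) by blast
  fix u assume "u \<in> \<Union>(image g ` X)"
  then obtain v where v: "v \<in> \<Union>X" "u = g v" by blast
  have "lk (image g ` X) {u} = image g ` lk X {v}" using relabel_lk[OF g, of "{v}"] v by simp
  moreover have "\<Union>(lk X {v}) \<subseteq> \<Union>X" by (auto simp: lk_def)
  then have "inj_on g (\<Union>(lk X {v}))" using g by (rule inj_on_subset[rotated])
  ultimately show "normal (n - 1) (lk (image g ` X) {u})" "tight (n - 1) (lk (image g ` X) {u})"
    using relabel_normal relabel_tight loc_tightD[OF X v(1)] by metis+
qed

theorem theorem5p2:
  fixes \<Delta> :: "'a set set" and d :: nat
  assumes "infinite (UNIV :: 'k::field set)"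
    and "d \<ge> 4"
    and "homology_manifold TYPE('k) d \<Delta>"
    and "connected_complex \<Delta>"
    and "orientable TYPE('k) d \<Delta>"
  shows "g2 d \<Delta> \<ge> int ((d + 1) choose 2) * int (reduced_betti TYPE('k) \<Delta> 1) \<and>
    (g2 d \<Delta> = int ((d + 1) choose 2) * int (reduced_betti TYPE('k) \<Delta> 1) \<and> d \<ge> 5 \<longrightarrow>
      in_walkup_class d \<Delta>)"
proof -
  let ?X = "{F. facet \<Delta> F}"
  define r where "r = reduced_betti TYPE('k) \<Delta> 1"
  have d: "2 \<le> d" "3 \<le> d - 1" "Suc (d - 1) = d" "0 < d" "1 < d" "0 < d - 1" using assms(2) by auto
  have N: "normal d ?X" by (rule homology_manifold_normal[OF assms(3,4) d(1)])
  have K: "simplicial_complex \<Delta>" using assms(3) by (simp add: homology_manifold_def)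
  have fX: "faces ?X = \<Delta>" by (rule complex_facets[OF K])
  have P: "pure d ?X" by (rule normal_pure[OF N])
  have c: "circuit d ?X" by (rule normal_circuit[OF N d(4)])
  have con: "conn ?X" by (rule circuit_conn[OF c d(1)])
  have ne: "?X \<noteq> {}" by (rule circuitD(3)[OF c])
  obtain z :: "nat \<Rightarrow> 'a \<Rightarrow> 'a \<Rightarrow> 'k" where z: "indep_cocycles ?X r z"
    using betti_1_cocycles[OF K fX] unfolding r_def by blast
  obtain p :: "'a \<Rightarrow> nat \<Rightarrow> 'k" where p: "generic d (\<Union>?X) p"
    using generic_exists[OF assms(1) pure_finite_Union[OF P]] by blast
  have span: "spans d F p" if "F \<in> ?X" for F
    by (rule generic_spans[OF p _ pureD(2)[OF P that]]) (use that in blast)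
  have lkn: "normal (d - 1) (lk ?X {v})" if "v \<in> \<Union>?X" for v
    by (rule normal_lk_vertex[OF N that d(5)])
  have star: "solid d (edges (star ?X v)) p (\<Union>(star ?X v))" if "v \<in> \<Union>?X" for v
    using star_solid[OF assms(1) d(2), of ?X v "\<Union>?X" p] P p normal_circuit[OF lkn[OF that] d(6)] d(3) by simp
  have g2: "g2 d \<Delta> = int (card (edges ?X)) - int d * int (card (\<Union>?X)) + int (Suc d choose 2)"
    using g2_eq[OF P ne d(1)] fX by simp
  have count: "r * (Suc d choose 2) + d * card (\<Union>?X) \<le> card (edges ?X) + (Suc d choose 2)"
    by (rule cocycle_count(1)[OF P d(1) con ne _ _ z], erule span, erule star)
  have "int (r * (Suc d choose 2) + d * card (\<Union>?X)) \<le> int (card (edges ?X) + (Suc d choose 2))"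
    using count by (simp only: of_nat_le_iff)
  then have ineq: "int ((d + 1) choose 2) * int r \<le> g2 d \<Delta>" unfolding g2 by (simp add: mult.commute)
  have "in_walkup_class d \<Delta>" if eq: "g2 d \<Delta> = int ((d + 1) choose 2) * int r" and d5: "5 \<le> d"
  proof -
    have "int (card (edges ?X) + (Suc d choose 2)) = int (r * (Suc d choose 2) + d * card (\<Union>?X))"
      using eq unfolding g2 by (simp add: mult.commute)
    then have le: "card (edges ?X) + (Suc d choose 2) \<le> r * (Suc d choose 2) + d * card (\<Union>?X)"
      by (simp only: of_nat_eq_iff)
    \<comment> \<open>Equality makes the edge equations of each star independent, which bounds the
      number of its edges from above; \<open>tight_star_lk\<close> carries the bound from the cone
      to the link.\<close>
    have "tight (d - 1) (lk ?X {v})" if v: "v \<in> \<Union>?X" for v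
    proof -
      have fr: "free d (edges (star ?X v)) p"
        by (rule cocycle_count(2)[OF P d(1) con ne _ _ z le], erule span, erule star)
      obtain F where F: "F \<in> ?X" "v \<in> F" using v by blast
      have PS: "pure d (star ?X v)" by (rule star_pure[OF P])
      have US: "\<Union>(edges (star ?X v)) = \<Union>(star ?X v)" by (rule Union_edges[OF PS d(1)])
      have "F \<subseteq> \<Union>(edges (star ?X v))" unfolding US using F by (auto simp: star_def)
      then have "tight d (star ?X v)"
        using free_card_le[OF fr graph_edges[OF PS] span[OF F(1)]]
        by (simp add: tight_def US)
      moreover have "pure (d - 1) (lk ?X {v})" "lk ?X {v} \<noteq> {}" using lkn[OF v] by (auto simp: normal_def)
      ultimately show ?thesis using tight_star_lk[of "d - 1" ?X v] d(3) by simp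
    qed
    then have loc: "loc_tight d ?X" unfolding loc_tight_def using P ne lkn by blast
    obtain f :: "'a \<Rightarrow> nat" where f: "inj_on f (\<Union>?X)"
      using finite_imp_inj_to_nat_seg[OF pure_finite_Union[OF P]] by blast
    have "conn (image f ` ?X)"
      by (rule circuit_conn[OF normal_circuit[OF relabel_normal[OF f N] d(4)] d(1)])
    then have "walkup d (faces (image f ` ?X))" by (rule loc_tight_walkup[OF d5 loc_tight_relabel[OF loc f]])
    then have "walkup d (image f ` \<Delta>)" by (simp only: relabel_faces fX)
    moreover have "inj_on f (\<Union>\<Delta>)" using f Union_faces[of ?X] fX by simp
    ultimately show ?thesis unfolding in_walkup_class_def by blast
  qed
  then show ?thesis using ineq by (simp add: r_def)
qed

end
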